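(* Given a DAG $G=(V,E)$ and a positive integer $k$, the problems MCP-$k$ and MA-$k$ can be solved in $\tilde{O}(\alpha_k|E|)$ time, and the problems MAP-$k$ and MC-$k$ can be solved in $\tilde{O}(\beta_k|E|)$ time, by randomized Las Vegas algorithms (always correct output) whose running times hold with high probability and in expectation.
   Context: Let $G=(V,E)$ be a directed acyclic graph. A chain is a set of vertices that occur, in order, as a subsequence of the vertices of some directed path of $G$. An antichain is a set of vertices that are pairwise unreachable from one another. A chain partition (resp. antichain partition) is a partition of $V$ into pairwise disjoint chains (resp. antichains); its $k$-norm is $\sum_{C}\min(|C|,k)$ over its parts $C$. The problems are: MA-$k$: find $k$ pairwise disjoint antichains maximizing the size of their union; $\alpha_k$ denotes this maximum. MC-$k$: find $k$ pairwise disjoint chains maximizing the size of their union; $\beta_k$ denotes this maximum. MCP-$k$: find a chain partition of $V$ of minimum $k$-norm. MAP-$k$: find an antichain partition of $V$ of minimum $k$-norm. The notation $\tilde{O}(\cdot)$ hides factors polylogarithmic in the input size.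
   Formalization: The time bounds proved are α_k|E| (resp. β_k|E|) plus the number of isolated vertices plus 1, since the literal bounds are 0 for edgeless graphs and, for β_k, can be smaller than the output when isolated vertices dominate. *)

theory Defs
  imports "HOL-Probability.Probability" "HOL-Library.Sublist" "HOL-Library.Disjoint_Sets"
begin

section \<open>Chains and antichains of a directed graph\<close>

text \<open>
  The empty list counts as a path, so that the empty set is a chain in every graph; in an acyclic
  graph there is no difference between walks and paths.
\<close>

definition dpath :: "'a set \<Rightarrow> ('a \<times> 'a) set \<Rightarrow> 'a list \<Rightarrow> bool" where
  "dpath V E p \<longleftrightarrow> set p \<subseteq> V \<and> successively (\<lambda>u v. (u, v) \<in> E) p"

definition dag_chain :: "'a set \<Rightarrow> ('a \<times> 'a) set \<Rightarrow> 'a set \<Rightarrow> bool" where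
  "dag_chain V E C \<longleftrightarrow> (\<exists>p xs. dpath V E p \<and> subseq xs p \<and> C = set xs)"

definition dag_antichain :: "'a set \<Rightarrow> ('a \<times> 'a) set \<Rightarrow> 'a set \<Rightarrow> bool" where
  "dag_antichain V E A \<longleftrightarrow> A \<subseteq> V \<and> (\<forall>u\<in>A. \<forall>v\<in>A. u \<noteq> v \<longrightarrow> (u, v) \<notin> E\<^sup>*)"

definition k_norm :: "nat \<Rightarrow> 'a set set \<Rightarrow> nat" where
  "k_norm k \<C> = (\<Sum>C\<in>\<C>. min (card C) k)"

definition chain_partition :: "'a set \<Rightarrow> ('a \<times> 'a) set \<Rightarrow> 'a set set \<Rightarrow> bool" where
  "chain_partition V E \<C> \<longleftrightarrow> partition_on V \<C> \<and> (\<forall>C\<in>\<C>. dag_chain V E C)"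

definition antichain_partition :: "'a set \<Rightarrow> ('a \<times> 'a) set \<Rightarrow> 'a set set \<Rightarrow> bool" where
  "antichain_partition V E \<A> \<longleftrightarrow> partition_on V \<A> \<and> (\<forall>A\<in>\<A>. dag_antichain V E A)"

text \<open>
  Families of \<open>k\<close> sets are indexed by \<open>{1..k}\<close>. Members may be empty, so such families exist
  also when \<open>k\<close> exceeds the number of vertices.
\<close>

definition k_antichains :: "'a set \<Rightarrow> ('a \<times> 'a) set \<Rightarrow> nat \<Rightarrow> (nat \<Rightarrow> 'a set) \<Rightarrow> bool" where
  "k_antichains V E k A \<longleftrightarrow> (\<forall>i\<in>{1..k}. dag_antichain V E (A i)) \<and> disjoint_family_on A {1..k}"

definition k_chains :: "'a set \<Rightarrow> ('a \<times> 'a) set \<Rightarrow> nat \<Rightarrow> (nat \<Rightarrow> 'a set) \<Rightarrow> bool" where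
  "k_chains V E k C \<longleftrightarrow> (\<forall>i\<in>{1..k}. dag_chain V E (C i)) \<and> disjoint_family_on C {1..k}"

definition alpha :: "'a set \<Rightarrow> ('a \<times> 'a) set \<Rightarrow> nat \<Rightarrow> nat" where
  "alpha V E k = Max {card (\<Union>i\<in>{1..k}. A i) | A. k_antichains V E k A}"

definition beta :: "'a set \<Rightarrow> ('a \<times> 'a) set \<Rightarrow> nat \<Rightarrow> nat" where
  "beta V E k = Max {card (\<Union>i\<in>{1..k}. C i) | C. k_chains V E k C}"

definition MA_solution :: "'a set \<Rightarrow> ('a \<times> 'a) set \<Rightarrow> nat \<Rightarrow> (nat \<Rightarrow> 'a set) \<Rightarrow> bool" where
  "MA_solution V E k A \<longleftrightarrow> k_antichains V E k A \<and> card (\<Union>i\<in>{1..k}. A i) = alpha V E k"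

definition MC_solution :: "'a set \<Rightarrow> ('a \<times> 'a) set \<Rightarrow> nat \<Rightarrow> (nat \<Rightarrow> 'a set) \<Rightarrow> bool" where
  "MC_solution V E k C \<longleftrightarrow> k_chains V E k C \<and> card (\<Union>i\<in>{1..k}. C i) = beta V E k"

definition MCP_solution :: "'a set \<Rightarrow> ('a \<times> 'a) set \<Rightarrow> nat \<Rightarrow> 'a set set \<Rightarrow> bool" where
  "MCP_solution V E k \<C> \<longleftrightarrow> chain_partition V E \<C> \<and>
     (\<forall>\<C>'. chain_partition V E \<C>' \<longrightarrow> k_norm k \<C> \<le> k_norm k \<C>')"

definition MAP_solution :: "'a set \<Rightarrow> ('a \<times> 'a) set \<Rightarrow> nat \<Rightarrow> 'a set set \<Rightarrow> bool" where
  "MAP_solution V E k \<A> \<longleftrightarrow> antichain_partition V E \<A> \<and>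
     (\<forall>\<A>'. antichain_partition V E \<A>' \<longrightarrow> k_norm k \<A> \<le> k_norm k \<A>')"


section \<open>A randomized word RAM\<close>

text \<open>
  The machine has \<open>w\<close>-bit words, a bank of registers addressed by constants of the program, and a
  random-access memory addressed by words. Every instruction takes unit time. Randomness is an
  infinite tape of independent uniform words, of which \<open>Random\<close> consumes one. The machine halts
  when its program counter leaves the program.
\<close>

datatype binop = Plus | Minus | Times | Divide | Modulo | And | Or | Xor | Shl | Shr

fun eval_op :: "nat \<Rightarrow> binop \<Rightarrow> nat \<Rightarrow> nat \<Rightarrow> nat" where
  "eval_op w Plus x y = take_bit w (x + y)"
| "eval_op w Minus x y = take_bit w (2 ^ w + x - y)"
| "eval_op w Times x y = take_bit w (x * y)"
| "eval_op w Divide x y = take_bit w (x div y)"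
| "eval_op w Modulo x y = take_bit w (x mod y)"
| "eval_op w And x y = take_bit w (Bit_Operations.and x y)"
| "eval_op w Or x y = take_bit w (Bit_Operations.or x y)"
| "eval_op w Xor x y = take_bit w (Bit_Operations.xor x y)"
| "eval_op w Shl x y = take_bit w (push_bit y x)"
| "eval_op w Shr x y = take_bit w (drop_bit y x)"

datatype instr =
    Const nat nat
  | Load nat nat
  | Store nat nat
  | Op binop nat nat nat
  | Random nat
  | Jump nat
  | Jump_Less nat nat nat

record config =
  pc :: nat
  reg :: "nat \<Rightarrow> nat"
  mem :: "nat \<Rightarrow> nat"
  tape :: "nat stream"

definition set_reg :: "nat \<Rightarrow> nat \<Rightarrow> config \<Rightarrow> config" where
  "set_reg i x c = c\<lparr>pc := pc c + 1, reg := (reg c)(i := x)\<rparr>"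

fun exec_instr :: "nat \<Rightarrow> instr \<Rightarrow> config \<Rightarrow> config" where
  "exec_instr w (Const i x) c = set_reg i (take_bit w x) c"
| "exec_instr w (Load i j) c = set_reg i (mem c (reg c j)) c"
| "exec_instr w (Store i j) c = c\<lparr>pc := pc c + 1, mem := (mem c)(reg c i := reg c j)\<rparr>"
| "exec_instr w (Op b i j l) c = set_reg i (eval_op w b (reg c j) (reg c l)) c"
| "exec_instr w (Random i) c = set_reg i (shd (tape c)) (c\<lparr>tape := stl (tape c)\<rparr>)"
| "exec_instr w (Jump l) c = c\<lparr>pc := l\<rparr>"
| "exec_instr w (Jump_Less i j l) c = c\<lparr>pc := (if reg c i < reg c j then l else pc c + 1)\<rparr>"

definition halted :: "instr list \<Rightarrow> config \<Rightarrow> bool" where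
  "halted P c \<longleftrightarrow> length P \<le> pc c"

definition step :: "nat \<Rightarrow> instr list \<Rightarrow> config \<Rightarrow> config" where
  "step w P c = (if halted P c then c else exec_instr w (P ! pc c) c)"

definition start :: "nat list \<Rightarrow> nat stream \<Rightarrow> config" where
  "start ws \<omega> =
     \<lparr>pc = 0, reg = (\<lambda>_. 0), mem = (\<lambda>a. if a < length ws then ws ! a else 0), tape = \<omega>\<rparr>"

definition run :: "nat \<Rightarrow> instr list \<Rightarrow> nat list \<Rightarrow> nat stream \<Rightarrow> nat \<Rightarrow> config" where
  "run w P ws \<omega> t = (step w P ^^ t) (start ws \<omega>)"

definition runtime :: "nat \<Rightarrow> instr list \<Rightarrow> nat list \<Rightarrow> nat stream \<Rightarrow> enat" where
  "runtime w P ws \<omega> = (INF t\<in>{t. halted P (run w P ws \<omega> t)}. enat t)"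

definition random_tape :: "nat \<Rightarrow> nat stream measure" where
  "random_tape w = stream_space (uniform_count_measure {..<2 ^ w})"


section \<open>Las Vegas algorithms on acyclic graphs\<close>

text \<open>
  An input is an acyclic graph on the vertices \<open>{..<n}\<close>, given by a list of its edges in arbitrary
  order, together with the parameter \<open>k\<close>.
\<close>

definition dag_input :: "nat \<Rightarrow> (nat \<times> nat) list \<Rightarrow> nat \<Rightarrow> bool" where
  "dag_input n es k \<longleftrightarrow>
     distinct es \<and> set es \<subseteq> {..<n} \<times> {..<n} \<and> acyclic (set es) \<and> 0 < k"

definition encode :: "nat \<Rightarrow> (nat \<times> nat) list \<Rightarrow> nat \<Rightarrow> nat list" where
  "encode n es k = [n, length es, k] @ concat (map (\<lambda>(u, v). [u, v]) es)"

text \<open>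
  The offset makes the logarithm of the input size at least 1. The parameter \<open>k\<close> occupies a single
  word, hence contributes nothing beyond a constant.
\<close>

definition input_size :: "nat \<Rightarrow> (nat \<times> nat) list \<Rightarrow> nat" where
  "input_size n es = n + length es + 2"

text \<open>
  A word has to hold \<open>k\<close> and numbers polynomial in the input size; \<open>a\<close> is the degree of that
  polynomial. So \<open>w\<close> is at least a constant multiple of the logarithm of the input size and \<open>k\<close>.
\<close>

definition word_size_ok :: "nat \<Rightarrow> nat \<Rightarrow> (nat \<times> nat) list \<Rightarrow> nat \<Rightarrow> nat \<Rightarrow> bool" where
  "word_size_ok a n es k w \<longleftrightarrow> (input_size n es + k) ^ a \<le> 2 ^ w"

text \<open>
  A problem is a relation \<open>Sol n es k out\<close> between inputs and outputs, where \<open>out\<close> is the memory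
  at halting time. One program, one word-size constant \<open>a\<close> and one exponent \<open>d\<close> of the logarithm
  serve all inputs and all admissible word sizes. In the high-probability bound the failure
  probability is below any prescribed inverse polynomial in the input size, at the expense of the
  constant factor \<open>K\<close> only. The expectation bound entails almost sure termination.
\<close>

definition las_vegas_solvable ::
  "(nat \<Rightarrow> (nat \<times> nat) list \<Rightarrow> nat \<Rightarrow> (nat \<Rightarrow> nat) \<Rightarrow> bool) \<Rightarrow>
   (nat \<Rightarrow> (nat \<times> nat) list \<Rightarrow> nat \<Rightarrow> nat) \<Rightarrow> bool" where
  "las_vegas_solvable Sol f \<longleftrightarrow> (\<exists>P a d. 1 \<le> a \<and>
     (\<forall>n es k w. dag_input n es k \<and> word_size_ok a n es k w \<longrightarrow>
        (\<forall>\<omega>\<in>space (random_tape w). \<forall>t. halted P (run w P (encode n es k) \<omega> t) \<longrightarrow>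
           Sol n es k (mem (run w P (encode n es k) \<omega> t)))) \<and>
     (\<forall>c::nat. \<exists>K::real. \<forall>n es k w. dag_input n es k \<and> word_size_ok a n es k w \<longrightarrow>
        measure (random_tape w)
          {\<omega> \<in> space (random_tape w). ennreal_of_enat (runtime w P (encode n es k) \<omega>)
             \<le> ennreal (K * real (f n es k) * log 2 (real (input_size n es)) ^ d)}
          \<ge> 1 - 1 / real (input_size n es) ^ c) \<and>
     (\<exists>K::real. \<forall>n es k w. dag_input n es k \<and> word_size_ok a n es k w \<longrightarrow>
        (\<integral>\<^sup>+ \<omega>. ennreal_of_enat (runtime w P (encode n es k) \<omega>) \<partial>random_tape w)
          \<le> ennreal (K * real (f n es k) * log 2 (real (input_size n es)) ^ d)))"

text \<open>
  An output is a label for each vertex: cell \<open>v\<close> contains the label of vertex \<open>v\<close>. For partitions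
  the parts are the classes of equally labelled vertices; for families of \<open>k\<close> sets the \<open>i\<close>-th
  member consists of the vertices labelled \<open>i\<close>, and a label outside \<open>{1..k}\<close> marks an uncovered vertex.
\<close>

definition label_class :: "nat \<Rightarrow> (nat \<Rightarrow> nat) \<Rightarrow> nat \<Rightarrow> nat set" where
  "label_class n out i = {v. v < n \<and> out v = i}"

definition label_partition :: "nat \<Rightarrow> (nat \<Rightarrow> nat) \<Rightarrow> nat set set" where
  "label_partition n out = label_class n out ` out ` {..<n}"

definition solves_MA :: "nat \<Rightarrow> (nat \<times> nat) list \<Rightarrow> nat \<Rightarrow> (nat \<Rightarrow> nat) \<Rightarrow> bool" where
  "solves_MA n es k out \<longleftrightarrow> MA_solution {..<n} (set es) k (label_class n out)"

definition solves_MC :: "nat \<Rightarrow> (nat \<times> nat) list \<Rightarrow> nat \<Rightarrow> (nat \<Rightarrow> nat) \<Rightarrow> bool" where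
  "solves_MC n es k out \<longleftrightarrow> MC_solution {..<n} (set es) k (label_class n out)"

definition solves_MCP :: "nat \<Rightarrow> (nat \<times> nat) list \<Rightarrow> nat \<Rightarrow> (nat \<Rightarrow> nat) \<Rightarrow> bool" where
  "solves_MCP n es k out \<longleftrightarrow> MCP_solution {..<n} (set es) k (label_partition n out)"

definition solves_MAP :: "nat \<Rightarrow> (nat \<times> nat) list \<Rightarrow> nat \<Rightarrow> (nat \<Rightarrow> nat) \<Rightarrow> bool" where
  "solves_MAP n es k out \<longleftrightarrow> MAP_solution {..<n} (set es) k (label_partition n out)"

text \<open>
  Isolated vertices do not show up in the number of edges but have to be output, so a bound of
  \<open>\<alpha>\<^sub>k |E|\<close> or \<open>\<beta>\<^sub>k |E|\<close> tacitly takes \<open>|E|\<close> to dominate \<open>|V|\<close>. To cover all acyclic graphs the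
  number of isolated vertices is added, and 1 for the empty graph. On a nonempty graph without
  isolated vertices the products are at least 1 and these bounds are, up to a factor of 2, \<open>\<alpha>\<^sub>k |E|\<close>
  and \<open>\<beta>\<^sub>k |E|\<close>; the bound with \<open>\<alpha>\<^sub>k\<close> is so, up to a factor of 3, whenever there is an edge,
  because the isolated vertices form an antichain.
\<close>

definition isolated :: "nat \<Rightarrow> (nat \<times> nat) list \<Rightarrow> nat set" where
  "isolated n es = {..<n} - Field (set es)"

definition alpha_bound :: "nat \<Rightarrow> (nat \<times> nat) list \<Rightarrow> nat \<Rightarrow> nat" where
  "alpha_bound n es k = alpha {..<n} (set es) k * card (set es) + card (isolated n es) + 1"

definition beta_bound :: "nat \<Rightarrow> (nat \<times> nat) list \<Rightarrow> nat \<Rightarrow> nat" where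
  "beta_bound n es k = beta {..<n} (set es) k * card (set es) + card (isolated n es) + 1"

end

theory Submission
  imports Defs
begin

text \<open>
  Following Frank's flow proof of the Greene-Kleitman theorem, split every vertex by an arc that
  carries one unit of flow at gain 1, in parallel to a free arc. A maximum gain flow of value \<open>r\<close>
  together with optimal node potentials of source-sink difference \<open>l\<close> yields \<open>r\<close> disjoint chains and
  \<open>l\<close> disjoint antichains (the level sets of the potential) which together have at least \<open>n + r l\<close>
  elements. As a chain and an antichain share at most one vertex, such a pair is simultaneously optimal:
  with \<open>l = k\<close> for the first two problems, with \<open>r = k\<close> or \<open>l = 1\<close> for the other two, where in each case
  the uncovered vertices become singletons of the partition.

  The pair is found by successive shortest paths, starting from the potential given by a topological
  order. A phase takes linear time: distances matter only up to the amount by which \<open>l\<close> may still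
  fall, which is at most the length of that order, so an array of buckets serves as priority queue. The number
  of augmentations is \<open>r \<le> \<alpha>\<^sub>k\<close> in the first case and \<open>r \<le> \<beta>\<^sub>k\<close> in the second.
  The algorithm is deterministic, so that all time bounds hold surely and without a logarithm.
\<close>

section \<open>A structured language on arrays\<close>

text \<open>The starting potential is feasible for the zero flow because positions in a topological
  order rise by at least 1 along every arc, while no arc gains more than 1. Placing the sink at
  \<open>len + K\<close> leaves \<open>len\<close> levels for \<open>l\<close> to fall to its target
  \<open>K\<close>. A phase lowers \<open>l\<close> by the residual distance of the sink, so either
  a tight path appears and \<open>r\<close> grows, or \<open>l\<close> reaches \<open>K\<close>. The
  free arcs ought to have infinite capacity. Flow on an arc of an acyclic network is at most
  \<open>r\<close> times the rank of the sink, and \<open>r * l \<le> n\<close> holds throughout, so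
  the finite capacity \<open>N\<close> is never exhausted. The main obstacle is that a phase must be
  linear in the number of edges even if vertices outnumber edges. Hence isolated vertices stay
  outside the network, loops over nodes run over arc heads instead, and the buckets are empty again
  after each phase. The structured language separates graph reasoning on natural numbers from word
  arithmetic and program counters.\<close>

datatype exp = Num nat | Var nat | Rd nat exp | Bin binop exp exp

datatype com =
    Skip
  | Asg nat exp
  | Wr nat exp exp
  | Seq com com (infixr ";;" 60)
  | Ite exp exp com com
  | While exp exp com

text \<open>\<open>tm\<close> is a ghost clock that ticks at every assignment, write and test;
  compiled code spends a bounded number of machine steps per tick.\<close>

record st =
  var :: "nat \<Rightarrow> nat"
  arr :: "nat \<Rightarrow> nat \<Rightarrow> nat"
  tm :: nat

fun op_val :: "binop \<Rightarrow> nat \<Rightarrow> nat \<Rightarrow> nat" where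
  "op_val Plus x y = x + y"
| "op_val Minus x y = x - y"
| "op_val Times x y = x * y"
| "op_val Divide x y = x div y"
| "op_val Modulo x y = x mod y"
| "op_val And x y = Bit_Operations.and x y"
| "op_val Or x y = Bit_Operations.or x y"
| "op_val Xor x y = Bit_Operations.xor x y"
| "op_val Shl x y = push_bit y x"
| "op_val Shr x y = drop_bit y x"

fun ev :: "st \<Rightarrow> exp \<Rightarrow> nat" where
  "ev s (Num c) = c"
| "ev s (Var x) = var s x"
| "ev s (Rd a e) = arr s a (ev s e)"
| "ev s (Bin b e1 e2) = op_val b (ev s e1) (ev s e2)"

text \<open>
  Array 0 is the input/output segment of the memory, the cells below \<open>bs\<close>; the cells of the other
  arrays are interleaved above \<open>bs\<close>. Evaluation on natural numbers agrees with that on words as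
  long as no intermediate result reaches \<open>L\<close>.
\<close>

locale bounds =
  fixes L bs :: nat
begin

definition index_ok :: "nat \<Rightarrow> nat \<Rightarrow> bool" where
  "index_ok a i \<longleftrightarrow> i < (if a = 0 then bs else L)"

text \<open>The last conjunct excludes underflow: subtraction of natural numbers truncates at 0,
  machine subtraction wraps around.\<close>

fun safe :: "st \<Rightarrow> exp \<Rightarrow> bool" where
  "safe s (Num c) \<longleftrightarrow> c < L"
| "safe s (Var x) \<longleftrightarrow> True"
| "safe s (Rd a e) \<longleftrightarrow> safe s e \<and> index_ok a (ev s e)"
| "safe s (Bin b e1 e2) \<longleftrightarrow> safe s e1 \<and> safe s e2 \<and> op_val b (ev s e1) (ev s e2) < L
     \<and> (b = Minus \<longrightarrow> ev s e2 \<le> ev s e1)"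

text \<open>Only safe steps have a rule, so a derivation certifies termination together with the
  absence of overflow and of out-of-range accesses.\<close>

inductive big :: "com \<Rightarrow> st \<Rightarrow> st \<Rightarrow> bool" where
  Skip: "big Skip s s"
| Asg: "safe s e \<Longrightarrow> big (Asg x e) s (s\<lparr>var := (var s)(x := ev s e), tm := Suc (tm s)\<rparr>)"
| Wr: "safe s e1 \<Longrightarrow> safe s e2 \<Longrightarrow> index_ok a (ev s e1) \<Longrightarrow>
    big (Wr a e1 e2) s (s\<lparr>arr := (arr s)(a := (arr s a)(ev s e1 := ev s e2)), tm := Suc (tm s)\<rparr>)"
| Seq: "big c1 s s' \<Longrightarrow> big c2 s' s'' \<Longrightarrow> big (c1 ;; c2) s s''"
| Then: "safe s e1 \<Longrightarrow> safe s e2 \<Longrightarrow> ev s e1 < ev s e2 \<Longrightarrow> big c1 (s\<lparr>tm := Suc (tm s)\<rparr>) s' \<Longrightarrow>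
    big (Ite e1 e2 c1 c2) s s'"
| Else: "safe s e1 \<Longrightarrow> safe s e2 \<Longrightarrow> \<not> ev s e1 < ev s e2 \<Longrightarrow> big c2 (s\<lparr>tm := Suc (tm s)\<rparr>) s' \<Longrightarrow>
    big (Ite e1 e2 c1 c2) s s'"
| Loop: "safe s e1 \<Longrightarrow> safe s e2 \<Longrightarrow> ev s e1 < ev s e2 \<Longrightarrow> big c (s\<lparr>tm := Suc (tm s)\<rparr>) s' \<Longrightarrow>
    big (While e1 e2 c) s' s'' \<Longrightarrow> big (While e1 e2 c) s s''"
| Exit: "safe s e1 \<Longrightarrow> safe s e2 \<Longrightarrow> \<not> ev s e1 < ev s e2 \<Longrightarrow>
    big (While e1 e2 c) s (s\<lparr>tm := Suc (tm s)\<rparr>)"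

inductive_cases big_SkipE: "big Skip s s'"
inductive_cases big_AsgE: "big (Asg x e) s s'"
inductive_cases big_WrE: "big (Wr a e1 e2) s s'"
inductive_cases big_SeqE: "big (c1 ;; c2) s s'"
inductive_cases big_IteE: "big (Ite e1 e2 c1 c2) s s'"

lemma tm_mono: "big c s s' \<Longrightarrow> tm s \<le> tm s'"
  by (induction rule: big.induct) auto

text \<open>Asserting that a final state exists makes this total correctness; the language is
  deterministic, so there is no other final state.\<close>

definition wp :: "com \<Rightarrow> (st \<Rightarrow> bool) \<Rightarrow> st \<Rightarrow> bool" where
  "wp c Q s \<longleftrightarrow> (\<exists>s'. big c s s' \<and> Q s')"

lemma wp_conseq: "wp c Q s \<Longrightarrow> (\<And>s'. Q s' \<Longrightarrow> Q' s') \<Longrightarrow> wp c Q' s"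
  by (auto simp: wp_def)

lemma wp_Skip [simp]: "wp Skip Q s \<longleftrightarrow> Q s"
  by (auto simp: wp_def intro: big.intros elim: big_SkipE)

lemma wp_Asg [simp]:
  "wp (Asg x e) Q s \<longleftrightarrow> safe s e \<and> Q (s\<lparr>var := (var s)(x := ev s e), tm := Suc (tm s)\<rparr>)"
  by (auto simp: wp_def intro: big.intros elim: big_AsgE)

lemma wp_Wr [simp]:
  "wp (Wr a e1 e2) Q s \<longleftrightarrow> safe s e1 \<and> safe s e2 \<and> index_ok a (ev s e1) \<and>
     Q (s\<lparr>arr := (arr s)(a := (arr s a)(ev s e1 := ev s e2)), tm := Suc (tm s)\<rparr>)"
  by (auto simp: wp_def intro: big.intros elim: big_WrE)

lemma wp_Seq [simp]: "wp (c1 ;; c2) Q s \<longleftrightarrow> wp c1 (wp c2 Q) s"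
  by (auto simp: wp_def intro: big.intros elim!: big_SeqE)

lemma wp_Ite [simp]:
  "wp (Ite e1 e2 c1 c2) Q s \<longleftrightarrow> safe s e1 \<and> safe s e2 \<and>
     (if ev s e1 < ev s e2 then wp c1 Q (s\<lparr>tm := Suc (tm s)\<rparr>) else wp c2 Q (s\<lparr>tm := Suc (tm s)\<rparr>))"
  by (auto simp: wp_def intro: big.intros elim!: big_IteE)

lemma wp_While:
  fixes \<mu> :: "st \<Rightarrow> nat"
  assumes inv: "I s"
    and cond: "\<And>s. I s \<Longrightarrow> safe s e1 \<and> safe s e2"
    and body: "\<And>s. I s \<Longrightarrow> ev s e1 < ev s e2 \<Longrightarrow>
      wp c (\<lambda>s'. I s' \<and> \<mu> s' < \<mu> s) (s\<lparr>tm := Suc (tm s)\<rparr>)"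
    and final: "\<And>s. I s \<Longrightarrow> \<not> ev s e1 < ev s e2 \<Longrightarrow> Q (s\<lparr>tm := Suc (tm s)\<rparr>)"
  shows "wp (While e1 e2 c) Q s"
  using inv
proof (induction "\<mu> s" arbitrary: s rule: less_induct)
  case less
  show ?case
  proof (cases "ev s e1 < ev s e2")
    case True
    then obtain s' where s': "big c (s\<lparr>tm := Suc (tm s)\<rparr>) s'" "I s'" "\<mu> s' < \<mu> s"
      using body[OF less.prems] by (auto simp: wp_def)
    then obtain s'' where "big (While e1 e2 c) s' s''" "Q s''"
      using less.hyps by (auto simp: wp_def)
    then show ?thesis
      using s' True cond[OF less.prems] by (auto simp: wp_def intro: big.Loop)
  next
    case False
    then show ?thesis
      using cond[OF less.prems] final[OF less.prems] by (auto simp: wp_def intro: big.Exit)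
  qed
qed

fun wvars :: "com \<Rightarrow> nat set" where
  "wvars (Asg x e) = {x}"
| "wvars (c1 ;; c2) = wvars c1 \<union> wvars c2"
| "wvars (Ite e1 e2 c1 c2) = wvars c1 \<union> wvars c2"
| "wvars (While e1 e2 c) = wvars c"
| "wvars _ = {}"

fun warrs :: "com \<Rightarrow> nat set" where
  "warrs (Wr a e1 e2) = {a}"
| "warrs (c1 ;; c2) = warrs c1 \<union> warrs c2"
| "warrs (Ite e1 e2 c1 c2) = warrs c1 \<union> warrs c2"
| "warrs (While e1 e2 c) = warrs c"
| "warrs _ = {}"

lemma big_frame:
  "big c s s' \<Longrightarrow> (\<forall>x. x \<notin> wvars c \<longrightarrow> var s' x = var s x) \<and> (\<forall>a. a \<notin> warrs c \<longrightarrow> arr s' a = arr s a)"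
  by (induction rule: big.induct) auto

text \<open>Lets a specification omit the variables and arrays that a command does not write; they
  are recovered from its syntax.\<close>

lemma wp_frame:
  assumes "wp c Q s"
    and "\<And>s'. Q s' \<Longrightarrow> (\<And>x. x \<notin> wvars c \<Longrightarrow> var s' x = var s x) \<Longrightarrow>
      (\<And>a. a \<notin> warrs c \<Longrightarrow> arr s' a = arr s a) \<Longrightarrow> Q' s'"
  shows "wp c Q' s"
  using assms big_frame by (fastforce simp: wp_def)

end

subsection \<open>Compilation\<close>

text \<open>
  Register 0 holds \<open>bs\<close>, the registers below 32 hold the variables, the others are temporaries.
\<close>

definition addr_code :: "nat \<Rightarrow> nat \<Rightarrow> instr list" where
  "addr_code a r = (if a = 0 then [] else
     [Const (Suc r) 32, Op Times r r (Suc r), Const (Suc r) a, Op Plus r r (Suc r), Op Plus r r 0])"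

text \<open>The instruction \<open>Op Or r x x\<close> serves as a register move. Temporaries form a
  stack from register \<open>r\<close> upwards, so the registers below \<open>r\<close>
  survive.\<close>

fun cexp :: "exp \<Rightarrow> nat \<Rightarrow> instr list" where
  "cexp (Num c) r = [Const r c]"
| "cexp (Var x) r = [Op Or r x x]"
| "cexp (Rd a e) r = cexp e r @ addr_code a r @ [Load r r]"
| "cexp (Bin b e1 e2) r = cexp e1 r @ cexp e2 (Suc r) @ [Op b r r (Suc r)]"

text \<open>Jump targets are absolute, hence the parameter \<open>p\<close>, the address of the
  code. The else branch comes first because the conditional jump is taken when the test
  succeeds.\<close>

fun ccom :: "com \<Rightarrow> nat \<Rightarrow> instr list" where
  "ccom Skip p = []"
| "ccom (Asg x e) p = cexp e 32 @ [Op Or x 32 32]"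
| "ccom (Wr a e1 e2) p = cexp e1 32 @ addr_code a 32 @ cexp e2 33 @ [Store 32 33]"
| "ccom (c1 ;; c2) p = (let is1 = ccom c1 p in is1 @ ccom c2 (p + length is1))"
| "ccom (Ite e1 e2 c1 c2) p =
    (let b = cexp e1 32 @ cexp e2 33; q = p + length b;
         is2 = ccom c2 (q + 1); is1 = ccom c1 (q + 2 + length is2) in
     b @ [Jump_Less 32 33 (q + 2 + length is2)] @ is2 @
     [Jump (q + 2 + length is2 + length is1)] @ is1)"
| "ccom (While e1 e2 c) p =
    (let b = cexp e1 32 @ cexp e2 33; q = p + length b; is = ccom c (q + 2) in
     b @ [Jump_Less 32 33 (q + 2), Jump (q + 3 + length is)] @ is @ [Jump p])"

fun exp_ok :: "exp \<Rightarrow> bool" where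
  "exp_ok (Num c) \<longleftrightarrow> True"
| "exp_ok (Var x) \<longleftrightarrow> 0 < x \<and> x < 32"
| "exp_ok (Rd a e) \<longleftrightarrow> a < 32 \<and> exp_ok e"
| "exp_ok (Bin b e1 e2) \<longleftrightarrow> exp_ok e1 \<and> exp_ok e2"

fun com_ok :: "com \<Rightarrow> bool" where
  "com_ok Skip \<longleftrightarrow> True"
| "com_ok (Asg x e) \<longleftrightarrow> 0 < x \<and> x < 32 \<and> exp_ok e"
| "com_ok (Wr a e1 e2) \<longleftrightarrow> a < 32 \<and> exp_ok e1 \<and> exp_ok e2"
| "com_ok (c1 ;; c2) \<longleftrightarrow> com_ok c1 \<and> com_ok c2"
| "com_ok (Ite e1 e2 c1 c2) \<longleftrightarrow> exp_ok e1 \<and> exp_ok e2 \<and> com_ok c1 \<and> com_ok c2"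
| "com_ok (While e1 e2 c) \<longleftrightarrow> exp_ok e1 \<and> exp_ok e2 \<and> com_ok c"

text \<open>A crude bound on the cost of a single tick: summing over all subcommands is harmless, as
  the result depends on the program only.\<close>

fun unit_cost :: "com \<Rightarrow> nat" where
  "unit_cost Skip = 0"
| "unit_cost (Asg x e) = length (cexp e 32) + 1"
| "unit_cost (Wr a e1 e2) = length (cexp e1 32 @ addr_code a 32 @ cexp e2 33) + 1"
| "unit_cost (c1 ;; c2) = unit_cost c1 + unit_cost c2"
| "unit_cost (Ite e1 e2 c1 c2) = length (cexp e1 32 @ cexp e2 33) + 2 + unit_cost c1 + unit_cost c2"
| "unit_cost (While e1 e2 c) = length (cexp e1 32 @ cexp e2 33) + 3 + unit_cost c"

section \<open>Execution of straight-line code\<close>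

fun pure_instr :: "instr \<Rightarrow> bool" where
  "pure_instr (Random _) \<longleftrightarrow> False"
| "pure_instr (Jump _) \<longleftrightarrow> False"
| "pure_instr (Jump_Less _ _ _) \<longleftrightarrow> False"
| "pure_instr _ \<longleftrightarrow> True"

definition steps :: "nat \<Rightarrow> instr list \<Rightarrow> nat \<Rightarrow> config \<Rightarrow> config" where
  "steps w P t c = (step w P ^^ t) c"

definition code_at :: "instr list \<Rightarrow> nat \<Rightarrow> instr list \<Rightarrow> bool" where
  "code_at P p is \<longleftrightarrow> (\<forall>i<length is. p + i < length P \<and> P ! (p + i) = is ! i)"

lemma code_at_Nil: "code_at P p []"
  by (simp add: code_at_def)

lemma code_at_Cons: "code_at P p (i # is) \<longleftrightarrow> p < length P \<and> P ! p = i \<and> code_at P (p + 1) is"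
  unfolding code_at_def by (auto simp: less_Suc_eq_0_disj)

lemma code_at_append: "code_at P p (is @ js) \<longleftrightarrow> code_at P p is \<and> code_at P (p + length is) js"
  by (induction "is" arbitrary: p) (auto simp: code_at_Cons code_at_Nil)

lemma code_at_mid: "code_at P p is \<Longrightarrow> is = xs @ ys @ zs \<Longrightarrow> code_at P (p + length xs) ys"
  by (simp add: code_at_append)

lemma steps_0 [simp]: "steps w P 0 c = c"
  by (simp add: steps_def)

lemma steps_add: "steps w P (t + u) c = steps w P u (steps w P t c)"
  by (simp add: steps_def funpow_add add.commute[of t])

lemma steps_Suc: "steps w P (Suc t) c = steps w P t (step w P c)"
  by (simp add: steps_def funpow_Suc_right del: funpow.simps)

lemma steps_1 [simp]: "steps w P (Suc 0) c = step w P c"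
  by (simp add: steps_def)

lemma step_at: "code_at P (pc c) (i # is) \<Longrightarrow> step w P c = exec_instr w i c"
  by (simp add: code_at_Cons step_def halted_def)

lemma steps_pure:
  assumes "code_at P (pc c) is" "list_all pure_instr is"
  shows "steps w P (length is) c = fold (exec_instr w) is c
    \<and> pc (fold (exec_instr w) is c) = pc c + length is"
  using assms
proof (induction "is" arbitrary: c)
  case (Cons i "is")
  have 1: "step w P c = exec_instr w i c"
    using step_at Cons.prems(1) by blast
  have 2: "pc (exec_instr w i c) = pc c + 1"
    using Cons.prems(2) by (cases i) (auto simp: set_reg_def)
  show ?case
    using Cons.IH[of "exec_instr w i c"] Cons.prems 1 2 by (auto simp: steps_Suc code_at_Cons)
qed auto

lemma pure_cexp: "list_all pure_instr (cexp e r)"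
  by (induction e r rule: cexp.induct) (auto simp: addr_code_def)

lemma pure_addr_code: "list_all pure_instr (addr_code a r)"
  by (auto simp: addr_code_def)

section \<open>Word arithmetic and simulation of the language by the machine\<close>

lemma op_val_less:
  assumes "x < 2 ^ w" "y < 2 ^ w" "op_val b x y < 2 ^ w" "b = Minus \<longrightarrow> y \<le> x"
  shows "eval_op w b x y = op_val b x y"
proof (cases b)
  case Minus
  then have 1: "2 ^ w + x - y = 2 ^ w + (x - y)" "x - y < 2 ^ w"
    using assms by auto
  then have "(2 ^ w + (x - y)) mod 2 ^ w = x - y"
    by (metis mod_add_self1 mod_less)
  then show ?thesis
    using Minus 1 by (simp only: eval_op.simps op_val.simps take_bit_eq_mod)
qed (use assms(3) in \<open>simp_all only: eval_op.simps op_val.simps take_bit_nat_eq_self\<close>)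

text \<open>The first bound makes every address a word: \<open>i < L\<close> and
  \<open>a < 32\<close> give \<open>bs + 32 * i + a < bs + 32 * L\<close>. Six bits are needed for
  the stride 32 itself.\<close>

locale compiled = bounds +
  fixes w :: nat
  assumes word: "bs + 32 * L \<le> 2 ^ w" "1 \<le> L" "6 \<le> w"
begin

lemma lim_word: "x < L \<Longrightarrow> x < 2 ^ w"
  using word by linarith

lemma word_32: "32 < (2::nat) ^ w"
  using power_increasing[OF word(3), of "2::nat"] by simp

text \<open>The stride 32 interleaves the arrays, so none needs a size fixed in advance. Stored
  values only have to be words; the limit \<open>L\<close> is imposed by \<open>safe\<close> on
  constants and on results of operations.\<close>

definition rep :: "st \<Rightarrow> config \<Rightarrow> bool" where
  "rep s c \<longleftrightarrow> reg c 0 = bs \<and> (\<forall>x. 0 < x \<and> x < 32 \<longrightarrow> reg c x = var s x \<and> var s x < 2 ^ w) \<and>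
     (\<forall>i<bs. mem c i = arr s 0 i) \<and>
     (\<forall>a i. 0 < a \<and> a < 32 \<longrightarrow> mem c (bs + 32 * i + a) = arr s a i) \<and> (\<forall>a i. arr s a i < 2 ^ w)"

definition same_regs :: "nat \<Rightarrow> config \<Rightarrow> config \<Rightarrow> bool" where
  "same_regs r c c' \<longleftrightarrow> mem c' = mem c \<and> (\<forall>x<r. reg c' x = reg c x)"

lemma rep_same_regs: "rep s c \<Longrightarrow> same_regs r c c' \<Longrightarrow> 32 \<le> r \<Longrightarrow> rep s c'"
  by (auto simp: rep_def same_regs_def)

lemma addr_code_correct:
  assumes "rep s c" "reg c r = i" "index_ok a i" "a < 32" "32 \<le> r"
  shows "same_regs r c (fold (exec_instr w) (addr_code a r) c)
    \<and> reg (fold (exec_instr w) (addr_code a r) c) r = (if a = 0 then i else bs + 32 * i + a)"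
proof (cases "a = 0")
  case True
  then show ?thesis
    using assms by (simp add: addr_code_def same_regs_def)
next
  case False
  then have "i < L"
    using assms by (simp add: index_ok_def)
  then have 1: "bs + 32 * i + a < 2 ^ w"
    using word(1) assms(4) by linarith
  have 2: "take_bit w (i * 32) = i * 32" "take_bit w (i * 32 + a) = i * 32 + a"
    "take_bit w (i * 32 + a + bs) = i * 32 + a + bs" "take_bit w 32 = (32::nat)" "take_bit w a = a"
    using 1 assms(4) word_32 word(1) \<open>i < L\<close> by (auto simp: take_bit_nat_eq_self_iff)
  show ?thesis
    using False assms by (auto simp: addr_code_def same_regs_def set_reg_def rep_def 2)
qed

lemma ev_less: "rep s c \<Longrightarrow> safe s e \<Longrightarrow> exp_ok e \<Longrightarrow> ev s e < 2 ^ w"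
  by (induction e) (auto simp: rep_def lim_word)

lemma mem_index: "rep s c \<Longrightarrow> index_ok a i \<Longrightarrow> a < 32 \<Longrightarrow>
    mem c (if a = 0 then i else bs + 32 * i + a) = arr s a i"
  by (auto simp: rep_def index_ok_def)

lemma cexp_correct:
  assumes "rep s c" "safe s e" "exp_ok e" "32 \<le> r"
  shows "same_regs r c (fold (exec_instr w) (cexp e r) c)
    \<and> reg (fold (exec_instr w) (cexp e r) c) r = ev s e"
  using assms
proof (induction e arbitrary: c r)
  case (Num x)
  then show ?case
    by (auto simp: same_regs_def set_reg_def take_bit_nat_eq_self_iff lim_word)
next
  case (Var x)
  then show ?case
    by (auto simp: same_regs_def set_reg_def take_bit_nat_eq_self_iff rep_def)
next
  case (Rd a e)
  let ?c1 = "fold (exec_instr w) (cexp e r) c"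
  let ?c2 = "fold (exec_instr w) (addr_code a r) ?c1"
  have 1: "same_regs r c ?c1" "reg ?c1 r = ev s e"
    using Rd by auto
  then have 2: "rep s ?c1"
    using rep_same_regs Rd by blast
  have 3: "same_regs r ?c1 ?c2" "reg ?c2 r = (if a = 0 then ev s e else bs + 32 * ev s e + a)"
    using addr_code_correct[OF 2 1(2)] Rd by auto
  then have "rep s ?c2"
    using rep_same_regs 2 Rd by blast
  then have "mem ?c2 (reg ?c2 r) = arr s a (ev s e)"
    unfolding 3(2) using Rd by (intro mem_index) auto
  then show ?case
    using 1 3(1) by (auto simp: same_regs_def set_reg_def)
next
  case (Bin b e1 e2)
  let ?c1 = "fold (exec_instr w) (cexp e1 r) c"
  let ?c2 = "fold (exec_instr w) (cexp e2 (Suc r)) ?c1"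
  have 1: "same_regs r c ?c1" "reg ?c1 r = ev s e1"
    using Bin by auto
  then have 2: "rep s ?c1"
    using rep_same_regs Bin by blast
  have 3: "same_regs (Suc r) ?c1 ?c2" "reg ?c2 (Suc r) = ev s e2"
    using Bin 2 by auto
  have "eval_op w b (ev s e1) (ev s e2) = op_val b (ev s e1) (ev s e2)"
    using Bin by (intro op_val_less) (auto simp: lim_word intro!: ev_less)
  then show ?case
    using 1 3 by (auto simp: same_regs_def set_reg_def)
qed

lemma cexp2_correct:
  assumes "rep s c" "safe s e1" "exp_ok e1" "safe s e2" "exp_ok e2"
  shows "rep s (fold (exec_instr w) (cexp e1 32 @ cexp e2 33) c)
    \<and> reg (fold (exec_instr w) (cexp e1 32 @ cexp e2 33) c) 32 = ev s e1
    \<and> reg (fold (exec_instr w) (cexp e1 32 @ cexp e2 33) c) 33 = ev s e2"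
proof -
  let ?c1 = "fold (exec_instr w) (cexp e1 32) c"
  have 1: "same_regs 32 c ?c1" "reg ?c1 32 = ev s e1"
    using cexp_correct[OF assms(1-3)] by auto
  then have 2: "rep s ?c1"
    using rep_same_regs assms by blast
  have 3: "same_regs 33 ?c1 (fold (exec_instr w) (cexp e2 33) ?c1)"
    "reg (fold (exec_instr w) (cexp e2 33) ?c1) 33 = ev s e2"
    using cexp_correct[OF 2 assms(4,5)] by auto
  then have "rep s (fold (exec_instr w) (cexp e2 33) ?c1)"
    using rep_same_regs[OF 2] by simp
  then show ?thesis
    using 1 3 by (auto simp: same_regs_def)
qed

lemma rep_pc [simp]: "rep s (c\<lparr>pc := p\<rparr>) \<longleftrightarrow> rep s c"
  by (simp add: rep_def)

lemma rep_tm [simp]: "rep (s\<lparr>tm := t\<rparr>) c \<longleftrightarrow> rep s c"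
  by (simp add: rep_def)

lemma test_steps:
  assumes "rep s c" "safe s e1" "exp_ok e1" "safe s e2" "exp_ok e2"
    and "code_at P (pc c) (cexp e1 32 @ cexp e2 33 @ Jump_Less 32 33 l # is)"
  shows "\<exists>c'. steps w P (length (cexp e1 32 @ cexp e2 33) + 1) c = c' \<and> rep s c' \<and>
    pc c' = (if ev s e1 < ev s e2 then l else pc c + length (cexp e1 32 @ cexp e2 33) + 1)"
proof -
  let ?is = "cexp e1 32 @ cexp e2 33"
  let ?c = "fold (exec_instr w) ?is c"
  have 1: "steps w P (length ?is) c = ?c" "pc ?c = pc c + length ?is"
    using steps_pure[of P c ?is] assms(6) pure_cexp by (auto simp: code_at_append)
  then have "step w P ?c = exec_instr w (Jump_Less 32 33 l) ?c"
    using step_at[of P ?c "Jump_Less 32 33 l" "is" w] assms(6) by (simp add: code_at_append add.assoc)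
  then have "steps w P (length ?is + 1) c = exec_instr w (Jump_Less 32 33 l) ?c"
    using 1 by (simp only: steps_add) simp
  then show ?thesis
    using cexp2_correct[OF assms(1-5)] 1(2) by (auto simp del: fold_append)
qed

lemma rep_write:
  assumes "rep s c" "index_ok a i" "a < 32" "x < 2 ^ w"
  shows "rep (s\<lparr>arr := (arr s)(a := (arr s a)(i := x)), tm := t\<rparr>)
    (c\<lparr>pc := p, mem := (mem c)((if a = 0 then i else bs + 32 * i + a) := x)\<rparr>)"
proof (cases "a = 0")
  case True
  then show ?thesis
    using assms by (simp add: rep_def index_ok_def)
next
  case False
  \<comment> \<open>Different cells have different addresses, since division by 32 recovers the cell
    number.\<close>
  have "bs + 32 * j + b = bs + 32 * i + a \<longleftrightarrow> j = i \<and> b = a" if "b < 32" for j b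
  proof -
    have "(32 * i + a) div 32 = i" "(32 * j + b) div 32 = j"
      using that assms(3) by simp_all
    then have "32 * i + a = 32 * j + b \<Longrightarrow> i = j"
      by argo
    then show ?thesis
      by linarith
  qed
  then have 1: "((mem c)(bs + 32 * i + a := x)) (bs + 32 * j + b) =
      ((arr s)(a := (arr s a)(i := x))) b j" if "0 < b" "b < 32" for j b
    using assms(1) that by (auto simp: rep_def)
  have 2: "((mem c)(bs + 32 * i + a := x)) j = ((arr s)(a := (arr s a)(i := x))) 0 j" if "j < bs" for j
    using assms(1) that False by (simp add: rep_def)
  have 3: "((arr s)(a := (arr s a)(i := x))) b j < 2 ^ w" for b j
    using assms by (simp add: rep_def)
  show ?thesis
    using assms(1) False 1 2 3 unfolding rep_def by simp
qed

text \<open>Simulation by induction on the derivation. \<open>K\<close> may exceed the unit cost, so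
  that one constant serves a command and all its parts.\<close>

lemma ccom_correct:
  "big cm s s' \<Longrightarrow> com_ok cm \<Longrightarrow> rep s c \<Longrightarrow> code_at P (pc c) (ccom cm (pc c)) \<Longrightarrow> unit_cost cm \<le> K \<Longrightarrow>
   \<exists>t. t \<le> K * (tm s' - tm s) \<and> rep s' (steps w P t c) \<and>
     pc (steps w P t c) = pc c + length (ccom cm (pc c))"
proof (induction arbitrary: c rule: big.induct)
  case (Skip s)
  then show ?case
    by (intro exI[of _ 0]) auto
next
  case (Asg s e x)
  let ?c = "fold (exec_instr w) (cexp e 32) c"
  have 1: "steps w P (length (cexp e 32 @ [Op Or x 32 32])) c = exec_instr w (Op Or x 32 32) ?c"
    "pc (exec_instr w (Op Or x 32 32) ?c) = pc c + length (cexp e 32) + 1"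
    using steps_pure[of P c "cexp e 32 @ [Op Or x 32 32]" w] Asg pure_cexp by auto
  have 2: "same_regs 32 c ?c" "reg ?c 32 = ev s e"
    using cexp_correct[of s c e 32] Asg by auto
  have "ev s e < 2 ^ w"
    using Asg ev_less by auto
  then have "rep (s\<lparr>var := (var s)(x := ev s e), tm := Suc (tm s)\<rparr>) (exec_instr w (Op Or x 32 32) ?c)"
    using Asg 2 by (auto simp: rep_def same_regs_def set_reg_def take_bit_nat_eq_self_iff)
  then show ?case
    using 1 Asg.prems by (intro exI[of _ "length (cexp e 32 @ [Op Or x 32 32])"]) auto
next
  case (Wr s e1 e2 a)
  let ?is = "cexp e1 32 @ addr_code a 32 @ cexp e2 33"
  let ?c1 = "fold (exec_instr w) (cexp e1 32) c"
  let ?c2 = "fold (exec_instr w) (addr_code a 32) ?c1"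
  let ?c3 = "fold (exec_instr w) (cexp e2 33) ?c2"
  let ?i = "ev s e1" and ?x = "ev s e2"
  have 1: "steps w P (length (?is @ [Store 32 33])) c = exec_instr w (Store 32 33) ?c3"
    "pc (exec_instr w (Store 32 33) ?c3) = pc c + length ?is + 1"
    using steps_pure[of P c "?is @ [Store 32 33]" w] Wr pure_cexp pure_addr_code by auto
  have 2: "same_regs 32 c ?c1" "reg ?c1 32 = ?i"
    using cexp_correct[of s c e1 32] Wr by auto
  then have r1: "rep s ?c1"
    using rep_same_regs Wr by blast
  have 3: "same_regs 32 ?c1 ?c2" "reg ?c2 32 = (if a = 0 then ?i else bs + 32 * ?i + a)"
    using addr_code_correct[OF r1 2(2)] Wr by auto
  then have r2: "rep s ?c2"
    using rep_same_regs r1 by blast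
  have 4: "same_regs 33 ?c2 ?c3" "reg ?c3 33 = ?x"
    using cexp_correct[OF r2, of e2 33] Wr by auto
  then have r3: "rep s ?c3"
    using rep_same_regs[OF r2, of 33] by simp
  have "ev s e2 < 2 ^ w"
    using Wr ev_less by auto
  moreover have "reg ?c3 32 = (if a = 0 then ?i else bs + 32 * ?i + a)"
    using 3(2) 4(1) by (auto simp: same_regs_def)
  moreover have "a < 32" "index_ok a ?i"
    using Wr by auto
  ultimately have "rep (s\<lparr>arr := (arr s)(a := (arr s a)(?i := ?x)), tm := Suc (tm s)\<rparr>)
      (exec_instr w (Store 32 33) ?c3)"
    using rep_write[OF r3, of a ?i ?x] 4(2) by simp
  then show ?case
    using 1 Wr.prems by (intro exI[of _ "length (?is @ [Store 32 33])"]) auto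
next
  case (Seq c1 s s' c2 s'')
  let ?is = "ccom c1 (pc c)"
  obtain t where t: "t \<le> K * (tm s' - tm s)" "rep s' (steps w P t c)" "pc (steps w P t c) = pc c + length ?is"
    using Seq.IH(1)[of c] Seq.prems by (auto simp: Let_def code_at_append)
  obtain u where u: "u \<le> K * (tm s'' - tm s')" "rep s'' (steps w P u (steps w P t c))"
    "pc (steps w P u (steps w P t c)) = pc c + length ?is + length (ccom c2 (pc c + length ?is))"
    using Seq.IH(2)[of "steps w P t c"] Seq.prems t by (auto simp: Let_def code_at_append)
  have "t + u \<le> K * (tm s'' - tm s)"
  proof -
    have "tm s'' - tm s = (tm s' - tm s) + (tm s'' - tm s')"
      using tm_mono[OF Seq.hyps(1)] tm_mono[OF Seq.hyps(2)] by simp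
    then show ?thesis
      using t(1) u(1) by (simp add: distrib_left)
  qed
  then show ?case
    using u by (intro exI[of _ "t + u"]) (auto simp: steps_add Let_def)
next
  case (Then s e1 e2 c1 s' c2)
  define b where "b = cexp e1 32 @ cexp e2 33"
  define is2 where "is2 = ccom c2 (pc c + length b + 1)"
  define l where "l = pc c + length b + 2 + length is2"
  define is1 where "is1 = ccom c1 l"
  have code: "ccom (Ite e1 e2 c1 c2) (pc c) = b @ [Jump_Less 32 33 l] @ is2 @ [Jump (l + length is1)] @ is1"
    by (simp add: Let_def b_def is2_def l_def is1_def)
  have at: "code_at P l is1"
    using code_at_mid[OF Then.prems(3)[unfolded code], of "b @ [Jump_Less 32 33 l] @ is2 @ [Jump (l + length is1)]"
        is1 "[]"]
    by (simp add: l_def ac_simps)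
  have ok: "exp_ok e1" "exp_ok e2"
    using Then.prems(1) by simp_all
  obtain c' where c': "steps w P (length b + 1) c = c'" "rep s c'" "pc c' = l"
    using test_steps[OF Then.prems(2) Then.hyps(1) ok(1) Then.hyps(2) ok(2), of P] Then.prems(3) Then.hyps(3)
    unfolding code by (simp add: b_def)
  obtain t where t: "t \<le> K * (tm s' - Suc (tm s))" "rep s' (steps w P t c')"
    "pc (steps w P t c') = l + length is1"
    using Then.IH[of c'] Then.prems c' at by (auto simp: is1_def)
  have "length b + 1 + t \<le> K * (tm s' - tm s)"
  proof -
    have "tm s' - tm s = Suc (tm s' - Suc (tm s))"
      using tm_mono[OF Then.hyps(4)] by simp
    moreover have "length b + 1 \<le> K"
      using Then.prems by (simp add: b_def)
    ultimately show ?thesis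
      using t(1) by simp
  qed
  then show ?case
    using t c' by (intro exI[of _ "length b + 1 + t"]) (auto simp: steps_add code l_def simp del: ccom.simps add_Suc)
next
  case (Else s e1 e2 c2 s' c1)
  define b where "b = cexp e1 32 @ cexp e2 33"
  define is2 where "is2 = ccom c2 (pc c + length b + 1)"
  define l where "l = pc c + length b + 2 + length is2"
  define is1 where "is1 = ccom c1 l"
  have code: "ccom (Ite e1 e2 c1 c2) (pc c) = b @ [Jump_Less 32 33 l] @ is2 @ [Jump (l + length is1)] @ is1"
    by (simp add: Let_def b_def is2_def l_def is1_def)
  have at: "code_at P (pc c + length b + 1) is2" "code_at P (pc c + length b + 1 + length is2) [Jump (l + length is1)]"
    using code_at_mid[OF Else.prems(3)[unfolded code], of "b @ [Jump_Less 32 33 l]" is2 "[Jump (l + length is1)] @ is1"]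
      code_at_mid[OF Else.prems(3)[unfolded code], of "b @ [Jump_Less 32 33 l] @ is2" "[Jump (l + length is1)]" is1]
    by (simp_all add: ac_simps)
  have ok: "exp_ok e1" "exp_ok e2"
    using Else.prems(1) by simp_all
  obtain c' where c': "steps w P (length b + 1) c = c'" "rep s c'" "pc c' = pc c + length b + 1"
    using test_steps[OF Else.prems(2) Else.hyps(1) ok(1) Else.hyps(2) ok(2), of P] Else.prems(3) Else.hyps(3)
    unfolding code by (simp add: b_def)
  obtain t where t: "t \<le> K * (tm s' - Suc (tm s))" "rep s' (steps w P t c')"
    "pc (steps w P t c') = pc c + length b + 1 + length is2"
    using Else.IH[of c'] Else.prems c' at by (auto simp: is2_def)
  have "step w P (steps w P t c') = exec_instr w (Jump (l + length is1)) (steps w P t c')"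
    using at(2) t(3) step_at by metis
  moreover have "length b + 1 + t + 1 \<le> K * (tm s' - tm s)"
  proof -
    have "tm s' - tm s = Suc (tm s' - Suc (tm s))"
      using tm_mono[OF Else.hyps(4)] by simp
    moreover have "length b + 2 \<le> K"
      using Else.prems by (simp add: b_def)
    ultimately show ?thesis
      using t(1) by simp
  qed
  ultimately show ?case
    using t c' by (intro exI[of _ "length b + 1 + t + 1"])
      (auto simp only: steps_add, auto simp: code l_def simp del: ccom.simps)
next
  case (Loop s e1 e2 cm s' s'')
  define b where "b = cexp e1 32 @ cexp e2 33"
  define l where "l = pc c + length b + 2"
  define body where "body = ccom cm l"
  have code: "ccom (While e1 e2 cm) (pc c) =
      b @ [Jump_Less 32 33 l, Jump (l + 1 + length body)] @ body @ [Jump (pc c)]"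
    by (simp add: Let_def b_def l_def body_def)
  have at: "code_at P l body" "code_at P (l + length body) [Jump (pc c)]"
    using code_at_mid[OF Loop.prems(3)[unfolded code], of "b @ [Jump_Less 32 33 l, Jump (l + 1 + length body)]"
        body "[Jump (pc c)]"]
      code_at_mid[OF Loop.prems(3)[unfolded code], of "b @ [Jump_Less 32 33 l, Jump (l + 1 + length body)] @ body"
        "[Jump (pc c)]" "[]"]
    by (simp_all add: l_def ac_simps)
  have ok: "exp_ok e1" "exp_ok e2"
    using Loop.prems(1) by simp_all
  obtain c' where c': "steps w P (length b + 1) c = c'" "rep s c'" "pc c' = l"
    using test_steps[OF Loop.prems(2) Loop.hyps(1) ok(1) Loop.hyps(2) ok(2), of P] Loop.prems(3) Loop.hyps(3)
    unfolding code by (simp add: b_def)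
  obtain t where t: "t \<le> K * (tm s' - Suc (tm s))" "rep s' (steps w P t c')"
    "pc (steps w P t c') = l + length body"
    using Loop.IH(1)[of c'] Loop.prems c' at by (auto simp: body_def)
  define c'' where "c'' = step w P (steps w P t c')"
  have c''_eq: "c'' = (steps w P t c')\<lparr>pc := pc c\<rparr>"
    using at(2) t(3) step_at[of P "steps w P t c'" "Jump (pc c)" "[]" w] by (simp add: c''_def)
  then have "rep s' c''" "pc c'' = pc c"
    using t by auto
  then obtain u where u: "u \<le> K * (tm s'' - tm s')" "rep s'' (steps w P u c'')"
    "pc (steps w P u c'') = pc c + length (ccom (While e1 e2 cm) (pc c))"
    using Loop.IH(2)[of c''] Loop.prems by auto
  \<comment> \<open>The tick of the test pays for evaluating it, for the conditional jump and for
    the jump back.\<close>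
  have "length b + 1 + t + 1 + u \<le> K * (tm s'' - tm s)"
  proof -
    have "length b + 2 \<le> K"
      using Loop.prems by (simp add: b_def)
    have "tm s'' - tm s = Suc ((tm s' - Suc (tm s)) + (tm s'' - tm s'))"
      using tm_mono[OF Loop.hyps(4)] tm_mono[OF Loop.hyps(5)] by simp
    then have "K * (tm s'' - tm s) = K + K * (tm s' - Suc (tm s)) + K * (tm s'' - tm s')"
      by (simp only: mult_Suc_right distrib_left add.assoc)
    then show ?thesis
      using t(1) u(1) \<open>length b + 2 \<le> K\<close> by linarith
  qed
  moreover have "steps w P (length b + 1 + t + 1 + u) c = steps w P u c''"
    using c'(1) by (simp only: steps_add) (simp add: c''_def)
  ultimately show ?case
    using u by metis
next
  case (Exit s e1 e2 cm)
  define b where "b = cexp e1 32 @ cexp e2 33"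
  define l where "l = pc c + length b + 2"
  define body where "body = ccom cm l"
  have code: "ccom (While e1 e2 cm) (pc c) =
      b @ [Jump_Less 32 33 l, Jump (l + 1 + length body)] @ body @ [Jump (pc c)]"
    by (simp add: Let_def b_def l_def body_def)
  have at: "code_at P (pc c + length b + 1) (Jump (l + 1 + length body) # body @ [Jump (pc c)])"
    using code_at_mid[OF Exit.prems(3)[unfolded code], of "b @ [Jump_Less 32 33 l]"
        "Jump (l + 1 + length body) # body @ [Jump (pc c)]" "[]"]
    by simp
  have ok: "exp_ok e1" "exp_ok e2"
    using Exit.prems(1) by simp_all
  obtain c' where c': "steps w P (length b + 1) c = c'" "rep s c'" "pc c' = pc c + length b + 1"
    using test_steps[OF Exit.prems(2) Exit.hyps(1) ok(1) Exit.hyps(2) ok(2), of P] Exit.prems(3) Exit.hyps(3)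
    unfolding code by (simp add: b_def)
  have "step w P c' = c'\<lparr>pc := l + 1 + length body\<rparr>"
    using at c'(3) step_at[of P c' _ _ w] by fastforce
  moreover have "length b + 2 \<le> K"
    using Exit.prems by (simp add: b_def)
  moreover have "steps w P (length b + 1 + 1) c = step w P c'"
    using c'(1) by (simp only: steps_add) simp
  ultimately show ?case
    using c' by (intro exI[of _ "length b + 1 + 1"]) (auto simp: code l_def simp del: ccom.simps)
qed

end

text \<open>The prelude loads \<open>bs = 3 + 2m + n\<close> into register 0.\<close>

definition prelude :: "instr list" where
  "prelude = [Const 1 1, Load 0 1, Op Plus 0 0 0, Const 1 0, Load 1 1, Op Plus 0 0 1, Const 1 3, Op Plus 0 0 1]"

definition program :: "com \<Rightarrow> instr list" where
  "program cm = prelude @ ccom cm (length prelude)"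

text \<open>Variable 1 starts at 3 because the prelude uses register 1 as scratch and leaves this
  constant there.\<close>

definition init_st :: "nat list \<Rightarrow> st" where
  "init_st ws = \<lparr>var = (\<lambda>x. if x = 1 then 3 else 0),
     arr = (\<lambda>a i. if a = 0 \<and> i < length ws then ws ! i else 0), tm = 0\<rparr>"

lemma length_encode: "length (encode n es k) = 3 + 2 * length es"
proof -
  have "length (concat (map (\<lambda>(u, v). [u, v]) es)) = 2 * length es"
    by (induction es) auto
  then show ?thesis
    by (simp add: encode_def)
qed

lemma run_steps: "run w P ws \<omega> t = steps w P t (start ws \<omega>)"
  by (simp add: run_def steps_def)

lemma prelude_correct:
  assumes w: "2 * length es + n + 3 + 32 * L \<le> 2 ^ w" "1 \<le> L" "6 \<le> w"
    and ws: "\<And>i. i < length (encode n es k) \<Longrightarrow> encode n es k ! i < 2 ^ w"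
  shows "\<exists>c. run w (program cm) (encode n es k) \<omega> (length prelude) = c \<and> pc c = length prelude \<and>
    compiled.rep (2 * length es + n + 3) w (init_st (encode n es k)) c"
proof -
  interpret compiled L "2 * length es + n + 3" w
    using w by unfold_locales simp_all
  let ?c = "fold (exec_instr w) prelude (start (encode n es k) \<omega>)"
  have "code_at (program cm) (pc (start (encode n es k) \<omega>)) prelude"
    by (simp add: code_at_def start_def program_def nth_append)
  moreover have "list_all pure_instr prelude"
    by (simp add: prelude_def)
  ultimately have 1: "run w (program cm) (encode n es k) \<omega> (length prelude) = ?c" "pc ?c = length prelude"
    using steps_pure[of "program cm" "start (encode n es k) \<omega>" prelude w] by (simp_all add: run_steps start_def)
  have 2: "encode n es k ! 0 = n" "encode n es k ! 1 = length es"
    by (simp_all add: encode_def)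
  have 3: "take_bit w (length es + length es) = length es + length es"
    "take_bit w (length es + length es + n) = length es + length es + n"
    "take_bit w (length es + length es + n + 3) = length es + length es + n + 3"
    "take_bit w (Suc 0) = Suc 0" "take_bit w 3 = (3::nat)"
    using w word_32 by (simp_all add: take_bit_nat_eq_self_iff del: take_bit_of_Suc_0)
  have regs: "reg ?c 0 = 2 * length es + n + 3" "reg ?c 1 = 3" "\<And>x. 1 < x \<Longrightarrow> reg ?c x = 0"
    and mems: "mem ?c = (\<lambda>a. if a < length (encode n es k) then encode n es k ! a else 0)"
    using 2 3 by (simp_all add: prelude_def start_def set_reg_def length_encode)
  have "rep (init_st (encode n es k)) ?c"
    unfolding rep_def regs(1) mems
    using regs ws word_32 by (auto simp: init_st_def length_encode)
  then show ?thesis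
    using 1 by blast
qed

text \<open>\<open>Q\<close> may look at the first \<open>n\<close> cells only, since the memory at
  halting time also holds the other arrays, above \<open>bs\<close>.\<close>

theorem program_correct:
  assumes w: "2 * length es + n + 3 + 32 * L \<le> 2 ^ w" "1 \<le> L" "6 \<le> w"
    and ws: "\<And>i. i < length (encode n es k) \<Longrightarrow> encode n es k ! i < 2 ^ w"
    and ok: "com_ok cm"
    and cm: "bounds.wp L (2 * length es + n + 3) cm (\<lambda>s. tm s \<le> T \<and> Q (\<lambda>v. arr s 0 v))
      (init_st (encode n es k))"
    and Q: "\<And>f g. (\<And>v. v < n \<Longrightarrow> f v = g v) \<Longrightarrow> Q f \<Longrightarrow> Q g"
  shows "\<exists>t \<le> length prelude + unit_cost cm * T. halted (program cm) (run w (program cm) (encode n es k) \<omega> t) \<and>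
    Q (mem (run w (program cm) (encode n es k) \<omega> t))"
proof -
  interpret compiled L "2 * length es + n + 3" w
    using w by unfold_locales simp_all
  let ?P = "program cm"
  obtain c where c: "steps w ?P (length prelude) (start (encode n es k) \<omega>) = c" "pc c = length prelude"
    "rep (init_st (encode n es k)) c"
    using prelude_correct[OF w ws] unfolding run_steps by blast
  obtain s' where s': "big cm (init_st (encode n es k)) s'" "tm s' \<le> T" "Q (\<lambda>v. arr s' 0 v)"
    using cm by (auto simp: wp_def)
  have "code_at ?P (pc c) (ccom cm (pc c))"
    using c(2) by (simp add: code_at_def program_def nth_append)
  from ccom_correct[OF s'(1) ok c(3) this order_refl]
  obtain t where t: "t \<le> unit_cost cm * tm s'" "rep s' (steps w ?P t c)"
    "pc (steps w ?P t c) = length prelude + length (ccom cm (length prelude))"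
    using c(2) by (auto simp: init_st_def)
  have eq: "run w ?P (encode n es k) \<omega> (length prelude + t) = steps w ?P t c"
    by (simp only: run_steps steps_add c(1))
  have "t \<le> unit_cost cm * T"
    using t(1) s'(2) by (meson le_trans mult_le_mono2)
  moreover have "halted ?P (steps w ?P t c)"
    using t(3) by (simp add: halted_def program_def)
  moreover have "Q (mem (steps w ?P t c))"
    using t(2) by (intro Q[OF _ s'(3)]) (auto simp: rep_def)
  ultimately show ?thesis
    using eq by (intro exI[of _ "length prelude + t"]) auto
qed

subsection \<open>Deterministic algorithms are Las Vegas algorithms\<close>

lemma halted_stays: "halted P (run w P ws \<omega> t) \<Longrightarrow> run w P ws \<omega> (t + u) = run w P ws \<omega> t"
proof (induction u)
  case (Suc u)
  then show ?case
    by (simp add: run_def step_def)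
qed simp

lemma prob_space_random_tape: "prob_space (random_tape w)"
  unfolding random_tape_def
  by (intro prob_space.prob_space_stream_space prob_space_uniform_count_measure) (auto simp: lessThan_empty_iff)

text \<open>The bound holds for every tape, so the event of the tail bound is the whole space and
  the integrand of the expectation lies below a constant.\<close>

lemma las_vegas_solvable_deterministic:
  fixes P :: "instr list" and a K :: nat
  assumes a: "1 \<le> a"
    and halts: "\<And>n es k w \<omega>. dag_input n es k \<Longrightarrow> word_size_ok a n es k w \<Longrightarrow>
      \<exists>t \<le> K * f n es k. halted P (run w P (encode n es k) \<omega> t) \<and> Sol n es k (mem (run w P (encode n es k) \<omega> t))"
  shows "las_vegas_solvable Sol f"
proof -
  have bound: "ennreal_of_enat (runtime w P (encode n es k) \<omega>)
      \<le> ennreal (real K * real (f n es k) * log 2 (real (input_size n es)) ^ 0)"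
    if "dag_input n es k" "word_size_ok a n es k w" for n es k w \<omega>
  proof -
    obtain t where t: "t \<le> K * f n es k" "halted P (run w P (encode n es k) \<omega> t)"
      using halts[OF \<open>dag_input n es k\<close> \<open>word_size_ok a n es k w\<close>] by blast
    have "runtime w P (encode n es k) \<omega> \<le> enat t"
      unfolding runtime_def using t(2) by (intro INF_lower) simp
    also have "\<dots> \<le> enat (K * f n es k)"
      using t(1) by simp
    finally have "ennreal_of_enat (runtime w P (encode n es k) \<omega>) \<le> ennreal_of_enat (enat (K * f n es k))"
      by (simp only: ennreal_of_enat_le_iff)
    also have "\<dots> = ennreal (real K * real (f n es k))"
      by (simp only: ennreal_of_enat_enat flip: ennreal_of_nat_eq_real_of_nat of_nat_mult)
    finally show ?thesis
      by simp
  qed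
  have correct: "Sol n es k (mem (run w P (encode n es k) \<omega> t))"
    if asm: "dag_input n es k" "word_size_ok a n es k w" "halted P (run w P (encode n es k) \<omega> t)" for n es k w \<omega> t
  proof -
    obtain u where u: "halted P (run w P (encode n es k) \<omega> u)" "Sol n es k (mem (run w P (encode n es k) \<omega> u))"
      using halts[OF asm(1,2)] by blast
    \<comment> \<open>Two halting configurations coincide because both equal the configuration after
      \<open>t + u\<close> steps.\<close>
    have "run w P (encode n es k) \<omega> t = run w P (encode n es k) \<omega> u"
      using halted_stays[OF asm(3), of u] halted_stays[OF u(1), of t] by (simp add: add.commute)
    then show ?thesis
      using u(2) by simp
  qed
  show ?thesis
    unfolding las_vegas_solvable_def
  proof (rule exI[of _ P], rule exI[of _ a], rule exI[of _ "0::nat"], intro conjI a allI ballI impI)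
    fix c :: nat
    show "\<exists>K::real. \<forall>n es k w. dag_input n es k \<and> word_size_ok a n es k w \<longrightarrow>
        1 - 1 / real (input_size n es) ^ c \<le> measure (random_tape w)
          {\<omega> \<in> space (random_tape w). ennreal_of_enat (runtime w P (encode n es k) \<omega>)
             \<le> ennreal (K * real (f n es k) * log 2 (real (input_size n es)) ^ 0)}"
    proof (intro exI[of _ "real K"] allI impI)
      fix n es k w
      assume "dag_input n es k \<and> word_size_ok a n es k w"
      then have "{\<omega> \<in> space (random_tape w). ennreal_of_enat (runtime w P (encode n es k) \<omega>)
          \<le> ennreal (real K * real (f n es k) * log 2 (real (input_size n es)) ^ 0)} = space (random_tape w)"
        using bound by blast
      then show "1 - 1 / real (input_size n es) ^ c \<le> measure (random_tape w)
          {\<omega> \<in> space (random_tape w). ennreal_of_enat (runtime w P (encode n es k) \<omega>)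
             \<le> ennreal (real K * real (f n es k) * log 2 (real (input_size n es)) ^ 0)}"
        by (simp only: prob_space.prob_space[OF prob_space_random_tape]) simp
    qed
  next
    show "\<exists>K::real. \<forall>n es k w. dag_input n es k \<and> word_size_ok a n es k w \<longrightarrow>
        (\<integral>\<^sup>+ \<omega>. ennreal_of_enat (runtime w P (encode n es k) \<omega>) \<partial>random_tape w)
          \<le> ennreal (K * real (f n es k) * log 2 (real (input_size n es)) ^ 0)"
    proof (intro exI[of _ "real K"] allI impI)
      fix n es k w
      assume "dag_input n es k \<and> word_size_ok a n es k w"
      then have "(\<integral>\<^sup>+ \<omega>. ennreal_of_enat (runtime w P (encode n es k) \<omega>) \<partial>random_tape w)
          \<le> (\<integral>\<^sup>+ \<omega>. ennreal (real K * real (f n es k) * log 2 (real (input_size n es)) ^ 0) \<partial>random_tape w)"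
        using bound by (intro nn_integral_mono) blast
      also have "\<dots> = ennreal (real K * real (f n es k) * log 2 (real (input_size n es)) ^ 0)"
        using prob_space.emeasure_space_1[OF prob_space_random_tape] by simp
      finally show "(\<integral>\<^sup>+ \<omega>. ennreal_of_enat (runtime w P (encode n es k) \<omega>) \<partial>random_tape w)
          \<le> ennreal (real K * real (f n es k) * log 2 (real (input_size n es)) ^ 0)" .
    qed
  qed (use correct in blast)
qed

section \<open>Duality between chains and antichains\<close>

lemma dpath_reach:
  assumes "dpath V E p" "u \<in> set p" "v \<in> set p"
  shows "(u, v) \<in> E\<^sup>* \<or> (v, u) \<in> E\<^sup>*"
  using assms
proof (induction p)
  case (Cons x p)
  have tail: "dpath V E p"
    using Cons.prems(1) by (cases p) (auto simp: dpath_def)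
  have from_x: "\<forall>y\<in>set p. (x, y) \<in> E\<^sup>*"
    using Cons.prems(1)
  proof (induction p arbitrary: x)
    case (Cons z p)
    then have "(x, z) \<in> E" "\<forall>y\<in>set p. (z, y) \<in> E\<^sup>*"
      by (auto simp: dpath_def)
    then show ?case
      by (auto intro: converse_rtrancl_into_rtrancl)
  qed simp
  show ?case
    using Cons.IH[OF tail] from_x Cons.prems(2,3) by auto
qed simp

lemma subseq_subset: "subseq xs ys \<Longrightarrow> set xs \<subseteq> set ys"
  by (induction rule: list_emb.induct) auto

lemma dag_chain_subset: "dag_chain V E C \<Longrightarrow> C \<subseteq> V"
  unfolding dag_chain_def dpath_def by (meson order_trans subseq_subset)

lemma dag_chain_subsetI: "dpath V E p \<Longrightarrow> C \<subseteq> set p \<Longrightarrow> dag_chain V E C"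
  unfolding dag_chain_def
  by (intro exI[of _ p] exI[of _ "filter (\<lambda>v. v \<in> C) p"]) auto

lemma dag_antichain_subset: "dag_antichain V E A \<Longrightarrow> A \<subseteq> V"
  by (simp add: dag_antichain_def)

lemma card_le_Suc_0I: "(\<And>u v. u \<in> X \<Longrightarrow> v \<in> X \<Longrightarrow> u = v) \<Longrightarrow> card X \<le> 1"
  by (cases "finite X") (auto simp: card_le_Suc0_iff_eq)

text \<open>Any two vertices of a path are comparable under reachability, distinct ones of an
  antichain are not.\<close>

lemma card_chain_antichain:
  assumes "dag_chain V E C" "dag_antichain V E A"
  shows "card (C \<inter> A) \<le> 1"
proof (rule card_le_Suc_0I)
  fix u v
  assume uv: "u \<in> C \<inter> A" "v \<in> C \<inter> A"
  obtain p xs where p: "dpath V E p" "subseq xs p" "C = set xs"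
    using assms(1) by (auto simp: dag_chain_def)
  then have in_p: "u \<in> set p" "v \<in> set p"
    using uv subseq_subset[OF p(2)] by blast+
  have "u \<noteq> v \<longrightarrow> (u, v) \<notin> E\<^sup>* \<and> (v, u) \<notin> E\<^sup>*"
    using uv assms(2) unfolding dag_antichain_def by simp
  then show "u = v"
    using dpath_reach[OF p(1) in_p] by argo
qed

lemma small_chain: "C \<subseteq> V \<Longrightarrow> card C \<le> 1 \<Longrightarrow> finite C \<Longrightarrow> dag_chain V E C"
proof -
  assume C: "C \<subseteq> V" "card C \<le> 1" "finite C"
  then have "card C = 0 \<or> card C = 1"
    by linarith
  then consider "C = {}" | v where "C = {v}"
    using C(3) by (auto simp: card_1_singleton_iff)
  then show ?thesis
  proof cases
    case 1
    then show ?thesis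
      by (intro dag_chain_subsetI[of _ _ "[]"]) (auto simp: dpath_def)
  next
    case (2 v)
    then show ?thesis
      using C by (intro dag_chain_subsetI[of _ _ "[v]"]) (auto simp: dpath_def)
  qed
qed

lemma small_antichain: "A \<subseteq> V \<Longrightarrow> card A \<le> 1 \<Longrightarrow> finite A \<Longrightarrow> dag_antichain V E A"
  by (auto simp: dag_antichain_def card_le_Suc0_iff_eq)

text \<open>Weak duality, phrased without chains or antichains so that it serves both pairs of
  problems: a part meets each of the \<open>k\<close> sets at most once, so it contributes at most
  the minimum of its size and \<open>k\<close>.\<close>

lemma card_Union_le_k_norm:
  assumes "finite V" "partition_on V \<Q>" "\<And>i. i \<in> {1..k} \<Longrightarrow> P i \<subseteq> V"
    and one: "\<And>i Q. i \<in> {1..k} \<Longrightarrow> Q \<in> \<Q> \<Longrightarrow> card (P i \<inter> Q) \<le> 1"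
  shows "card (\<Union>i\<in>{1..k}. P i) \<le> k_norm k \<Q>"
proof -
  let ?U = "\<Union>i\<in>{1..k}. P i"
  have fin: "finite \<Q>" "\<And>Q. Q \<in> \<Q> \<Longrightarrow> finite Q"
    using finite_elements[OF assms(1,2)] partition_onD1[OF assms(2)] assms(1)
    by (auto intro: finite_subset)
  have "?U = (\<Union>Q\<in>\<Q>. ?U \<inter> Q)"
    using assms(3) partition_onD1[OF assms(2)] by blast
  then have "card ?U \<le> (\<Sum>Q\<in>\<Q>. card (?U \<inter> Q))"
    using card_UN_le[OF fin(1), of "\<lambda>Q. ?U \<inter> Q"] by simp
  also have "\<dots> \<le> (\<Sum>Q\<in>\<Q>. min (card Q) k)"
  proof (rule sum_mono)
    fix Q
    assume Q: "Q \<in> \<Q>"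
    have "card (?U \<inter> Q) = card (\<Union>i\<in>{1..k}. P i \<inter> Q)"
      by (simp only: UN_simps)
    also have "\<dots> \<le> (\<Sum>i\<in>{1..k}. card (P i \<inter> Q))"
      by (intro card_UN_le) simp
    also have "\<dots> \<le> (\<Sum>i\<in>{1..k}. 1)"
      using one Q by (intro sum_mono) auto
    finally have "card (?U \<inter> Q) \<le> k"
      by simp
    moreover have "card (?U \<inter> Q) \<le> card Q"
      using fin(2) Q by (intro card_mono) auto
    ultimately show "card (?U \<inter> Q) \<le> min (card Q) k"
      by simp
  qed
  finally show ?thesis
    by (simp add: k_norm_def)
qed

lemma finite_family_cards:
  fixes V :: "'a set"
  assumes "finite V"
    and "\<And>A. P A \<Longrightarrow> (\<Union>i\<in>{1..k}. A i) \<subseteq> V"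
  shows "finite {card (\<Union>i\<in>{1..k}. A i) | A. P A}"
proof (rule finite_subset)
  show "{card (\<Union>i\<in>{1..k}. A i) | A. P A} \<subseteq> {..card V}"
    using assms by (auto intro!: card_mono)
qed simp

lemma k_antichains_subset: "k_antichains V E k A \<Longrightarrow> (\<Union>i\<in>{1..k}. A i) \<subseteq> V"
  using dag_antichain_subset unfolding k_antichains_def by fastforce

lemma k_chains_subset: "k_chains V E k A \<Longrightarrow> (\<Union>i\<in>{1..k}. A i) \<subseteq> V"
  using dag_chain_subset unfolding k_chains_def by fastforce

lemma card_le_alpha: "finite V \<Longrightarrow> k_antichains V E k A \<Longrightarrow> card (\<Union>i\<in>{1..k}. A i) \<le> alpha V E k"
  unfolding alpha_def by (intro Max_ge finite_family_cards[of V] k_antichains_subset) auto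

lemma card_le_beta: "finite V \<Longrightarrow> k_chains V E k A \<Longrightarrow> card (\<Union>i\<in>{1..k}. A i) \<le> beta V E k"
  unfolding beta_def by (intro Max_ge finite_family_cards[of V] k_chains_subset) auto

lemma antichains_le_chain_partition:
  assumes "finite V" "k_antichains V E k A" "chain_partition V E \<C>"
  shows "card (\<Union>i\<in>{1..k}. A i) \<le> k_norm k \<C>"
  using assms card_chain_antichain[of V E] dag_antichain_subset[of V E]
  by (intro card_Union_le_k_norm[of V]) (auto simp: k_antichains_def chain_partition_def Int_commute)

lemma chains_le_antichain_partition:
  assumes "finite V" "k_chains V E k C" "antichain_partition V E \<A>"
  shows "card (\<Union>i\<in>{1..k}. C i) \<le> k_norm k \<A>"
  using assms card_chain_antichain[of V E] dag_chain_subset[of V E]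
  by (intro card_Union_le_k_norm[of V]) (auto simp: k_chains_def antichain_partition_def)

text \<open>Weak duality bounds all families by all partitions, so one pair satisfying the reverse
  inequality is optimal on both sides.\<close>

lemma MA_MCP_optimal:
  assumes "finite V" "k_antichains V E k A" "chain_partition V E \<C>" "k_norm k \<C> \<le> card (\<Union>i\<in>{1..k}. A i)"
  shows "MA_solution V E k A" "MCP_solution V E k \<C>"
proof -
  have "card (\<Union>i\<in>{1..k}. B i) \<le> card (\<Union>i\<in>{1..k}. A i)" if "k_antichains V E k B" for B
    using antichains_le_chain_partition[OF assms(1) that assms(3)] assms(4) by linarith
  then have "alpha V E k = card (\<Union>i\<in>{1..k}. A i)"
    unfolding alpha_def using assms
    by (intro Max_eqI finite_family_cards[of V] k_antichains_subset) auto
  then show "MA_solution V E k A"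
    using assms(2) by (simp add: MA_solution_def)
  show "MCP_solution V E k \<C>"
    using assms antichains_le_chain_partition[OF assms(1,2)] by (auto simp: MCP_solution_def intro: order_trans)
qed

lemma MC_MAP_optimal:
  assumes "finite V" "k_chains V E k C" "antichain_partition V E \<A>" "k_norm k \<A> \<le> card (\<Union>i\<in>{1..k}. C i)"
  shows "MC_solution V E k C" "MAP_solution V E k \<A>"
proof -
  have "card (\<Union>i\<in>{1..k}. B i) \<le> card (\<Union>i\<in>{1..k}. C i)" if "k_chains V E k B" for B
    using chains_le_antichain_partition[OF assms(1) that assms(3)] assms(4) by linarith
  then have "beta V E k = card (\<Union>i\<in>{1..k}. C i)"
    unfolding beta_def using assms
    by (intro Max_eqI finite_family_cards[of V] k_chains_subset) auto
  then show "MC_solution V E k C"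
    using assms(2) by (simp add: MC_solution_def)
  show "MAP_solution V E k \<A>"
    using assms chains_le_antichain_partition[OF assms(1,2)] by (auto simp: MAP_solution_def intro: order_trans)
qed

text \<open>For the running time: there can be one phase more than augmentations, and it fits into a
  bound proportional to \<open>alpha\<close> only if \<open>alpha\<close> is positive.\<close>

lemma alpha_pos:
  assumes "finite V" "V \<noteq> {}" "0 < k"
  shows "1 \<le> alpha V E k"
proof -
  obtain v where v: "v \<in> V"
    using assms(2) by blast
  define B where "B i = (if i = (1::nat) then {v} else {})" for i
  have "k_antichains V E k B"
    using v by (auto simp: k_antichains_def dag_antichain_def disjoint_family_on_def B_def)
  moreover have "(\<Union>i\<in>{1..k}. B i) = {v}"
    using assms(3) by (auto simp: B_def split: if_splits)
  ultimately show ?thesis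
    using card_le_alpha[OF assms(1)] by fastforce
qed

lemma beta_pos:
  assumes "finite V" "V \<noteq> {}" "0 < k"
  shows "1 \<le> beta V E k"
proof -
  obtain v where v: "v \<in> V"
    using assms(2) by blast
  define B where "B i = (if i = (1::nat) then {v} else {})" for i
  have "k_chains V E k B"
    using v by (auto simp: k_chains_def disjoint_family_on_def B_def intro!: small_chain)
  moreover have "(\<Union>i\<in>{1..k}. B i) = {v}"
    using assms(3) by (auto simp: B_def split: if_splits)
  ultimately show ?thesis
    using card_le_beta[OF assms(1)] by fastforce
qed

subsection \<open>Completing a labelling by singletons\<close>

definition zero_rank :: "(nat \<Rightarrow> nat) \<Rightarrow> nat \<Rightarrow> nat" where
  "zero_rank lab v = card {u. u \<le> v \<and> lab u = 0}"

text \<open>Label 0 marks uncovered vertices. They receive the fresh labels \<open>c + 1\<close>,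
  \<open>c + 2\<close>, ... up to the limit \<open>l\<close>: with \<open>l = c\<close> nothing
  changes, with \<open>l = k\<close> a family is padded to \<open>k\<close> sets, and with
  \<open>l \<ge> c + n\<close> every uncovered vertex becomes a singleton.\<close>

definition fill :: "nat \<Rightarrow> nat \<Rightarrow> (nat \<Rightarrow> nat) \<Rightarrow> nat \<Rightarrow> nat" where
  "fill c l lab v = (if 0 < lab v then lab v
     else if c + zero_rank lab v \<le> l then c + zero_rank lab v else 0)"

definition zeros :: "nat \<Rightarrow> (nat \<Rightarrow> nat) \<Rightarrow> nat set" where
  "zeros n lab = {v. v < n \<and> lab v = 0}"

definition nonzeros :: "nat \<Rightarrow> (nat \<Rightarrow> nat) \<Rightarrow> nat set" where
  "nonzeros n lab = {v. v < n \<and> 0 < lab v}"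

lemma finite_zeros [simp]: "finite (zeros n lab)" "finite (nonzeros n lab)" "finite (label_class n lab i)"
  by (simp_all add: zeros_def nonzeros_def label_class_def)

lemma card_zeros: "card (zeros n lab) + card (nonzeros n lab) = n"
proof -
  have "zeros n lab \<union> nonzeros n lab = {..<n}" "zeros n lab \<inter> nonzeros n lab = {}"
    by (auto simp: zeros_def nonzeros_def)
  then show ?thesis
    using card_Un_disjoint[of "zeros n lab" "nonzeros n lab"] by simp
qed

lemma zero_rank_bij: "bij_betw (zero_rank lab) (zeros n lab) {1..card (zeros n lab)}"
proof -
  have less: "zero_rank lab u < zero_rank lab v" if "u < v" "lab v = 0" for u v
  proof -
    have "{x. x \<le> u \<and> lab x = 0} \<subseteq> {x. x \<le> v \<and> lab x = 0}" "v \<in> {x. x \<le> v \<and> lab x = 0}"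
      "v \<notin> {x. x \<le> u \<and> lab x = 0}"
      using that by auto
    then have "{x. x \<le> u \<and> lab x = 0} \<subset> {x. x \<le> v \<and> lab x = 0}"
      by blast
    then show ?thesis
      unfolding zero_rank_def by (intro psubset_card_mono) simp
  qed
  have "inj_on (zero_rank lab) (zeros n lab)"
  proof (rule inj_onI)
    fix u v
    assume "u \<in> zeros n lab" "v \<in> zeros n lab" "zero_rank lab u = zero_rank lab v"
    then show "u = v"
      using less[of u v] less[of v u] by (cases u v rule: linorder_cases) (auto simp: zeros_def)
  qed
  moreover have "zero_rank lab ` zeros n lab \<subseteq> {1..card (zeros n lab)}"
  proof
    fix x
    assume "x \<in> zero_rank lab ` zeros n lab"
    then obtain v where v: "v \<in> zeros n lab" "x = zero_rank lab v"
      by blast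
    then have "{u. u \<le> v \<and> lab u = 0} \<subseteq> zeros n lab" "v \<in> {u. u \<le> v \<and> lab u = 0}"
      by (auto simp: zeros_def)
    then show "x \<in> {1..card (zeros n lab)}"
      unfolding v(2) zero_rank_def by (auto simp: Suc_le_eq card_gt_0_iff intro!: card_mono)
  qed
  ultimately show ?thesis
    by (simp add: bij_betw_def card_image card_subset_eq)
qed

lemma zero_rank_pos: "lab v = 0 \<Longrightarrow> 0 < zero_rank lab v"
  unfolding zero_rank_def by (auto simp: card_gt_0_iff)

lemma zero_rank_le: "v < n \<Longrightarrow> zero_rank lab v \<le> n"
proof -
  assume "v < n"
  then have "{u. u \<le> v \<and> lab u = 0} \<subseteq> {..<n}"
    by auto
  then show ?thesis
    unfolding zero_rank_def using card_mono[of "{..<n}"] by simp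
qed

lemma label_class_fill:
  assumes "i \<in> {1..c}"
  shows "label_class n (fill c l lab) i = label_class n lab i"
proof -
  have "fill c l lab v = i \<longleftrightarrow> lab v = i" for v
    using assms zero_rank_pos[of lab v] by (auto simp: fill_def)
  then show ?thesis
    by (simp add: label_class_def)
qed

lemma card_label_class_fill:
  assumes "\<And>v. v < n \<Longrightarrow> lab v \<le> c" "c < i"
  shows "card (label_class n (fill c l lab) i) \<le> 1"
proof (rule card_le_Suc_0I)
  have zero: "x \<in> zeros n lab \<and> zero_rank lab x = i - c" if "x \<in> label_class n (fill c l lab) i" for x
  proof -
    have x: "x < n" "fill c l lab x = i"
      using that by (simp_all add: label_class_def)
    then have "lab x = 0"
      using assms(1)[OF x(1)] assms(2) by (simp add: fill_def split: if_splits)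
    then show ?thesis
      using x assms(2) by (auto simp: fill_def zeros_def split: if_splits)
  qed
  fix u v
  assume "u \<in> label_class n (fill c l lab) i" "v \<in> label_class n (fill c l lab) i"
  then have "u \<in> zeros n lab" "v \<in> zeros n lab" "zero_rank lab u = zero_rank lab v"
    using zero by simp_all
  then show "u = v"
    using zero_rank_bij[of lab n] unfolding bij_betw_def inj_on_def by blast
qed

lemma label_partition_on: "partition_on {..<n} (label_partition n lab)"
  by (rule partition_onI) (auto simp: label_partition_def label_class_def disjnt_def)

lemma k_norm_label_partition:
  "k_norm k (label_partition n lab) = (\<Sum>i\<in>lab ` {..<n}. min (card (label_class n lab i)) k)"
proof -
  have "inj_on (label_class n lab) (lab ` {..<n})"
    by (rule inj_onI) (auto simp: label_class_def)
  then show ?thesis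
    by (simp add: k_norm_def label_partition_def sum.reindex)
qed

text \<open>There is room for \<open>n\<close> fresh labels, so none runs out: the classes are the
  old ones and singletons, and each singleton has norm at most 1.\<close>

lemma k_norm_fill:
  assumes lab: "\<And>v. v < n \<Longrightarrow> lab v \<le> c" and l: "c + n \<le> l"
  shows "k_norm k (label_partition n (fill c l lab))
    \<le> (\<Sum>i\<in>{1..c}. min (card (label_class n lab i)) k) + card (zeros n lab)"
proof -
  let ?f = "fill c l lab"
  have f: "?f v = (if lab v = 0 then c + zero_rank lab v else lab v)" if "v < n" for v
    using that l zero_rank_le[of v n lab] by (auto simp: fill_def)
  have sub: "?f ` {..<n} \<subseteq> {1..c} \<union> ?f ` zeros n lab"
    using f lab by (fastforce simp: zeros_def)
  have big: "c < i" if "i \<in> ?f ` zeros n lab" for i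
    using that f zero_rank_pos[of lab] by (auto simp: zeros_def)
  have "k_norm k (label_partition n ?f) \<le> (\<Sum>i\<in>{1..c} \<union> ?f ` zeros n lab. min (card (label_class n ?f i)) k)"
    unfolding k_norm_label_partition using sub by (intro sum_mono2) auto
  also have "\<dots> = (\<Sum>i\<in>{1..c}. min (card (label_class n ?f i)) k) +
      (\<Sum>i\<in>?f ` zeros n lab. min (card (label_class n ?f i)) k)"
    using big by (intro sum.union_disjoint) fastforce+
  also have "(\<Sum>i\<in>?f ` zeros n lab. min (card (label_class n ?f i)) k) \<le> (\<Sum>i\<in>?f ` zeros n lab. 1)"
    using big card_label_class_fill[OF lab] by (intro sum_mono) (meson min.coboundedI1)
  also have "\<dots> \<le> card (zeros n lab)"
    by (simp add: card_image_le)
  also have "(\<Sum>i\<in>{1..c}. min (card (label_class n ?f i)) k) = (\<Sum>i\<in>{1..c}. min (card (label_class n lab i)) k)"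
    by (intro sum.cong) (simp_all add: label_class_fill)
  finally show ?thesis
    by simp
qed

lemma Union_label_class:
  assumes "\<And>v. v < n \<Longrightarrow> lab v \<le> c"
  shows "(\<Union>i\<in>{1..c}. label_class n lab i) = nonzeros n lab"
  using assms by (auto simp: label_class_def nonzeros_def Suc_le_eq)

lemma disjoint_label_class: "disjoint_family_on (label_class n lab) I"
  by (auto simp: disjoint_family_on_def label_class_def)

lemma card_nonzeros_fill:
  assumes "c \<le> l"
  shows "card (nonzeros n (fill c l lab)) = card (nonzeros n lab) + min (l - c) (card (zeros n lab))"
proof -
  let ?Z = "{v \<in> zeros n lab. zero_rank lab v \<le> l - c}"
  have "nonzeros n (fill c l lab) = nonzeros n lab \<union> ?Z"
    using assms zero_rank_pos[of lab] by (auto simp: nonzeros_def zeros_def fill_def split: if_splits)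
  moreover have "nonzeros n lab \<inter> ?Z = {}"
    by (auto simp: nonzeros_def zeros_def)
  ultimately have 1: "card (nonzeros n (fill c l lab)) = card (nonzeros n lab) + card ?Z"
    by (simp add: card_Un_disjoint)
  have "zero_rank lab ` ?Z = zero_rank lab ` zeros n lab \<inter> {..l - c}"
    by auto
  then have "zero_rank lab ` ?Z = {1..card (zeros n lab)} \<inter> {..l - c}"
    using zero_rank_bij[of lab n] by (simp add: bij_betw_def)
  moreover have "inj_on (zero_rank lab) ?Z"
    using zero_rank_bij[of lab n] by (auto simp: bij_betw_def inj_on_def)
  ultimately have "card ?Z = card ({1..card (zeros n lab)} \<inter> {..l - c})"
    by (metis card_image)
  also have "{1..card (zeros n lab)} \<inter> {..l - c} = {1..min (l - c) (card (zeros n lab))}"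
    by auto
  finally show ?thesis
    using 1 by simp
qed

subsection \<open>Optimality certificates\<close>

text \<open>A chain and an antichain share at most one vertex, so at most \<open>r * l\<close>
  vertices are covered twice. The inequality is therefore extremal: it forces every vertex to be
  covered and every chain to meet every antichain.\<close>

definition certificate ::
  "nat \<Rightarrow> (nat \<times> nat) set \<Rightarrow> nat \<Rightarrow> nat \<Rightarrow> (nat \<Rightarrow> nat) \<Rightarrow> (nat \<Rightarrow> nat) \<Rightarrow> bool" where
  "certificate n E r l lc la \<longleftrightarrow>
     (\<forall>v<n. lc v \<le> r) \<and> (\<forall>v<n. la v \<le> l) \<and>
     (\<forall>i\<in>{1..r}. dag_chain {..<n} E (label_class n lc i)) \<and>
     (\<forall>i\<in>{1..l}. dag_antichain {..<n} E (label_class n la i)) \<and>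
     n + r * l \<le> card (nonzeros n lc) + card (nonzeros n la)"

context
  fixes n :: nat and E :: "(nat \<times> nat) set" and r l :: nat and lc la :: "nat \<Rightarrow> nat"
  assumes cert: "certificate n E r l lc la"
begin

lemma cert_k_antichains: "k_antichains {..<n} E l (label_class n la)"
  using cert disjoint_label_class by (auto simp: certificate_def k_antichains_def)

lemma cert_k_chains: "r \<le> k \<Longrightarrow> k_chains {..<n} E k (label_class n (fill r k lc))"
proof -
  have "dag_chain {..<n} E (label_class n (fill r k lc) i)" if "i \<in> {1..k}" for i
  proof (cases "i \<le> r")
    case True
    then show ?thesis
      using cert that by (simp add: label_class_fill certificate_def)
  next
    case False
    then show ?thesis
      using cert card_label_class_fill[of n lc r i k]
      by (intro small_chain) (auto simp: certificate_def label_class_def)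
  qed
  then show ?thesis
    using disjoint_label_class by (auto simp: k_chains_def)
qed

lemma cert_chain_partition: "r + n \<le> m \<Longrightarrow> chain_partition {..<n} E (label_partition n (fill r m lc))"
proof -
  assume m: "r + n \<le> m"
  have "dag_chain {..<n} E (label_class n (fill r m lc) (fill r m lc v))" if v: "v < n" for v
  proof (cases "fill r m lc v \<in> {1..r}")
    case True
    then show ?thesis
      using cert by (simp add: label_class_fill certificate_def)
  next
    case False
    then have "r < fill r m lc v"
      using cert v m zero_rank_le[OF v, of lc] zero_rank_pos[of lc v] by (fastforce simp: certificate_def fill_def)
    then show ?thesis
      using cert card_label_class_fill[of n lc r _ m]
      by (intro small_chain) (auto simp: certificate_def label_class_def)
  qed
  then show ?thesis
    using label_partition_on by (auto simp: chain_partition_def label_partition_def)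
qed

lemma cert_antichain_partition: "l + n \<le> m \<Longrightarrow> antichain_partition {..<n} E (label_partition n (fill l m la))"
proof -
  assume m: "l + n \<le> m"
  have "dag_antichain {..<n} E (label_class n (fill l m la) (fill l m la v))" if v: "v < n" for v
  proof (cases "fill l m la v \<in> {1..l}")
    case True
    then show ?thesis
      using cert by (simp add: label_class_fill certificate_def)
  next
    case False
    then have "l < fill l m la v"
      using cert v m zero_rank_le[OF v, of la] zero_rank_pos[of la v] by (fastforce simp: certificate_def fill_def)
    then show ?thesis
      using cert card_label_class_fill[of n la l _ m]
      by (intro small_antichain) (auto simp: certificate_def label_class_def)
  qed
  then show ?thesis
    using label_partition_on by (auto simp: antichain_partition_def label_partition_def)
qed

text \<open>All \<open>l\<close> labels are in use already, so the limit stops \<open>fill\<close>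
  at once. This lets all four programs end with the same fill step.\<close>

lemma cert_fill_antichains: "fill l l la v = la v"
  using zero_rank_pos[of la v] by (auto simp: fill_def)

lemma card_label_class_le_nonzeros: "0 < i \<Longrightarrow> card (label_class n lab i) \<le> card (nonzeros n lab)"
  by (intro card_mono) (auto simp: label_class_def nonzeros_def)

text \<open>Each of the \<open>r\<close> chains has norm at most \<open>l\<close> and each remaining
  vertex counts once; by the certificate \<open>r * l\<close> plus the number of vertices off the
  chains is at most the size of the antichains.\<close>

lemma cert_MA_MCP:
  assumes "r + n \<le> m"
  shows "MA_solution {..<n} E l (label_class n (fill l l la))"
    "MCP_solution {..<n} E l (label_partition n (fill r m lc))"
proof -
  have "k_norm l (label_partition n (fill r m lc))
      \<le> (\<Sum>i\<in>{1..r}. min (card (label_class n lc i)) l) + card (zeros n lc)"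
    using cert assms by (intro k_norm_fill) (auto simp: certificate_def)
  also have "(\<Sum>i\<in>{1..r}. min (card (label_class n lc i)) l) \<le> (\<Sum>i\<in>{1..r}. l)"
    by (intro sum_mono) simp
  finally have "k_norm l (label_partition n (fill r m lc)) \<le> card (nonzeros n la)"
    using cert card_zeros[of n lc] by (simp add: certificate_def)
  then have le: "k_norm l (label_partition n (fill r m lc)) \<le> card (\<Union>i\<in>{1..l}. label_class n la i)"
    using cert by (subst Union_label_class) (auto simp: certificate_def)
  have "fill l l la = la"
    using cert_fill_antichains by blast
  then show "MA_solution {..<n} E l (label_class n (fill l l la))"
    "MCP_solution {..<n} E l (label_partition n (fill r m lc))"
    using MA_MCP_optimal[OF _ cert_k_antichains cert_chain_partition[OF assms] le] by simp_all
qed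

lemma cert_MC_MAP:
  assumes k: "r \<le> k" "r = k \<or> l = 1" and m: "l + n \<le> m"
  shows "MC_solution {..<n} E k (label_class n (fill r k lc))"
    "MAP_solution {..<n} E k (label_partition n (fill l m la))"
proof -
  have "fill r k lc v \<le> k" if "v < n" for v
    using cert k(1) that by (auto simp: fill_def certificate_def intro: le_trans)
  then have "card (\<Union>i\<in>{1..k}. label_class n (fill r k lc) i) = card (nonzeros n (fill r k lc))"
    by (subst Union_label_class) auto
  then have U: "card (\<Union>i\<in>{1..k}. label_class n (fill r k lc) i)
      = card (nonzeros n lc) + min (k - r) (card (zeros n lc))"
    using card_nonzeros_fill[OF k(1)] by simp
  have norm: "k_norm k (label_partition n (fill l m la))
      \<le> (\<Sum>i\<in>{1..l}. min (card (label_class n la i)) k) + card (zeros n la)"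
    using cert m by (intro k_norm_fill) (auto simp: certificate_def)
  have cardinality: "n + r * l \<le> card (nonzeros n lc) + card (nonzeros n la)"
    using cert by (simp add: certificate_def)
  have "k_norm k (label_partition n (fill l m la)) \<le> card (\<Union>i\<in>{1..k}. label_class n (fill r k lc) i)"
  proof (cases "r = k")
    case True
    have "(\<Sum>i\<in>{1..l}. min (card (label_class n la i)) k) \<le> (\<Sum>i\<in>{1..l}. k)"
      by (intro sum_mono) simp
    then have "(\<Sum>i\<in>{1..l}. min (card (label_class n la i)) k) \<le> r * l"
      using True by (simp add: mult.commute)
    then show ?thesis
      using norm U cardinality True card_zeros[of n la] by linarith
  next
    \<comment> \<open>Let c and a be the numbers of vertices covered by the chains and by the single
      antichain, so \<open>n + r \<le> c + a\<close>. The chains and \<open>k - r\<close> singletons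
      cover all \<open>n\<close> vertices, or \<open>c + k - r \<ge> n - a + k\<close> of them; both
      are at least \<open>min a k + (n - a)\<close>.\<close>
    case False
    then have l: "l = 1"
      using k by simp
    have "card (label_class n la 1) \<le> card (nonzeros n la)"
      by (intro card_label_class_le_nonzeros) simp
    then have "k_norm k (label_partition n (fill l m la)) \<le> min (card (nonzeros n la)) k + card (zeros n la)"
      using norm l by simp
    then show ?thesis
      using U cardinality l k(1) card_zeros[of n la] card_zeros[of n lc] by simp
  qed
  then show "MC_solution {..<n} E k (label_class n (fill r k lc))"
    "MAP_solution {..<n} E k (label_partition n (fill l m la))"
    using MC_MAP_optimal[OF _ cert_k_chains[OF k(1)] cert_antichain_partition[OF m]] by simp_all
qed

text \<open>The chains cover at most \<open>n\<close> vertices, so the certificate leaves at least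
  \<open>r * l\<close> for the antichains. This bounds the number of augmentations.\<close>

lemma cert_r_le_alpha: "0 < l \<Longrightarrow> r \<le> alpha {..<n} E l"
proof -
  assume "0 < l"
  have "r \<le> r * l"
    using \<open>0 < l\<close> by simp
  also have "r * l \<le> card (nonzeros n la)"
    using cert card_zeros[of n lc] by (simp add: certificate_def)
  also have "\<dots> = card (\<Union>i\<in>{1..l}. label_class n la i)"
    using cert by (subst Union_label_class) (auto simp: certificate_def)
  also have "\<dots> \<le> alpha {..<n} E l"
    using cert_k_antichains by (intro card_le_alpha) auto
  finally show ?thesis .
qed

lemma cert_r_le_beta: "0 < l \<Longrightarrow> r \<le> k \<Longrightarrow> r \<le> beta {..<n} E k"
proof -
  assume "0 < l" and k: "r \<le> k"
  have "fill r k lc v \<le> k" if "v < n" for v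
    using cert k(1) that by (auto simp: fill_def certificate_def intro: le_trans)
  then have U: "card (\<Union>i\<in>{1..k}. label_class n (fill r k lc) i)
      = card (nonzeros n lc) + min (k - r) (card (zeros n lc))"
    using card_nonzeros_fill[OF k(1)] by (subst Union_label_class) auto
  have "r \<le> r * l"
    using \<open>0 < l\<close> by simp
  also have "r * l \<le> card (nonzeros n lc)"
    using cert card_zeros[of n la] by (simp add: certificate_def)
  also have "\<dots> \<le> card (\<Union>i\<in>{1..k}. label_class n (fill r k lc) i)"
    using U by simp
  also have "\<dots> \<le> beta {..<n} E k"
    using cert_k_chains[OF k] by (intro card_le_beta) auto
  finally show ?thesis .
qed

end

section \<open>The flow network\<close>

text \<open>
  Node 0 is the source, node 1 the sink, and a vertex \<open>v\<close> is split into \<open>2v + 2\<close> and \<open>2v + 3\<close>,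
  joined by an arc of cost and capacity 1 and by a parallel arc of cost 0 and large capacity.
  The residual arc \<open>i\<close> leads to \<open>head i\<close>; forward arcs have even numbers and \<open>twin i\<close> is the
  reversal of \<open>i\<close>. Flow conservation is expressed by \<open>net_flow\<close>, for arbitrary node potentials.
\<close>

fun llist :: "(nat \<Rightarrow> nat) \<Rightarrow> nat \<Rightarrow> nat list \<Rightarrow> bool" where
  "llist nx p [] \<longleftrightarrow> p = 0"
| "llist nx p (i # is) \<longleftrightarrow> p = Suc i \<and> llist nx (nx i) is"

lemma llist_upd: "i \<notin> set xs \<Longrightarrow> llist (nx(i := k)) p xs = llist nx p xs"
  by (induction xs arbitrary: p) auto

lemma llist_0: "llist nx 0 xs \<longleftrightarrow> xs = []"
  by (cases xs) auto

lemma llist_pos: "llist nx p xs \<Longrightarrow> 0 < p \<Longrightarrow> \<exists>xs'. xs = (p - 1) # xs' \<and> llist nx (nx (p - 1)) xs'"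
  by (cases xs) auto

definition twin :: "nat \<Rightarrow> nat" where
  "twin i = (if even i then Suc i else i - 1)"

lemma xor_1: "Bit_Operations.xor i (Suc 0) = twin i" "Bit_Operations.xor i 1 = twin i"
proof -
  show "Bit_Operations.xor i 1 = twin i"
    by (simp only: xor_one_eq twin_def) simp
  then show "Bit_Operations.xor i (Suc 0) = twin i"
    by simp
qed

lemma twin_twin [simp]: "twin (twin i) = i"
  by (auto simp: twin_def)

lemma twin_neq [simp]: "twin i \<noteq> i"
  by (cases i) (auto simp: twin_def)

text \<open>Triples of tail, head and cost. Isolated vertices are left out to keep the network
  linear in the number of edges; they join the first antichain at the end.\<close>

definition arc_spec :: "(nat \<times> nat) set \<Rightarrow> (nat \<times> nat \<times> nat) set" where
  "arc_spec E = (\<Union>v\<in>Field E. {(0, 2 * v+2, 0), (2 * v+2, 2 * v+3, 1), (2 * v+2, 2 * v+3, 0), (2 * v+3, 1, 0)})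
     \<union> (\<lambda>(u, v). (2 * u+3, 2 * v+2, 0)) ` E"

text \<open>\<open>arcs\<close> fixes only the set of triples and so admits parallel copies;
  \<open>unit_arc\<close> excludes them for the arcs of cost 1, which are going to be
  counted.\<close>

locale network =
  fixes n :: nat and E :: "(nat \<times> nat) set" and M :: nat and head cost :: "nat \<Rightarrow> nat"
  assumes E: "E \<subseteq> {..<n} \<times> {..<n}" "acyclic E"
    and even_M: "even M"
    and arcs: "(\<lambda>i. (head (Suc i), head i, cost i)) ` {i. i < M \<and> even i} = arc_spec E"
    and cost_odd: "\<And>i. i < M \<Longrightarrow> odd i \<Longrightarrow> cost i = 0"
    and unit_arc: "\<And>i j. i < M \<Longrightarrow> j < M \<Longrightarrow> cost i = 1 \<Longrightarrow> cost j = 1 \<Longrightarrow> head i = head j \<Longrightarrow> i = j"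
begin

definition fwd :: "nat set" where "fwd = {i. i < M \<and> even i}"

definition nodes :: "nat set" where "nodes = {0, 1} \<union> head ` {..<M}"

abbreviation tail :: "nat \<Rightarrow> nat" where "tail i \<equiv> head (twin i)"

text \<open>\<open>rc\<close> is the residual capacity, so \<open>rc (Suc i)\<close> is the flow on
  the forward arc \<open>i\<close>.\<close>

definition capacities :: "nat \<Rightarrow> (nat \<Rightarrow> nat) \<Rightarrow> bool" where
  "capacities N rc \<longleftrightarrow> (\<forall>i\<in>fwd. rc i + rc (Suc i) = (if cost i = 1 then 1 else N))"

text \<open>Dual feasibility: a residual arc gains at most the rise of potential along it. Its gain
  \<open>cost i - cost (twin i)\<close> can be negative; distributing the terms over both sides
  stays within the natural numbers.\<close>

definition feasible :: "(nat \<Rightarrow> nat) \<Rightarrow> (nat \<Rightarrow> nat) \<Rightarrow> bool" where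
  "feasible pt rc \<longleftrightarrow> (\<forall>i<M. 0 < rc i \<longrightarrow> pt (tail i) + cost i \<le> pt (head i) + cost (twin i))"

text \<open>Demanding the value \<open>r * (p 1 - p 0)\<close> for every \<open>p\<close> expresses
  conservation at the inner nodes and flow value \<open>r\<close> at once, as indicator functions
  show. Rankings and the dual potential are the other choices of \<open>p\<close> used
  below.\<close>

definition net_flow :: "(nat \<Rightarrow> nat) \<Rightarrow> (nat \<Rightarrow> int) \<Rightarrow> int" where
  "net_flow rc p = (\<Sum>i\<in>fwd. int (rc (Suc i)) * (p (head i) - p (head (Suc i))))"

definition ranking :: "(nat \<Rightarrow> nat) \<Rightarrow> bool" where
  "ranking rho \<longleftrightarrow> (\<forall>i\<in>fwd. rho (head (Suc i)) < rho (head i))"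

lemma finite_fwd [simp]: "finite fwd"
  by (simp add: fwd_def)

lemma finite_nodes [simp]: "finite nodes"
  by (simp add: nodes_def)

lemma twin_less:
  assumes "i < M"
  shows "twin i < M"
proof (cases "even i")
  case True
  then have "Suc i \<noteq> M"
    using even_M by auto
  then show ?thesis
    using True assms by (simp add: twin_def)
qed (use assms in \<open>simp add: twin_def\<close>)

lemma fwd_less: "i \<in> fwd \<Longrightarrow> i < M" "i \<in> fwd \<Longrightarrow> Suc i < M" "i \<in> fwd \<Longrightarrow> even i" "i \<in> fwd \<Longrightarrow> twin i = Suc i"
  using twin_less[of i] by (auto simp: fwd_def twin_def)

lemma twin_eq_iff: "j \<in> fwd \<Longrightarrow> twin i = j \<longleftrightarrow> i = Suc j" "j \<in> fwd \<Longrightarrow> twin i = Suc j \<longleftrightarrow> i = j"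
  using twin_twin[of i] twin_twin[of j] fwd_less(4)[of j] by metis+

lemma head_node: "i < M \<Longrightarrow> head i \<in> nodes" "i < M \<Longrightarrow> tail i \<in> nodes"
  using twin_less[of i] by (auto simp: nodes_def)

lemma arc_cases:
  assumes "i \<in> fwd"
  obtains (source) v where "v \<in> Field E" "head (Suc i) = 0" "head i = 2 * v+2" "cost i = 0"
  | (unit) v where "v \<in> Field E" "head (Suc i) = 2 * v+2" "head i = 2 * v+3" "cost i = 1"
  | (free) v where "v \<in> Field E" "head (Suc i) = 2 * v+2" "head i = 2 * v+3" "cost i = 0"
  | (sink) v where "v \<in> Field E" "head (Suc i) = 2 * v+3" "head i = 1" "cost i = 0"
  | (edge) u v where "(u, v) \<in> E" "head (Suc i) = 2 * u+3" "head i = 2 * v+2" "cost i = 0"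
proof -
  have "(head (Suc i), head i, cost i) \<in> arc_spec E"
    using arcs assms by (auto simp: fwd_def)
  then show ?thesis
    using that by (auto simp: arc_spec_def)
qed

lemma arc_exists: "(a, b, c) \<in> arc_spec E \<Longrightarrow> \<exists>i\<in>fwd. head (Suc i) = a \<and> head i = b \<and> cost i = c"
  unfolding arcs[symmetric] fwd_def by auto

lemma cost_le: "i \<in> fwd \<Longrightarrow> cost i \<le> 1" "i \<in> fwd \<Longrightarrow> cost (Suc i) = 0"
  using cost_odd fwd_less by (auto elim!: arc_cases)

lemma cost_le_1: "i < M \<Longrightarrow> cost i \<le> 1"
  using cost_le(1)[of i] cost_odd[of i] by (cases "even i") (auto simp: fwd_def)

lemma Field_less: "v \<in> Field E \<Longrightarrow> v < n"
  using E(1) by (auto simp: Field_def)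

lemma nodes_less: "x \<in> nodes \<Longrightarrow> x < 2 * n + 2"
proof -
  have "head i < 2 * n + 2 \<and> head (Suc i) < 2 * n + 2" if "i \<in> fwd" for i
    using that E(1) by (cases rule: arc_cases) (auto dest!: Field_less)
  moreover have "i \<in> fwd \<or> i - 1 \<in> fwd \<and> Suc (i - 1) = i" if "i < M" for i
    using that by (auto simp: fwd_def elim: oddE)
  ultimately have "head i < 2 * n + 2" if "i < M" for i
    using that by metis
  then show "x \<in> nodes \<Longrightarrow> x < 2 * n + 2"
    by (auto simp: nodes_def)
qed

lemma card_nodes: "card nodes \<le> M + 2"
proof -
  have "card nodes \<le> card {0, 1::nat} + card (head ` {..<M})"
    unfolding nodes_def by (rule card_Un_le)
  also have "\<dots> \<le> 2 + M"
    using card_image_le[of "{..<M}" head] by simp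
  finally show ?thesis
    by simp
qed

lemma card_nodes_n: "card nodes \<le> 2 * n + 2"
  using card_mono[of "{..<2 * n + 2}" nodes] nodes_less by auto

lemma feasibleD: "feasible pt rc \<Longrightarrow> i < M \<Longrightarrow> 0 < rc i \<Longrightarrow> pt (tail i) + cost i \<le> pt (head i) + cost (twin i)"
  by (simp add: feasible_def)

text \<open>The reversed residual arc exists exactly when the arc carries flow. Together with
  \<open>feasible_residual\<close> this is complementary slackness.\<close>

lemma feasible_flow:
  assumes "feasible pt rc" "i \<in> fwd" "0 < rc (Suc i)"
  shows "pt (head i) \<le> pt (head (Suc i)) + cost i"
  using feasibleD[OF assms(1) fwd_less(2)[OF assms(2)] assms(3)] fwd_less[OF assms(2)] cost_le[OF assms(2)]
  by (simp add: twin_def)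

lemma feasible_residual:
  assumes "feasible pt rc" "i \<in> fwd" "0 < rc i"
  shows "pt (head (Suc i)) + cost i \<le> pt (head i)"
  using feasibleD[OF assms(1) fwd_less(1)[OF assms(2)] assms(3)] fwd_less[OF assms(2)] cost_le[OF assms(2)]
  by simp

definition push :: "nat \<Rightarrow> (nat \<Rightarrow> nat) \<Rightarrow> nat \<Rightarrow> nat" where
  "push i rc = rc(i := rc i - 1, twin i := rc (twin i) + 1)"

lemma push_capacities:
  assumes "capacities N rc" "i < M" "0 < rc i"
  shows "capacities N (push i rc)"
  unfolding capacities_def
proof
  fix j
  assume j: "j \<in> fwd"
  have old: "rc j + rc (Suc j) = (if cost j = 1 then 1 else N)"
    using assms(1) j by (simp add: capacities_def)
  consider "i = j" | "i = Suc j" | "i \<noteq> j" "i \<noteq> Suc j"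
    by blast
  then show "push i rc j + push i rc (Suc j) = (if cost j = 1 then 1 else N)"
  proof cases
    case 1
    then show ?thesis
      using old j assms(3) by (simp add: push_def fwd_less)
  next
    case 2
    then show ?thesis
      using old j assms(3) by (simp add: push_def fwd_less twin_def)
  next
    case 3
    then have "twin i \<noteq> j" "twin i \<noteq> Suc j"
      using twin_eq_iff[OF j] by simp_all
    then show ?thesis
      using old 3 by (simp add: push_def)
  qed
qed

text \<open>Forward and reversed arcs behave alike: adding flow to an arc and cancelling flow on its
  reversal both move one unit from tail to head.\<close>

lemma push_net_flow:
  assumes "i < M" "0 < rc i"
  shows "net_flow (push i rc) p = net_flow rc p + (p (head i) - p (tail i))"
proof -
  define a where "a = (if even i then i else i - 1)"
  have a: "a \<in> fwd" "i = a \<or> i = Suc a"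
    using assms(1) by (auto simp: a_def fwd_def elim: oddE)
  let ?g = "\<lambda>rc j. int (rc (Suc j)) * (p (head j) - p (head (Suc j)))"
  have "?g (push i rc) j = ?g rc j" if "j \<in> fwd - {a}" for j
  proof -
    have "Suc j \<noteq> i" "Suc j \<noteq> twin i"
      using that a fwd_less(3)[of j] fwd_less(3)[of a] twin_eq_iff(2)[of j i] by auto
    then show ?thesis
      by (simp add: push_def)
  qed
  then have "sum (?g (push i rc)) (fwd - {a}) = sum (?g rc) (fwd - {a})"
    by (intro sum.cong refl)
  then have "net_flow (push i rc) p - net_flow rc p = ?g (push i rc) a - ?g rc a"
    unfolding net_flow_def by (simp only: sum.remove[OF finite_fwd a(1)] algebra_simps)
  also have "\<dots> = p (head i) - p (tail i)"
    using a(2)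
  proof
    assume "i = a"
    then show ?thesis
      using fwd_less[OF a(1)] by (simp add: push_def algebra_simps)
  next
    assume i: "i = Suc a"
    then have "twin i = a"
      using fwd_less[OF a(1)] by (simp add: twin_def)
    then show ?thesis
      using i assms(2) by (simp add: push_def algebra_simps of_nat_diff)
  qed
  finally show ?thesis
    by simp
qed

text \<open>Only the twin can become residual, and along a tight arc its inequality holds with
  equality.\<close>

lemma push_feasible:
  assumes "feasible pt rc" "i < M" "pt (tail i) + cost i = pt (head i) + cost (twin i)"
  shows "feasible pt (push i rc)"
  unfolding feasible_def
proof (intro allI impI)
  fix j
  assume j: "j < M" "0 < push i rc j"
  show "pt (tail j) + cost j \<le> pt (head j) + cost (twin j)"
  proof (cases "j = twin i")
    case True
    then show ?thesis
      using assms(3) by simp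
  next
    case False
    then have "0 < rc j"
      using j(2) by (auto simp: push_def split: if_splits)
    then show ?thesis
      using assms(1) j(1) by (simp add: feasible_def)
  qed
qed

text \<open>Against a ranking, conservation becomes a sum of nonnegative terms, each at least the
  flow on its arc. This is where acyclicity excludes circulations.\<close>

lemma flow_bound:
  assumes "ranking rho" "net_flow rc (\<lambda>x. int (rho x)) = int r * (int (rho 1) - int (rho 0))" "i \<in> fwd"
  shows "rc (Suc i) \<le> r * rho 1"
proof -
  let ?g = "\<lambda>j. int (rc (Suc j)) * (int (rho (head j)) - int (rho (head (Suc j))))"
  have pos: "int (rc (Suc j)) \<le> ?g j" if "j \<in> fwd" for j
  proof -
    have "1 \<le> int (rho (head j)) - int (rho (head (Suc j)))"
      using assms(1) that by (auto simp: ranking_def)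
    then show ?thesis
      using mult_left_mono[of 1 _ "int (rc (Suc j))"] by simp
  qed
  have "int (rc (Suc i)) \<le> ?g i"
    using pos assms(3) by blast
  also have "\<dots> \<le> sum ?g fwd"
    using pos by (intro member_le_sum assms(3)) (auto intro: order_trans[OF of_nat_0_le_iff])
  also have "\<dots> = int r * (int (rho 1) - int (rho 0))"
    using assms(2) by (simp add: net_flow_def)
  also have "\<dots> \<le> int (r * rho 1)"
    by (simp add: algebra_simps)
  finally show ?thesis
    by linarith
qed

lemma flow_zero:
  assumes "ranking rho" "net_flow rc (\<lambda>x. int (rho x)) = 0" "i \<in> fwd"
  shows "rc (Suc i) = 0"
  using flow_bound[of rho rc 0 i] assms by simp

text \<open>Against the indicator of \<open>x\<close>, only arcs that leave \<open>x\<close>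
  contribute negatively.\<close>

lemma out_arc_with_flow:
  assumes "net_flow rc (\<lambda>y. if y = x then 1 else 0) < 0"
  shows "\<exists>i\<in>fwd. head (Suc i) = x \<and> 0 < rc (Suc i)"
proof (rule ccontr)
  assume "\<not> ?thesis"
  then have "0 \<le> net_flow rc (\<lambda>y. if y = x then 1 else 0)"
    unfolding net_flow_def by (intro sum_nonneg) auto
  then show False
    using assms by simp
qed

section \<open>Optimal flows and the level sets of their potentials\<close>

definition flow_state :: "nat \<Rightarrow> (nat \<Rightarrow> nat) \<Rightarrow> (nat \<Rightarrow> nat) \<Rightarrow> nat \<Rightarrow> nat \<Rightarrow> bool" where
  "flow_state N pt rc r l \<longleftrightarrow> capacities N rc \<and> feasible pt rc \<and> pt 1 = pt 0 + l \<and>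
     (\<forall>p. net_flow rc p = int r * (p 1 - p 0))"

definition crossing :: "(nat \<Rightarrow> nat) \<Rightarrow> (nat \<Rightarrow> nat) \<Rightarrow> nat set" where
  "crossing pt rc = {i \<in> fwd. cost i = 1 \<and> rc (Suc i) = 1 \<and> pt (head (Suc i)) < pt (head i)}"

text \<open>Every unit of flow climbs a total of \<open>l\<close>, and along an arc with flow the
  potential rises by at most the cost: by at most 1, and only on unit arcs.\<close>

lemma flow_le_crossing:
  assumes fs: "flow_state N pt rc r l"
  shows "r * l \<le> card (crossing pt rc)"
proof -
  have "int (rc (Suc i)) * (int (pt (head i)) - int (pt (head (Suc i))))
      \<le> (if i \<in> crossing pt rc then 1 else 0)" if i: "i \<in> fwd" for i
  proof (cases "rc (Suc i) = 0 \<or> pt (head i) \<le> pt (head (Suc i))")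
    case True
    then have "int (rc (Suc i)) * (int (pt (head i)) - int (pt (head (Suc i)))) \<le> 0"
      by (auto simp: mult_le_0_iff)
    then show ?thesis
      by (rule order_trans) simp
  next
    case False
    then have le: "pt (head i) \<le> pt (head (Suc i)) + cost i"
      using feasible_flow[of pt rc i] fs i by (auto simp: flow_state_def)
    then have c: "cost i = 1"
      using False cost_le[OF i] by linarith
    then have "rc i + rc (Suc i) = 1"
      using fs i by (auto simp: flow_state_def capacities_def)
    then have "rc (Suc i) = 1"
      using False by linarith
    then show ?thesis
      using le c False i by (auto simp: crossing_def)
  qed
  then have "net_flow rc (\<lambda>x. int (pt x)) \<le> (\<Sum>i\<in>fwd. if i \<in> crossing pt rc then 1 else 0)"
    unfolding net_flow_def by (intro sum_mono)
  also have "\<dots> = int (card (crossing pt rc))"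
    by (subst sum.If_cases) (auto simp: crossing_def Int_def)
  finally have "int r * (int (pt 1) - int (pt 0)) \<le> int (card (crossing pt rc))"
    using fs by (simp add: flow_state_def)
  then have "int (r * l) \<le> int (card (crossing pt rc))"
    using fs by (simp add: flow_state_def)
  then show ?thesis
    by linarith
qed

lemma unit_arc_tail:
  assumes "i \<in> fwd" "cost i = 1"
  obtains v where "v \<in> Field E" "v < n" "head (Suc i) = 2 * v+2" "head i = 2 * v+3"
  using assms Field_less by (auto elim!: arc_cases)

definition arc_vertex :: "nat \<Rightarrow> nat" where "arc_vertex i = (head i - 3) div 2"

lemma arc_vertex: "i \<in> fwd \<Longrightarrow> cost i = 1 \<Longrightarrow> arc_vertex i \<in> Field E \<and> arc_vertex i < n
    \<and> head (Suc i) = 2 * arc_vertex i + 2 \<and> head i = 2 * arc_vertex i + 3"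
  by (rule unit_arc_tail) (auto simp: arc_vertex_def)

lemma inj_on_arc_vertex: "inj_on arc_vertex {i \<in> fwd. cost i = 1}"
proof (rule inj_onI)
  fix i j
  assume "i \<in> {i \<in> fwd. cost i = 1}" "j \<in> {i \<in> fwd. cost i = 1}" "arc_vertex i = arc_vertex j"
  then show "i = j"
    using arc_vertex[of i] arc_vertex[of j] unit_arc[of i j] fwd_less by auto
qed

text \<open>Distinct crossing arcs belong to distinct vertices. As \<open>l\<close> stays positive,
  this bounds the flow value by \<open>n\<close> in every intermediate state.\<close>

lemma flow_le_n:
  assumes "flow_state N pt rc r l"
  shows "r * l \<le> n"
proof -
  have "card (crossing pt rc) = card (arc_vertex ` crossing pt rc)"
    using inj_on_arc_vertex by (intro card_image[symmetric]) (auto simp: inj_on_def crossing_def)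
  also have "\<dots> \<le> card {..<n}"
    using arc_vertex by (intro card_mono) (auto simp: crossing_def)
  finally show ?thesis
    using flow_le_crossing[OF assms] by simp
qed

text \<open>Without arcs there is no flow; this later absorbs the constant cost of each augmentation
  into \<open>r * M\<close>.\<close>

lemma flow_M_0:
  assumes "flow_state N pt rc r l" "M = 0"
  shows "r * l = 0"
proof -
  have "\<not> i < M" for i
    using assms(2) by simp
  then have "crossing pt rc = {}"
    by (auto simp: crossing_def fwd_def)
  then show ?thesis
    using flow_le_crossing[OF assms(1)] by (simp only: card.empty le_zero_eq)
qed

text \<open>A vertex across which the potential rises by several levels is put on the topmost one.
  Isolated vertices are comparable to no other vertex and may join level 1.\<close>

definition antichain_label :: "(nat \<Rightarrow> nat) \<Rightarrow> nat \<Rightarrow> nat" where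
  "antichain_label pt v = (if v \<in> Field E then
     (if pt (2 * v+2) < pt (2 * v+3) then pt (2 * v+3) - pt 0 else 0) else 1)"

lemma potential_steps:
  fixes pt :: "nat \<Rightarrow> nat"
  assumes pt: "\<And>i. i \<in> fwd \<Longrightarrow> pt (head (Suc i)) \<le> pt (head i)" and uv: "(u, v) \<in> E\<^sup>+"
  shows "pt (2 * u+3) \<le> pt (2 * v+2)"
proof -
  have edge: "pt (2 * u+3) \<le> pt (2 * v+2)" if "(u, v) \<in> E" for u v
  proof -
    have "(2 * u+3, 2 * v+2, 0) \<in> arc_spec E"
      using that by (force simp: arc_spec_def)
    then obtain i where "i \<in> fwd" "head (Suc i) = 2 * u+3" "head i = 2 * v+2"
      using arc_exists by blast
    then show ?thesis
      using pt[of i] by simp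
  qed
  have vertex: "pt (2 * v+2) \<le> pt (2 * v+3)" if "v \<in> Field E" for v
  proof -
    have "(2 * v+2, 2 * v+3, 1) \<in> arc_spec E"
      using that by (auto simp: arc_spec_def)
    then obtain i where "i \<in> fwd" "head (Suc i) = 2 * v+2" "head i = 2 * v+3"
      using arc_exists by blast
    then show ?thesis
      using pt[of i] by simp
  qed
  show ?thesis
    using uv
  proof (induction rule: trancl_induct)
    case (base y)
    then show ?case
      using edge by blast
  next
    case (step y z)
    have "y \<in> Field E"
      using step.hyps(2) by (auto simp: Field_def)
    then show ?case
      using step.IH edge[OF step.hyps(2)] vertex[OF \<open>y \<in> Field E\<close>] by linarith
  qed
qed

lemma reach_isolated: "v \<notin> Field E \<Longrightarrow> (u, v) \<in> E\<^sup>* \<Longrightarrow> u = v" "v \<notin> Field E \<Longrightarrow> (v, u) \<in> E\<^sup>* \<Longrightarrow> u = v"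
proof -
  show "v \<notin> Field E \<Longrightarrow> (u, v) \<in> E\<^sup>* \<Longrightarrow> u = v"
    by (erule rtranclE) (auto simp: Field_def)
  show "v \<notin> Field E \<Longrightarrow> (v, u) \<in> E\<^sup>* \<Longrightarrow> u = v"
    by (erule converse_rtranclE) (auto simp: Field_def)
qed

lemma antichain_label_le:
  assumes "\<And>i. i \<in> fwd \<Longrightarrow> pt (head (Suc i)) \<le> pt (head i)" "pt 1 = pt 0 + l" "1 \<le> l"
  shows "antichain_label pt v \<le> l"
proof (cases "v \<in> Field E")
  case True
  then have "(2 * v+3, 1, 0) \<in> arc_spec E"
    by (auto simp: arc_spec_def)
  then obtain i where "i \<in> fwd" "head (Suc i) = 2 * v+3" "head i = 1"
    using arc_exists by blast
  then have "pt (2 * v+3) \<le> pt 1"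
    using assms(1)[of i] by simp
  then show ?thesis
    using assms(2) True by (simp add: antichain_label_def le_diff_conv add.commute)
qed (use assms in \<open>simp add: antichain_label_def\<close>)

text \<open>If \<open>u\<close> reaches \<open>v\<close>, the potential is at least the level of
  \<open>u\<close> when it enters \<open>v\<close> and rises once more inside \<open>v\<close>, so
  the labels differ.\<close>

lemma antichain_label_class:
  assumes pt: "\<And>i. i \<in> fwd \<Longrightarrow> pt (head (Suc i)) \<le> pt (head i)" and k: "0 < k"
  shows "dag_antichain {..<n} E (label_class n (antichain_label pt) k)"
  unfolding dag_antichain_def
proof (intro conjI ballI impI)
  fix u v
  assume u: "u \<in> label_class n (antichain_label pt) k" and v: "v \<in> label_class n (antichain_label pt) k"
    and "u \<noteq> v"
  show "(u, v) \<notin> E\<^sup>*"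
  proof
    assume uv: "(u, v) \<in> E\<^sup>*"
    then have F: "u \<in> Field E" "v \<in> Field E"
      using reach_isolated \<open>u \<noteq> v\<close> by metis+
    have "(u, v) \<in> E\<^sup>+"
      using uv \<open>u \<noteq> v\<close> by (meson rtranclD)
    then have 1: "pt (2 * u+3) \<le> pt (2 * v+2)"
      using potential_steps pt by blast
    have "pt (2 * v+2) < pt (2 * v+3)" "pt (2 * v+3) - pt 0 = pt (2 * u+3) - pt 0" "0 < pt (2 * u+3) - pt 0"
      using u v k F by (auto simp: label_class_def antichain_label_def split: if_splits)
    then show False
      using 1 by linarith
  qed
qed (auto simp: label_class_def)

text \<open>
  By complementary slackness every vertex off the flow is crossed by a level set of the potential,
  and every unit of flow crosses each of the \<open>l\<close> level sets on its way from source to sink.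
\<close>

lemma certificate_from_flow:
  assumes fs: "flow_state N pt rc r l" and l: "1 \<le> l"
    and free: "\<And>i. i \<in> fwd \<Longrightarrow> cost i = 0 \<Longrightarrow> 0 < rc i"
    and lc: "\<And>v. v < n \<Longrightarrow> lc v \<le> r" "\<And>i. i \<in> {1..r} \<Longrightarrow> dag_chain {..<n} E (label_class n lc i)"
      "\<And>i. i \<in> fwd \<Longrightarrow> cost i = 1 \<Longrightarrow> 0 < rc (Suc i) \<Longrightarrow> 0 < lc (arc_vertex i)"
  shows "certificate n E r l lc (antichain_label pt)"
proof -
  have fe: "feasible pt rc" "pt 1 = pt 0 + l"
    using fs by (simp_all add: flow_state_def)
  let ?la = "antichain_label pt"
  have unit: "rc i + rc (Suc i) = 1" if "i \<in> fwd" "cost i = 1" for i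
    using fs that by (auto simp: flow_state_def capacities_def)
  have mono: "pt (head (Suc i)) \<le> pt (head i)" if i: "i \<in> fwd" for i
  proof (cases "cost i = 0")
    case True
    then show ?thesis
      using feasible_residual[OF fe(1) i] free[OF i] by simp
  next
    \<comment> \<open>A saturated unit arc gives no lower bound on the rise of the potential; its
      parallel free arc, which always has residual capacity, does.\<close>
    case False
    then obtain v where v: "v \<in> Field E" "head (Suc i) = 2 * v+2" "head i = 2 * v+3"
      using i by (auto elim!: arc_cases)
    then have "(2 * v+2, 2 * v+3, 0) \<in> arc_spec E"
      by (auto simp: arc_spec_def)
    then obtain j where "j \<in> fwd" "head (Suc j) = 2 * v+2" "head j = 2 * v+3" "cost j = 0"
      using arc_exists by blast
    then show ?thesis
      using feasible_residual[OF fe(1), of j] free[of j] v by simp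
  qed
  have la_pos: "0 < ?la v" if "v \<in> Field E" "pt (2 * v+2) < pt (2 * v+3)" for v
  proof -
    have "(0, 2 * v+2, 0) \<in> arc_spec E"
      using that by (auto simp: arc_spec_def)
    then obtain i where "i \<in> fwd" "head (Suc i) = 0" "head i = 2 * v+2"
      using arc_exists by blast
    then have "pt 0 \<le> pt (2 * v+2)"
      using mono[of i] by simp
    then show ?thesis
      using that by (simp add: antichain_label_def)
  qed
  have covered: "v \<in> nonzeros n lc \<union> nonzeros n ?la" if v: "v < n" for v
  proof (cases "v \<in> Field E")
    case True
    then have "(2 * v+2, 2 * v+3, 1) \<in> arc_spec E"
      by (auto simp: arc_spec_def)
    then obtain i where i: "i \<in> fwd" "head (Suc i) = 2 * v+2" "head i = 2 * v+3" "cost i = 1"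
      using arc_exists by blast
    then have av: "arc_vertex i = v"
      by (simp add: arc_vertex_def)
    show ?thesis
    proof (cases "0 < rc (Suc i)")
      case True
      then show ?thesis
        using lc(3)[OF i(1,4)] av v by (simp add: nonzeros_def)
    next
      case False
      then have "0 < rc i"
        using unit[OF i(1,4)] by linarith
      then have "pt (2 * v+2) < pt (2 * v+3)"
        using feasible_residual[OF fe(1) i(1)] i by simp
      then show ?thesis
        using la_pos[OF True] v by (simp add: nonzeros_def)
    qed
  next
    case False
    then show ?thesis
      using v by (simp add: nonzeros_def antichain_label_def)
  qed
  \<comment> \<open>Vertices crossed by flow while the potential rises are covered twice; they
    provide the surplus \<open>r * l\<close>.\<close>
  have "arc_vertex ` crossing pt rc \<subseteq> nonzeros n lc \<inter> nonzeros n ?la"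
  proof
    fix v
    assume "v \<in> arc_vertex ` crossing pt rc"
    then obtain i where i: "i \<in> fwd" "cost i = 1" "rc (Suc i) = 1" "pt (head (Suc i)) < pt (head i)"
        "v = arc_vertex i"
      by (auto simp: crossing_def)
    then show "v \<in> nonzeros n lc \<inter> nonzeros n ?la"
      using lc(3)[OF i(1,2)] la_pos[of v] arc_vertex[OF i(1,2)] by (simp add: nonzeros_def)
  qed
  then have "card (crossing pt rc) \<le> card (nonzeros n lc \<inter> nonzeros n ?la)"
    using inj_on_arc_vertex
    by (intro card_inj_on_le[of arc_vertex]) (auto simp: inj_on_def crossing_def)
  moreover have "n = card (nonzeros n lc \<union> nonzeros n ?la)"
  proof -
    have "nonzeros n f \<subseteq> {..<n}" for f
      by (auto simp: nonzeros_def)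
    then have "nonzeros n lc \<union> nonzeros n ?la = {..<n}"
      using covered by blast
    then show ?thesis
      by simp
  qed
  ultimately have "n + r * l \<le> card (nonzeros n lc) + card (nonzeros n ?la)"
    using flow_le_crossing[OF fs] card_Un_Int[of "nonzeros n lc" "nonzeros n ?la"] by simp
  then show ?thesis
    unfolding certificate_def
    using lc antichain_label_le[OF mono fe(2) l] antichain_label_class[OF mono] by auto
qed

text \<open>The number of strict predecessors is a rank on vertices; doubling it makes room for the
  two halves of a vertex. It serves the proofs, whereas the program computes a topological
  order.\<close>

lemma ranking_exists: "\<exists>rho. ranking rho"
proof -
  have fin: "finite E"
    using E(1) by (rule finite_subset) simp
  define f where "f v = card {u. (u, v) \<in> E\<^sup>+}" for v
  have finf: "finite {u. (u, v) \<in> E\<^sup>+}" for v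
  proof (rule finite_subset)
    show "{u. (u, v) \<in> E\<^sup>+} \<subseteq> Domain E"
      by (auto dest: tranclD)
  qed (use fin in \<open>simp add: finite_Domain\<close>)
  have f: "f u < f v" if uv: "(u, v) \<in> E" for u v
  proof -
    have "{x. (x, u) \<in> E\<^sup>+} \<subseteq> {x. (x, v) \<in> E\<^sup>+}"
      using uv by (auto intro: trancl_into_trancl)
    moreover have "u \<in> {x. (x, v) \<in> E\<^sup>+}" "u \<notin> {x. (x, u) \<in> E\<^sup>+}"
      using uv E(2) by (auto simp: acyclic_def)
    ultimately show ?thesis
      unfolding f_def by (intro psubset_card_mono finf) blast
  qed
  \<comment> \<open>Any upper bound of the ranks would do; a sum avoids the maximum of a possibly
    empty set.\<close>
  define B where "B = (\<Sum>v\<in>Field E. f v)"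
  have B: "f v \<le> B" if "v \<in> Field E" for v
    unfolding B_def using that fin by (intro member_le_sum) (auto simp: finite_Field)
  define rho where "rho x = (if x = 0 then 0 else if x = 1 then 2 * B + 3
      else if even x then 2 * f (x div 2 - 1) + 1 else 2 * f (x div 2 - 1) + 2)" for x
  have "rho 0 = 0" "rho 1 = 2 * B + 3" "rho (2 * v+2) = 2 * f v + 1" "rho (2 * v+3) = 2 * f v + 2" for v
    by (simp_all add: rho_def)
  then have "ranking rho"
    unfolding ranking_def using B f by (auto elim!: arc_cases simp: less_Suc_eq_le) fastforce+
  then show ?thesis
    by blast
qed

subsection \<open>Topological order\<close>

definition scanned :: "nat list \<Rightarrow> nat list \<Rightarrow> nat \<Rightarrow> bool" where
  "scanned popped pend i \<longleftrightarrow> tail i \<in> set popped \<and> i \<notin> set pend"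

definition kahn :: "nat \<Rightarrow> nat list \<Rightarrow> nat list \<Rightarrow> (nat \<Rightarrow> nat) \<Rightarrow> (nat \<Rightarrow> nat) \<Rightarrow> bool" where
  "kahn h pend q deg pos \<longleftrightarrow>
     distinct q \<and> h \<le> length q \<and> 0 < length q \<and> q ! 0 = 0 \<and> set q \<subseteq> nodes \<and>
     (\<forall>j<length q. pos (q ! j) = j) \<and>
     (\<forall>y. deg y = card {i \<in> fwd. head i = y \<and> \<not> scanned (take h q) pend i}) \<and>
     (\<forall>y\<in>head ` fwd. y \<in> set q \<longleftrightarrow> deg y = 0) \<and>
     (\<forall>j<length q. \<forall>i\<in>fwd. head i = q ! j \<longrightarrow> tail i \<in> set (take j q)) \<and>
     distinct pend \<and> (\<forall>i\<in>set pend. i < M \<and> tail i \<in> set (take h q))"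

text \<open>An unscanned arc weighs 2 because scanning it may append a node, of weight 1, to the
  queue.\<close>

definition kahn_measure :: "nat \<Rightarrow> nat list \<Rightarrow> nat list \<Rightarrow> nat" where
  "kahn_measure h pend q = 2 * card {i. i < M \<and> tail i \<notin> set (take h q)} + 2 * length pend + (length q - h)"

definition is_adj :: "nat \<Rightarrow> nat list \<Rightarrow> bool" where
  "is_adj x l \<longleftrightarrow> distinct l \<and> set l = {i. i < M \<and> tail i = x}"

lemma card_unvisited:
  assumes "is_adj y l" "y \<notin> S"
  shows "card {i. i < M \<and> tail i \<notin> S} = card {i. i < M \<and> tail i \<notin> insert y S} + length l"
proof -
  let ?X = "{i. i < M \<and> tail i \<notin> insert y S}" and ?Y = "{i. i < M \<and> tail i = y}"
  have "{i. i < M \<and> tail i \<notin> S} = ?X \<union> ?Y"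
    using assms(2) by blast
  moreover have "?X \<inter> ?Y = {}"
    by blast
  moreover have "card ?Y = length l"
    using assms(1) distinct_card[of l] unfolding is_adj_def by simp
  ultimately show ?thesis
    by (simp add: card_Un_disjoint)
qed

lemma source_not_head: "0 \<notin> head ` fwd"
proof
  assume "0 \<in> head ` fwd"
  then obtain i where "i \<in> fwd" "head i = 0"
    by auto
  then show False
    by (auto elim!: arc_cases)
qed

text \<open>Only the source has no entering arc, so the queue may start with the source
  alone.\<close>

lemma tail_source_or_head: "i \<in> fwd \<Longrightarrow> tail i = 0 \<or> tail i \<in> head ` fwd"
proof -
  assume i: "i \<in> fwd"
  have into: "2 * v + 2 \<in> head ` fwd" "2 * v + 3 \<in> head ` fwd" if v: "v \<in> Field E" for v
  proof -
    have "(0, 2 * v + 2, 0) \<in> arc_spec E" "(2 * v + 2, 2 * v + 3, 0) \<in> arc_spec E"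
      using v by (auto simp: arc_spec_def)
    then show "2 * v + 2 \<in> head ` fwd" "2 * v + 3 \<in> head ` fwd"
      using arc_exists by (metis image_eqI)+
  qed
  have t: "tail i = head (Suc i)"
    using fwd_less(4)[OF i] by simp
  show ?thesis
    using i
  proof (cases rule: arc_cases)
    case (edge u v)
    then have "u \<in> Field E"
      by (auto simp: Field_def)
    then show ?thesis
      using into(2)[of u] edge(2) t by simp
  next
    case (source v)
    then show ?thesis
      using t by simp
  next
    case (unit v)
    then show ?thesis
      using into(1)[OF unit(1)] t by simp
  next
    case (free v)
    then show ?thesis
      using into(1)[OF free(1)] t by simp
  next
    case (sink v)
    then show ?thesis
      using into(2)[OF sink(1)] t by simp
  qed
qed

lemma rankingD: "ranking rho \<Longrightarrow> i \<in> fwd \<Longrightarrow> rho (head (Suc i)) < rho (head i)"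
  by (simp add: ranking_def)

lemma kahnD:
  assumes "kahn h pend q deg pos"
  shows "distinct q" "h \<le> length q" "0 < length q" "q ! 0 = 0" "set q \<subseteq> nodes"
    "\<forall>j<length q. pos (q ! j) = j"
    "\<forall>y. deg y = card {i \<in> fwd. head i = y \<and> \<not> scanned (take h q) pend i}"
    "\<forall>y\<in>head ` fwd. y \<in> set q \<longleftrightarrow> deg y = 0"
    "\<forall>j<length q. \<forall>i\<in>fwd. head i = q ! j \<longrightarrow> tail i \<in> set (take j q)"
    "distinct pend" "\<forall>i\<in>set pend. i < M \<and> tail i \<in> set (take h q)"
  using assms[unfolded kahn_def] by - (elim conjE, assumption)+

lemmas kahn_facts = kahnD[rule_format]

lemma kahnI:
  assumes "distinct q" "h \<le> length q" "0 < length q" "q ! 0 = 0" "set q \<subseteq> nodes"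
    "\<And>j. j < length q \<Longrightarrow> pos (q ! j) = j"
    "\<And>y. deg y = card {i \<in> fwd. head i = y \<and> \<not> scanned (take h q) pend i}"
    "\<And>y. y \<in> head ` fwd \<Longrightarrow> y \<in> set q \<longleftrightarrow> deg y = 0"
    "\<And>j i. j < length q \<Longrightarrow> i \<in> fwd \<Longrightarrow> head i = q ! j \<Longrightarrow> tail i \<in> set (take j q)"
    "distinct pend" "\<And>i. i \<in> set pend \<Longrightarrow> i < M" "\<And>i. i \<in> set pend \<Longrightarrow> tail i \<in> set (take h q)"
  shows "kahn h pend q deg pos"
  unfolding kahn_def by (intro conjI allI ballI impI) (rule assms; assumption)+

lemma kahn_start:
  assumes "\<And>y. deg y = card {i \<in> fwd. head i = y}" "pos 0 = 0"
  shows "kahn 0 [] [0] deg pos"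
proof (rule kahnI)
  fix y
  assume y: "y \<in> head ` fwd"
  then have "{i \<in> fwd. head i = y} \<noteq> {}"
    by auto
  then have "deg y \<noteq> 0"
    unfolding assms(1) by (subst card_0_eq) auto
  moreover have "y \<noteq> 0"
    using y source_not_head by metis
  ultimately show "y \<in> set [0] \<longleftrightarrow> deg y = 0"
    by simp
next
  fix j i
  assume "j < length [0::nat]" "i \<in> fwd" "head i = [0] ! j"
  then show "tail i \<in> set (take j [0])"
    using source_not_head by (metis One_nat_def image_eqI length_Cons less_Suc0 list.size(3) nth_Cons_0)
qed (use assms in \<open>simp_all add: nodes_def scanned_def\<close>)

text \<open>Adjacency lists also contain the reversals, which have odd numbers and do not affect the
  topological order.\<close>

lemma kahn_skip:
  assumes K: "kahn h (i # pend) q deg pos" and "odd i"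
  shows "kahn h pend q deg pos"
proof -
  have "scanned (take h q) (i # pend) j = scanned (take h q) pend j" if "j \<in> fwd" for j
    using that assms(2) by (auto simp: scanned_def fwd_def)
  then have "{j \<in> fwd. head j = y \<and> \<not> scanned (take h q) (i # pend) j}
      = {j \<in> fwd. head j = y \<and> \<not> scanned (take h q) pend j}" for y
    by auto
  then have deg: "deg y = card {j \<in> fwd. head j = y \<and> \<not> scanned (take h q) pend j}" for y
    using kahn_facts(7)[OF K, of y] by simp
  have pend: "distinct pend" "\<And>j. j \<in> set pend \<Longrightarrow> j < M" "\<And>j. j \<in> set pend \<Longrightarrow> tail j \<in> set (take h q)"
    using kahn_facts(10)[OF K] kahn_facts(11)[OF K] by simp_all
  show ?thesis
    by (rule kahnI; (rule kahn_facts(1-6,8,9)[OF K] deg pend; assumption))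
qed

lemma kahn_scan:
  assumes K: "kahn h (i # pend) q deg pos" and "even i"
  shows "0 < deg (head i)"
    "deg (head i) \<noteq> 1 \<Longrightarrow> kahn h pend q (deg(head i := deg (head i) - 1)) pos"
    "deg (head i) = 1 \<Longrightarrow> kahn h pend (q @ [head i]) (deg(head i := 0)) (pos(head i := length q))"
    "i < M"
proof -
  show "i < M"
    using kahn_facts(11)[OF K, of i] by simp
  then have i: "i \<in> fwd"
    using \<open>even i\<close> by (simp add: fwd_def)
  let ?U = "\<lambda>pend y. {j \<in> fwd. head j = y \<and> \<not> scanned (take h q) pend j}"
  have deg: "deg y = card (?U (i # pend) y)" for y
    using kahn_facts(7)[OF K] .
  have i_pend: "i \<notin> set pend" "tail i \<in> set (take h q)"
    using kahn_facts(10)[OF K] kahn_facts(11)[OF K, of i] by simp_all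
  have pend: "distinct pend" "\<And>j. j \<in> set pend \<Longrightarrow> j < M" "\<And>j. j \<in> set pend \<Longrightarrow> tail j \<in> set (take h q)"
    using kahn_facts(10)[OF K] kahn_facts(11)[OF K] by simp_all
  have i_in: "i \<in> ?U (i # pend) (head i)"
    using i by (simp add: scanned_def)
  then show pos: "0 < deg (head i)"
    unfolding deg by (subst card_gt_0_iff) auto
  have U: "?U pend y = ?U (i # pend) y - {i}" for y
    using i_pend by (auto simp: scanned_def)
  have card_head: "card (?U pend (head i)) = deg (head i) - 1"
    unfolding U deg using i_in by (subst card_Diff_singleton) auto
  have card_other: "card (?U pend y) = deg y" if "y \<noteq> head i" for y
    unfolding U deg using that by (intro arg_cong[where f = card]) auto
  have new_deg: "(deg(head i := deg (head i) - 1)) y = card (?U pend y)" for y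
    using card_head card_other by simp
  have queued: "y \<in> set q \<longleftrightarrow> deg y = 0" if "y \<in> head ` fwd" for y
    using kahn_facts(8)[OF K] that .
  have notin: "head i \<notin> set q"
    using queued[of "head i"] pos i by simp
  show "kahn h pend q (deg(head i := deg (head i) - 1)) pos" if "deg (head i) \<noteq> 1"
  proof -
    have "y \<in> set q \<longleftrightarrow> (deg(head i := deg (head i) - 1)) y = 0" if "y \<in> head ` fwd" for y
      using queued[OF that] notin \<open>deg (head i) \<noteq> 1\<close> pos by auto
    note iff = this
    show ?thesis
      by (rule kahnI; (rule kahn_facts(1-6,9)[OF K] new_deg pend iff; assumption))
  qed
  show "kahn h pend (q @ [head i]) (deg(head i := 0)) (pos(head i := length q))" if one: "deg (head i) = 1"
  proof -
    let ?q = "q @ [head i]"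
    have h: "take h ?q = take h q"
      using kahn_facts(2)[OF K] by simp
    have deg0: "(deg(head i := 0)) = (deg(head i := deg (head i) - 1))"
      using one by simp
    have in_q: "y \<in> set ?q \<longleftrightarrow> (deg(head i := 0)) y = 0" if "y \<in> head ` fwd" for y
      using queued[OF that] by auto
    have "finite (?U pend (head i))" "card (?U pend (head i)) = 0"
      using card_head one by simp_all
    then have "?U pend (head i) = {}"
      by (simp only: card_0_eq)
    \<comment> \<open>No unscanned arc enters the node any more, so all its predecessors have been
      popped.\<close>
    then have done_arcs: "tail j \<in> set (take h q)" if "j \<in> fwd" "head j = head i" for j
      using that by (auto simp: scanned_def)
    have order: "tail j \<in> set (take m ?q)" if "m < length ?q" "j \<in> fwd" "head j = ?q ! m" for m j
    proof (cases "m = length q")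
      case True
      then show ?thesis
        using done_arcs[of j] that set_take_subset[of h q] by auto
    next
      case False
      then show ?thesis
        using kahn_facts(9)[OF K, of m j] that by (auto simp: nth_append)
    qed
    have posn: "(pos(head i := length q)) (?q ! m) = m" if "m < length ?q" for m
    proof (cases "m = length q")
      case False
      then have "m < length q"
        using that by simp
      moreover from this have "q ! m \<noteq> head i"
        using notin nth_mem by metis
      ultimately show ?thesis
        using kahn_facts(6)[OF K, of m] by (simp add: nth_append)
    qed simp
    have q: "set ?q \<subseteq> nodes" "distinct ?q" "?q ! 0 = 0" "0 < length ?q" "h \<le> length ?q"
      using kahn_facts(1-5)[OF K] notin head_node(1)[OF \<open>i < M\<close>] by (auto simp: nth_append)
    have new_deg': "(deg(head i := 0)) y = card {j \<in> fwd. head j = y \<and> \<not> scanned (take h ?q) pend j}" for y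
      unfolding deg0 h by (rule new_deg)
    have pend': "tail j \<in> set (take h ?q)" if "j \<in> set pend" for j
      unfolding h using pend(3) that .
    show ?thesis
      by (rule kahnI) (rule q(2), rule q(5), rule q(4), rule q(3), rule q(1), erule posn, rule new_deg',
        erule in_q, erule (2) order, rule pend(1), erule pend(2), erule pend')
  qed
qed

lemma kahn_scan_measure:
  "kahn_measure h pend q < kahn_measure h (i # pend) q"
  "h \<le> length q \<Longrightarrow> kahn_measure h pend (q @ [y]) < kahn_measure h (i # pend) q"
  by (simp_all add: kahn_measure_def)

lemma kahn_pop:
  assumes K: "kahn h [] q deg pos" and h: "h < length q" and adj: "is_adj (q ! h) l"
  shows "kahn (Suc h) l q deg pos" "kahn_measure (Suc h) l q < kahn_measure h [] q"
proof -
  have take: "take (Suc h) q = take h q @ [q ! h]"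
    using h by (rule take_Suc_conv_app_nth)
  have "distinct (take (Suc h) q)"
    using kahn_facts(1)[OF K] by simp
  then have dst: "q ! h \<notin> set (take h q)"
    by (simp add: take)
  have l: "distinct l" "\<And>i. i \<in> set l \<longleftrightarrow> i < M \<and> tail i = q ! h"
    using adj by (auto simp: is_adj_def)
  have "scanned (take (Suc h) q) l i = scanned (take h q) [] i" if "i \<in> fwd" for i
    using dst l(2)[of i] fwd_less(1)[OF that] by (auto simp: scanned_def take)
  then have "{i \<in> fwd. head i = y \<and> \<not> scanned (take (Suc h) q) l i}
      = {i \<in> fwd. head i = y \<and> \<not> scanned (take h q) [] i}" for y
    by auto
  then have deg: "deg y = card {i \<in> fwd. head i = y \<and> \<not> scanned (take (Suc h) q) l i}" for y
    using kahn_facts(7)[OF K, of y] by simp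
  have rest: "Suc h \<le> length q" "\<And>i. i \<in> set l \<Longrightarrow> i < M" "\<And>i. i \<in> set l \<Longrightarrow> tail i \<in> set (take (Suc h) q)"
    using h l by (simp_all add: take)
  show "kahn (Suc h) l q deg pos"
    by (rule kahnI) (rule kahn_facts(1)[OF K], rule rest(1), rule kahn_facts(3)[OF K], rule kahn_facts(4)[OF K],
      rule kahn_facts(5)[OF K], erule kahn_facts(6)[OF K], rule deg, erule kahn_facts(8)[OF K],
      erule (2) kahn_facts(9)[OF K], rule l(1), erule rest(2), erule rest(3))
  have "set (take (Suc h) q) = insert (q ! h) (set (take h q))"
    by (simp add: take)
  then have "card {i. i < M \<and> tail i \<notin> set (take h q)}
      = card {i. i < M \<and> tail i \<notin> set (take (Suc h) q)} + length l"
    using card_unvisited[OF adj dst] by simp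
  then show "kahn_measure (Suc h) l q < kahn_measure h [] q"
    using h by (simp add: kahn_measure_def)
qed

text \<open>All nodes get queued, by induction along a ranking: when the predecessors of a node have
  been scanned, its counter is 0. A node is queued after all its predecessors, so positions rise
  along arcs.\<close>

lemma kahn_end:
  assumes K: "kahn (length q) [] q deg pos"
  shows "\<And>i. i \<in> fwd \<Longrightarrow> pos (head (Suc i)) < pos (head i)" "\<And>i. i \<in> fwd \<Longrightarrow> pos (head i) < length q"
    "0 < length q" "pos 0 = 0" "length q \<le> M + 2" "length q \<le> 2 * n + 2"
proof -
  obtain rho where rho: "ranking rho"
    using ranking_exists by blast
  have all: "y = 0 \<or> y \<in> head ` fwd \<Longrightarrow> y \<in> set q" for y
  proof (induction "rho y" arbitrary: y rule: less_induct)
    case less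
    show ?case
    proof (cases "y = 0")
      case True
      then show ?thesis
        using nth_mem[OF kahn_facts(3)[OF K]] kahn_facts(4)[OF K] by simp
    next
      case False
      then have y: "y \<in> head ` fwd"
        using less.prems by blast
      have "tail i \<in> set q" if i: "i \<in> fwd" "head i = y" for i
        using less.hyps[of "tail i"] rankingD[OF rho i(1)] i(2) tail_source_or_head[OF i(1)] fwd_less(4)[OF i(1)]
        by simp
      then have "{i \<in> fwd. head i = y \<and> \<not> scanned (take (length q) q) [] i} = {}"
        by (auto simp: scanned_def)
      then have "deg y = 0"
        using kahn_facts(7)[OF K, of y] by (simp only: card.empty)
      then show ?thesis
        using kahn_facts(8)[OF K y] by simp
    qed
  qed
  have pos: "pos (q ! j) = j" if "j < length q" for j
    using kahn_facts(6)[OF K that] .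
  have both: "pos (head (Suc i)) < pos (head i) \<and> pos (head i) < length q" if i: "i \<in> fwd" for i
  proof -
    have "head i \<in> set q"
      using all i by simp
    then obtain j where j: "j < length q" "q ! j = head i"
      by (auto simp: in_set_conv_nth)
    then have "tail i \<in> set (take j q)"
      using kahn_facts(9)[OF K j(1) i] by simp
    then obtain m where m: "m < j" "q ! m = tail i"
      using j(1) by (auto simp: in_set_conv_nth)
    then show ?thesis
      using pos[of j] pos[of m] j fwd_less(4)[OF i] by simp
  qed
  then show "\<And>i. i \<in> fwd \<Longrightarrow> pos (head (Suc i)) < pos (head i)" "\<And>i. i \<in> fwd \<Longrightarrow> pos (head i) < length q"
    by blast+
  have "length q = card (set q)" "set q \<subseteq> nodes"
    using kahn_facts(1,5)[OF K] by (simp_all add: distinct_card)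
  then have "length q \<le> card nodes"
    by (simp add: card_mono)
  then show "length q \<le> M + 2" "length q \<le> 2 * n + 2"
    using card_nodes card_nodes_n by simp_all
  show "0 < length q" "pos 0 = 0"
    using kahn_facts(3)[OF K] kahn_facts(4)[OF K] pos[of 0] by simp_all
qed

subsection \<open>Shortest residual paths\<close>

text \<open>The reduced length of a residual arc; on residual arcs feasibility makes the truncated
  subtraction exact.\<close>

definition slack :: "(nat \<Rightarrow> nat) \<Rightarrow> nat \<Rightarrow> nat" where
  "slack pt i = (pt (head i) + cost (twin i)) - (pt (tail i) + cost i)"

text \<open>Arcs of length 0 allow equal distances along the tree, so acyclicity of the parent
  pointers is expressed by the order of settling instead.\<close>

definition par_ok :: "(nat \<Rightarrow> nat) \<Rightarrow> (nat \<Rightarrow> nat) \<Rightarrow> nat list \<Rightarrow> (nat \<Rightarrow> nat) \<Rightarrow> (nat \<Rightarrow> nat) \<Rightarrow> bool" where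
  "par_ok pt rc ord dst par \<longleftrightarrow> (\<forall>j. 0 < j \<and> j < length ord \<longrightarrow>
     par (ord ! j) < M \<and> head (par (ord ! j)) = ord ! j \<and> 0 < rc (par (ord ! j)) \<and>
     dst (ord ! j) = dst (tail (par (ord ! j))) + slack pt (par (ord ! j)) \<and>
     tail (par (ord ! j)) \<in> set (take j ord))"

definition relaxed :: "(nat \<Rightarrow> nat) \<Rightarrow> (nat \<Rightarrow> nat) \<Rightarrow> (nat \<Rightarrow> nat list) \<Rightarrow> nat \<Rightarrow> bool" where
  "relaxed pt dst bks i \<longleftrightarrow> dst (head i) \<le> dst (tail i) + slack pt i \<or> i \<in> set (bks (dst (tail i) + slack pt i))"

definition waiting where
  "waiting pt rc D0 d pend ord dst e i \<longleftrightarrow> i < M \<and> 0 < rc i \<and> tail i \<in> set ord \<and>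
     i \<notin> set pend \<and> e = dst (tail i) + slack pt i \<and> d \<le> e \<and> e < D0"

text \<open>Dial's bucket version of Dijkstra's algorithm. Buckets hold arcs, keyed by the distance
  they offer, which replaces the decrease of keys; \<open>D0\<close> plays the role of infinity, so
  \<open>dst y < D0\<close> tells the settled nodes. \<open>pend\<close> lists the unscanned arcs of
  the node \<open>x\<close> settled last.\<close>

definition dial :: "(nat \<Rightarrow> nat) \<Rightarrow> (nat \<Rightarrow> nat) \<Rightarrow> nat \<Rightarrow> nat \<Rightarrow> nat \<Rightarrow> nat list \<Rightarrow> nat list \<Rightarrow>
    (nat \<Rightarrow> nat list) \<Rightarrow> (nat \<Rightarrow> nat) \<Rightarrow> (nat \<Rightarrow> nat) \<Rightarrow> bool" where
  "dial pt rc D0 d x pend ord bks dst par \<longleftrightarrow>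
     distinct ord \<and> 0 < length ord \<and> ord ! 0 = 0 \<and> set ord \<subseteq> nodes \<and>
     (\<forall>y\<in>nodes. dst y \<le> D0) \<and> (\<forall>y\<in>nodes. dst y < D0 \<longleftrightarrow> y \<in> set ord) \<and> dst 0 = 0 \<and>
     (\<forall>y\<in>set ord. dst y \<le> d) \<and> par_ok pt rc ord dst par \<and>
     (\<forall>i<M. 0 < rc i \<longrightarrow> tail i \<in> set ord \<longrightarrow> i \<notin> set pend \<longrightarrow> relaxed pt dst bks i) \<and>
     (\<forall>e. distinct (bks e)) \<and> (\<forall>e. \<forall>i\<in>set (bks e). waiting pt rc D0 d pend ord dst e i) \<and>
     distinct pend \<and> (\<forall>i\<in>set pend. i < M \<and> tail i = x) \<and>
     (pend \<noteq> [] \<longrightarrow> x \<in> set ord) \<and> (pend \<noteq> [] \<longrightarrow> dst x = d)"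

lemma dialD:
  assumes "dial pt rc D0 d x pend ord bks dst par"
  shows "distinct ord" "0 < length ord" "ord ! 0 = 0" "set ord \<subseteq> nodes"
    "\<forall>y\<in>nodes. dst y \<le> D0" "\<forall>y\<in>nodes. dst y < D0 \<longleftrightarrow> y \<in> set ord" "dst 0 = 0"
    "\<forall>y\<in>set ord. dst y \<le> d" "par_ok pt rc ord dst par"
    "\<forall>i<M. 0 < rc i \<longrightarrow> tail i \<in> set ord \<longrightarrow> i \<notin> set pend \<longrightarrow> relaxed pt dst bks i"
    "\<forall>e. distinct (bks e)" "\<forall>e. \<forall>i\<in>set (bks e). waiting pt rc D0 d pend ord dst e i"
    "distinct pend" "\<forall>i\<in>set pend. i < M \<and> tail i = x"
    "pend \<noteq> [] \<longrightarrow> x \<in> set ord" "pend \<noteq> [] \<longrightarrow> dst x = d"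
  using assms[unfolded dial_def] by - (elim conjE, assumption)+

lemmas dial_facts = dialD[rule_format]

lemma dialI:
  assumes "distinct ord" "0 < length ord" "ord ! 0 = 0" "set ord \<subseteq> nodes"
    "\<And>y. y \<in> nodes \<Longrightarrow> dst y \<le> D0" "\<And>y. y \<in> nodes \<Longrightarrow> dst y < D0 \<longleftrightarrow> y \<in> set ord" "dst 0 = 0"
    "\<And>y. y \<in> set ord \<Longrightarrow> dst y \<le> d" "par_ok pt rc ord dst par"
    "\<And>i. i < M \<Longrightarrow> 0 < rc i \<Longrightarrow> tail i \<in> set ord \<Longrightarrow> i \<notin> set pend \<Longrightarrow> relaxed pt dst bks i"
    "\<And>e. distinct (bks e)" "\<And>e i. i \<in> set (bks e) \<Longrightarrow> waiting pt rc D0 d pend ord dst e i"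
    "distinct pend" "\<And>i. i \<in> set pend \<Longrightarrow> i < M" "\<And>i. i \<in> set pend \<Longrightarrow> tail i = x"
    "pend \<noteq> [] \<Longrightarrow> x \<in> set ord" "pend \<noteq> [] \<Longrightarrow> dst x = d"
  shows "dial pt rc D0 d x pend ord bks dst par"
  unfolding dial_def by (intro conjI allI ballI impI) (rule assms; assumption)+

text \<open>An arc weighs 2 before it is scanned and 1 while it waits in a bucket. The last term
  counts the remaining buckets, which is why \<open>D0\<close> has to be linear in
  \<open>M\<close>.\<close>

definition dial_measure :: "nat \<Rightarrow> nat \<Rightarrow> nat list \<Rightarrow> nat list \<Rightarrow> (nat \<Rightarrow> nat list) \<Rightarrow> nat" where
  "dial_measure D0 d pend ord bks = 2 * card {i. i < M \<and> tail i \<notin> set ord} + 2 * length pend +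
     (\<Sum>e<D0. length (bks e)) + (D0 - d)"

lemma sum_length_upd:
  fixes D0 :: nat
  assumes "e < D0"
  shows "(\<Sum>e'<D0. length ((bks(e := b)) e')) + length (bks e) = (\<Sum>e'<D0. length (bks e')) + length b"
proof -
  have "(\<Sum>e'\<in>{..<D0} - {e}. length ((bks(e := b)) e')) = (\<Sum>e'\<in>{..<D0} - {e}. length (bks e'))"
    by (intro sum.cong) auto
  then show ?thesis
    using assms sum.remove[of "{..<D0}" e "\<lambda>e'. length ((bks(e := b)) e')"]
      sum.remove[of "{..<D0}" e "\<lambda>e'. length (bks e')"] by simp
qed

lemma dial_start:
  assumes "0 < D0" "is_adj 0 l" "dst 0 = 0" "\<And>y. y \<in> nodes \<Longrightarrow> y \<noteq> 0 \<Longrightarrow> dst y = D0"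
  shows "dial pt rc D0 0 0 l [0] (\<lambda>_. []) dst par"
    "dial_measure D0 0 l [0] (\<lambda>_. []) \<le> 4 * M + D0"
proof -
  have l: "distinct l" "\<And>i. i \<in> set l \<longleftrightarrow> i < M \<and> tail i = 0"
    using assms(2) unfolding is_adj_def by simp_all
  have "dst y \<le> D0 \<and> (dst y < D0 \<longleftrightarrow> y \<in> set [0])" if "y \<in> nodes" for y
    using assms(1,3) assms(4)[OF that] by (cases "y = 0") auto
  then show "dial pt rc D0 0 0 l [0] (\<lambda>_. []) dst par"
    using l assms(3) by (intro dialI) (auto simp: par_ok_def nodes_def)
  have "card {i. i < M \<and> tail i \<noteq> 0} \<le> card {..<M}"
    by (intro card_mono) auto
  moreover have "length l \<le> card {..<M}"
    unfolding distinct_card[OF l(1), symmetric] using l(2) by (intro card_mono) auto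
  ultimately show "dial_measure D0 0 l [0] (\<lambda>_. []) \<le> 4 * M + D0"
    by (simp add: dial_measure_def)
qed

lemma dial_pend:
  assumes D: "dial pt rc D0 d x (i # pend) ord bks dst par"
  shows "i < M" "tail i = x" "x \<in> set ord" "dst x = d" "i \<notin> set pend" "distinct pend"
    "\<And>j. j \<in> set pend \<Longrightarrow> j < M" "\<And>j. j \<in> set pend \<Longrightarrow> tail j = x"
  using dial_facts(13)[OF D] dial_facts(14)[OF D] dial_facts(15)[OF D] dial_facts(16)[OF D] by simp_all

text \<open>An offer of at least \<open>D0\<close> may be dropped, because no distance exceeds
  \<open>D0\<close>.\<close>

lemma dial_scan_skip:
  assumes D: "dial pt rc D0 d x (i # pend) ord bks dst par" and skip: "rc i = 0 \<or> D0 \<le> d + slack pt i"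
  shows "dial pt rc D0 d x pend ord bks dst par"
    "dial_measure D0 d pend ord bks < dial_measure D0 d (i # pend) ord bks"
proof -
  note i = dial_pend[OF D]
  show "dial pt rc D0 d x pend ord bks dst par"
  proof (rule dialI)
    fix k
    assume k: "k < M" "0 < rc k" "tail k \<in> set ord" "k \<notin> set pend"
    show "relaxed pt dst bks k"
    proof (cases "k = i")
      case True
      then have "D0 \<le> dst (tail k) + slack pt k"
        using skip k(2) i by simp
      moreover have "dst (head k) \<le> D0"
        using dial_facts(5)[OF D] head_node(1)[OF k(1)] .
      ultimately show ?thesis
        unfolding relaxed_def by linarith
    next
      case False
      then show ?thesis
        using dial_facts(10)[OF D k(1-3)] k(4) by simp
    qed
  next
    fix e k
    assume "k \<in> set (bks e)"
    then show "waiting pt rc D0 d pend ord dst e k"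
      using dial_facts(12)[OF D] by (simp add: waiting_def)
  qed (use dial_facts(1-9,11)[OF D] i in simp_all)
  show "dial_measure D0 d pend ord bks < dial_measure D0 d (i # pend) ord bks"
    by (simp add: dial_measure_def)
qed

lemma dial_scan_notin:
  assumes D: "dial pt rc D0 d x (i # pend) ord bks dst par"
  shows "i \<notin> set (bks e)"
  using dial_facts(12)[OF D, of i e] by (auto simp: waiting_def)

lemma dial_scan_push:
  assumes D: "dial pt rc D0 d x (i # pend) ord bks dst par" and "0 < rc i" and e: "e = d + slack pt i" "e < D0"
  shows "dial pt rc D0 d x pend ord (bks(e := i # bks e)) dst par"
    "dial_measure D0 d pend ord (bks(e := i # bks e)) < dial_measure D0 d (i # pend) ord bks"
proof -
  note i = dial_pend[OF D]
  note notin = dial_scan_notin[OF D]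
  let ?bks = "bks(e := i # bks e)"
  have sub: "set (bks e') \<subseteq> set (?bks e')" for e'
    by auto
  show "dial pt rc D0 d x pend ord ?bks dst par"
  proof (rule dialI)
    fix k
    assume k: "k < M" "0 < rc k" "tail k \<in> set ord" "k \<notin> set pend"
    show "relaxed pt dst ?bks k"
    proof (cases "k = i")
      case True
      then show ?thesis
        using i e by (simp add: relaxed_def)
    next
      case False
      then show ?thesis
        using dial_facts(10)[OF D k(1-3)] k(4) sub unfolding relaxed_def by auto
    qed
  next
    fix e' k
    assume "k \<in> set (?bks e')"
    then consider "k \<in> set (bks e')" | "k = i" "e' = e"
      by (auto split: if_splits)
    then show "waiting pt rc D0 d pend ord dst e' k"
    proof cases
      case 1
      then show ?thesis
        using dial_facts(12)[OF D] by (simp add: waiting_def)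
    next
      case 2
      then show ?thesis
        using i e assms(2) by (simp add: waiting_def)
    qed
  next
    fix e'
    show "distinct (?bks e')"
      using dial_facts(11)[OF D] notin by simp
  qed (use dial_facts(1-9)[OF D] i in simp_all)
  show "dial_measure D0 d pend ord ?bks < dial_measure D0 d (i # pend) ord bks"
    using sum_length_upd[OF e(2), of bks "i # bks e"] by (simp add: dial_measure_def del: fun_upd_apply)
qed

lemma dial_pop_measure:
  fixes d D0 :: nat
  assumes "bks d = i # b" "d < D0"
  shows "(\<Sum>e<D0. length ((bks(d := b)) e)) < (\<Sum>e<D0. length (bks e))"
  using sum_length_upd[OF assms(2), of bks b] assms(1) by simp

lemma dial_bucket:
  assumes D: "dial pt rc D0 d x [] ord bks dst par" and b: "bks d = i # b"
  shows "distinct b" "i \<notin> set b" "i < M" "0 < rc i" "tail i \<in> set ord" "d = dst (tail i) + slack pt i"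
    "\<And>e k. k \<in> set ((bks(d := b)) e) \<Longrightarrow> k \<in> set (bks e)" "\<And>e. distinct ((bks(d := b)) e)"
    "\<And>k. k \<noteq> i \<Longrightarrow> relaxed pt dst bks k \<Longrightarrow> relaxed pt dst (bks(d := b)) k"
  using dial_facts(11)[OF D, of d] dial_facts(12)[OF D, of i d] dial_facts(11)[OF D] b
  by (auto simp: waiting_def relaxed_def split: if_splits)

text \<open>A settled node has distance at most \<open>d\<close>, so the inequality of the popped
  arc holds already.\<close>

lemma dial_pop_skip:
  assumes D: "dial pt rc D0 d x [] ord bks dst par" and b: "bks d = i # b" and "dst (head i) < D0" "d < D0"
  shows "dial pt rc D0 d x [] ord (bks(d := b)) dst par"
    "dial_measure D0 d [] ord (bks(d := b)) < dial_measure D0 d [] ord bks"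
proof -
  note bk = dial_bucket[OF D b]
  have "head i \<in> set ord"
    using dial_facts(6)[OF D head_node(1)[OF bk(3)]] assms(3) by simp
  then have near: "dst (head i) \<le> d"
    by (rule dial_facts(8)[OF D])
  show "dial pt rc D0 d x [] ord (bks(d := b)) dst par"
  proof (rule dialI)
    fix k
    assume k: "k < M" "0 < rc k" "tail k \<in> set ord"
    show "relaxed pt dst (bks(d := b)) k"
    proof (cases "k = i")
      case True
      then show ?thesis
        using bk(6) near by (simp add: relaxed_def)
    next
      case False
      then show ?thesis
        using dial_facts(10)[OF D k] by (intro bk(9)) simp_all
    qed
  next
    fix e k
    assume "k \<in> set ((bks(d := b)) e)"
    then show "waiting pt rc D0 d [] ord dst e k"
      using dial_facts(12)[OF D bk(7)] by blast
  qed (use dial_facts(1-9)[OF D] bk(8) in simp_all)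
  show "dial_measure D0 d [] ord (bks(d := b)) < dial_measure D0 d [] ord bks"
    using dial_pop_measure[of bks d i b D0] b assms(4) by (simp add: dial_measure_def del: fun_upd_apply)
qed

text \<open>Settling lowers a distance from \<open>D0\<close> to \<open>d\<close>, so inequalities
  at arcs into the node persist, and the arcs leaving it become pending.\<close>

lemma dial_pop_settle:
  assumes D: "dial pt rc D0 d x [] ord bks dst par" and b: "bks d = i # b" and "\<not> dst (head i) < D0" "d < D0"
    and adj: "is_adj (head i) l"
  shows "dial pt rc D0 d (head i) l (ord @ [head i]) (bks(d := b)) (dst(head i := d)) (par(head i := i))"
    "dial_measure D0 d l (ord @ [head i]) (bks(d := b)) < dial_measure D0 d [] ord bks"
proof -
  let ?y = "head i" and ?ord = "ord @ [head i]" and ?dst = "dst(head i := d)" and ?par = "par(head i := i)"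
  note bk = dial_bucket[OF D b]
  have y: "?y \<in> nodes"
    using head_node(1)[OF bk(3)] .
  have y_new: "?y \<notin> set ord"
    using dial_facts(6)[OF D y] assms(3) by simp
  have old: "?dst z = dst z" if "z \<in> set ord" for z
    using that y_new by auto
  have "0 \<in> set ord"
    using nth_mem[OF dial_facts(2)[OF D]] dial_facts(3)[OF D] by simp
  then have y0: "?y \<noteq> 0"
    using y_new by metis
  have l: "distinct l" "\<And>k. k \<in> set l \<longleftrightarrow> k < M \<and> tail k = ?y"
    using adj unfolding is_adj_def by simp_all
  have par: "par_ok pt rc ?ord ?dst ?par"
    unfolding par_ok_def
  proof (intro allI impI)
    fix j
    assume j: "0 < j \<and> j < length ?ord"
    show "?par (?ord ! j) < M \<and> head (?par (?ord ! j)) = ?ord ! j \<and> 0 < rc (?par (?ord ! j)) \<and>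
       ?dst (?ord ! j) = ?dst (tail (?par (?ord ! j))) + slack pt (?par (?ord ! j)) \<and>
       tail (?par (?ord ! j)) \<in> set (take j ?ord)"
    proof (cases "j = length ord")
      case True
      then show ?thesis
        using bk(3-6) old[OF bk(5)] by simp
    next
      case False
      then have j': "j < length ord" "0 < j"
        using j by auto
      have "ord ! j \<in> set ord"
        using j'(1) by simp
      then have ne: "ord ! j \<noteq> ?y"
        using y_new by metis
      have p: "par (ord ! j) < M" "head (par (ord ! j)) = ord ! j" "0 < rc (par (ord ! j))"
        "dst (ord ! j) = dst (tail (par (ord ! j))) + slack pt (par (ord ! j))"
        "tail (par (ord ! j)) \<in> set (take j ord)"
        using dial_facts(9)[OF D] j' by (simp_all add: par_ok_def)
      have "tail (par (ord ! j)) \<in> set ord"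
        using p(5) by (rule in_set_takeD)
      then have "tail (par (ord ! j)) \<noteq> ?y"
        using y_new by metis
      then show ?thesis
        using p j' ne by (simp add: nth_append)
    qed
  qed
  show "dial pt rc D0 d ?y l ?ord (bks(d := b)) ?dst ?par"
  proof (rule dialI)
    fix k
    assume k: "k < M" "0 < rc k" "tail k \<in> set ?ord" "k \<notin> set l"
    then have tk: "tail k \<in> set ord"
      using l(2)[of k] by simp
    have le: "?dst (head k) \<le> dst (head k)"
      using assms(3,4) by simp
    show "relaxed pt ?dst (bks(d := b)) k"
    proof (cases "k = i")
      case True
      then show ?thesis
        unfolding relaxed_def old[OF tk] using bk(6) by simp
    next
      case False
      then have "relaxed pt dst (bks(d := b)) k"
        using dial_facts(10)[OF D k(1,2) tk] by (intro bk(9)) simp_all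
      then show ?thesis
        unfolding relaxed_def old[OF tk] using le by linarith
    qed
  next
    fix e k
    assume "k \<in> set ((bks(d := b)) e)"
    then have w: "waiting pt rc D0 d [] ord dst e k"
      using dial_facts(12)[OF D bk(7)] by blast
    then have "tail k \<in> set ord"
      by (simp add: waiting_def)
    then have "?dst (tail k) = dst (tail k)" "tail k \<noteq> ?y"
      using old y_new by metis+
    then show "waiting pt rc D0 d l ?ord ?dst e k"
      using w l(2)[of k] by (simp add: waiting_def)
  next
    fix z
    assume "z \<in> nodes"
    then show "?dst z \<le> D0" "?dst z < D0 \<longleftrightarrow> z \<in> set ?ord"
      using dial_facts(5)[OF D, of z] dial_facts(6)[OF D, of z] assms(4) by auto
  next
    fix z
    assume "z \<in> set ?ord"
    then show "?dst z \<le> d"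
      using dial_facts(8)[OF D, of z] by auto
  next
    show "?ord ! 0 = 0"
      using dial_facts(2,3)[OF D] by (simp add: nth_append)
  qed (use dial_facts(1,2,4,7)[OF D] par bk(8) l y y_new y0 in simp_all)
  have "set ?ord = insert ?y (set ord)"
    by simp
  then have "card {k. k < M \<and> tail k \<notin> set ord} = card {k. k < M \<and> tail k \<notin> set ?ord} + length l"
    using card_unvisited[OF adj y_new] by simp
  then show "dial_measure D0 d l ?ord (bks(d := b)) < dial_measure D0 d [] ord bks"
    using dial_pop_measure[of bks d i b D0] b assms(4) by (simp add: dial_measure_def del: fun_upd_apply)
qed

lemma dial_next:
  assumes D: "dial pt rc D0 d x [] ord bks dst par" and b: "bks d = []" and d: "d < D0"
  shows "dial pt rc D0 (Suc d) x [] ord bks dst par"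
    "dial_measure D0 (Suc d) [] ord bks < dial_measure D0 d [] ord bks"
proof -
  show "dial pt rc D0 (Suc d) x [] ord bks dst par"
  proof (rule dialI)
    fix e k
    assume k: "k \<in> set (bks e)"
    then have "waiting pt rc D0 d [] ord dst e k" "d \<noteq> e"
      using dial_facts(12)[OF D k] b by auto
    then show "waiting pt rc D0 (Suc d) [] ord dst e k"
      by (simp add: waiting_def)
  next
    fix z
    assume "z \<in> set ord"
    then show "dst z \<le> Suc d"
      using dial_facts(8)[OF D] by (simp add: le_SucI)
  qed (use dial_facts(1-7,9-11)[OF D] in simp_all)
  show "dial_measure D0 (Suc d) [] ord bks < dial_measure D0 d [] ord bks"
    using d by (simp add: dial_measure_def)
qed

text \<open>Every bucketed arc offers less than \<open>D0\<close> but at least \<open>d\<close>, so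
  the buckets are empty and ready for the next phase. The triangle inequality on residual arcs and
  the tightness of parent arcs are what the dual update rests on.\<close>

lemma dial_end:
  assumes D: "dial pt rc D0 d x pend ord bks dst par" and d: "\<not> d < D0"
  shows "bks = (\<lambda>_. [])"
    "\<And>i. i < M \<Longrightarrow> 0 < rc i \<Longrightarrow> dst (head i) \<le> dst (tail i) + slack pt i"
proof -
  have "k \<notin> set (bks e)" for k e
    using dial_facts(12)[OF D, of k e] d by (auto simp: waiting_def)
  then have "bks e = []" for e
    by (metis last_in_set)
  then show bks: "bks = (\<lambda>_. [])"
    by blast
  \<comment> \<open>Pending arcs would start at a node settled at distance \<open>d\<close>, but
    settled nodes are closer than \<open>D0\<close>.\<close>
  have pend: "pend = []"
  proof (rule ccontr)
    assume "pend \<noteq> []"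
    then have x: "x \<in> set ord" "dst x = d"
      using dial_facts(15,16)[OF D] by blast+
    then have "x \<in> nodes"
      using dial_facts(4)[OF D] by blast
    then have "d < D0"
      using dial_facts(6)[OF D, of x] x by simp
    then show False
      using d by simp
  qed
  fix i
  assume i: "i < M" "0 < rc i"
  show "dst (head i) \<le> dst (tail i) + slack pt i"
  proof (cases "tail i \<in> set ord")
    case True
    then have "relaxed pt dst bks i"
      using dial_facts(10)[OF D i True] pend by simp
    then show ?thesis
      by (simp add: relaxed_def bks)
  next
    case False
    then have "\<not> dst (tail i) < D0" "dst (head i) \<le> D0"
      using dial_facts(6)[OF D head_node(2)[OF i(1)]] dial_facts(5)[OF D head_node(1)[OF i(1)]] by simp_all
    then show ?thesis
      by simp
  qed
qed

text \<open>The usual update \<open>pt x - min (dst x) D\<close>, shifted by \<open>D\<close> to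
  stay in the natural numbers. With \<open>D\<close> the distance of the sink, the sink keeps its
  potential and the source rises by \<open>D\<close>, so \<open>l\<close> falls by
  \<open>D\<close>.\<close>

definition raised :: "nat \<Rightarrow> (nat \<Rightarrow> nat) \<Rightarrow> (nat \<Rightarrow> nat) \<Rightarrow> nat \<Rightarrow> nat" where
  "raised D dst pt x = pt x + (D - min (dst x) D)"

text \<open>Capping distances at \<open>D\<close> preserves the triangle inequality because reduced
  lengths are nonnegative.\<close>

lemma raised_feasible:
  assumes "feasible pt rc" "\<And>i. i < M \<Longrightarrow> 0 < rc i \<Longrightarrow> dst (head i) \<le> dst (tail i) + slack pt i"
    and pt': "\<And>x. x \<in> nodes \<Longrightarrow> pt' x = raised D dst pt x"
  shows "feasible pt' rc"
  unfolding feasible_def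
proof (intro allI impI)
  fix i
  assume i: "i < M" "0 < rc i"
  then have "pt (tail i) + cost i \<le> pt (head i) + cost (twin i)"
    "dst (head i) \<le> dst (tail i) + slack pt i"
    using assms(2) feasibleD[OF assms(1)] by auto
  then show "pt' (tail i) + cost i \<le> pt' (head i) + cost (twin i)"
    unfolding pt'[OF head_node(1)[OF i(1)]] pt'[OF head_node(2)[OF i(1)]] raised_def slack_def
    by linarith
qed

lemma raised_tight:
  assumes "feasible pt rc" "i < M" "0 < rc i" "dst (head i) = dst (tail i) + slack pt i" "dst (head i) \<le> D"
    and pt': "\<And>x. x \<in> nodes \<Longrightarrow> pt' x = raised D dst pt x"
  shows "pt' (tail i) + cost i = pt' (head i) + cost (twin i)"
proof -
  have "pt (tail i) + cost i \<le> pt (head i) + cost (twin i)"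
    using feasibleD[OF assms(1-3)] .
  then show ?thesis
    using assms(4,5)
    unfolding pt'[OF head_node(1)[OF assms(2)]] pt'[OF head_node(2)[OF assms(2)]] raised_def slack_def
    by linarith
qed

subsection \<open>Augmentation\<close>

text \<open>The walk goes from the sink back to the source; \<open>j\<close> is the position of its current node in \<open>ord\<close>.\<close>

definition augmenting where
  "augmenting N pt rc r ord par ok j y \<longleftrightarrow> j < length ord \<and> ord ! j = y \<and>
     capacities N rc \<and> feasible pt rc \<and>
     (\<forall>p. net_flow rc p = int r * (p 1 - p 0) + (p 1 - p y)) \<and>
     (\<forall>j'. 0 < j' \<and> j' \<le> j \<longrightarrow> 0 < rc (par (ord ! j'))) \<and> ok y"

text \<open>Parent arcs have distinct heads, so a push along one of them decreases no other, and the
  rest of the path stays residual. The position in \<open>ord\<close> falls, hence the walk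
  ends.\<close>

lemma augmenting_step:
  assumes aug: "augmenting N pt rc r ord par ok j y" and y: "y \<noteq> 0"
    and ord: "distinct ord" "ord ! 0 = 0"
    and par: "\<And>j. 0 < j \<Longrightarrow> j < length ord \<Longrightarrow> par (ord ! j) < M \<and> head (par (ord ! j)) = ord ! j \<and>
      tail (par (ord ! j)) \<in> set (take j ord)"
    and ok: "\<And>j. 0 < j \<Longrightarrow> j < length ord \<Longrightarrow> ok (ord ! j) \<Longrightarrow> ok (tail (par (ord ! j))) \<and>
      pt (tail (par (ord ! j))) + cost (par (ord ! j)) = pt (head (par (ord ! j))) + cost (twin (par (ord ! j)))"
  shows "par y < M" "0 < rc (par y)" "\<exists>j'<j. augmenting N pt (push (par y) rc) r ord par ok j' (tail (par y))"
proof -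
  have j: "j < length ord" "ord ! j = y" "0 < j"
    using aug y ord(2) by (auto simp: augmenting_def intro!: gr0I)
  show p: "par y < M" "0 < rc (par y)"
    using par[of j] aug j by (auto simp: augmenting_def)
  have "tail (par y) \<in> set (take j ord)" "head (par y) = y"
    using par[of j] j by auto
  then obtain j' where j': "j' < j" "ord ! j' = tail (par y)"
    using j(1) by (auto simp: in_set_conv_nth)
  have t: "ok (tail (par y))" "pt (tail (par y)) + cost (par y) = pt (head (par y)) + cost (twin (par y))"
    using ok[of j] aug j by (auto simp: augmenting_def)
  have "0 < push (par y) rc (par (ord ! m))" if m: "0 < m" "m \<le> j'" for m
  proof -
    have "head (par (ord ! m)) = ord ! m"
      using par[of m] m j' j by simp
    moreover have "m < length ord" "m \<noteq> j"
      using m j' j by simp_all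
    then have "ord ! m \<noteq> ord ! j"
      using nth_eq_iff_index_eq[OF ord(1)] j(1) by blast
    ultimately have "par (ord ! m) \<noteq> par y"
      using \<open>head (par y) = y\<close> j by auto
    moreover have "0 < rc (par (ord ! m))"
      using aug m j' by (simp add: augmenting_def)
    ultimately show ?thesis
      by (simp add: push_def)
  qed
  moreover have "net_flow (push (par y) rc) q = int r * (q 1 - q 0) + (q 1 - q (tail (par y)))" for q
    using aug push_net_flow[of "par y" rc, OF p] \<open>head (par y) = y\<close> by (simp add: augmenting_def)
  moreover have "capacities N (push (par y) rc)" "feasible pt (push (par y) rc)"
    using push_capacities[of N rc "par y", OF _ p] push_feasible[OF _ p(1) t(2)] aug by (auto simp: augmenting_def)
  ultimately show "\<exists>j'<j. augmenting N pt (push (par y) rc) r ord par ok j' (tail (par y))"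
    using j' j t(1) by (intro exI[of _ j']) (auto simp: augmenting_def)
qed

subsection \<open>Decomposition into chains\<close>

text \<open>\<open>rc (Suc i)\<close> is the flow still to be walked: \<open>j\<close> walks are
  complete, and the current one has led from the source to \<open>x\<close>. \<open>rest\<close>
  keeps the arcs not yet found empty, and \<open>pl\<close> is the path of the graph under the
  current walk. A unit of the original flow \<open>rc0\<close> on a unit arc is either still there
  or has become a label.\<close>

definition walking where
  "walking rc0 r rc j x rest lab pl \<longleftrightarrow>
     j \<le> r \<and> (j = r \<longrightarrow> x = 0) \<and> x \<in> nodes \<and>
     (\<forall>p. net_flow rc p = int (r - j) * (p 1 - p 0) - (p x - p 0)) \<and>
     (\<forall>y. distinct (rest y)) \<and> (\<forall>y. \<forall>i\<in>set (rest y). i < M \<and> tail i = y) \<and>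
     (\<forall>i\<in>fwd. 0 < rc (Suc i) \<longrightarrow> i \<in> set (rest (head (Suc i)))) \<and>
     (\<forall>i\<in>fwd. cost i = 1 \<longrightarrow> rc (Suc i) + (if 0 < lab (arc_vertex i) then 1 else 0) = rc0 (Suc i)) \<and>
     (\<forall>v<n. lab v \<le> (if j = r then r else Suc j)) \<and>
     (\<forall>i\<in>{1..j}. dag_chain {..<n} E (label_class n lab i)) \<and>
     label_class n lab (Suc j) \<subseteq> set pl \<and> dpath {..<n} E pl \<and>
     (x = 0 \<longrightarrow> pl = []) \<and>
     (x \<noteq> 0 \<longrightarrow> x \<noteq> 1 \<longrightarrow> pl \<noteq> [] \<and> (x = 2 * last pl + 2 \<or> x = 2 * last pl + 3))"

lemma walkingD:
  assumes "walking rc0 r rc j x rest lab pl"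
  shows "j \<le> r" "j = r \<longrightarrow> x = 0" "x \<in> nodes"
     "\<forall>p. net_flow rc p = int (r - j) * (p 1 - p 0) - (p x - p 0)"
     "\<forall>y. distinct (rest y)" "\<forall>y. \<forall>i\<in>set (rest y). i < M \<and> tail i = y"
     "\<forall>i\<in>fwd. 0 < rc (Suc i) \<longrightarrow> i \<in> set (rest (head (Suc i)))"
     "\<forall>i\<in>fwd. cost i = 1 \<longrightarrow> rc (Suc i) + (if 0 < lab (arc_vertex i) then 1 else 0) = rc0 (Suc i)"
     "\<forall>v<n. lab v \<le> (if j = r then r else Suc j)"
     "\<forall>i\<in>{1..j}. dag_chain {..<n} E (label_class n lab i)"
     "label_class n lab (Suc j) \<subseteq> set pl" "dpath {..<n} E pl" "x = 0 \<longrightarrow> pl = []"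
     "x \<noteq> 0 \<longrightarrow> x \<noteq> 1 \<longrightarrow> pl \<noteq> [] \<and> (x = 2 * last pl + 2 \<or> x = 2 * last pl + 3)"
  using assms[unfolded walking_def] by - (elim conjE, assumption)+

lemmas walking_facts = walkingD[rule_format]

lemma walkingI:
  assumes "j \<le> r" "j = r \<Longrightarrow> x = 0" "x \<in> nodes"
     "\<And>p. net_flow rc p = int (r - j) * (p 1 - p 0) - (p x - p 0)"
     "\<And>y. distinct (rest y)" "\<And>y i. i \<in> set (rest y) \<Longrightarrow> i < M" "\<And>y i. i \<in> set (rest y) \<Longrightarrow> tail i = y"
     "\<And>i. i \<in> fwd \<Longrightarrow> 0 < rc (Suc i) \<Longrightarrow> i \<in> set (rest (head (Suc i)))"
     "\<And>i. i \<in> fwd \<Longrightarrow> cost i = 1 \<Longrightarrow> rc (Suc i) + (if 0 < lab (arc_vertex i) then 1 else 0) = rc0 (Suc i)"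
     "\<And>v. v < n \<Longrightarrow> lab v \<le> (if j = r then r else Suc j)"
     "\<And>i. i \<in> {1..j} \<Longrightarrow> dag_chain {..<n} E (label_class n lab i)"
     "label_class n lab (Suc j) \<subseteq> set pl" "dpath {..<n} E pl" "x = 0 \<Longrightarrow> pl = []"
     "x \<noteq> 0 \<Longrightarrow> x \<noteq> 1 \<Longrightarrow> pl \<noteq> []" "x \<noteq> 0 \<Longrightarrow> x \<noteq> 1 \<Longrightarrow> x = 2 * last pl + 2 \<or> x = 2 * last pl + 3"
   shows "walking rc0 r rc j x rest lab pl"
  unfolding walking_def by (intro conjI allI ballI impI) (rule assms; assumption)+

text \<open>Ranks rise along a walk, so each walk takes a number of moves linear in
  \<open>W\<close>; the last term pays for discarding arcs, which happens at most once per arc over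
  all walks.\<close>

definition walking_measure :: "(nat \<Rightarrow> nat) \<Rightarrow> nat \<Rightarrow> nat \<Rightarrow> nat \<Rightarrow> nat \<Rightarrow> (nat \<Rightarrow> nat list) \<Rightarrow> nat" where
  "walking_measure rho W r j x rest = (r - j) * (W + 2) + (W + 1 - rho x) + card {i. i < M \<and> i \<in> set (rest (tail i))}"

lemma walking_start:
  assumes "\<And>p. net_flow rc p = int r * (p 1 - p 0)" "\<And>y. is_adj y (rest y)" "\<And>v. v < n \<Longrightarrow> lab v = 0"
  shows "walking rc r rc 0 0 rest lab []"
proof (rule walkingI)
  fix i
  assume "i \<in> fwd" "cost i = 1"
  then show "rc (Suc i) + (if 0 < lab (arc_vertex i) then 1 else 0) = rc (Suc i)"
    using assms(3) arc_vertex by simp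
next
  show "label_class n lab (Suc 0) \<subseteq> set []"
    using assms(3) by (auto simp: label_class_def)
next
  fix i
  assume "i \<in> fwd"
  then show "i \<in> set (rest (head (Suc i)))"
    using assms(2)[of "head (Suc i)"] fwd_less by (simp add: is_adj_def)
qed (use assms is_adj_def in \<open>auto simp: nodes_def dpath_def\<close>)

lemma walking_next_path:
  assumes W: "walking rc0 r rc j 1 rest lab pl" and rho: "\<And>x. rho x \<le> W"
  shows "walking rc0 r rc (Suc j) 0 rest lab []"
    "walking_measure rho W r (Suc j) 0 rest < walking_measure rho W r j 1 rest"
proof -
  have "j \<noteq> r"
    using walking_facts(2)[OF W] by auto
  then have j: "j < r"
    using walking_facts(1)[OF W] by simp
  have chain: "dag_chain {..<n} E (label_class n lab (Suc j))"
    by (rule dag_chain_subsetI[OF walking_facts(12)[OF W] walking_facts(11)[OF W]])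
  have lab: "lab v \<le> Suc j" if "v < n" for v
    using walking_facts(9)[OF W that] j by simp
  show "walking rc0 r rc (Suc j) 0 rest lab []"
  proof (rule walkingI)
    show "label_class n lab (Suc (Suc j)) \<subseteq> set []"
      using lab by (fastforce simp: label_class_def)
  next
    fix p :: "nat \<Rightarrow> int"
    have "int (r - j) = int (r - Suc j) + 1"
      using j by simp
    then show "net_flow rc p = int (r - Suc j) * (p 1 - p 0) - (p 0 - p 0)"
      using walking_facts(4)[OF W, of p] by (simp add: algebra_simps)
  next
    fix v
    assume "v < n"
    then show "lab v \<le> (if Suc j = r then r else Suc (Suc j))"
      using lab[of v] j by simp
  next
    fix i
    assume "i \<in> {1..Suc j}"
    then show "dag_chain {..<n} E (label_class n lab i)"
      using walking_facts(10)[OF W, of i] chain by (cases "i = Suc j") simp_all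
  qed (use j walking_facts(5-8)[OF W] in \<open>simp_all add: nodes_def dpath_def\<close>)
  have "r - j = Suc (r - Suc j)"
    using j by simp
  then have "(r - j) * (W + 2) = (r - Suc j) * (W + 2) + (W + 2)"
    by simp
  then show "walking_measure rho W r (Suc j) 0 rest < walking_measure rho W r j 1 rest"
    unfolding walking_measure_def by linarith
qed

text \<open>Away from the sink the remaining flow has a net outflow at \<open>x\<close>, so an arc
  with flow leaves it.\<close>

lemma walking_rest:
  assumes W: "walking rc0 r rc j x rest lab pl" and "j < r" "x \<noteq> 1"
  shows "rest x \<noteq> []"
proof -
  let ?p = "\<lambda>y. if y = x then 1 else 0 :: int"
  have "net_flow rc ?p = int (r - j) * (?p 1 - ?p 0) - (?p x - ?p 0)"
    by (rule walking_facts(4)[OF W])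
  then have "net_flow rc ?p < 0"
    using assms(2,3) by (cases "x = 0") auto
  then obtain i where "i \<in> fwd" "head (Suc i) = x" "0 < rc (Suc i)"
    using out_arc_with_flow by blast
  then have "i \<in> set (rest x)"
    using walking_facts(7)[OF W, of i] by simp
  then show ?thesis
    by auto
qed

text \<open>Flow only decreases during the walks, so an arc found empty stays empty.\<close>

lemma walking_skip:
  assumes W: "walking rc0 r rc j x rest lab pl" and l: "rest x = i # l"
    and no_flow: "odd i \<or> rc (Suc i) = 0"
  shows "walking rc0 r rc j x (rest(x := l)) lab pl"
    "walking_measure rho W r j x (rest(x := l)) < walking_measure rho W r j x rest"
proof -
  let ?rest = "rest(x := l)"
  have il: "i \<notin> set l" "i < M" "tail i = x"
    using walking_facts(5)[OF W, of x] walking_facts(6)[OF W, of i x] l by simp_all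
  have sub: "k \<in> set (rest y)" if "k \<in> set (?rest y)" for k y
    using that l by (cases "y = x") simp_all
  show "walking rc0 r rc j x ?rest lab pl"
  proof (rule walkingI)
    fix y
    show "distinct (?rest y)"
      using walking_facts(5)[OF W, of y] l by (cases "y = x") simp_all
  next
    fix k
    assume k: "k \<in> fwd" "0 < rc (Suc k)"
    then have "k \<in> set (rest (head (Suc k)))" "k \<noteq> i"
      using walking_facts(7)[OF W k] no_flow fwd_less(3)[OF k(1)] by auto
    then show "k \<in> set (?rest (head (Suc k)))"
      using l by (cases "head (Suc k) = x") simp_all
  next
    fix k y
    assume "k \<in> set (?rest y)"
    then show "k < M" "tail k = y"
      using walking_facts(6)[OF W sub] by simp_all
  qed (use walking_facts(1-4,8-14)[OF W] in simp_all)
  have "{k. k < M \<and> k \<in> set (?rest (tail k))} \<subseteq> {k. k < M \<and> k \<in> set (rest (tail k))}"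
    using sub by blast
  moreover have "i \<in> {k. k < M \<and> k \<in> set (rest (tail k))}" "i \<notin> {k. k < M \<and> k \<in> set (?rest (tail k))}"
    using l il by simp_all
  ultimately have "{k. k < M \<and> k \<in> set (?rest (tail k))} \<subset> {k. k < M \<and> k \<in> set (rest (tail k))}"
    by blast
  then have "card {k. k < M \<and> k \<in> set (?rest (tail k))} < card {k. k < M \<and> k \<in> set (rest (tail k))}"
    by (intro psubset_card_mono) simp
  then show "walking_measure rho W r j x ?rest < walking_measure rho W r j x rest"
    by (simp add: walking_measure_def del: fun_upd_apply)
qed

text \<open>Walks may share vertices through the free arcs. Only the unit arc labels its vertex, and
  its capacity ensures that this happens once, so the chains are disjoint although the paths need
  not be.\<close>

lemma walking_take:
  assumes W: "walking rc0 r rc j x rest lab pl" and l: "rest x = i # l" and j: "j < r"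
    and i: "even i" "0 < rc (Suc i)"
    and lab': "lab' = (if cost i = 1 then lab(arc_vertex i := Suc j) else lab)"
    and cap: "cost i = 1 \<Longrightarrow> rc0 (Suc i) \<le> 1"
  shows "\<exists>pl'. walking rc0 r (rc(Suc i := rc (Suc i) - 1)) j (head i) rest lab' pl'"
    "ranking rho \<Longrightarrow> (\<And>x. rho x \<le> W) \<Longrightarrow> walking_measure rho W r j (head i) rest < walking_measure rho W r j x rest"
    "i \<in> fwd" "head (Suc i) = x"
proof -
  let ?rc = "rc(Suc i := rc (Suc i) - 1)"
  have iM: "i < M" "tail i = x"
    using walking_facts(6)[OF W, of i x] l by simp_all
  then show i_fwd: "i \<in> fwd" and tail: "head (Suc i) = x"
    using i by (simp_all add: fwd_def twin_def)
  have lab_zero: "lab (arc_vertex i) = 0" "rc (Suc i) = 1" if "cost i = 1"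
    using walking_facts(8)[OF W i_fwd that] cap[OF that] i(2) by (auto split: if_splits)
  have flow: "net_flow ?rc p = int (r - j) * (p 1 - p 0) - (p (head i) - p 0)" for p
  proof -
    let ?g = "\<lambda>rc k. int (rc (Suc k)) * (p (head k) - p (head (Suc k)))"
    have "sum (?g ?rc) (fwd - {i}) = sum (?g rc) (fwd - {i})"
      by (intro sum.cong) auto
    then have "net_flow ?rc p = net_flow rc p + (?g ?rc i - ?g rc i)"
      unfolding net_flow_def by (simp only: sum.remove[OF finite_fwd i_fwd] algebra_simps)
    also have "?g ?rc i - ?g rc i = p x - p (head i)"
      using i(2) tail by (simp add: of_nat_diff algebra_simps)
    finally show ?thesis
      using walking_facts(4)[OF W, of p] by linarith
  qed
  have units: "?rc (Suc k) + (if 0 < lab' (arc_vertex k) then 1 else 0) = rc0 (Suc k)"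
    if k: "k \<in> fwd" "cost k = 1" for k
  proof (cases "k = i")
    case True
    then show ?thesis
      using walking_facts(8)[OF W k] k lab_zero by (simp add: lab')
  next
    case False
    then have "arc_vertex k \<noteq> arc_vertex i" if "cost i = 1"
      using inj_on_arc_vertex that k i_fwd unfolding inj_on_def by blast
    then have "lab' (arc_vertex k) = lab (arc_vertex k)"
      by (simp add: lab')
    then show ?thesis
      using walking_facts(8)[OF W k] False by simp
  qed
  have classes: "label_class n lab' m = label_class n lab m" if "m \<in> {1..j}" for m
    using that lab_zero by (auto simp: lab' label_class_def)
  have cls: "label_class n lab' (Suc j) \<subseteq> insert (arc_vertex i) (label_class n lab (Suc j))" if "cost i = 1"
    using that by (auto simp: lab' label_class_def)
  note cur = walking_facts(11)[OF W] walking_facts(12)[OF W] walking_facts(13)[OF W] walking_facts(14)[OF W]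
  have last: "pl \<noteq> [] \<and> last pl = v" if "x = 2 * v + 2 \<or> x = 2 * v + 3" for v
  proof -
    have "x \<noteq> 0" "x \<noteq> 1"
      using that by auto
    from cur(4)[OF this] have "pl \<noteq> []" "last pl = (x - 2) div 2"
      by auto
    moreover have "v = (x - 2) div 2"
      using that by auto
    ultimately show ?thesis
      by simp
  qed
  have "\<exists>pl'. label_class n lab' (Suc j) \<subseteq> set pl' \<and> dpath {..<n} E pl' \<and>
     (head i = 0 \<longrightarrow> pl' = []) \<and>
     (head i \<noteq> 0 \<and> head i \<noteq> 1 \<longrightarrow> pl' \<noteq> [] \<and> (head i = 2 * last pl' + 2 \<or> head i = 2 * last pl' + 3))"
    using i_fwd
  proof (cases rule: arc_cases)
    case (source v)
    then have "pl = []" "lab' = lab"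
      using cur(3) tail by (simp_all add: lab')
    then show ?thesis
      using source cur(1) Field_less[of v] by (intro exI[of _ "[v]"]) (auto simp: dpath_def)
  next
    case (unit v)
    then have pl: "pl \<noteq> []" "last pl = v"
      using last[of v] tail by simp_all
    have "arc_vertex i = v"
      using unit by (simp add: arc_vertex_def)
    then have "arc_vertex i \<in> set pl"
      using pl last_in_set[of pl] by simp
    then have "label_class n lab' (Suc j) \<subseteq> set pl"
      using cur(1) by (intro order_trans[OF cls[OF unit(4)]]) simp
    then show ?thesis
      using unit cur(2) pl by (intro exI[of _ pl]) simp
  next
    case (free v)
    then have "pl \<noteq> []" "last pl = v" "lab' = lab"
      using last[of v] tail by (simp_all add: lab')
    then show ?thesis
      using free cur(1,2) by (intro exI[of _ pl]) simp
  next
    case (sink v)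
    then have "lab' = lab"
      by (simp add: lab')
    then show ?thesis
      using cur(1,2) sink by (intro exI[of _ pl]) simp
  next
    case (edge u v)
    then have "pl \<noteq> []" "last pl = u" "lab' = lab"
      using last[of u] tail by (simp_all add: lab')
    note pl = this
    have "v < n"
      using edge(1) E(1) by auto
    then have "dpath {..<n} E (pl @ [v])"
      using cur(2) edge(1) pl(1,2) by (simp add: dpath_def successively_append_iff)
    moreover have "label_class n lab' (Suc j) \<subseteq> set (pl @ [v])"
      using cur(1) pl(3) by (simp add: subset_insertI2)
    ultimately show ?thesis
      using edge by (intro exI[of _ "pl @ [v]"]) simp
  qed
  then obtain pl' where pl': "label_class n lab' (Suc j) \<subseteq> set pl'" "dpath {..<n} E pl'"
    "head i = 0 \<longrightarrow> pl' = []"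
    "head i \<noteq> 0 \<and> head i \<noteq> 1 \<longrightarrow> pl' \<noteq> [] \<and> (head i = 2 * last pl' + 2 \<or> head i = 2 * last pl' + 3)"
    by (elim exE conjE)
  have "walking rc0 r ?rc j (head i) rest lab' pl'"
  proof (rule walkingI)
    fix k
    assume k: "k \<in> fwd" "0 < ?rc (Suc k)"
    then have "0 < rc (Suc k)"
      using i(2) by (cases "k = i") simp_all
    then show "k \<in> set (rest (head (Suc k)))"
      using walking_facts(7)[OF W k(1)] by blast
  next
    fix m
    assume "m \<in> {1..j}"
    then show "dag_chain {..<n} E (label_class n lab' m)"
      using classes walking_facts(10)[OF W] by simp
  next
    fix v
    assume "v < n"
    then show "lab' v \<le> (if j = r then r else Suc j)"
      using walking_facts(9)[OF W, of v] j by (auto simp: lab')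
  next
    fix k y
    assume "k \<in> set (rest y)"
    then show "k < M" "tail k = y"
      using walking_facts(6)[OF W] by simp_all
  qed (use j flow units pl' head_node(1)[OF iM(1)] walking_facts(5)[OF W] in \<open>simp_all del: fun_upd_apply\<close>)
  then show "\<exists>pl'. walking rc0 r ?rc j (head i) rest lab' pl'"
    by blast
  assume "ranking rho" "\<And>x. rho x \<le> W"
  then have "rho x < rho (head i)" "rho (head i) \<le> W"
    using rankingD[of rho i] i_fwd tail by simp_all
  then show "walking_measure rho W r j (head i) rest < walking_measure rho W r j x rest"
    by (simp add: walking_measure_def)
qed

text \<open>What remains is a flow of value 0, which vanishes by acyclicity; so all flow on unit
  arcs has been turned into labels.\<close>

lemma walking_end:
  assumes W: "walking rc0 r rc r x rest lab pl"
  shows "\<And>v. v < n \<Longrightarrow> lab v \<le> r" "\<And>i. i \<in> {1..r} \<Longrightarrow> dag_chain {..<n} E (label_class n lab i)"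
    "\<And>i. i \<in> fwd \<Longrightarrow> cost i = 1 \<Longrightarrow> 0 < rc0 (Suc i) \<Longrightarrow> 0 < lab (arc_vertex i)"
proof -
  show "\<And>v. v < n \<Longrightarrow> lab v \<le> r" "\<And>i. i \<in> {1..r} \<Longrightarrow> dag_chain {..<n} E (label_class n lab i)"
    using walking_facts(9,10)[OF W] by simp_all
  fix i
  assume i: "i \<in> fwd" "cost i = 1" "0 < rc0 (Suc i)"
  obtain rho where rho: "ranking rho"
    using ranking_exists by blast
  have "net_flow rc (\<lambda>x. int (rho x)) = 0"
    using walking_facts(4)[OF W, of "\<lambda>x. int (rho x)"] walking_facts(2)[OF W] by simp
  then have "rc (Suc i) = 0"
    using flow_zero rho i(1) by blast
  then show "0 < lab (arc_vertex i)"
    using walking_facts(8)[OF W i(1,2)] i(3) by (simp split: if_splits)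
qed

end

section \<open>The program\<close>

abbreviation (input) plus_exp (infixl "+." 65) where "a +. b \<equiv> Bin Plus a b"
abbreviation (input) minus_exp (infixl "-." 65) where "a -. b \<equiv> Bin Minus a b"
abbreviation (input) times_exp (infixl "*." 70) where "a *. b \<equiv> Bin Times a b"

abbreviation (input) "vn \<equiv> 24 :: nat"
abbreviation (input) "vm \<equiv> 2 :: nat"
abbreviation (input) "vk \<equiv> 3 :: nat"
abbreviation (input) "vK \<equiv> 4 :: nat"
abbreviation (input) "vR \<equiv> 5 :: nat"
abbreviation (input) "vN \<equiv> 6 :: nat"
abbreviation (input) "vM \<equiv> 7 :: nat"
abbreviation (input) "vv \<equiv> 8 :: nat"
abbreviation (input) "vx \<equiv> 9 :: nat"
abbreviation (input) "vy \<equiv> 10 :: nat"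
abbreviation (input) "vi \<equiv> 11 :: nat"
abbreviation (input) "vcur \<equiv> 12 :: nat"
abbreviation (input) "vh \<equiv> 13 :: nat"
abbreviation (input) "vq \<equiv> 14 :: nat"
abbreviation (input) "vl \<equiv> 15 :: nat"
abbreviation (input) "vD0 \<equiv> 16 :: nat"
abbreviation (input) "vd \<equiv> 17 :: nat"
abbreviation (input) "ve \<equiv> 18 :: nat"
abbreviation (input) "vD \<equiv> 19 :: nat"
abbreviation (input) "vr \<equiv> 20 :: nat"
abbreviation (input) "vj \<equiv> 21 :: nat"
abbreviation (input) "vc \<equiv> 22 :: nat"
abbreviation (input) "vlim \<equiv> 23 :: nat"

abbreviation (input) "aIO \<equiv> 0 :: nat"
abbreviation (input) "aFirst \<equiv> 14 :: nat"
abbreviation (input) "aNext \<equiv> 2 :: nat"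
abbreviation (input) "aHead \<equiv> 3 :: nat"
abbreviation (input) "aCost \<equiv> 4 :: nat"
abbreviation (input) "aRes \<equiv> 5 :: nat"
abbreviation (input) "aPot \<equiv> 6 :: nat"
abbreviation (input) "aDist \<equiv> 7 :: nat"
abbreviation (input) "aPar \<equiv> 8 :: nat"
abbreviation (input) "aBucket \<equiv> 9 :: nat"
abbreviation (input) "aBnext \<equiv> 10 :: nat"
abbreviation (input) "aDeg \<equiv> 11 :: nat"
abbreviation (input) "aQueue \<equiv> 12 :: nat"
abbreviation (input) "aMark \<equiv> 13 :: nat"

definition incr :: "nat \<Rightarrow> com" where
  "incr x = Asg x (Var x +. Num 1)"

text \<open>\<open>K\<close> is the target of \<open>l\<close> and \<open>R\<close> the limit of
  \<open>r\<close>. When the number of antichains is prescribed, \<open>R = n + 1\<close> is out of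
  reach because \<open>r * l \<le> n\<close> and \<open>l \<ge> 1\<close>. The capacity
  \<open>N\<close> exceeds \<open>n * (2 * n + 2)\<close>, a bound on the flow on any arc.\<close>

definition init_code :: "bool \<Rightarrow> com" where
  "init_code antichain_bound =
     Asg vn (Rd aIO (Num 0)) ;; Asg vm (Rd aIO (Num 1)) ;; Asg vk (Rd aIO (Num 2)) ;;
     Asg vK (if antichain_bound then Var vk else Num 1) ;;
     Asg vR (if antichain_bound then Var vn +. Num 1 else Var vk) ;;
     Asg vN ((Var vn +. Num 1) *. (Num 2 *. Var vn +. Num 4))"

text \<open>Marks the vertices that are not isolated. Edge \<open>v\<close> occupies the input cells
  \<open>2 v + 3\<close> and \<open>2 v + 4\<close>, after the three parameters.\<close>

definition mark_code :: com where
  "mark_code =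
     Asg vv (Num 0) ;;
     While (Var vv) (Var vm) (
       Wr aMark (Rd aIO (Num 2 *. Var vv +. Num 3)) (Num 1) ;;
       Wr aMark (Rd aIO (Num 2 *. Var vv +. Num 4)) (Num 1) ;;
       incr vv)"

text \<open>The reversal \<open>M + 1\<close> has cost 0 and residual capacity 0 because these cells
  keep their initial value.\<close>

definition arc_code :: "exp \<Rightarrow> exp \<Rightarrow> exp \<Rightarrow> exp \<Rightarrow> com" where
  "arc_code x y c u =
     Asg vx x ;; Asg vy y ;;
     Wr aHead (Var vM) (Var vy) ;; Wr aHead (Var vM +. Num 1) (Var vx) ;;
     Wr aCost (Var vM) c ;; Wr aRes (Var vM) u ;;
     Wr aNext (Var vM) (Rd aFirst (Var vx)) ;; Wr aFirst (Var vx) (Var vM +. Num 1) ;;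
     Wr aNext (Var vM +. Num 1) (Rd aFirst (Var vy)) ;; Wr aFirst (Var vy) (Var vM +. Num 2) ;;
     Wr aDeg (Var vy) (Rd aDeg (Var vy) +. Num 1) ;;
     Asg vM (Var vM +. Num 2)"

definition vertex_code :: com where
  "vertex_code =
     arc_code (Num 0) (Num 2 *. Var vv +. Num 2) (Num 0) (Var vN) ;;
     arc_code (Num 2 *. Var vv +. Num 2) (Num 2 *. Var vv +. Num 3) (Num 1) (Num 1) ;;
     arc_code (Num 2 *. Var vv +. Num 2) (Num 2 *. Var vv +. Num 3) (Num 0) (Var vN) ;;
     arc_code (Num 2 *. Var vv +. Num 3) (Num 1) (Num 0) (Var vN)"

definition build_code :: com where
  "build_code =
     Asg vM (Num 0) ;; Asg vv (Num 0) ;;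
     While (Var vv) (Var vn) (
       Ite (Num 0) (Rd aMark (Var vv)) vertex_code Skip ;;
       incr vv) ;;
     Asg vv (Num 0) ;;
     While (Var vv) (Var vm) (
       arc_code (Num 2 *. Rd aIO (Num 2 *. Var vv +. Num 3) +. Num 3)
         (Num 2 *. Rd aIO (Num 2 *. Var vv +. Num 4) +. Num 2) (Num 0) (Var vN) ;;
       incr vv)"

text \<open>The read position never passes the write position, so the loop test says that a node is
  queued or an arc is pending. Lifting the sink to \<open>q + K\<close> afterwards only relaxes the
  constraints of the arcs entering it.\<close>

definition kahn_code :: com where
  "kahn_code =
     Wr aQueue (Num 0) (Num 0) ;; Asg vh (Num 0) ;; Asg vq (Num 1) ;; Asg vcur (Num 0) ;;
     While (Var vh) (Var vq +. Var vcur) (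
       Ite (Num 0) (Var vcur) (
         Asg vi (Var vcur -. Num 1) ;;
         Asg vcur (Rd aNext (Var vi)) ;;
         Ite (Bin Modulo (Var vi) (Num 2)) (Num 1) (
           Asg vy (Rd aHead (Var vi)) ;;
           Wr aDeg (Var vy) (Rd aDeg (Var vy) -. Num 1) ;;
           Ite (Rd aDeg (Var vy)) (Num 1) (
             Wr aQueue (Var vq) (Var vy) ;;
             Wr aPot (Var vy) (Var vq) ;;
             incr vq) Skip) Skip) (
         Asg vx (Rd aQueue (Var vh)) ;;
         incr vh ;;
         Asg vcur (Rd aFirst (Var vx)))) ;;
     Wr aPot (Num 1) (Var vq +. Var vK) ;; Asg vl (Var vq +. Var vK) ;; Asg vr (Num 0)"

definition twin_exp :: "exp \<Rightarrow> exp" where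
  "twin_exp e = Bin Xor e (Num 1)"

text \<open>Initialization runs over arc heads instead of all node numbers, because a phase must be
  linear in \<open>M\<close> even if most vertices are isolated.\<close>

definition dial_code :: com where
  "dial_code =
     Asg vD0 (Var vl -. Var vK) ;;
     Asg vi (Num 0) ;;
     While (Var vi) (Var vM) (Wr aDist (Rd aHead (Var vi)) (Var vD0) ;; incr vi) ;;
     Wr aDist (Num 1) (Var vD0) ;; Wr aDist (Num 0) (Num 0) ;;
     Asg vd (Num 0) ;; Asg vx (Num 0) ;; Asg vcur (Rd aFirst (Num 0)) ;;
     While (Var vd) (Var vD0) (
       Ite (Num 0) (Var vcur) (
         Asg vi (Var vcur -. Num 1) ;;
         Asg vcur (Rd aNext (Var vi)) ;;
         Ite (Num 0) (Rd aRes (Var vi)) (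
           Asg ve (Var vd +. ((Rd aPot (Rd aHead (Var vi)) +. Rd aCost (twin_exp (Var vi)))
             -. (Rd aPot (Var vx) +. Rd aCost (Var vi)))) ;;
           Ite (Var ve) (Var vD0) (
             Wr aBnext (Var vi) (Rd aBucket (Var ve)) ;;
             Wr aBucket (Var ve) (Var vi +. Num 1)) Skip) Skip) (
         Ite (Num 0) (Rd aBucket (Var vd)) (
           Asg vi (Rd aBucket (Var vd) -. Num 1) ;;
           Wr aBucket (Var vd) (Rd aBnext (Var vi)) ;;
           Asg vy (Rd aHead (Var vi)) ;;
           Ite (Rd aDist (Var vy)) (Var vD0) Skip (
             Wr aDist (Var vy) (Var vd) ;;
             Wr aPar (Var vy) (Var vi) ;;
             Asg vx (Var vy) ;;
             Asg vcur (Rd aFirst (Var vy)))) (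
           incr vd)))"

text \<open>A node is met once for every arc into it; setting its distance to \<open>D\<close> after
  the raise makes later visits harmless.\<close>

definition raise_code :: com where
  "raise_code =
     Asg vD (Rd aDist (Num 1)) ;;
     Wr aPot (Num 0) (Rd aPot (Num 0) +. Var vD) ;; Wr aDist (Num 0) (Var vD) ;;
     Asg vi (Num 0) ;;
     While (Var vi) (Var vM) (
       Asg vy (Rd aHead (Var vi)) ;;
       Ite (Rd aDist (Var vy)) (Var vD) (
         Wr aPot (Var vy) (Rd aPot (Var vy) +. (Var vD -. Rd aDist (Var vy))) ;;
         Wr aDist (Var vy) (Var vD)) Skip ;;
       incr vi) ;;
     Asg vl (Var vl -. Var vD)"

definition augment_code :: com where
  "augment_code =
     Asg vy (Num 1) ;;
     While (Num 0) (Var vy) (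
       Asg vi (Rd aPar (Var vy)) ;;
       Wr aRes (Var vi) (Rd aRes (Var vi) -. Num 1) ;;
       Wr aRes (twin_exp (Var vi)) (Rd aRes (twin_exp (Var vi)) +. Num 1) ;;
       Asg vy (Rd aHead (twin_exp (Var vi)))) ;;
     incr vr"

text \<open>The product is positive exactly if \<open>l > K\<close> and \<open>r < R\<close>. A
  phase in which the sink is not reached below \<open>D0\<close> only raises potentials.\<close>

definition flow_code :: com where
  "flow_code =
     While (Num 0) ((Var vl -. Var vK) *. (Var vR -. Var vr)) (
       dial_code ;; raise_code ;; Ite (Var vD) (Var vD0) augment_code Skip)"

text \<open>The only test is \<open><\<close>, so \<open>x = 1\<close> is written as
  \<open>x xor 1 < 1\<close>, and being an even arc with flow as positivity of a product.
  Overwriting the list heads discards arcs for good.\<close>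

definition chain_code :: com where
  "chain_code =
     Asg vv (Num 0) ;;
     While (Var vv) (Var vn) (Wr aIO (Var vv) (Num 0) ;; incr vv) ;;
     Asg vj (Num 0) ;; Asg vx (Num 0) ;;
     While (Var vj) (Var vr) (
       Ite (Bin Xor (Var vx) (Num 1)) (Num 1) (
         incr vj ;; Asg vx (Num 0)) (
         Asg vi (Rd aFirst (Var vx) -. Num 1) ;;
         Ite (Num 0) ((Num 1 -. Bin Modulo (Var vi) (Num 2)) *. Rd aRes (twin_exp (Var vi))) (
           Wr aRes (Var vi +. Num 1) (Rd aRes (Var vi +. Num 1) -. Num 1) ;;
           Ite (Num 0) (Rd aCost (Var vi)) (
             Wr aIO (Bin Divide (Var vx) (Num 2) -. Num 1) (Var vj +. Num 1)) Skip ;;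
           Asg vx (Rd aHead (Var vi))) (
           Wr aFirst (Var vx) (Rd aNext (Var vi)))))"

definition antichain_code :: com where
  "antichain_code =
     Asg vv (Num 0) ;;
     While (Var vv) (Var vn) (
       Ite (Num 0) (Rd aMark (Var vv)) (
         Ite (Rd aPot (Num 2 *. Var vv +. Num 2)) (Rd aPot (Num 2 *. Var vv +. Num 3)) (
           Wr aIO (Var vv) (Rd aPot (Num 2 *. Var vv +. Num 3) -. Rd aPot (Num 0))) (
           Wr aIO (Var vv) (Num 0))) (
         Wr aIO (Var vv) (Num 1)) ;;
       incr vv)"

definition fill_code :: com where
  "fill_code =
     Asg vv (Num 0) ;;
     While (Var vv) (Var vn) (
       Ite (Num 0) (Rd aIO (Var vv)) Skip (
         Ite (Var vc) (Var vlim) (incr vc ;; Wr aIO (Var vv) (Var vc)) Skip) ;;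
       incr vv)"

definition main_code :: "bool \<Rightarrow> com" where
  "main_code antichain_bound =
     init_code antichain_bound ;; mark_code ;; build_code ;; kahn_code ;; flow_code ;; chain_code"

definition MCP_code :: com where
  "MCP_code = main_code True ;; Asg vc (Var vr) ;; Asg vlim (Var vr +. Var vn) ;; fill_code"

definition MA_code :: com where
  "MA_code = main_code True ;; antichain_code ;; Asg vc (Var vl) ;; Asg vlim (Var vk) ;; fill_code"

definition MAP_code :: com where
  "MAP_code = main_code False ;; antichain_code ;; Asg vc (Var vl) ;; Asg vlim (Var vl +. Var vn) ;; fill_code"

definition MC_code :: com where
  "MC_code = main_code False ;; Asg vc (Var vr) ;; Asg vlim (Var vk) ;; fill_code"

context bounds
begin

lemma big_While_tick: "big c (s\<lparr>tm := Suc (tm s)\<rparr>) s' \<Longrightarrow> tm s < tm s'"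
  using tm_mono by fastforce

text \<open>Every round advances the clock, so an upper bound on the clock doubles as a termination
  measure.\<close>

lemma wp_While_tm:
  assumes inv: "I s"
    and time: "\<And>s. I s \<Longrightarrow> tm s \<le> T"
    and cond: "\<And>s. I s \<Longrightarrow> safe s e1 \<and> safe s e2"
    and body: "\<And>s. I s \<Longrightarrow> ev s e1 < ev s e2 \<Longrightarrow> wp c I (s\<lparr>tm := Suc (tm s)\<rparr>)"
    and final: "\<And>s. I s \<Longrightarrow> \<not> ev s e1 < ev s e2 \<Longrightarrow> Q (s\<lparr>tm := Suc (tm s)\<rparr>)"
  shows "wp (While e1 e2 c) Q s"
proof (rule wp_While[where I = I and \<mu> = "\<lambda>s. T - tm s"])
  fix s
  assume s: "I s" "ev s e1 < ev s e2"
  then obtain s' where "big c (s\<lparr>tm := Suc (tm s)\<rparr>) s'" "I s'"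
    using body by (auto simp: wp_def)
  moreover from this have "T - tm s' < T - tm s"
    using big_While_tick time[of s'] by fastforce
  ultimately show "wp c (\<lambda>s'. I s' \<and> T - tm s' < T - tm s) (s\<lparr>tm := Suc (tm s)\<rparr>)"
    by (auto simp: wp_def)
qed (use inv cond final in auto)

end

section \<open>Building the network in memory\<close>

definition vertex_arcs :: "nat \<Rightarrow> (nat \<times> nat \<times> nat) list" where
  "vertex_arcs v = [(0, 2 * v + 2, 0), (2 * v + 2, 2 * v + 3, 1), (2 * v + 2, 2 * v + 3, 0), (2 * v + 3, 1, 0)]"

definition edge_arc :: "nat \<times> nat \<Rightarrow> nat \<times> nat \<times> nat" where
  "edge_arc = (\<lambda>(u, v). (2 * u + 3, 2 * v + 2, 0))"

text \<open>\<open>L\<close> is quadratic because the capacity \<open>N\<close> and the product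
  tested by the main loop are.\<close>

locale input = bounds L bs for L bs :: nat +
  fixes n k :: nat and es :: "(nat \<times> nat) list" and antichain_bound :: bool
  assumes dag: "dag_input n es k"
    and bs: "bs = 2 * length es + n + 3"
    and L: "L = 64 * ((n + length es + k + 2) * (n + length es + k + 2))"
begin

definition "K = (if antichain_bound then k else 1)"
definition "Rm = (if antichain_bound then n + 1 else k)"
definition "N = (n + 1) * (2 * n + 4)"
definition "io = (\<lambda>i. if i < length (encode n es k) then encode n es k ! i else 0)"

lemma L_large: "100 * n + 100 * length es + 100 * k + 200 < L"
proof -
  define S where "S = n + length es + k + 2"
  have "2 * S \<le> S * S"
    unfolding S_def by (intro mult_right_mono) simp_all
  moreover have "L = 64 * (S * S)"
    by (simp only: L S_def)
  ultimately have "128 * S \<le> L"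
    by linarith
  then have "128 * n + 128 * length es + 128 * k + 256 \<le> L"
    by (simp add: S_def)
  moreover have "100 * x \<le> 128 * x" for x :: nat
    by simp
  ultimately show ?thesis
    using add_le_mono[OF add_le_mono, of "100 * n" "128 * n" "100 * length es" "128 * length es" "100 * k" "128 * k"]
    by fastforce
qed

lemma L_pos: "0 < L"
  using L_large by linarith

lemma product_less_L:
  assumes "x \<le> 2 * (n + length es + k + 2)" "y \<le> 2 * (n + length es + k + 2)"
  shows "x * y < L"
proof -
  define S where "S = n + length es + k + 2"
  have "x * y \<le> (2 * S) * (2 * S)"
    using assms unfolding S_def by (rule mult_mono) simp_all
  moreover have "0 < S * S"
    by (simp add: S_def)
  moreover have "L = 64 * (S * S)"
    by (simp only: L S_def)
  moreover have "(2 * S) * (2 * S) = 4 * (S * S)"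
    by simp
  ultimately show ?thesis
    by linarith
qed

lemma bs_bounds: "2 * length es + n + 3 \<le> bs" "n \<le> bs"
  by (simp_all add: bs)

lemma N_less_L: "N < L"
  unfolding N_def by (rule product_less_L) simp_all

lemma k_pos: "0 < k"
  using dag by (simp add: dag_input_def)

lemma K_bounds: "1 \<le> K" "K \<le> k"
  using k_pos by (simp_all add: K_def)

lemma Rm_bounds: "1 \<le> Rm" "Rm \<le> n + k + 1"
  using k_pos by (simp_all add: Rm_def)

lemma es_bounds: "j < length es \<Longrightarrow> fst (es ! j) < n" "j < length es \<Longrightarrow> snd (es ! j) < n"
proof -
  assume "j < length es"
  then have "es ! j \<in> {..<n} \<times> {..<n}"
    using dag unfolding dag_input_def by (meson nth_mem subsetD)
  then show "fst (es ! j) < n" "snd (es ! j) < n"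
    by auto
qed

lemma concat_pairs_nth: "j < length xs \<Longrightarrow>
    concat (map (\<lambda>(u, v). [u, v]) xs) ! (2 * j) = fst (xs ! j) \<and>
    concat (map (\<lambda>(u, v). [u, v]) xs) ! (2 * j + 1) = snd (xs ! j)"
proof (induction xs arbitrary: j)
  case (Cons x xs)
  then show ?case
    by (cases j) (auto simp: split_beta)
qed simp

lemma io_params: "io 0 = n" "io (Suc 0) = length es" "io 2 = k"
  by (simp_all add: io_def encode_def)

lemma io_edge: "j < length es \<Longrightarrow> io (2 * j + 3) = fst (es ! j)" "j < length es \<Longrightarrow> io (2 * j + 4) = snd (es ! j)"
proof -
  assume j: "j < length es"
  have len: "length (concat (map (\<lambda>(u, v). [u, v]) es)) = 2 * length es"
    using length_encode[of n es k] by (simp add: encode_def)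
  have "2 * j + 4 = Suc (Suc (Suc (2 * j + 1)))" "2 * j + 3 = Suc (Suc (Suc (2 * j)))"
    by simp_all
  then show "io (2 * j + 3) = fst (es ! j)" "io (2 * j + 4) = snd (es ! j)"
    using j len concat_pairs_nth[OF j] by (simp_all add: io_def encode_def)
qed

definition base :: "st \<Rightarrow> bool" where
  "base s \<longleftrightarrow> var s 24 = n \<and> var s 2 = length es \<and> var s 3 = k \<and> var s 4 = K \<and> var s 5 = Rm \<and> var s 6 = N"

lemma init_correct:
  "wp (init_code antichain_bound) (\<lambda>s. base s \<and> arr s = (\<lambda>a. if a = 0 then io else (\<lambda>_. 0)) \<and> tm s = 6)
     (init_st (encode n es k))"
proof -
  have "arr (init_st (encode n es k)) = (\<lambda>a. if a = 0 then io else (\<lambda>_. 0))"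
    by (auto simp: init_st_def io_def fun_eq_iff)
  moreover have "tm (init_st (encode n es k)) = 0"
    by (simp add: init_st_def)
  ultimately show ?thesis
    using L_large N_less_L[unfolded N_def] bs_bounds
    by (simp add: init_code_def base_def index_ok_def io_params K_def Rm_def N_def)
qed

definition marks :: "nat \<Rightarrow> nat" where
  "marks v = (if v \<in> Field (set es) then 1 else 0)"

lemma mark_correct:
  assumes "base s" "arr s = (\<lambda>a. if a = 0 then io else (\<lambda>_. 0))"
  shows "wp mark_code (\<lambda>s'. base s' \<and> arr s' = (\<lambda>a. if a = 0 then io else if a = 13 then marks else (\<lambda>_. 0)) \<and>
    tm s' \<le> tm s + 4 * length es + 2) s"
proof -
  define marked where "marked j = (\<lambda>v. if v \<in> Field (set (take j es)) then 1 else (0::nat))" for j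
  define I where "I s' \<longleftrightarrow> base s' \<and> var s' 8 \<le> length es \<and>
      arr s' 0 = io \<and> arr s' 13 = marked (var s' 8) \<and> (\<forall>a. a \<noteq> 0 \<and> a \<noteq> 13 \<longrightarrow> arr s' a = (\<lambda>_. 0)) \<and>
      tm s' + 4 * (length es - var s' 8) \<le> tm s + 4 * length es + 1" for s'
  show ?thesis
    unfolding mark_code_def wp_Seq wp_Asg
  proof (rule conjI, simp add: L_pos, rule wp_While_tm[where I = I and T = "tm s + 4 * length es + 1"])
    have "marked 0 = (\<lambda>_. 0)"
      by (simp add: marked_def)
    then show "I (s\<lparr>var := (var s)(8 := ev s (Num 0)), tm := Suc (tm s)\<rparr>)"
      using assms by (simp add: I_def base_def)
  next
    fix s'
    assume I: "I s'" and c: "ev s' (Var 8) < ev s' (Var 2)"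
    define j where "j = var s' 8"
    have j: "j < length es"
      using I c by (simp add: I_def base_def j_def)
    obtain u v where uv: "es ! j = (u, v)"
      by (cases "es ! j")
    have "Field (set (take (Suc j) es)) = insert u (insert v (Field (set (take j es))))"
      using j uv by (simp add: take_Suc_conv_app_nth Field_insert Un_commute)
    then have mark_Suc: "marked (Suc j) = (marked j)(u := 1, v := 1)"
      by (auto simp: marked_def fun_eq_iff)
    have io_uv: "io (2 * j + 3) = u" "io (2 * j + 4) = v" "u < n" "v < n"
      using io_edge[OF j] es_bounds[OF j] uv by simp_all
    have sj: "var s' 8 = j"
      by (simp add: j_def)
    have diff: "length es - j = Suc (length es - Suc j)"
      using j by simp
    show "wp (Wr 13 (Rd 0 (Num 2 *. Var 8 +. Num 3)) (Num 1) ;; Wr 13 (Rd 0 (Num 2 *. Var 8 +. Num 4)) (Num 1) ;; incr 8)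
       I (s'\<lparr>tm := Suc (tm s')\<rparr>)"
      using I j io_uv L_large bs_bounds diff unfolding I_def sj
      by (simp add: incr_def index_ok_def base_def mark_Suc sj)
  next
    fix s'
    assume I: "I s'" and "\<not> ev s' (Var 8) < ev s' (Var 2)"
    then have "var s' 8 = length es"
      by (simp add: I_def base_def)
    then have "arr s' 13 = marks"
      using I by (simp add: I_def marked_def marks_def fun_eq_iff)
    then show "base (s'\<lparr>tm := Suc (tm s')\<rparr>) \<and> arr (s'\<lparr>tm := Suc (tm s')\<rparr>) =
       (\<lambda>a. if a = 0 then io else if a = 13 then marks else (\<lambda>_. 0)) \<and>
       tm (s'\<lparr>tm := Suc (tm s')\<rparr>) \<le> tm s + 4 * length es + 2"
      using I by (simp add: I_def base_def fun_eq_iff)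
  qed (use L_large in \<open>simp_all add: I_def\<close>)
qed

definition built where
  "built as hf cs rc dg nx fs \<longleftrightarrow>
     (\<forall>a<length as. as ! a = (hf (Suc (2 * a)), hf (2 * a), cs (2 * a))) \<and>
     (\<forall>a<length as. rc (2 * a) = (if cs (2 * a) = 1 then 1 else N)) \<and>
     (\<forall>i. odd i \<longrightarrow> cs i = 0 \<and> rc i = 0) \<and>
     (\<forall>y. dg y = card {a. a < length as \<and> hf (2 * a) = y}) \<and>
     (\<forall>x. \<exists>l. llist nx (fs x) l \<and> distinct l \<and> set l = {i. i < 2 * length as \<and> hf (twin i) = x})"

lemma built_Nil: "built [] hf (\<lambda>_. 0) (\<lambda>_. 0) (\<lambda>_. 0) nx (\<lambda>_. 0)"
  by (simp add: built_def llist_0)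

lemma twin_less_even: "i < 2 * a \<Longrightarrow> twin i < 2 * a"
  unfolding twin_def by presburger

lemma built_snoc:
  assumes b: "built as hf cs rc dg nx fs" and M: "M = 2 * length as" and "x \<noteq> y"
    and u: "u = (if c = 1 then 1 else N)"
  shows "built (as @ [(x, y, c)]) (hf(M := y, Suc M := x)) (cs(M := c)) (rc(M := u)) (dg(y := Suc (dg y)))
    (nx(M := fs x, Suc M := fs y)) (fs(x := Suc M, y := Suc (Suc M)))"
proof -
  let ?hf = "hf(M := y, Suc M := x)" and ?nx = "nx(M := fs x, Suc M := fs y)"
    and ?fs = "fs(x := Suc M, y := Suc (Suc M))"
  have old: "?hf i = hf i" if "i < M" for i
    using that by simp
  have less: "2 * a < M" "Suc (2 * a) < M" if "a < length as" for a
    using that M by simp_all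
  have 1: "(as @ [(x, y, c)]) ! a = (?hf (Suc (2 * a)), ?hf (2 * a), (cs(M := c)) (2 * a))"
    if "a < Suc (length as)" for a
  proof (cases "a = length as")
    case True
    then show ?thesis
      using M by simp
  next
    case False
    then have a: "a < length as"
      using that by simp
    then show ?thesis
      using b less[OF a] by (simp add: built_def nth_append)
  qed
  have 2: "(rc(M := u)) (2 * a) = (if (cs(M := c)) (2 * a) = 1 then 1 else N)" if "a < Suc (length as)" for a
  proof (cases "a = length as")
    case True
    then show ?thesis
      using M u by simp
  next
    case False
    then have a: "a < length as"
      using that by simp
    then show ?thesis
      using b less[OF a] by (simp add: built_def)
  qed
  have 3: "(cs(M := c)) i = 0 \<and> (rc(M := u)) i = 0" if "odd i" for i
    using b that M by (auto simp: built_def)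
  have 4: "(dg(y := Suc (dg y))) z = card {a. a < Suc (length as) \<and> ?hf (2 * a) = z}" for z
  proof -
    have "{a. a < Suc (length as) \<and> ?hf (2 * a) = z}
        = {a. a < length as \<and> hf (2 * a) = z} \<union> (if y = z then {length as} else {})"
      using M less by (auto simp: less_Suc_eq split: if_splits)
    then show ?thesis
      using b by (auto simp: built_def)
  qed
  have 5: "\<exists>l. llist ?nx (?fs z) l \<and> distinct l \<and> set l = {i. i < 2 * Suc (length as) \<and> ?hf (twin i) = z}" for z
  proof -
    obtain l where l: "llist nx (fs z) l" "distinct l" "set l = {i. i < M \<and> hf (twin i) = z}"
      using b M unfolding built_def by metis
    have upd: "llist ?nx p l = llist nx p l" for p
      using l(3) by (subst llist_upd, simp)+ simp
    have twin_M: "twin M = Suc M" "twin (Suc M) = M"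
      using M by (simp_all add: twin_def)
    have eq: "{i. i < 2 * Suc (length as) \<and> ?hf (twin i) = z}
        = {i. i < M \<and> hf (twin i) = z} \<union> (if x = z then {M} else {}) \<union> (if y = z then {Suc M} else {})"
    proof (rule set_eqI)
      fix i
      consider "i < M" | "i = M" | "i = Suc M" | "Suc M < i"
        by linarith
      then show "i \<in> {i. i < 2 * Suc (length as) \<and> ?hf (twin i) = z} \<longleftrightarrow>
          i \<in> {i. i < M \<and> hf (twin i) = z} \<union> (if x = z then {M} else {}) \<union> (if y = z then {Suc M} else {})"
      proof cases
        case 1
        then have "twin i < M"
          using twin_less_even M by simp
        then show ?thesis
          using 1 M by simp
      qed (use M twin_M in simp_all)
    qed
    consider "z = x" | "z = y" | "z \<noteq> x" "z \<noteq> y"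
      by blast
    then show ?thesis
    proof cases
      case 1
      then have "llist ?nx (?fs z) (M # l)"
        using assms(3) l(1) upd by simp
      then show ?thesis
        using l 1 assms(3) unfolding eq by (intro exI[of _ "M # l"]) auto
    next
      case 2
      then have "llist ?nx (?fs z) (Suc M # l)"
        using assms(3) l(1) upd by simp
      then show ?thesis
        using l 2 assms(3) unfolding eq by (intro exI[of _ "Suc M # l"]) auto
    next
      case 3
      then show ?thesis
        using l upd unfolding eq by (intro exI[of _ l]) auto
    qed
  qed
  show ?thesis
    unfolding built_def using 1 2 3 4 5 by (simp only: length_append_singleton) blast
qed

text \<open>\<open>arc_code\<close> evaluates its arguments between its own writes. Stable
  expressions depend only on the loop index, the capacity and the input, none of which it
  changes.\<close>

definition stable :: "st \<Rightarrow> exp \<Rightarrow> nat \<Rightarrow> bool" where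
  "stable s e x \<longleftrightarrow> (\<forall>s'. var s' 8 = var s 8 \<longrightarrow> var s' 6 = var s 6 \<longrightarrow> arr s' 0 = arr s 0 \<longrightarrow> safe s' e \<and> ev s' e = x)"

lemma stableD: "stable s e x \<Longrightarrow> var s' 8 = var s 8 \<Longrightarrow> var s' 6 = var s 6 \<Longrightarrow> arr s' 0 = arr s 0 \<Longrightarrow>
    safe s' e \<and> ev s' e = x"
  by (simp add: stable_def)

abbreviation built_st :: "(nat \<times> nat \<times> nat) list \<Rightarrow> st \<Rightarrow> bool" where
  "built_st as s \<equiv> var s 7 = 2 * length as \<and> built as (arr s 3) (arr s 4) (arr s 5) (arr s 11) (arr s 2) (arr s 14)"

definition arc_frame :: "st \<Rightarrow> st \<Rightarrow> bool" where
  "arc_frame s s' \<longleftrightarrow> (\<forall>a. a \<notin> {2, 3, 4, 5, 11, 14} \<longrightarrow> arr s' a = arr s a) \<and> (\<forall>x. x \<notin> {7, 9, 10} \<longrightarrow> var s' x = var s x)"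

lemma arc_correct:
  assumes st: "stable s ex x" "stable s ey y" "stable s ec c" "stable s eu u"
    and b: "built_st as s" and "x \<noteq> y" "u = (if c = 1 then 1 else N)" "x < L" "y < L" "c < L"
    and len: "length as \<le> 4 * n + length es"
  shows "wp (arc_code ex ey ec eu) (\<lambda>s'. built_st (as @ [(x, y, c)]) s' \<and> arc_frame s s' \<and> tm s' = tm s + 12) s"
proof -
  have M: "var s 7 = 2 * length as"
    using b by simp
  have "arr s 11 y = card {a. a < length as \<and> arr s 3 (2 * a) = y}"
    using b by (simp add: built_def)
  also have "\<dots> \<le> card {..<length as}"
    by (intro card_mono) auto
  finally have deg: "arr s 11 y \<le> length as"
    by simp
  have "built (as @ [(x, y, c)]) ((arr s 3)(var s 7 := y, Suc (var s 7) := x)) ((arr s 4)(var s 7 := c))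
      ((arr s 5)(var s 7 := u)) ((arr s 11)(y := Suc (arr s 11 y)))
      ((arr s 2)(var s 7 := arr s 14 x, Suc (var s 7) := arr s 14 y))
      ((arr s 14)(x := Suc (var s 7), y := Suc (Suc (var s 7))))"
    using b assms(6,7) by (intro built_snoc) simp_all
  then show ?thesis
    using assms(6,8-11) M deg L_large
    by (simp add: arc_code_def index_ok_def stableD[OF st(1)] stableD[OF st(2)] stableD[OF st(3)] stableD[OF st(4)]
        arc_frame_def)
qed

definition vertex_part :: "nat \<Rightarrow> (nat \<times> nat \<times> nat) list" where
  "vertex_part j = concat (map vertex_arcs (filter (\<lambda>v. v \<in> Field (set es)) [0..<j]))"

definition all_arcs :: "(nat \<times> nat \<times> nat) list" where
  "all_arcs = vertex_part n @ map edge_arc es"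

lemma vertex_part_0: "vertex_part 0 = []"
  by (simp add: vertex_part_def)

lemma vertex_part_Suc:
  "vertex_part (Suc j) = vertex_part j @ (if j \<in> Field (set es) then vertex_arcs j else [])"
  by (simp add: vertex_part_def)

lemma length_vertex_part: "length (vertex_part j) \<le> 4 * j"
  by (induction j) (simp_all add: vertex_part_0 vertex_part_Suc vertex_arcs_def)

lemma Field_bound: "v \<in> Field (set es) \<Longrightarrow> v < n"
  using dag by (auto simp: dag_input_def Field_def)

lemma length_vertex_part_Field: "length (vertex_part j) = 4 * card (Field (set es) \<inter> {..<j})"
proof (induction j)
  case (Suc j)
  have "Field (set es) \<inter> {..<Suc j} = (if j \<in> Field (set es) then insert j (Field (set es) \<inter> {..<j})
      else Field (set es) \<inter> {..<j})"
    by (auto simp: lessThan_Suc)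
  then show ?case
    using Suc by (simp add: vertex_part_Suc vertex_arcs_def)
qed (simp add: vertex_part_0)

lemma card_Field: "card (Field (set es)) \<le> 2 * length es"
proof -
  have "Field (set es) = set (map fst es) \<union> set (map snd es)"
    by (auto simp: Field_def Domain_fst Range_snd)
  then have "card (Field (set es)) \<le> card (set (map fst es)) + card (set (map snd es))"
    by (simp add: card_Un_le)
  also have "\<dots> \<le> length es + length es"
    using card_length[of "map fst es"] card_length[of "map snd es"] by simp
  finally show ?thesis
    by simp
qed

text \<open>The bound with \<open>n\<close> limits addresses and values, the other one limits time:
  at most two vertices per edge are not isolated, and each has four arcs.\<close>

lemma length_all_arcs: "length all_arcs \<le> 4 * n + length es" "length all_arcs \<le> 9 * length es"
proof -
  show "length all_arcs \<le> 4 * n + length es"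
    using length_vertex_part[of n] by (simp add: all_arcs_def)
  have "card (Field (set es) \<inter> {..<n}) \<le> card (Field (set es))"
    by (intro card_mono) (simp_all add: finite_Field)
  then show "length all_arcs \<le> 9 * length es"
    using length_vertex_part_Field[of n] card_Field by (simp add: all_arcs_def)
qed

lemma set_vertex_part: "set (vertex_part j) = (\<Union>v\<in>Field (set es) \<inter> {..<j}. set (vertex_arcs v))"
  by (auto simp: vertex_part_def)

lemma set_all_arcs: "set all_arcs = arc_spec (set es)"
proof -
  have "Field (set es) \<inter> {..<n} = Field (set es)"
    using Field_bound by auto
  then show ?thesis
    unfolding all_arcs_def set_append set_vertex_part arc_spec_def
    by (simp add: vertex_arcs_def edge_arc_def)
qed

text \<open>The vertex of a vertex arc can be read off its triple, so different vertices contribute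
  different arcs. Edge arcs are told apart by leaving an odd node without entering the sink.\<close>

lemma distinct_all_arcs: "distinct all_arcs"
proof -
  define key :: "nat \<times> nat \<times> nat \<Rightarrow> nat" where
    "key = (\<lambda>(x, y, c). if x = 0 then y div 2 - 1 else x div 2 - 1)"
  have key: "key t = v" if "t \<in> set (vertex_arcs v)" for t v
    using that by (auto simp: vertex_arcs_def key_def)
  have "distinct (vertex_part j)" for j
  proof (induction j)
    case (Suc j)
    have "key t < j" if t: "t \<in> set (vertex_part j)" for t
    proof -
      obtain v where "v < j" "t \<in> set (vertex_arcs v)"
        using t by (auto simp: set_vertex_part)
      then show ?thesis
        using key[of t v] by simp
    qed
    then have "set (vertex_part j) \<inter> set (vertex_arcs j) = {}"
      using key by fastforce
    moreover have "distinct (vertex_arcs j)"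
      by (simp add: vertex_arcs_def)
    ultimately show ?case
      using Suc by (simp add: vertex_part_Suc)
  qed (simp add: vertex_part_0)
  moreover have "distinct (map edge_arc es)"
    using dag by (auto simp: dag_input_def distinct_map edge_arc_def inj_on_def)
  moreover have "set (vertex_part n) \<inter> set (map edge_arc es) = {}"
  proof -
    have "odd x \<longrightarrow> y = 1" if "(x, y, c) \<in> set (vertex_part n)" for x y c
      using that by (auto simp: set_vertex_part vertex_arcs_def)
    moreover have "odd x \<and> y \<noteq> 1" if "(x, y, c) \<in> set (map edge_arc es)" for x y c
      using that by (auto simp: edge_arc_def)
    ultimately show ?thesis
      by fast
  qed
  ultimately show ?thesis
    by (simp add: all_arcs_def)
qed

lemma stable_Num: "c < L \<Longrightarrow> stable s (Num c) c"
  by (simp add: stable_def)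

lemma stable_N: "base s \<Longrightarrow> stable s (Var 6) N"
  by (simp add: stable_def base_def)

lemma stable_vertex: "var s 8 = v \<Longrightarrow> v < n \<Longrightarrow> c \<le> 3 \<Longrightarrow> stable s (Num 2 *. Var 8 +. Num c) (2 * v + c)"
  using L_large by (simp add: stable_def)

lemma stable_edge:
  assumes "var s 8 = j" "j < length es" "arr s 0 = io" "c \<le> 3"
  shows "stable s (Num 2 *. Rd aIO (Num 2 *. Var 8 +. Num 3) +. Num c) (2 * fst (es ! j) + c)"
    "stable s (Num 2 *. Rd aIO (Num 2 *. Var 8 +. Num 4) +. Num c) (2 * snd (es ! j) + c)"
  using assms L_large bs_bounds io_edge[OF assms(2)] es_bounds[OF assms(2)]
  by (simp_all add: stable_def index_ok_def)

lemma arc_frame_base: "arc_frame s s' \<Longrightarrow> base s \<Longrightarrow> base s'"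
  by (simp add: arc_frame_def base_def)

lemma arc_frame_simps: "arc_frame s s' \<Longrightarrow> var s' 8 = var s 8" "arc_frame s s' \<Longrightarrow> arr s' 0 = arr s 0"
    "arc_frame s s' \<Longrightarrow> arr s' 13 = arr s 13" "arc_frame s s' \<Longrightarrow> arr s' 6 = arr s 6"
    "arc_frame s s' \<Longrightarrow> arr s' 9 = arr s 9"
  by (simp_all add: arc_frame_def)

lemma arc_frame_trans: "arc_frame s s' \<Longrightarrow> arc_frame s' s'' \<Longrightarrow> arc_frame s s''"
  by (simp add: arc_frame_def)

lemma vertex_correct:
  assumes "base s" "var s 8 = v" "v < n" "built_st as s" "length as \<le> 4 * v"
  shows "wp vertex_code (\<lambda>s'. built_st (as @ vertex_arcs v) s' \<and> arc_frame s s' \<and> tm s' = tm s + 48) s"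
proof -
  have b: "2 * v + 3 < L" "2 * v + 2 < L" "1 < L" "0 < L"
    using assms(3) L_large by linarith+
  \<comment> \<open>One invariant for all four arcs, indexed by those already added; 12 is the cost
    of one arc.\<close>
  define P where "P l s' \<longleftrightarrow> built_st (as @ l) s' \<and> arc_frame s s' \<and> tm s' = tm s + 12 * length l" for l s'
  have step: "wp (arc_code ex ey ec eu) (P (l @ [(x, y, c)])) s1"
    if "P l s1" "length l \<le> 3" "stable s1 ex x" "stable s1 ey y" "stable s1 ec c" "stable s1 eu u"
      "x \<noteq> y" "u = (if c = 1 then 1 else N)" "x < L" "y < L" "c < L" for ex ey ec eu x y c u l s1
  proof -
    have "length (as @ l) \<le> 4 * n + length es"
      using assms(3,5) that(2) by simp
    with that have "wp (arc_code ex ey ec eu) (\<lambda>s'. built_st ((as @ l) @ [(x, y, c)]) s' \<and> arc_frame s1 s' \<and> tm s' = tm s1 + 12) s1"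
      by (intro arc_correct) (simp_all add: P_def)
    then show ?thesis
      by (rule wp_conseq) (use that(1) arc_frame_trans[of s s1] in \<open>auto simp: P_def\<close>)
  qed
  have sv: "stable s1 (Num 2 *. Var 8 +. Num c) (2 * v + c)" if "P l s1" "c \<le> 3" for l s1 c
    using that assms(2,3) arc_frame_simps(1)[of s s1] by (intro stable_vertex) (simp_all add: P_def)
  have sN: "stable s1 (Var 6) N" if "P l s1" for l s1
    using that assms(1) arc_frame_base[of s s1] by (intro stable_N) (simp add: P_def)
  have P0: "P [] s"
    using assms(4) by (simp add: P_def arc_frame_def)
  note st = stable_Num sv sN
  show ?thesis
    unfolding vertex_code_def wp_Seq
  proof (rule wp_conseq[OF step[OF P0 _ stable_Num sv[OF P0] stable_Num sN[OF P0]]])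
    fix s1
    assume P1: "P ([] @ [(0, 2 * v + 2, 0)]) s1"
    show "wp (arc_code (Num 2 *. Var 8 +. Num 2) (Num 2 *. Var 8 +. Num 3) (Num 1) (Num 1))
       (wp (arc_code (Num 2 *. Var 8 +. Num 2) (Num 2 *. Var 8 +. Num 3) (Num 0) (Var 6))
         (wp (arc_code (Num 2 *. Var 8 +. Num 3) (Num 1) (Num 0) (Var 6))
           (\<lambda>s'. built_st (as @ vertex_arcs v) s' \<and> arc_frame s s' \<and> tm s' = tm s + 48))) s1"
    proof (rule wp_conseq[OF step[OF P1 _ sv[OF P1] sv[OF P1] stable_Num stable_Num]])
      fix s2
      assume P2: "P (([] @ [(0, 2 * v + 2, 0)]) @ [(2 * v + 2, 2 * v + 3, 1)]) s2"
      show "wp (arc_code (Num 2 *. Var 8 +. Num 2) (Num 2 *. Var 8 +. Num 3) (Num 0) (Var 6))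
         (wp (arc_code (Num 2 *. Var 8 +. Num 3) (Num 1) (Num 0) (Var 6))
           (\<lambda>s'. built_st (as @ vertex_arcs v) s' \<and> arc_frame s s' \<and> tm s' = tm s + 48)) s2"
      proof (rule wp_conseq[OF step[OF P2 _ sv[OF P2] sv[OF P2] stable_Num sN[OF P2]]])
        fix s3
        assume P3: "P ((([] @ [(0, 2 * v + 2, 0)]) @ [(2 * v + 2, 2 * v + 3, 1)]) @ [(2 * v + 2, 2 * v + 3, 0)]) s3"
        show "wp (arc_code (Num 2 *. Var 8 +. Num 3) (Num 1) (Num 0) (Var 6))
           (\<lambda>s'. built_st (as @ vertex_arcs v) s' \<and> arc_frame s s' \<and> tm s' = tm s + 48) s3"
          by (rule wp_conseq[OF step[OF P3 _ sv[OF P3] stable_Num stable_Num sN[OF P3]]])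
            (use b in \<open>simp_all add: P_def vertex_arcs_def\<close>)
      qed (use b in simp_all)
    qed (use b in simp_all)
  qed (use b in simp_all)
qed

definition edge_part :: "nat \<Rightarrow> (nat \<times> nat \<times> nat) list" where
  "edge_part j = vertex_part n @ map edge_arc (take j es)"

lemma build_correct:
  assumes "base s" "arr s = (\<lambda>a. if a = 0 then io else if a = 13 then marks else (\<lambda>_. 0))"
  shows "wp build_code (\<lambda>s'. base s' \<and> built_st all_arcs s' \<and> arr s' 0 = io \<and> arr s' 13 = marks \<and>
    arr s' 6 = (\<lambda>_. 0) \<and> arr s' 9 = (\<lambda>_. 0) \<and> tm s' \<le> tm s + 52 * n + 14 * length es + 5) s"
proof -
  define rest where "rest s' \<longleftrightarrow> base s' \<and> arr s' 0 = io \<and> arr s' 13 = marks \<and> arr s' 6 = (\<lambda>_. 0) \<and> arr s' 9 = (\<lambda>_. 0)" for s'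
  have rest_frame: "rest s''" if "arc_frame s' s''" "rest s'" for s' s''
    using that arc_frame_base arc_frame_simps by (simp add: rest_def)
  have rest_upd: "rest (s'\<lparr>tm := t\<rparr>) \<longleftrightarrow> rest s'" "rest (s'\<lparr>var := (var s')(8 := x)\<rparr>) \<longleftrightarrow> rest s'"
    "rest (s'\<lparr>var := (var s')(8 := x), tm := t\<rparr>) \<longleftrightarrow> rest s'" for s' t x
    by (simp_all add: rest_def base_def)
  define I where "I s' \<longleftrightarrow> rest s' \<and> var s' 8 \<le> n \<and> built_st (vertex_part (var s' 8)) s' \<and>
      tm s' + 52 * (n - var s' 8) \<le> tm s + 52 * n + 2" for s'
  define J where "J s' \<longleftrightarrow> rest s' \<and> var s' 8 \<le> length es \<and> built_st (edge_part (var s' 8)) s' \<and>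
      tm s' + 14 * (length es - var s' 8) \<le> tm s + 52 * n + 14 * length es + 4" for s'
  have n: "var s' 24 = n" "var s' 2 = length es" if "rest s'" for s'
    using that by (simp_all add: rest_def base_def)
  have loop2: "wp (While (Var 8) (Var 2)
       (arc_code (Num 2 *. Rd 0 (Num 2 *. Var 8 +. Num 3) +. Num 3)
         (Num 2 *. Rd 0 (Num 2 *. Var 8 +. Num 4) +. Num 2) (Num 0) (Var 6) ;; incr 8))
     (\<lambda>s'. base s' \<and> built_st all_arcs s' \<and> arr s' 0 = io \<and> arr s' 13 = marks \<and>
        arr s' 6 = (\<lambda>_. 0) \<and> arr s' 9 = (\<lambda>_. 0) \<and> tm s' \<le> tm s + 52 * n + 14 * length es + 5) s1"
    if "J s1" for s1
  proof (rule wp_While_tm[where I = J and T = "tm s + 52 * n + 14 * length es + 4"])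
    fix s'
    assume J: "J s'" and "ev s' (Var 8) < ev s' (Var 2)"
    define j where "j = var s' 8"
    have j: "var s' 8 = j" "j < length es"
      using J \<open>ev s' (Var 8) < ev s' (Var 2)\<close> n by (simp_all add: J_def j_def)
    let ?s = "s'\<lparr>tm := Suc (tm s')\<rparr>"
    obtain u v where uv: "es ! j = (u, v)" "u < n" "v < n"
      using es_bounds[OF j(2)] by (cases "es ! j") simp
    have io: "arr ?s 0 = io" "var ?s 8 = j" "base ?s" "built_st (edge_part j) ?s"
      using J j by (simp_all add: J_def rest_def base_def)
    have len: "length (edge_part j) \<le> 4 * n + length es"
      using length_vertex_part[of n] j(2) by (simp add: edge_part_def)
    have snoc: "edge_part (Suc j) = edge_part j @ [(2 * u + 3, 2 * v + 2, 0)]"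
      using j(2) uv(1) by (simp add: edge_part_def take_Suc_conv_app_nth edge_arc_def)
    have "wp (arc_code (Num 2 *. Rd 0 (Num 2 *. Var 8 +. Num 3) +. Num 3)
         (Num 2 *. Rd 0 (Num 2 *. Var 8 +. Num 4) +. Num 2) (Num 0) (Var 6))
         (\<lambda>s''. built_st (edge_part j @ [(2 * u + 3, 2 * v + 2, 0)]) s'' \<and> arc_frame ?s s'' \<and> tm s'' = tm ?s + 12) ?s"
    proof (rule arc_correct[OF _ _ stable_Num stable_N[OF io(3)] io(4)])
      show "stable ?s (Num 2 *. Rd 0 (Num 2 *. Var 8 +. Num 3) +. Num 3) (2 * u + 3)"
        using stable_edge(1)[OF io(2) j(2) io(1), of 3] uv(1) by simp
      show "stable ?s (Num 2 *. Rd 0 (Num 2 *. Var 8 +. Num 4) +. Num 2) (2 * v + 2)"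
        using stable_edge(2)[OF io(2) j(2) io(1), of 2] uv(1) by simp
      show "2 * u + 3 \<noteq> 2 * v + 2"
        by presburger
    qed (use L_large uv len in simp_all)
    then have "wp (arc_code (Num 2 *. Rd 0 (Num 2 *. Var 8 +. Num 3) +. Num 3)
         (Num 2 *. Rd 0 (Num 2 *. Var 8 +. Num 4) +. Num 2) (Num 0) (Var 6)) (wp (incr 8) J) ?s"
    proof (rule wp_conseq)
      fix s''
      assume s'': "built_st (edge_part j @ [(2 * u + 3, 2 * v + 2, 0)]) s'' \<and> arc_frame ?s s'' \<and> tm s'' = tm ?s + 12"
      then have r: "rest s''" "var s'' 8 = j"
        using rest_frame[of ?s s''] J io(2) arc_frame_simps(1)[of ?s s''] by (simp_all add: J_def rest_upd)
      have d: "length es - j = Suc (length es - Suc j)"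
        using j(2) by simp
      show "wp (incr 8) J s''"
        using J s'' r j L_large d by (simp add: incr_def J_def rest_upd snoc)
    qed
    then show "wp (arc_code (Num 2 *. Rd 0 (Num 2 *. Var 8 +. Num 3) +. Num 3)
         (Num 2 *. Rd 0 (Num 2 *. Var 8 +. Num 4) +. Num 2) (Num 0) (Var 6) ;; incr 8) J ?s"
      by simp
  next
    fix s'
    assume J: "J s'" and "\<not> ev s' (Var 8) < ev s' (Var 2)"
    then have "var s' 8 = length es"
      using n by (simp add: J_def)
    then show "base (s'\<lparr>tm := Suc (tm s')\<rparr>) \<and> built_st all_arcs (s'\<lparr>tm := Suc (tm s')\<rparr>) \<and>
        arr (s'\<lparr>tm := Suc (tm s')\<rparr>) 0 = io \<and> arr (s'\<lparr>tm := Suc (tm s')\<rparr>) 13 = marks \<and>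
        arr (s'\<lparr>tm := Suc (tm s')\<rparr>) 6 = (\<lambda>_. 0) \<and> arr (s'\<lparr>tm := Suc (tm s')\<rparr>) 9 = (\<lambda>_. 0) \<and>
        tm (s'\<lparr>tm := Suc (tm s')\<rparr>) \<le> tm s + 52 * n + 14 * length es + 5"
      using J by (simp add: J_def rest_def base_def edge_part_def all_arcs_def)
  qed (use that L_large in \<open>simp_all add: J_def\<close>)
  have loop1: "wp (While (Var 8) (Var 24) (Ite (Num 0) (Rd 13 (Var 8)) vertex_code Skip ;; incr 8))
     (\<lambda>s'. J (s'\<lparr>var := (var s')(8 := 0), tm := Suc (tm s')\<rparr>)) s1" if "I s1" for s1
  proof (rule wp_While_tm[where I = I and T = "tm s + 52 * n + 2"])
    fix s'
    assume I: "I s'" and "ev s' (Var 8) < ev s' (Var 24)"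
    define j where "j = var s' 8"
    have j: "var s' 8 = j" "j < n"
      using I \<open>ev s' (Var 8) < ev s' (Var 24)\<close> n by (simp_all add: I_def j_def)
    have d: "n - j = Suc (n - Suc j)"
      using j(2) by simp
    have idx: "index_ok 13 j" "0 < L"
      using j(2) L_large by (simp_all add: index_ok_def)
    have mk: "arr s' 13 j = marks j"
      using I by (simp add: I_def rest_def)
    let ?s = "s'\<lparr>tm := Suc (Suc (tm s'))\<rparr>"
    show "wp (Ite (Num 0) (Rd 13 (Var 8)) vertex_code Skip ;; incr 8) I (s'\<lparr>tm := Suc (tm s')\<rparr>)"
    proof (cases "j \<in> Field (set es)")
      case True
      have pre: "base ?s" "var ?s 8 = j" "built_st (vertex_part j) ?s"
        using I j by (simp_all add: I_def rest_def base_def)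
      have "wp vertex_code (wp (incr 8) I) ?s"
      proof (rule wp_conseq[OF vertex_correct[OF pre(1,2) j(2) pre(3) length_vertex_part]])
        fix s''
        assume s'': "built_st (vertex_part j @ vertex_arcs j) s'' \<and> arc_frame ?s s'' \<and> tm s'' = tm ?s + 48"
        then have r: "rest s''" "var s'' 8 = j"
          using rest_frame[of ?s s''] I pre(2) arc_frame_simps(1)[of ?s s''] by (simp_all add: I_def rest_upd)
        show "wp (incr 8) I s''"
          using I s'' r j L_large d True by (simp add: incr_def I_def rest_upd vertex_part_Suc)
      qed
      then show ?thesis
        using True idx mk j by (simp add: marks_def)
    next
      case False
      then show ?thesis
        using I j idx mk L_large d by (simp add: marks_def incr_def I_def rest_upd vertex_part_Suc)
    qed
  next
    fix s'
    assume I: "I s'" and "\<not> ev s' (Var 8) < ev s' (Var 24)"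
    then have "var s' 8 = n"
      using n by (simp add: I_def)
    then show "J ((s'\<lparr>tm := Suc (tm s')\<rparr>)\<lparr>var := (var (s'\<lparr>tm := Suc (tm s')\<rparr>))(8 := 0),
        tm := Suc (tm (s'\<lparr>tm := Suc (tm s')\<rparr>))\<rparr>)"
      using I by (simp add: J_def I_def rest_upd edge_part_def)
  qed (use that L_large in \<open>simp_all add: I_def\<close>)
  let ?s = "s\<lparr>var := (var s)(7 := 0, 8 := 0), tm := Suc (Suc (tm s))\<rparr>"
  have "I ?s"
    using assms by (simp add: I_def rest_def base_def vertex_part_0 built_Nil)
  from wp_conseq[OF loop1[OF this]]
  have "wp (While (Var 8) (Var 24) (Ite (Num 0) (Rd 13 (Var 8)) vertex_code Skip ;; incr 8))
     (wp (Asg 8 (Num 0) ;; While (Var 8) (Var 2)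
       (arc_code (Num 2 *. Rd 0 (Num 2 *. Var 8 +. Num 3) +. Num 3)
         (Num 2 *. Rd 0 (Num 2 *. Var 8 +. Num 4) +. Num 2) (Num 0) (Var 6) ;; incr 8))
     (\<lambda>s'. base s' \<and> built_st all_arcs s' \<and> arr s' 0 = io \<and> arr s' 13 = marks \<and>
        arr s' 6 = (\<lambda>_. 0) \<and> arr s' 9 = (\<lambda>_. 0) \<and> tm s' \<le> tm s + 52 * n + 14 * length es + 5)) ?s"
    using loop2 L_pos by (simp only: wp_Seq wp_Asg safe.simps ev.simps simp_thms)
  then show ?thesis
    unfolding build_code_def using L_pos by simp
qed

end

lemma (in input) network_built:
  assumes b: "built all_arcs hf cs rc dg nx fs"
  shows "network n (set es) (2 * length all_arcs) hf cs"
proof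
  have nth: "all_arcs ! a = (hf (Suc (2 * a)), hf (2 * a), cs (2 * a))" if "a < length all_arcs" for a
    using b that by (simp add: built_def)
  have odd0: "cs i = 0" if "odd i" for i
    using b that by (simp add: built_def)
  show "set es \<subseteq> {..<n} \<times> {..<n}" "acyclic (set es)"
    using dag by (simp_all add: dag_input_def)
  show "even (2 * length all_arcs)"
    by simp
  have "(\<lambda>i. (hf (Suc i), hf i, cs i)) ` {i. i < 2 * length all_arcs \<and> even i} = set all_arcs"
  proof (intro equalityI subsetI)
    fix t
    assume "t \<in> (\<lambda>i. (hf (Suc i), hf i, cs i)) ` {i. i < 2 * length all_arcs \<and> even i}"
    then obtain a where "a < length all_arcs" "t = (hf (Suc (2 * a)), hf (2 * a), cs (2 * a))"
      by (auto elim!: evenE)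
    then show "t \<in> set all_arcs"
      using nth nth_mem by metis
  next
    fix t
    assume "t \<in> set all_arcs"
    then obtain a where a: "a < length all_arcs" "t = all_arcs ! a"
      by (auto simp: in_set_conv_nth)
    then show "t \<in> (\<lambda>i. (hf (Suc i), hf i, cs i)) ` {i. i < 2 * length all_arcs \<and> even i}"
      using nth[of a] by (intro image_eqI[of _ _ "2 * a"]) simp_all
  qed
  then show "(\<lambda>i. (hf (Suc i), hf i, cs i)) ` {i. i < 2 * length all_arcs \<and> even i} = arc_spec (set es)"
    by (simp only: set_all_arcs)
  show "cs i = 0" if "odd i" for i
    using odd0 that .
  fix i j
  assume ij: "i < 2 * length all_arcs" "j < 2 * length all_arcs" "cs i = 1" "cs j = 1" "hf i = hf j"
  then have "even i" "even j"
    using odd0 by force+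
  then obtain a c where ac: "i = 2 * a" "j = 2 * c" "a < length all_arcs" "c < length all_arcs"
    using ij(1,2) by (auto elim!: evenE)
  \<comment> \<open>The head of an arc of cost 1 determines its vertex and hence its tail.\<close>
  have spec: "hf (2 * d) = 2 * ((hf (2 * d) - 3) div 2) + 3 \<and> hf (Suc (2 * d)) = 2 * ((hf (2 * d) - 3) div 2) + 2"
    if "d < length all_arcs" "cs (2 * d) = 1" for d
  proof -
    have "(hf (Suc (2 * d)), hf (2 * d), cs (2 * d)) \<in> arc_spec (set es)"
      using nth[OF that(1)] nth_mem[OF that(1)] set_all_arcs by simp
    then show ?thesis
      using that(2) by (auto simp: arc_spec_def)
  qed
  have "hf (Suc i) = hf (Suc j)"
    using spec[of a] spec[of c] ac ij by metis
  then have "all_arcs ! a = all_arcs ! c"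
    using nth[OF ac(3)] nth[OF ac(4)] ij ac by simp
  then show "i = j"
    using nth_eq_iff_index_eq[OF distinct_all_arcs ac(3,4)] ac by simp
qed

section \<open>Correctness of the topological sort\<close>

locale residual = input + network n "set es" M head cost for M :: nat and head cost :: "nat \<Rightarrow> nat" +
  fixes nx first :: "nat \<Rightarrow> nat" and adj :: "nat \<Rightarrow> nat list"
  assumes adj_list: "\<And>x. llist nx (first x) (adj x)"
    and adj: "\<And>x. is_adj x (adj x)"
    and M_bound: "M \<le> 8 * n + 2 * length es"
begin

definition static :: "st \<Rightarrow> bool" where
  "static s \<longleftrightarrow> base s \<and> var s 7 = M \<and> arr s 3 = head \<and> arr s 4 = cost \<and> arr s 2 = nx \<and> arr s 14 = first"

lemma llist_le: "llist nx' p l \<Longrightarrow> (\<And>i. i \<in> set l \<Longrightarrow> i < m) \<Longrightarrow> p \<le> m"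
  by (cases l) (auto simp: Suc_le_eq)

lemma head_less: "i < M \<Longrightarrow> head i < 2 * n + 2" "i < M \<Longrightarrow> head (twin i) < 2 * n + 2"
  using head_node nodes_less by auto

text \<open>Amortized time: the factor is at least the number of ticks of one round, so the clock
  plus the weighted measure never increases. The later loops follow the same scheme.\<close>

definition kahn_st :: "nat \<Rightarrow> st \<Rightarrow> bool" where
  "kahn_st T s \<longleftrightarrow> static s \<and> (\<exists>pend q. kahn (var s 13) pend q (arr s 11) (arr s 6) \<and>
     llist nx (var s 12) pend \<and> (\<forall>j<length q. arr s 12 j = q ! j) \<and> var s 14 = length q \<and>
     tm s + 12 * kahn_measure (var s 13) pend q \<le> T)"

lemma kahn_stI:
  assumes "static s" "kahn h pend q (arr s 11) (arr s 6)" "var s 13 = h" "llist nx (var s 12) pend"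
    "\<And>j. j < length q \<Longrightarrow> arr s 12 j = q ! j" "var s 14 = length q"
    "tm s + 12 * kahn_measure h pend q \<le> T"
  shows "kahn_st T s"
  using assms unfolding kahn_st_def by blast

lemma kahn_queue_length: "kahn h pend q deg pos \<Longrightarrow> length q \<le> 2 * n + 2"
proof -
  assume K: "kahn h pend q deg pos"
  have "length q = card (set q)" "set q \<subseteq> nodes"
    using kahn_facts(1,5)[OF K] by (simp_all add: distinct_card)
  then show ?thesis
    using card_mono[of nodes "set q"] card_nodes_n by simp
qed

lemma kahn_deg_le: "kahn h pend q deg pos \<Longrightarrow> deg y \<le> M"
proof -
  assume K: "kahn h pend q deg pos"
  have "deg y \<le> card {..<M}"
    unfolding kahn_facts(7)[OF K] by (intro card_mono) (auto simp: fwd_def)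
  then show ?thesis
    by simp
qed

text \<open>The zero flow with an optimal potential. The order also survives as a ranking bounded by
  \<open>len\<close>, which is needed after the potential has changed: for the length of the walks
  and for the flow on a single arc.\<close>

definition flow_ready :: "nat \<Rightarrow> st \<Rightarrow> bool" where
  "flow_ready len s \<longleftrightarrow> static s \<and> flow_state N (arr s 6) (arr s 5) 0 (var s 15) \<and> var s 15 = len + K \<and>
     var s 20 = 0 \<and> arr s 6 1 = len + K \<and> arr s 6 0 = 0 \<and> (\<forall>x\<in>nodes. arr s 6 x \<le> len + K) \<and>
     1 \<le> len \<and> len \<le> M + 2 \<and> len \<le> 2 * n + 2 \<and>
     (\<exists>rho. ranking rho \<and> (\<forall>x. x \<in> nodes \<longrightarrow> rho x \<le> len))"

lemma source_sink_arcs: "i \<in> fwd \<Longrightarrow> head i \<noteq> 0" "i \<in> fwd \<Longrightarrow> head (Suc i) \<noteq> 1"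
  by (auto elim!: arc_cases)

lemma nodes_cases:
  assumes "x \<in> nodes"
  shows "x = 0 \<or> x = 1 \<or> x \<in> head ` fwd"
proof -
  consider "x = 0" | "x = 1" | i where "i < M" "x = head i"
    using assms by (auto simp: nodes_def)
  then show ?thesis
  proof cases
    case (3 i)
    show ?thesis
    proof (cases "even i")
      case True
      then show ?thesis
        using 3 by (simp add: fwd_def)
    next
      case False
      then have "twin i \<in> fwd"
        using twin_less[OF 3(1)] by (simp add: fwd_def twin_def)
      from tail_source_or_head[OF this] show ?thesis
        unfolding twin_twin using 3(2) by argo
    qed
  qed simp_all
qed

lemma kahn_loop_step:
  assumes I: "kahn_st T s" and c: "var s 13 < var s 14 + var s 12"
  shows "wp (Ite (Num 0) (Var 12) (
         Asg 11 (Var 12 -. Num 1) ;;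
         Asg 12 (Rd 2 (Var 11)) ;;
         Ite (Bin Modulo (Var 11) (Num 2)) (Num 1) (
           Asg 10 (Rd 3 (Var 11)) ;;
           Wr 11 (Var 10) (Rd 11 (Var 10) -. Num 1) ;;
           Ite (Rd 11 (Var 10)) (Num 1) (
             Wr 12 (Var 14) (Var 10) ;;
             Wr 6 (Var 10) (Var 14) ;;
             incr 14) Skip) Skip) (
         Asg 9 (Rd 12 (Var 13)) ;;
         incr 13 ;;
         Asg 12 (Rd 14 (Var 9)))) (kahn_st T) (s\<lparr>tm := Suc (tm s)\<rparr>)"
proof -
  obtain pend q where S: "static s" and K: "kahn (var s 13) pend q (arr s 11) (arr s 6)"
    and p: "llist nx (var s 12) pend" and q: "\<And>j. j < length q \<Longrightarrow> arr s 12 j = q ! j" "var s 14 = length q"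
    and t: "tm s + 12 * kahn_measure (var s 13) pend q \<le> T"
    using I unfolding kahn_st_def by blast
  have len: "length q \<le> 2 * n + 2" "length q < L"
    using kahn_queue_length[OF K] L_large by linarith+
  have M: "M < L" "1 < L" "2 < L" "0 < L"
    using M_bound L_large by linarith+
  note sS = S[unfolded static_def base_def]
  have sf: "var s 7 = M" "arr s 3 = head" "arr s 2 = nx" "arr s 14 = first"
    using S by (simp_all add: static_def)
  show ?thesis
  proof (cases "0 < var s 12")
    case True
    then obtain pend' where pend: "pend = (var s 12 - 1) # pend'" "llist nx (nx (var s 12 - 1)) pend'"
      using llist_pos[OF p] by blast
    define i where "i = var s 12 - 1"
    have K': "kahn (var s 13) (i # pend') q (arr s 11) (arr s 6)" and p': "llist nx (nx i) pend'"
      using K pend by (simp_all add: i_def)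
    have i: "i < M" "i < L"
      using kahn_facts(11)[OF K', of i] M by simp_all
    have i_eq: "var s 12 - Suc 0 = i" "Suc 0 \<le> var s 12"
      using True by (simp_all add: i_def)
    note y = head_less(1)[OF i(1)]
    have y': "head i < L"
      using y L_large by linarith
    have t': "tm s + 12 * kahn_measure (var s 13) (i # pend') q \<le> T"
      using t pend(1) by (simp add: i_def)
    show ?thesis
    proof (cases "even i")
      case False
      have "kahn_st T s'"
        if "var s' = (var s)(11 := i, 12 := nx i)" "arr s' = arr s" "tm s' \<le> tm s + 5" for s'
        using kahn_skip[OF K' False] p' q t' kahn_scan_measure(1)[of "var s 13" pend' q i] that
        by (intro kahn_stI[of _ "var s 13" pend' q]) (simp_all add: static_def base_def sS)
      then show ?thesis
        using True False i i_eq M sf by (simp add: index_ok_def odd_iff_mod_2_eq_one)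
    next
      case even: True
      have dg: "0 < arr s 11 (head i)" "arr s 11 (head i) \<le> M"
        using kahn_scan(1)[OF K' even] kahn_deg_le[OF K'] by simp_all
      show ?thesis
      proof (cases "arr s 11 (head i) = 1")
        case one: True
        let ?q = "q @ [head i]"
        have "kahn_st T s'"
          if "var s' = (var s)(11 := i, 12 := nx i, 10 := head i, 14 := Suc (length q))"
            "arr s' = (arr s)(11 := (arr s 11)(head i := 0), 12 := (arr s 12)(length q := head i),
              6 := (arr s 6)(head i := length q))" "tm s' \<le> tm s + 11" for s'
          using kahn_scan(3)[OF K' even one] p' q t' that
            kahn_scan_measure(2)[of "var s 13" q pend' "head i" i] kahn_facts(2)[OF K']
          by (intro kahn_stI[of _ "var s 13" pend' ?q]) (simp_all add: static_def base_def sS nth_append)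
        then show ?thesis
          using True even one i i_eq M sf y' len q(2) L_large
          by (simp add: index_ok_def even_iff_mod_2_eq_zero incr_def)
      next
        case more: False
        have "kahn_st T s'"
          if "var s' = (var s)(11 := i, 12 := nx i, 10 := head i)"
            "arr s' = (arr s)(11 := (arr s 11)(head i := arr s 11 (head i) - Suc 0))" "tm s' \<le> tm s + 11" for s'
          using kahn_scan(2)[OF K' even more] p' q t' that
            kahn_scan_measure(1)[of "var s 13" pend' q i]
          by (intro kahn_stI[of _ "var s 13" pend' q]) (simp_all add: static_def base_def sS)
        then show ?thesis
          using True even more i i_eq M sf y' len q(2) L_large dg
          by (simp add: index_ok_def even_iff_mod_2_eq_zero incr_def)
      qed
    qed
  next
    case False
    then have 0: "var s 12 = 0" "pend = []"
      using p by (simp_all add: llist_0)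
    define h where "h = var s 13"
    have h: "var s 13 = h" "h < length q"
      using c 0 q(2) by (simp_all add: h_def)
    have K': "kahn h [] q (arr s 11) (arr s 6)"
      using K 0 h by simp
    have qh: "arr s 12 h = q ! h" "q ! h < 2 * n + 2"
      using q(1)[OF h(2)] nodes_less[of "q ! h"] kahn_facts(5)[OF K'] nth_mem[OF h(2)] by auto
    have "kahn_st T s'"
      if "var s' = (var s)(9 := q ! h, 13 := Suc h, 12 := first (q ! h))" "arr s' = arr s" "tm s' \<le> tm s + 5" for s'
      using kahn_pop[OF K' h(2) adj[of "q ! h"]] adj_list q t that 0 h
      by (intro kahn_stI[of _ "Suc h" "adj (q ! h)" q]) (simp_all add: static_def base_def sS)
    then show ?thesis
      using 0 h qh M sf len L_large
      by (simp add: index_ok_def incr_def)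
  qed
qed

lemma kahn_correct:
  assumes S: "static s" and deg: "\<And>y. arr s 11 y = card {i \<in> fwd. head i = y}" and pot: "arr s 6 = (\<lambda>_. 0)"
    and caps: "capacities N (arr s 5)" "\<And>i. odd i \<Longrightarrow> arr s 5 i = 0"
  shows "wp kahn_code (\<lambda>s'. (\<exists>len. flow_ready len s') \<and> tm s' \<le> tm s + 24 * M + 24) s"
proof -
  define T where "T = tm s + 24 * M + 20"
  note sS = S[unfolded static_def base_def]
  have M: "M < L" "1 < L" "0 < L"
    using M_bound L_large by linarith+
  let ?P = "wp (Wr 6 (Num 1) (Var 14 +. Var 4) ;; Asg 15 (Var 14 +. Var 4) ;; Asg 20 (Num 0))
    (\<lambda>s'. (\<exists>len. flow_ready len s') \<and> tm s' \<le> tm s + 24 * M + 24)"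
  let ?s = "s\<lparr>arr := (arr s)(12 := (arr s 12)(0 := 0)), var := (var s)(13 := 0, 14 := 1, 12 := 0), tm := Suc (Suc (Suc (Suc (tm s))))\<rparr>"
  have "wp (While (Var 13) (Var 14 +. Var 12) (Ite (Num 0) (Var 12) (
         Asg 11 (Var 12 -. Num 1) ;;
         Asg 12 (Rd 2 (Var 11)) ;;
         Ite (Bin Modulo (Var 11) (Num 2)) (Num 1) (
           Asg 10 (Rd 3 (Var 11)) ;;
           Wr 11 (Var 10) (Rd 11 (Var 10) -. Num 1) ;;
           Ite (Rd 11 (Var 10)) (Num 1) (
             Wr 12 (Var 14) (Var 10) ;;
             Wr 6 (Var 10) (Var 14) ;;
             incr 14) Skip) Skip) (
         Asg 9 (Rd 12 (Var 13)) ;;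
         incr 13 ;;
         Asg 12 (Rd 14 (Var 9))))) (\<lambda>s'. arr s' 5 = arr s 5 \<longrightarrow> ?P s') ?s"
  proof (rule wp_While_tm[where I = "kahn_st T" and T = T])
    have "kahn 0 [] [0] (arr s 11) (arr s 6)"
      using deg pot by (intro kahn_start) simp_all
    moreover have "card {i. i < M \<and> tail i \<notin> set (take 0 [0])} \<le> M"
      using card_mono[of "{..<M}" "{i. i < M \<and> tail i \<notin> set (take 0 [0])}"] by auto
    ultimately show "kahn_st T ?s"
      by (intro kahn_stI[of _ 0 "[]" "[0]"]) (simp_all add: static_def base_def sS llist_0 kahn_measure_def T_def)
  next
    fix s'
    assume I: "kahn_st T s'"
    then show "tm s' \<le> T"
      unfolding kahn_st_def by auto
    obtain pend q where K: "kahn (var s' 13) pend q (arr s' 11) (arr s' 6)" "llist nx (var s' 12) pend"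
      "var s' 14 = length q"
      using I unfolding kahn_st_def by blast
    have "var s' 12 \<le> M"
      using llist_le[OF K(2)] kahn_facts(11)[OF K(1)] by blast
    moreover have "length q \<le> 2 * n + 2"
      using kahn_queue_length[OF K(1)] .
    ultimately show "safe s' (Var 13) \<and> safe s' (Var 14 +. Var 12)"
      using K(3) M_bound L_large by simp
  next
    fix s'
    assume I: "kahn_st T s'" and "\<not> ev s' (Var 13) < ev s' (Var 14 +. Var 12)"
    obtain pend q where S': "static s'" and K: "kahn (var s' 13) pend q (arr s' 11) (arr s' 6)"
      and p: "llist nx (var s' 12) pend" and q: "var s' 14 = length q" and t: "tm s' \<le> T"
      using I unfolding kahn_st_def by auto
    have z: "var s' 13 = length q" "var s' 12 = 0"
      using \<open>\<not> ev s' (Var 13) < ev s' (Var 14 +. Var 12)\<close> q kahn_facts(2)[OF K] by simp_all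
    then have pend: "pend = []"
      using p by (simp add: llist_0)
    define len where "len = length q"
    have K': "kahn (length q) [] q (arr s' 11) (arr s' 6)"
      using K z pend by simp
    note e = kahn_end[OF K', folded len_def]
    have v: "var s' 4 = K" "var s' 14 = len"
      using S' q by (simp_all add: static_def base_def len_def)
    show "arr (s'\<lparr>tm := Suc (tm s')\<rparr>) 5 = arr s 5 \<longrightarrow> ?P (s'\<lparr>tm := Suc (tm s')\<rparr>)"
    proof
      assume "arr (s'\<lparr>tm := Suc (tm s')\<rparr>) 5 = arr s 5"
      then have rc: "arr s' 5 = arr s 5"
        by simp
      let ?pt = "(arr s' 6)(Suc 0 := len + K)"
      have pt0: "?pt 0 = 0"
        using e(4) by simp
      have rank: "ranking (arr s' 6)"
        using e(1) by (simp add: ranking_def)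
      have le: "arr s' 6 x \<le> len" if "x \<in> nodes" "x \<noteq> 1" for x
        using nodes_cases[OF that(1)] that(2) e(2,4) by (auto simp: less_imp_le)
      \<comment> \<open>At zero flow only forward arcs are residual; positions rise along them by at
        least 1, and costs are at most 1.\<close>
      have "feasible ?pt (arr s 5)"
        unfolding feasible_def
      proof (intro allI impI)
        fix i
        assume i: "i < M" "0 < arr s 5 i"
        then have f: "i \<in> fwd"
          using caps(2)[of i] by (cases "even i") (simp_all add: fwd_def)
        have "arr s' 6 (head (Suc i)) < arr s' 6 (head i)" "arr s' 6 (head i) < len"
          using e(1,2)[OF f] .
        then show "?pt (tail i) + cost i \<le> ?pt (head i) + cost (twin i)"
          using fwd_less(4)[OF f] cost_le(1)[OF f] source_sink_arcs(2)[OF f] by simp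
      qed
      moreover have "net_flow (arr s 5) p = 0" for p
        unfolding net_flow_def using caps(2) fwd_less by simp
      ultimately have fs: "flow_state N ?pt (arr s 5) 0 (len + K)"
        using caps(1) pt0 by (simp add: flow_state_def)
      \<comment> \<open>The truncation covers the sink, whose stored position is not controlled if
        the network has no arcs.\<close>
      define rho where "rho = (\<lambda>x. min (arr s' 6 x) len)"
      have "ranking rho"
        using e(1,2) by (simp add: ranking_def rho_def min_def) (metis less_imp_le less_trans linorder_not_le)
      then have rk: "\<exists>rho. ranking rho \<and> (\<forall>x. x \<in> nodes \<longrightarrow> rho x \<le> len)"
        by (intro exI[of _ rho]) (simp add: rho_def)
      have pts: "\<forall>x\<in>nodes. ?pt x \<le> len + K"
        using le by (simp add: trans_le_add1)
      have ready: "flow_ready len s''"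
        if "var s'' = (var s')(15 := len + K, 20 := 0)" "arr s'' = (arr s')(6 := ?pt)" for s''
        using fs rc pt0 pts rk e(3,5,6) that unfolding flow_ready_def
        by (simp add: S'[unfolded static_def base_def] static_def base_def)
      have "len + K < L"
        using e(6) K_bounds L_large by linarith
      then show "?P (s'\<lparr>tm := Suc (tm s')\<rparr>)"
        using ready t v M by (simp add: index_ok_def T_def exI[of _ len])
    qed
  qed (rule kahn_loop_step, assumption, simp)
  then have "wp (While (Var 13) (Var 14 +. Var 12) (Ite (Num 0) (Var 12) (
         Asg 11 (Var 12 -. Num 1) ;;
         Asg 12 (Rd 2 (Var 11)) ;;
         Ite (Bin Modulo (Var 11) (Num 2)) (Num 1) (
           Asg 10 (Rd 3 (Var 11)) ;;
           Wr 11 (Var 10) (Rd 11 (Var 10) -. Num 1) ;;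
           Ite (Rd 11 (Var 10)) (Num 1) (
             Wr 12 (Var 14) (Var 10) ;;
             Wr 6 (Var 10) (Var 14) ;;
             incr 14) Skip) Skip) (
         Asg 9 (Rd 12 (Var 13)) ;;
         incr 13 ;;
         Asg 12 (Rd 14 (Var 9))))) ?P ?s"
    by (rule wp_frame) (simp add: incr_def)
  then show ?thesis
    unfolding kahn_code_def using M by (simp add: index_ok_def del: One_nat_def)
qed

section \<open>One phase: distances and potentials\<close>

definition dial_st :: "(nat \<Rightarrow> nat) \<Rightarrow> (nat \<Rightarrow> nat) \<Rightarrow> nat \<Rightarrow> nat \<Rightarrow> st \<Rightarrow> bool" where
  "dial_st pt rc D0 T s \<longleftrightarrow> static s \<and> arr s 6 = pt \<and> arr s 5 = rc \<and> var s 16 = D0 \<and>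
     (\<exists>pend ord bks. dial pt rc D0 (var s 17) (var s 9) pend ord bks (arr s 7) (arr s 8) \<and>
       llist nx (var s 12) pend \<and> (\<forall>e. llist (arr s 10) (arr s 9 e) (bks e)) \<and>
       tm s + 15 * dial_measure D0 (var s 17) pend ord bks \<le> T)"

lemma dial_stI:
  assumes "static s" "arr s 6 = pt" "arr s 5 = rc" "var s 16 = D0"
    "dial pt rc D0 d x pend ord bks (arr s 7) (arr s 8)" "var s 17 = d" "var s 9 = x"
    "llist nx (var s 12) pend" "\<And>e. llist (arr s 10) (arr s 9 e) (bks e)"
    "tm s + 15 * dial_measure D0 d pend ord bks \<le> T"
  shows "dial_st pt rc D0 T s"
  using assms unfolding dial_st_def by blast

text \<open>The bound is twice \<open>2 n + 2 + k\<close>, the maximum of the initial difference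
  \<open>len + K\<close>: potentials exceed that of the source by at most \<open>len + K\<close>,
  and the source stays below the sink.\<close>

definition small_pot :: "(nat \<Rightarrow> nat) \<Rightarrow> bool" where
  "small_pot pt \<longleftrightarrow> (\<forall>x\<in>nodes. pt x \<le> 4 * n + 2 * k + 4)"

lemma dial_loop_step:
  assumes I: "dial_st pt rc D0 T s" and c: "var s 17 < var s 16"
    and pt: "feasible pt rc" "small_pot pt" and D0: "D0 \<le> 2 * n + 2"
  shows "wp (Ite (Num 0) (Var 12) (
         Asg 11 (Var 12 -. Num 1) ;;
         Asg 12 (Rd 2 (Var 11)) ;;
         Ite (Num 0) (Rd 5 (Var 11)) (
           Asg 18 (Var 17 +. ((Rd 6 (Rd 3 (Var 11)) +. Rd 4 (twin_exp (Var 11)))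
             -. (Rd 6 (Var 9) +. Rd 4 (Var 11)))) ;;
           Ite (Var 18) (Var 16) (
             Wr 10 (Var 11) (Rd 9 (Var 18)) ;;
             Wr 9 (Var 18) (Var 11 +. Num 1)) Skip) Skip) (
         Ite (Num 0) (Rd 9 (Var 17)) (
           Asg 11 (Rd 9 (Var 17) -. Num 1) ;;
           Wr 9 (Var 17) (Rd 10 (Var 11)) ;;
           Asg 10 (Rd 3 (Var 11)) ;;
           Ite (Rd 7 (Var 10)) (Var 16) Skip (
             Wr 7 (Var 10) (Var 17) ;;
             Wr 8 (Var 10) (Var 11) ;;
             Asg 9 (Var 10) ;;
             Asg 12 (Rd 14 (Var 10)))) (
           incr 17))) (dial_st pt rc D0 T) (s\<lparr>tm := Suc (tm s)\<rparr>)"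
proof -
  obtain pend ord bks where S: "static s" and e: "arr s 6 = pt" "arr s 5 = rc" "var s 16 = D0"
    and D: "dial pt rc D0 (var s 17) (var s 9) pend ord bks (arr s 7) (arr s 8)"
    and p: "llist nx (var s 12) pend" and b: "\<And>e. llist (arr s 10) (arr s 9 e) (bks e)"
    and t: "tm s + 15 * dial_measure D0 (var s 17) pend ord bks \<le> T"
    using I unfolding dial_st_def by blast
  note sS = S[unfolded static_def base_def]
  define d x where "d = var s 17" and "x = var s 9"
  have dx: "var s 17 = d" "var s 9 = x" "d < D0"
    using c e by (simp_all add: d_def x_def)
  have M: "M < L" "1 < L" "0 < L"
    using M_bound L_large by linarith+
  have sf: "var s 7 = M" "arr s 3 = head" "arr s 4 = cost" "arr s 2 = nx" "arr s 14 = first"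
    using S by (simp_all add: static_def)
  have dL: "d < L" "D0 < L"
    using dx(3) D0 L_large by linarith+
  show ?thesis
  proof (cases "0 < var s 12")
    case True
    then obtain pend' where pend: "pend = (var s 12 - 1) # pend'" "llist nx (nx (var s 12 - 1)) pend'"
      using llist_pos[OF p] by blast
    define i where "i = var s 12 - 1"
    have D': "dial pt rc D0 d x (i # pend') ord bks (arr s 7) (arr s 8)" and p': "llist nx (nx i) pend'"
      using D pend dx by (simp_all add: i_def)
    note ip = dial_pend[OF D']
    have iL: "i < L" "Suc i < L" "twin i < L" "head i < L" "x < L"
      using ip(1,2) twin_less[OF ip(1)] head_less[OF ip(1)] M L_large by linarith+
    have i_eq: "var s 12 - Suc 0 = i" "Suc 0 \<le> var s 12"
      using True by (simp_all add: i_def)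
    have t': "tm s + 15 * dial_measure D0 d (i # pend') ord bks \<le> T"
      using t pend(1) dx by (simp add: i_def)
    have skip: "dial_st pt rc D0 T s'"
      if "rc i = 0 \<or> D0 \<le> d + slack pt i" "var s' = (var s)(11 := i, 12 := nx i) \<or> var s' = (var s)(11 := i, 12 := nx i, 18 := d + slack pt i)"
        "arr s' = arr s" "tm s' \<le> tm s + 14" for s'
      using dial_scan_skip[OF D' that(1)] p' b t' that(2-4) e dx
      by (intro dial_stI[of _ _ _ _ d x pend' ord bks]) (auto simp: static_def base_def sS)
    show ?thesis
    proof (cases "rc i = 0")
      case zero: True
      then show ?thesis
        using True i_eq M sf iL e skip by (simp add: index_ok_def)
    next
      case pos: False
      have le: "pt (tail i) + cost i \<le> pt (head i) + cost (twin i)"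
        using feasibleD[OF pt(1) ip(1)] pos by simp
      have cs: "cost i \<le> 1" "cost (twin i) \<le> 1"
        using cost_le_1 ip(1) twin_less[OF ip(1)] by simp_all
      have ptL: "pt (head i) \<le> 4 * n + 2 * k + 4" "pt x \<le> 4 * n + 2 * k + 4"
        using pt(2) head_node[OF ip(1)] ip(2) by (auto simp: small_pot_def)
      have sl: "d + slack pt i = d + ((pt (head i) + cost (twin i)) - (pt x + cost i))"
        using ip(2) by (simp add: slack_def)
      have le': "pt x + cost i \<le> pt (head i) + cost (twin i)"
        using le ip(2) by simp
      define f where "f = d + slack pt i"
      have fL: "f < L" "pt (head i) + cost (twin i) < L" "pt x + cost i < L"
          "pt (head i) + cost (twin i) - (pt x + cost i) < L" "pt x + cost i \<le> pt (head i) + cost (twin i)"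
        using ptL cs dx(3) D0 L_large le' unfolding f_def sl by linarith+
      have f_eq: "d + (pt (head i) + cost (twin i) - (pt x + cost i)) = f"
        by (simp add: f_def sl)
      show ?thesis
      proof (cases "f < D0")
        case push: True
        have "dial_st pt rc D0 T s'"
          if "var s' = (var s)(11 := i, 12 := nx i, 18 := f)"
            "arr s' = (arr s)(10 := (arr s 10)(i := arr s 9 f), 9 := (arr s 9)(f := Suc i))" "tm s' \<le> tm s + 14" for s'
        proof (rule dial_stI[of _ _ _ _ d x pend' ord "bks(f := i # bks f)"])
          fix e'
          show "llist (arr s' 10) (arr s' 9 e') ((bks(f := i # bks f)) e')"
            using that b[of e'] b[of f] dial_scan_notin[OF D'] by (auto simp: llist_upd)
        qed (use dial_scan_push[OF D' _ f_def push] pos that p' t' e dx in \<open>auto simp: static_def base_def sS\<close>)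
        then show ?thesis
          using True pos i_eq M sf iL e dx fL f_eq push dL
          by (simp add: index_ok_def twin_exp_def xor_1 less_imp_diff_less)
      next
        case far: False
        then have "D0 \<le> d + slack pt i"
          by (simp add: f_def)
        then show ?thesis
          using True pos i_eq M sf iL e dx fL f_eq far dL skip[folded f_def]
          by (simp add: index_ok_def twin_exp_def xor_1 less_imp_diff_less)
      qed
    qed
  next
    case False
    then have 0: "var s 12 = 0" "pend = []"
      using p by (simp_all add: llist_0)
    have D': "dial pt rc D0 d x [] ord bks (arr s 7) (arr s 8)"
      using D 0 dx by simp
    have t': "tm s + 15 * dial_measure D0 d [] ord bks \<le> T"
      using t 0 dx by simp
    show ?thesis
    proof (cases "0 < arr s 9 d")
      case True
      obtain bd where bd: "bks d = (arr s 9 d - 1) # bd" "llist (arr s 10) (arr s 10 (arr s 9 d - 1)) bd"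
        using llist_pos[OF b[of d] True] by blast
      define i where "i = arr s 9 d - 1"
      have bi: "bks d = i # bd" "llist (arr s 10) (arr s 10 i) bd"
        using bd by (simp_all add: i_def)
      have iM: "i < M"
        using dial_bucket(3)[OF D' bi(1)] .
      have iL: "i < L" "head i < L"
        using iM head_less[OF iM] M L_large by linarith+
      have i_eq: "arr s 9 d - Suc 0 = i" "Suc 0 \<le> arr s 9 d"
        using True by (simp_all add: i_def)
      have lists: "llist (arr s 10) (((arr s 9)(d := arr s 10 i)) e') ((bks(d := bd)) e')" for e'
        using b[of e'] bi by simp
      show ?thesis
      proof (cases "arr s 7 (head i) < D0")
        case settled: True
        have "dial_st pt rc D0 T s'"
          if "var s' = (var s)(11 := i, 10 := head i)"
            "arr s' = (arr s)(9 := (arr s 9)(d := arr s 10 i))" "tm s' \<le> tm s + 14" for s'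
          using dial_pop_skip[OF D' bi(1) settled dx(3)] lists t' that e dx 0
          by (intro dial_stI[of _ _ _ _ d x "[]" ord "bks(d := bd)"])
            (simp_all add: static_def base_def sS llist_0 del: fun_upd_apply, simp_all add: sS)
        then show ?thesis
          using True 0 settled i_eq M sf iL e dx dL
          by (simp add: index_ok_def)
      next
        case new: False
        have "dial_st pt rc D0 T s'"
          if "var s' = (var s)(11 := i, 10 := head i, 9 := head i, 12 := first (head i))"
            "arr s' = (arr s)(9 := (arr s 9)(d := arr s 10 i), 7 := (arr s 7)(head i := d), 8 := (arr s 8)(head i := i))"
            "tm s' \<le> tm s + 14" for s'
        proof (rule dial_stI[of _ _ _ _ d "head i" "adj (head i)" "ord @ [head i]" "bks(d := bd)"])
          show "llist (arr s' 10) (arr s' 9 e') ((bks(d := bd)) e')" for e'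
            using lists[of e'] that(2) by simp
        qed (use dial_pop_settle[OF D' bi(1) new dx(3) adj] adj_list[of "head i"] t' that e dx 0
            in \<open>simp_all add: static_def base_def sS\<close>)
        then show ?thesis
          using True 0 new i_eq M sf iL e dx dL
          by (simp add: index_ok_def)
      qed
    next
      case empty: False
      then have "bks d = []"
        using b[of d] by (simp add: llist_0)
      then have "dial_st pt rc D0 T s'"
        if "var s' = (var s)(17 := Suc d)" "arr s' = arr s" "tm s' \<le> tm s + 14" for s'
        using dial_next[OF D' _ dx(3)] b t' that e dx 0
        by (intro dial_stI[of _ _ _ _ "Suc d" x "[]" ord bks]) (simp_all add: static_def base_def sS llist_0)
      then show ?thesis
        using empty 0 M sf e dx dL D0 L_large
        by (simp add: index_ok_def incr_def)
    qed
  qed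
qed

definition dial_done :: "(nat \<Rightarrow> nat) \<Rightarrow> (nat \<Rightarrow> nat) \<Rightarrow> nat \<Rightarrow> st \<Rightarrow> bool" where
  "dial_done pt rc D0 s \<longleftrightarrow> static s \<and> arr s 6 = pt \<and> arr s 5 = rc \<and> var s 16 = D0 \<and> arr s 9 = (\<lambda>_. 0) \<and>
     (\<exists>d x pend ord bks. dial pt rc D0 d x pend ord bks (arr s 7) (arr s 8) \<and> \<not> d < D0)"

lemma dial_correct:
  assumes S: "static s" and e: "arr s 6 = pt" "arr s 5 = rc" "arr s 9 = (\<lambda>_. 0)"
    and l: "var s 15 = D0 + K" "0 < D0"
    and pt: "feasible pt rc" "small_pot pt" and D0: "D0 \<le> 2 * n + 2" "D0 \<le> M + 2"
  shows "wp dial_code (\<lambda>s'. dial_done pt rc D0 s' \<and> tm s' \<le> tm s + 80 * M + 50) s"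
proof -
  note sS = S[unfolded static_def base_def]
  have M: "M < L" "1 < L" "0 < L" "D0 < L"
    using M_bound D0 L_large by linarith+
  define T1 where "T1 = tm s + 3 * M + 3"
  define T2 where "T2 = tm s + 78 * M + 45"
  define I where "I s' \<longleftrightarrow> static s' \<and> arr s' 6 = pt \<and> arr s' 5 = rc \<and> arr s' 9 = (\<lambda>_. 0) \<and> var s' 16 = D0 \<and>
    var s' 11 \<le> M \<and> (\<forall>j<var s' 11. arr s' 7 (head j) = D0) \<and> tm s' + 3 * (M - var s' 11) \<le> T1" for s'
  let ?loop2 = "While (Var 17) (Var 16) (
       Ite (Num 0) (Var 12) (
         Asg 11 (Var 12 -. Num 1) ;;
         Asg 12 (Rd 2 (Var 11)) ;;
         Ite (Num 0) (Rd 5 (Var 11)) (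
           Asg 18 (Var 17 +. ((Rd 6 (Rd 3 (Var 11)) +. Rd 4 (twin_exp (Var 11)))
             -. (Rd 6 (Var 9) +. Rd 4 (Var 11)))) ;;
           Ite (Var 18) (Var 16) (
             Wr 10 (Var 11) (Rd 9 (Var 18)) ;;
             Wr 9 (Var 18) (Var 11 +. Num 1)) Skip) Skip) (
         Ite (Num 0) (Rd 9 (Var 17)) (
           Asg 11 (Rd 9 (Var 17) -. Num 1) ;;
           Wr 9 (Var 17) (Rd 10 (Var 11)) ;;
           Asg 10 (Rd 3 (Var 11)) ;;
           Ite (Rd 7 (Var 10)) (Var 16) Skip (
             Wr 7 (Var 10) (Var 17) ;;
             Wr 8 (Var 10) (Var 11) ;;
             Asg 9 (Var 10) ;;
             Asg 12 (Rd 14 (Var 10)))) (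
           incr 17)))"
  let ?Q = "\<lambda>s'. dial_done pt rc D0 s' \<and> tm s' \<le> tm s + 80 * M + 50"
  have loop2: "wp ?loop2 ?Q s2" if s2: "dial_st pt rc D0 T2 s2" for s2
  proof (rule wp_While_tm[where I = "dial_st pt rc D0 T2" and T = T2])
    fix s'
    assume I: "dial_st pt rc D0 T2 s'" and "\<not> ev s' (Var 17) < ev s' (Var 16)"
    obtain pend ord bks where S': "static s'" "arr s' 6 = pt" "arr s' 5 = rc" "var s' 16 = D0"
      and D: "dial pt rc D0 (var s' 17) (var s' 9) pend ord bks (arr s' 7) (arr s' 8)"
      and b: "\<And>e. llist (arr s' 10) (arr s' 9 e) (bks e)" and t: "tm s' \<le> T2"
      using I unfolding dial_st_def by auto
    have d: "\<not> var s' 17 < D0"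
      using \<open>\<not> ev s' (Var 17) < ev s' (Var 16)\<close> S' by simp
    have "arr s' 9 = (\<lambda>_. 0)"
      using b dial_end(1)[OF D d] by (simp add: fun_eq_iff)
    moreover have "\<exists>d x pend ord bks. dial pt rc D0 d x pend ord bks (arr s' 7) (arr s' 8) \<and> \<not> d < D0"
      using D d by blast
    ultimately have "dial_done pt rc D0 (s'\<lparr>tm := Suc (tm s')\<rparr>)"
      using S' S'(1)[unfolded static_def base_def] unfolding dial_done_def by (simp add: static_def base_def)
    then show "?Q (s'\<lparr>tm := Suc (tm s')\<rparr>)"
      using t by (simp add: T2_def)
  next
    show "tm s' \<le> T2" if "dial_st pt rc D0 T2 s'" for s'
      using that unfolding dial_st_def by auto
  next
    show "wp (Ite (Num 0) (Var 12) (
         Asg 11 (Var 12 -. Num 1) ;;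
         Asg 12 (Rd 2 (Var 11)) ;;
         Ite (Num 0) (Rd 5 (Var 11)) (
           Asg 18 (Var 17 +. ((Rd 6 (Rd 3 (Var 11)) +. Rd 4 (twin_exp (Var 11)))
             -. (Rd 6 (Var 9) +. Rd 4 (Var 11)))) ;;
           Ite (Var 18) (Var 16) (
             Wr 10 (Var 11) (Rd 9 (Var 18)) ;;
             Wr 9 (Var 18) (Var 11 +. Num 1)) Skip) Skip) (
         Ite (Num 0) (Rd 9 (Var 17)) (
           Asg 11 (Rd 9 (Var 17) -. Num 1) ;;
           Wr 9 (Var 17) (Rd 10 (Var 11)) ;;
           Asg 10 (Rd 3 (Var 11)) ;;
           Ite (Rd 7 (Var 10)) (Var 16) Skip (
             Wr 7 (Var 10) (Var 17) ;;
             Wr 8 (Var 10) (Var 11) ;;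
             Asg 9 (Var 10) ;;
             Asg 12 (Rd 14 (Var 10)))) (
           incr 17))) (dial_st pt rc D0 T2) (s'\<lparr>tm := Suc (tm s')\<rparr>)"
      if "dial_st pt rc D0 T2 s'" "ev s' (Var 17) < ev s' (Var 16)" for s'
      using that(2) by (intro dial_loop_step[OF that(1) _ pt D0(1)]) simp
  qed (use s2 in simp_all)
  have loop1: "wp (While (Var 11) (Var 7) (Wr 7 (Rd 3 (Var 11)) (Var 16) ;; incr 11))
      (wp (Wr 7 (Num 1) (Var 16) ;; Wr 7 (Num 0) (Num 0) ;;
        Asg 17 (Num 0) ;; Asg 9 (Num 0) ;; Asg 12 (Rd 14 (Num 0)) ;; ?loop2) ?Q) s1" if "I s1" for s1
  proof (rule wp_While_tm[where I = I and T = T1])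
    fix s'
    assume I: "I s'" and "\<not> ev s' (Var 11) < ev s' (Var 7)"
    note sS' = I[unfolded I_def static_def base_def]
    have "var s' 11 = M"
      using sS' \<open>\<not> ev s' (Var 11) < ev s' (Var 7)\<close> by simp
    then have heads: "arr s' 7 (head j) = D0" if "j < M" for j
      using sS' that by simp
    let ?dst = "(arr s' 7)(Suc 0 := D0, 0 := 0)"
    have dst: "?dst y = D0" if "y \<in> nodes" "y \<noteq> 0" for y
      using heads that by (auto simp: nodes_def)
    have "dial_st pt rc D0 T2 s2"
      if "var s2 = (var s')(17 := 0, 9 := 0, 12 := first 0)" "arr s2 = (arr s')(7 := ?dst)" "tm s2 \<le> tm s' + 7" for s2
    proof (rule dial_stI[of _ _ _ _ 0 0 "adj 0" "[0]" "\<lambda>_. []"])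
      show "dial pt rc D0 0 0 (adj 0) [0] (\<lambda>_. []) (arr s2 7) (arr s2 8)"
        using dst that(2) by (intro dial_start(1)[OF l(2) adj]) simp_all
      have "dial_measure D0 0 (adj 0) [0] (\<lambda>_. []) \<le> 4 * M + D0"
        using dst by (intro dial_start(2)[OF l(2) adj, of ?dst]) simp_all
      then show "tm s2 + 15 * dial_measure D0 0 (adj 0) [0] (\<lambda>_. []) \<le> T2"
        using sS' that(3) D0(2) \<open>var s' 11 = M\<close> unfolding T1_def T2_def by simp
    qed (use that sS' adj_list in \<open>simp_all add: static_def base_def\<close>)
    then show "wp (Wr 7 (Num 1) (Var 16) ;; Wr 7 (Num 0) (Num 0) ;;
        Asg 17 (Num 0) ;; Asg 9 (Num 0) ;; Asg 12 (Rd 14 (Num 0)) ;; ?loop2) ?Q (s'\<lparr>tm := Suc (tm s')\<rparr>)"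
      using M sS' unfolding wp_Seq by (simp add: index_ok_def loop2[unfolded One_nat_def])
  next
    fix s'
    assume I: "I s'" and "ev s' (Var 11) < ev s' (Var 7)"
    note sS' = I[unfolded I_def static_def base_def]
    define i where "i = var s' 11"
    have i: "var s' 11 = i" "i < M" "M - i = Suc (M - Suc i)"
      using sS' \<open>ev s' (Var 11) < ev s' (Var 7)\<close> by (simp_all add: i_def)
    have "head i < L" "Suc i < L" "i < L"
      using head_less(1)[OF i(2)] i M L_large by linarith+
    then show "wp (Wr 7 (Rd 3 (Var 11)) (Var 16) ;; incr 11) I (s'\<lparr>tm := Suc (tm s')\<rparr>)"
      using sS' i M by (simp add: index_ok_def incr_def I_def static_def base_def less_Suc_eq)
  qed (use that M in \<open>simp_all add: I_def\<close>)
  have "I s1" if "var s1 = (var s)(16 := D0, 11 := 0)" "arr s1 = arr s" "tm s1 \<le> tm s + 2" for s1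
    using that e sS by (simp add: I_def static_def base_def T1_def)
  then show ?thesis
    unfolding dial_code_def wp_Seq
    using l M sS by (simp add: loop1[unfolded wp_Seq One_nat_def])
qed

definition raise_st :: "nat \<Rightarrow> (nat \<Rightarrow> nat) \<Rightarrow> (nat \<Rightarrow> nat) \<Rightarrow> nat \<Rightarrow> st \<Rightarrow> bool" where
  "raise_st D pt dst T s \<longleftrightarrow> static s \<and> var s 19 = D \<and> var s 11 \<le> M \<and>
     (\<forall>x\<in>nodes. (arr s 6 x = raised D dst pt x \<and> D \<le> arr s 7 x) \<or>
       (x \<noteq> 0 \<and> x \<notin> head ` {..<var s 11} \<and> arr s 6 x = pt x \<and> arr s 7 x = dst x)) \<and>
     tm s + 6 * (M - var s 11) \<le> T"

lemma raise_correct: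
  assumes S: "static s" and e: "arr s 6 = pt" "arr s 7 = dst" and dst: "dst 0 = 0" "dst 1 = D"
    and D: "D \<le> var s 15" "D \<le> 2 * n + 2" "var s 15 < L" and pt: "small_pot pt"
  shows "wp raise_code (\<lambda>s'. static s' \<and> (\<forall>x\<in>nodes. arr s' 6 x = raised D dst pt x) \<and>
    var s' 15 = var s 15 - D \<and> var s' 19 = D \<and> tm s' \<le> tm s + 6 * M + 6) s"
proof -
  note sS = S[unfolded static_def base_def]
  have M: "M < L" "1 < L" "0 < L" "D < L"
    using M_bound D(2) L_large by linarith+
  have ptL: "pt x + y < L" "raised D dst pt x < L" if "x \<in> nodes" "y \<le> D" for x y
  proof -
    have "pt x \<le> 4 * n + 2 * k + 4"
      using pt that(1) by (simp add: small_pot_def)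
    then show "pt x + y < L" "raised D dst pt x < L"
      using that(2) D(2) L_large unfolding raised_def by linarith+
  qed
  have zero: "0 \<in> nodes" "1 \<in> nodes"
    by (simp_all add: nodes_def)
  define T where "T = tm s + 6 * M + 4"
  let ?body = "Asg 10 (Rd 3 (Var 11)) ;;
       Ite (Rd 7 (Var 10)) (Var 19) (
         Wr 6 (Var 10) (Rd 6 (Var 10) +. (Var 19 -. Rd 7 (Var 10))) ;;
         Wr 7 (Var 10) (Var 19)) Skip ;;
       incr 11"
  have loop: "wp (While (Var 11) (Var 7) ?body)
     (\<lambda>s'. var s' 15 = var s 15 \<longrightarrow> wp (Asg 15 (Var 15 -. Var 19)) (\<lambda>s'. static s' \<and> (\<forall>x\<in>nodes. arr s' 6 x = raised D dst pt x) \<and>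
       var s' 15 = var s 15 - D \<and> var s' 19 = D \<and> tm s' \<le> tm s + 6 * M + 6) s') s1" if "raise_st D pt dst T s1" for s1
  proof (rule wp_While_tm[where I = "raise_st D pt dst T" and T = T])
    fix s'
    assume I: "raise_st D pt dst T s'" and c: "\<not> ev s' (Var 11) < ev s' (Var 7)"
    have sS': "static s'" "var s' 19 = D" "var s' 11 \<le> M" "tm s' \<le> T"
      and pts: "\<And>x. x \<in> nodes \<Longrightarrow> (arr s' 6 x = raised D dst pt x \<and> D \<le> arr s' 7 x) \<or>
       (x \<noteq> 0 \<and> x \<notin> head ` {..<var s' 11} \<and> arr s' 6 x = pt x \<and> arr s' 7 x = dst x)"
      using I unfolding raise_st_def by simp_all
    have "var s' 11 = M"
      using sS'(1,3) c by (simp add: static_def)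
    have "arr s' 6 x = raised D dst pt x" if x: "x \<in> nodes" for x
    proof (cases "x \<noteq> 0 \<and> x \<notin> head ` {..<M}")
      case True
      then have "x = 1"
        using x by (auto simp: nodes_def)
      then have "raised D dst pt x = pt x"
        using dst(2) by (simp add: raised_def)
      then show ?thesis
        using pts[OF x] by auto
    next
      case False
      then show ?thesis
        using pts[OF x] \<open>var s' 11 = M\<close> by auto
    qed
    then show "var (s'\<lparr>tm := Suc (tm s')\<rparr>) 15 = var s 15 \<longrightarrow> wp (Asg 15 (Var 15 -. Var 19)) (\<lambda>s'. static s' \<and> (\<forall>x\<in>nodes. arr s' 6 x = raised D dst pt x) \<and>
       var s' 15 = var s 15 - D \<and> var s' 19 = D \<and> tm s' \<le> tm s + 6 * M + 6) (s'\<lparr>tm := Suc (tm s')\<rparr>)"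
      using sS' sS'(1)[unfolded static_def base_def] D less_imp_diff_less[OF D(3)]
      by (simp add: static_def base_def T_def)
  next
    fix s'
    assume I: "raise_st D pt dst T s'" and c: "ev s' (Var 11) < ev s' (Var 7)"
    have sS': "static s'" "var s' 19 = D" "tm s' + 6 * (M - var s' 11) \<le> T"
      and pts: "\<And>x. x \<in> nodes \<Longrightarrow> (arr s' 6 x = raised D dst pt x \<and> D \<le> arr s' 7 x) \<or>
       (x \<noteq> 0 \<and> x \<notin> head ` {..<var s' 11} \<and> arr s' 6 x = pt x \<and> arr s' 7 x = dst x)"
      using I unfolding raise_st_def by simp_all
    note sf = sS'(1)[unfolded static_def base_def]
    define i where "i = var s' 11"
    have i: "var s' 11 = i" "i < M" "M - i = Suc (M - Suc i)"
      using sf c by (simp_all add: i_def)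
    define y where "y = head i"
    have y: "head i = y" "y \<in> nodes" "y < L" "i < L" "Suc i < L"
      using head_node(1)[OF i(2)] head_less(1)[OF i(2)] i M L_large by (simp_all add: y_def)
    show "wp ?body (raise_st D pt dst T) (s'\<lparr>tm := Suc (tm s')\<rparr>)"
    proof (cases "arr s' 7 y < D")
      case True
      then have old: "arr s' 6 y = pt y" "arr s' 7 y = dst y"
        using pts[OF y(2)] by auto
      have new: "pt y + (D - dst y) = raised D dst pt y"
        using True old by (simp add: raised_def)
      have "raise_st D pt dst T s''"
        if "var s'' = (var s')(10 := y, 11 := Suc i)"
          "arr s'' = (arr s')(6 := (arr s' 6)(y := raised D dst pt y), 7 := (arr s' 7)(y := D))" "tm s'' \<le> tm s' + 6" for s''
      proof -
        have "(arr s'' 6 x = raised D dst pt x \<and> D \<le> arr s'' 7 x) \<or>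
          (x \<noteq> 0 \<and> x \<notin> head ` {..<Suc i} \<and> arr s'' 6 x = pt x \<and> arr s'' 7 x = dst x)" if x: "x \<in> nodes" for x
          using pts[OF x] that i(1) y(1) by (cases "x = y") (simp_all add: \<open>arr s'' = _\<close> lessThan_Suc)
        then show ?thesis
          using that sS' sf i by (simp add: raise_st_def static_def base_def)
      qed
      then show ?thesis
        using True sf sS'(2) i y M old new ptL(2)[OF y(2), of 0] less_imp_diff_less[OF M(4)]
        by (simp add: index_ok_def incr_def)
    next
      case False
      have "raise_st D pt dst T s''"
        if "var s'' = (var s')(10 := y, 11 := Suc i)" "arr s'' = arr s'" "tm s'' \<le> tm s' + 6" for s''
      proof -
        have "(arr s'' 6 x = raised D dst pt x \<and> D \<le> arr s'' 7 x) \<or>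
          (x \<noteq> 0 \<and> x \<notin> head ` {..<Suc i} \<and> arr s'' 6 x = pt x \<and> arr s'' 7 x = dst x)" if x: "x \<in> nodes" for x
        proof (cases "x = y")
          case True
          then show ?thesis
            using pts[OF x] False by (auto simp: \<open>arr s'' = _\<close> raised_def)
        next
          case neq: False
          then show ?thesis
            using pts[OF x] i(1) y(1) by (simp add: \<open>arr s'' = _\<close> lessThan_Suc)
        qed
        then show ?thesis
          using that sS' sf i by (simp add: raise_st_def static_def base_def)
      qed
      then show ?thesis
        using False sf sS'(2) i y M by (simp add: index_ok_def incr_def)
    qed
  next
    show "tm s' \<le> T" if "raise_st D pt dst T s'" for s'
      using that unfolding raise_st_def by simp
  qed (use that M in simp_all)
  have start: "raise_st D pt dst T s1"
    if "var s1 = (var s)(19 := D, 11 := 0)"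
      "arr s1 = (arr s)(6 := pt(0 := pt 0 + D), 7 := dst(0 := D))" "tm s1 \<le> tm s + 4" for s1
    using that sS dst by (auto simp: raise_st_def static_def base_def raised_def T_def)
  have loop': "wp (While (Var 11) (Var 7) ?body)
     (wp (Asg 15 (Var 15 -. Var 19)) (\<lambda>s'. static s' \<and> (\<forall>x\<in>nodes. arr s' 6 x = raised D dst pt x) \<and>
       var s' 15 = var s 15 - D \<and> var s' 19 = D \<and> tm s' \<le> tm s + 6 * M + 6)) s1"
    if "raise_st D pt dst T s1" "var s1 15 = var s 15" for s1
    by (rule wp_frame[OF loop[OF that(1)]]) (use that(2) in \<open>simp add: incr_def del: wp_Asg\<close>)
  have "pt 0 + D < L"
    using ptL(1)[OF zero(1), of D] by simp
  then show ?thesis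
    unfolding raise_code_def wp_Seq
    using M e dst by (simp add: index_ok_def loop'[unfolded wp_Seq One_nat_def] start)
qed

lemma N_Suc_less: "Suc N < L" "1 \<le> N"
proof -
  have "(2 * (n + 1)) * (2 * n + 4) < L"
    by (rule product_less_L) simp_all
  moreover have "(2 * (n + 1)) * (2 * n + 4) = 2 * N"
    by (simp add: N_def)
  moreover show "1 \<le> N"
    by (simp add: N_def)
  ultimately show "Suc N < L"
    by linarith
qed

lemma capacities_le: "capacities N rc \<Longrightarrow> i < M \<Longrightarrow> rc i \<le> N"
proof -
  assume c: "capacities N rc" and i: "i < M"
  define a where "a = (if even i then i else i - 1)"
  have a: "a \<in> fwd" "i = a \<or> i = Suc a"
    using i by (auto simp: a_def fwd_def elim: oddE)
  have "rc a + rc (Suc a) = (if cost a = 1 then 1 else N)"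
    using c a(1) by (simp add: capacities_def)
  then show "rc i \<le> N"
    using a(2) N_Suc_less(2) by (auto split: if_splits)
qed

section \<open>Augmentation and the main loop\<close>

definition augment_st where
  "augment_st pt r ord par ok T s \<longleftrightarrow> static s \<and> arr s 6 = pt \<and> arr s 8 = par \<and>
     (\<exists>j. augmenting N pt (arr s 5) r ord par ok j (var s 10) \<and> tm s + 6 * j \<le> T)"

text \<open>\<open>ok\<close> will be instantiated by being at distance at most \<open>D\<close>, a
  property that passes from a node to its parent and makes the parent arc tight after the
  raise.\<close>

lemma augment_correct:
  assumes S: "static s" and e: "arr s 6 = pt" "arr s 8 = par"
    and ord: "distinct ord" "ord ! 0 = 0" "set ord \<subseteq> nodes" "1 \<in> set ord"
    and par: "\<And>j. 0 < j \<Longrightarrow> j < length ord \<Longrightarrow> par (ord ! j) < M \<and> head (par (ord ! j)) = ord ! j \<and>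
      tail (par (ord ! j)) \<in> set (take j ord) \<and> 0 < arr s 5 (par (ord ! j))"
    and ok: "\<And>j. 0 < j \<Longrightarrow> j < length ord \<Longrightarrow> ok (ord ! j) \<Longrightarrow> ok (tail (par (ord ! j))) \<and>
      pt (tail (par (ord ! j))) + cost (par (ord ! j)) = pt (head (par (ord ! j))) + cost (twin (par (ord ! j)))"
    and ok1: "ok 1" and fs: "flow_state N pt (arr s 5) (var s 20) l" and r: "Suc (var s 20) < L"
  shows "wp augment_code (\<lambda>s'. static s' \<and> flow_state N pt (arr s' 5) (Suc (var s 20)) l \<and>
    var s' 20 = Suc (var s 20) \<and> tm s' \<le> tm s + 6 * M + 16) s"
proof -
  note sS = S[unfolded static_def base_def]
  have M: "M < L" "1 < L" "0 < L"
    using M_bound L_large by linarith+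
  define T where "T = tm s + 6 * (M + 2) + 1"
  define r where "r = var s 20"
  let ?I = "augment_st pt r ord par ok T"
  have fsp: "feasible pt (arr s 5)" "capacities N (arr s 5)" "pt 1 = pt 0 + l"
    "\<And>p. net_flow (arr s 5) p = int r * (p 1 - p 0)"
    using fs by (simp_all add: flow_state_def r_def)
  let ?Q = "\<lambda>s'. static s' \<and> flow_state N pt (arr s' 5) (Suc (var s 20)) l \<and>
    var s' 20 = Suc (var s 20) \<and> tm s' \<le> tm s + 6 * M + 16"
  let ?body = "Asg 11 (Rd 8 (Var 10)) ;;
       Wr 5 (Var 11) (Rd 5 (Var 11) -. Num 1) ;;
       Wr 5 (twin_exp (Var 11)) (Rd 5 (twin_exp (Var 11)) +. Num 1) ;;
       Asg 10 (Rd 3 (twin_exp (Var 11)))"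
  have loop: "wp (While (Num 0) (Var 10) ?body) (\<lambda>s'. var s' 20 = r \<longrightarrow> wp (incr 20) ?Q s') s1" if "?I s1" for s1
  proof (rule wp_While_tm[where I = ?I and T = T])
    fix s'
    assume I: "?I s'" and c: "\<not> ev s' (Num 0) < ev s' (Var 10)"
    obtain j where S': "static s'" "arr s' 6 = pt" and aug: "augmenting N pt (arr s' 5) r ord par ok j 0" and t: "tm s' \<le> T"
      using I c unfolding augment_st_def by auto
    have eq: "net_flow (arr s' 5) p = int r * (p 1 - p 0) + (p 1 - p 0)" for p
      using aug unfolding augmenting_def by blast
    have "net_flow (arr s' 5) p = int (Suc r) * (p 1 - p 0)" for p
      using eq[of p] by (simp add: algebra_simps)
    then have "flow_state N pt (arr s' 5) (Suc r) l"
      using aug fsp(3) by (simp add: flow_state_def augmenting_def)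
    then show "var (s'\<lparr>tm := Suc (tm s')\<rparr>) 20 = r \<longrightarrow> wp (incr 20) ?Q (s'\<lparr>tm := Suc (tm s')\<rparr>)"
      using S'(1)[unfolded static_def base_def] t M r by (simp add: incr_def static_def base_def T_def r_def)
  next
    fix s'
    assume I: "?I s'" and c: "ev s' (Num 0) < ev s' (Var 10)"
    define y where "y = var s' 10"
    obtain j where S': "static s'" "arr s' 6 = pt" "arr s' 8 = par" and aug: "augmenting N pt (arr s' 5) r ord par ok j y"
      and t: "tm s' + 6 * j \<le> T"
      using I unfolding augment_st_def y_def by blast
    have y0: "y \<noteq> 0" "var s' 10 = y"
      using c by (simp_all add: y_def)
    note st = augmenting_step[OF aug y0(1) ord(1,2) _ ok]
    define i where "i = par y"
    have i: "i < M" "0 < arr s' 5 i" and ex: "\<exists>j'<j. augmenting N pt (push i (arr s' 5)) r ord par ok j' (tail i)"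
      using st par unfolding i_def by blast+
    obtain j' where j': "j' < j" "augmenting N pt (push i (arr s' 5)) r ord par ok j' (tail i)"
      using ex by blast
    have "y \<in> nodes"
      using aug ord(3) nth_mem[of j ord] by (auto simp: augmenting_def)
    then have yL: "y < L" "i < L" "twin i < L" "twin i < M"
      using nodes_less[of y] i(1) twin_less[OF i(1)] M L_large by linarith+
    have cap: "arr s' 5 i \<le> N" "arr s' 5 (twin i) \<le> N"
      using capacities_le[of "arr s' 5"] i(1) yL(4) aug by (auto simp: augmenting_def)
    have step: "?I s''" if "var s'' = (var s')(11 := i, 10 := tail i)"
        "arr s'' = (arr s')(5 := push i (arr s' 5))" "tm s'' \<le> tm s' + 6" for s''
      using j' t S' S'(1)[unfolded static_def base_def] that
      unfolding augment_st_def by (intro conjI exI[of _ j']) (simp_all add: static_def base_def)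
    have push_eq: "(arr s' 5)(i := arr s' 5 i - Suc 0, twin i := Suc (arr s' 5 (twin i))) = push i (arr s' 5)"
      by (simp add: push_def)
    show "wp ?body ?I (s'\<lparr>tm := Suc (tm s')\<rparr>)"
      using S'(1)[unfolded static_def base_def] S'(3) y0 i yL cap N_Suc_less M i_def[symmetric]
      by (simp add: index_ok_def twin_exp_def xor_1 push_eq step)
  next
    show "tm s' \<le> T" if "?I s'" for s'
      using that unfolding augment_st_def by auto
  qed (use that M in simp_all)
  have start: "?I s1" if "var s1 = (var s)(10 := 1)" "arr s1 = arr s" "tm s1 \<le> tm s + 1" for s1
  proof -
    obtain j where j: "j < length ord" "ord ! j = 1"
      using ord(4) by (auto simp: in_set_conv_nth)
    have "augmenting N pt (arr s 5) r ord par ok j 1"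
      using j fsp par ok1 unfolding augmenting_def by auto
    moreover have "length ord = card (set ord)"
      using ord(1) by (simp add: distinct_card)
    then have "length ord \<le> M + 2"
      using card_mono[OF finite_nodes ord(3)] card_nodes by simp
    ultimately show ?thesis
      using that e sS j(1) unfolding augment_st_def
      by (intro conjI exI[of _ j]) (simp_all add: static_def base_def T_def)
  qed
  have loop': "wp (While (Num 0) (Var 10) ?body) (wp (incr 20) ?Q) s1" if "?I s1" "var s1 20 = var s 20" for s1
    by (rule wp_frame[OF loop[OF that(1)]]) (use that(2) in \<open>simp add: r_def\<close>)
  show ?thesis
    unfolding augment_code_def wp_Seq
    using M by (simp add: loop'[unfolded wp_Seq One_nat_def] start)
qed

text \<open>A phase without augmentation brings \<open>l\<close> down to \<open>K\<close> and is the
  last, so \<open>r\<close> plus the indicator of \<open>l = K\<close> counts the phases. No node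
  rises by more than the source while the sink stays at \<open>len + K\<close>, which keeps all
  potentials small.\<close>

definition flow_st :: "nat \<Rightarrow> nat \<Rightarrow> st \<Rightarrow> bool" where
  "flow_st T0 len s \<longleftrightarrow> static s \<and> arr s 9 = (\<lambda>_. 0) \<and>
     flow_state N (arr s 6) (arr s 5) (var s 20) (var s 15) \<and> K \<le> var s 15 \<and> var s 15 \<le> len + K \<and>
     var s 20 \<le> Rm \<and> arr s 6 1 = len + K \<and> (\<forall>x\<in>nodes. arr s 6 x \<le> len + K + arr s 6 0) \<and>
     tm s \<le> T0 + (100 * M + 100) * (var s 20 + (if var s 15 = K then 1 else 0))"

lemma flow_stI:
  assumes "static s" "arr s 9 = (\<lambda>_. 0)" "flow_state N (arr s 6) (arr s 5) r l" "var s 20 = r" "var s 15 = l"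
    "K \<le> l" "l \<le> len + K" "r \<le> Rm" "arr s 6 1 = len + K" "\<And>x. x \<in> nodes \<Longrightarrow> arr s 6 x \<le> len + K + arr s 6 0"
    "tm s \<le> T0 + (100 * M + 100) * (r + (if l = K then 1 else 0))"
  shows "flow_st T0 len s"
  using assms unfolding flow_st_def by simp

lemma written:
  "wvars dial_code = {9, 10, 11, 12, 16, 17, 18}" "warrs dial_code = {7, 8, 9, 10}"
  "wvars raise_code = {10, 11, 15, 19}" "warrs raise_code = {6, 7}"
  "wvars augment_code = {10, 11, 20}" "warrs augment_code = {5}"
  by (auto simp: dial_code_def raise_code_def augment_code_def incr_def)

lemma phase_correct:
  assumes I: "flow_st T0 len s" and K: "K < var s 15" and r: "var s 20 < Rm"
    and len: "len \<le> 2 * n + 2" "len \<le> M + 2"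
  shows "wp (dial_code ;; raise_code ;; Ite (Var 19) (Var 16) augment_code Skip) (flow_st T0 len) (s\<lparr>tm := Suc (tm s)\<rparr>)"
proof -
  define pt rc l r where "pt = arr s 6" and "rc = arr s 5" and "l = var s 15" and "r = var s 20"
  let ?s = "s\<lparr>tm := Suc (tm s)\<rparr>"
  have S: "static s" "arr s 9 = (\<lambda>_. 0)" and fs: "flow_state N pt rc r l"
    and l: "K < l" "l \<le> len + K" and rr: "r < Rm" and pt1: "pt 1 = len + K"
    and pts: "\<And>x. x \<in> nodes \<Longrightarrow> pt x \<le> len + K + pt 0"
    and t: "tm s \<le> T0 + (100 * M + 100) * r"
    using I K r unfolding flow_st_def pt_def rc_def l_def r_def by simp_all
  have fs': "capacities N rc" "feasible pt rc" "pt 1 = pt 0 + l" "\<And>p. net_flow rc p = int r * (p 1 - p 0)"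
    using fs by (simp_all add: flow_state_def)
  define D0 where "D0 = l - K"
  have D0: "0 < D0" "l = D0 + K" "D0 \<le> 2 * n + 2" "D0 \<le> M + 2"
    using l len by (simp_all add: D0_def)
  have "small_pot pt"
    unfolding small_pot_def
  proof
    fix x
    assume "x \<in> nodes"
    then show "pt x \<le> 4 * n + 2 * k + 4"
      using pts[of x] fs'(3) pt1 len K_bounds by linarith
  qed
  note small = this
  have S1: "static ?s" "arr ?s 6 = pt" "arr ?s 5 = rc" "arr ?s 9 = (\<lambda>_. 0)" "var ?s 15 = D0 + K"
    using S D0(2) by (simp_all add: static_def base_def pt_def rc_def l_def)
  have rL: "Suc r < L" "l < L"
    using rr Rm_bounds l len K_bounds L_large by linarith+
  show ?thesis
    unfolding wp_Seq
  proof (rule wp_frame[OF dial_correct[OF S1 D0(1) fs'(2) small D0(3,4)]], unfold written)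
    fix s1
    assume d1: "dial_done pt rc D0 s1 \<and> tm s1 \<le> tm ?s + 80 * M + 50"
      and f1: "\<And>x. x \<notin> {9, 10, 11, 12, 16, 17, 18} \<Longrightarrow> var s1 x = var ?s x"
        "\<And>a. a \<notin> {7, 8, 9, 10} \<Longrightarrow> arr s1 a = arr ?s a"
    define dst par where "dst = arr s1 7" and "par = arr s1 8"
    obtain d x pend ord bks where Dl: "dial pt rc D0 d x pend ord bks dst par" and dD: "\<not> d < D0"
      and s1: "static s1" "arr s1 6 = pt" "arr s1 5 = rc" "var s1 16 = D0" "arr s1 9 = (\<lambda>_. 0)"
      using d1 unfolding dial_done_def dst_def par_def by blast
    have v1: "var s1 15 = l" "var s1 20 = r"
      using f1(1)[of 15] f1(1)[of 20] by (simp_all add: l_def r_def)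
    define D where "D = dst 1"
    have one: "0 \<in> nodes" "1 \<in> nodes"
      by (simp_all add: nodes_def)
    have D: "D \<le> D0" "dst 0 = 0" "dst 1 = D" "D \<le> var s1 15" "D \<le> 2 * n + 2" "var s1 15 < L"
      using dial_facts(5)[OF Dl one(2)] dial_facts(7)[OF Dl] v1 D0 rL by (simp_all add: D_def)
    note relax = dial_end(2)[OF Dl dD]
    show "wp raise_code (wp (Ite (Var 19) (Var 16) augment_code Skip) (flow_st T0 len)) s1"
    proof (rule wp_frame[OF raise_correct[OF s1(1,2) dst_def[symmetric] D(2-6) small]], unfold written)
      fix s2
      assume d2: "static s2 \<and> (\<forall>x\<in>nodes. arr s2 6 x = raised D dst pt x) \<and>
          var s2 15 = var s1 15 - D \<and> var s2 19 = D \<and> tm s2 \<le> tm s1 + 6 * M + 6"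
        and f2: "\<And>x. x \<notin> {10, 11, 15, 19} \<Longrightarrow> var s2 x = var s1 x"
          "\<And>a. a \<notin> {6, 7} \<Longrightarrow> arr s2 a = arr s1 a"
      define pt' where "pt' = arr s2 6"
      have s2: "static s2" "var s2 15 = l - D" "var s2 19 = D" "tm s2 \<le> tm s + 86 * M + 57"
        and pt': "\<And>x. x \<in> nodes \<Longrightarrow> pt' x = raised D dst pt x"
        using d1 d2 v1 by (simp_all add: pt'_def)
      have e2: "arr s2 5 = rc" "arr s2 8 = par" "arr s2 9 = (\<lambda>_. 0)" "var s2 16 = D0" "var s2 20 = r"
        using f2(1)[of 16] f2(1)[of 20] f2(2)[of 5] f2(2)[of 8] f2(2)[of 9] s1 v1 by (simp_all add: par_def)
      have p01: "pt' 0 = pt 0 + D" "pt' 1 = pt 1"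
        using pt'[OF one(1)] pt'[OF one(2)] D(2,3) by (simp_all add: raised_def)
      have fe: "feasible pt' rc"
        using raised_feasible[OF fs'(2) relax pt'] .
      have fs2: "flow_state N pt' rc r (l - D)"
        using fs' fe p01 D(1) D0(2) unfolding flow_state_def by simp
      have pts': "pt' x \<le> len + K + pt' 0" if "x \<in> nodes" for x
        using pts[OF that] pt'[OF that] p01 unfolding raised_def by linarith
      have pt1': "pt' 1 = len + K"
        using p01 pt1 by simp
      have D0L: "D0 < L"
        using D0(3) L_large by linarith
      show "wp (Ite (Var 19) (Var 16) augment_code Skip) (flow_st T0 len) s2"
      proof (cases "D < D0")
        case True
        let ?s2 = "s2\<lparr>tm := Suc (tm s2)\<rparr>"
        have in_ord: "1 \<in> set ord"
          using dial_facts(6)[OF Dl one(2)] True by (simp add: D_def)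
        have po: "par (ord ! j) < M" "head (par (ord ! j)) = ord ! j" "0 < rc (par (ord ! j))"
            "dst (ord ! j) = dst (tail (par (ord ! j))) + slack pt (par (ord ! j))"
            "tail (par (ord ! j)) \<in> set (take j ord)" if "0 < j" "j < length ord" for j
          using dial_facts(9)[OF Dl] that unfolding par_ok_def by blast+
        have st2: "static ?s2" "arr ?s2 6 = pt'" "arr ?s2 8 = par" "flow_state N pt' (arr ?s2 5) (var ?s2 20) (l - D)"
          "Suc (var ?s2 20) < L"
          using s2(1) e2 fs2 rL by (simp_all add: static_def base_def pt'_def)
        have "wp augment_code (flow_st T0 len) ?s2"
        proof (rule wp_frame[OF augment_correct[where ok = "\<lambda>y. dst y \<le> D", OF st2(1-3)
              dial_facts(1)[OF Dl] dial_facts(3)[OF Dl] dial_facts(4)[OF Dl] in_ord _ _ _ st2(4,5)]], unfold written)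
          show "par (ord ! j) < M \<and> head (par (ord ! j)) = ord ! j \<and>
              tail (par (ord ! j)) \<in> set (take j ord) \<and> 0 < arr ?s2 5 (par (ord ! j))"
            if "0 < j" "j < length ord" for j
            using po[OF that] e2(1) by simp
          show "dst (tail (par (ord ! j))) \<le> D \<and>
              pt' (tail (par (ord ! j))) + cost (par (ord ! j)) = pt' (head (par (ord ! j))) + cost (twin (par (ord ! j)))"
            if "0 < j" "j < length ord" "dst (ord ! j) \<le> D" for j
          proof
            note p = po[OF that(1,2)]
            show "dst (tail (par (ord ! j))) \<le> D"
              using p(4) that(3) by linarith
            show "pt' (tail (par (ord ! j))) + cost (par (ord ! j)) = pt' (head (par (ord ! j))) + cost (twin (par (ord ! j)))"
              using p(2,4) that(3) by (intro raised_tight[OF fs'(2) p(1,3) _ _ pt']) simp_all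
          qed
          show "dst 1 \<le> D"
            by (simp add: D_def)
        next
          fix s3
          assume d3: "static s3 \<and> flow_state N pt' (arr s3 5) (Suc (var ?s2 20)) (l - D) \<and>
              var s3 20 = Suc (var ?s2 20) \<and> tm s3 \<le> tm ?s2 + 6 * M + 16"
            and f3: "\<And>x. x \<notin> {10, 11, 20} \<Longrightarrow> var s3 x = var ?s2 x"
              "\<And>a. a \<notin> {5} \<Longrightarrow> arr s3 a = arr ?s2 a"
          have "arr s3 6 = pt'" "arr s3 9 = (\<lambda>_. 0)" "var s3 15 = l - D"
            using f3(1)[of 15] f3(2)[of 6] f3(2)[of 9] e2(3) s2(2) by (simp_all add: pt'_def)
          then show "flow_st T0 len s3"
            using d3 e2(5) pt1' pts' rr l True t s2(4) D0(2)
            by (intro flow_stI[of _ "Suc r" "l - D"]) (simp_all add: algebra_simps)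
        qed
        then show ?thesis
          using True s2(3) e2(4) by simp
      next
        \<comment> \<open>The sink is at distance exactly \<open>D0\<close>, so \<open>l\<close>
          falls to \<open>K\<close> and nothing is augmented.\<close>
        case False
        then have "l - D = K"
          using D(1) D0(2) by simp
        then have "flow_st T0 len s3" if "var s3 = var s2" "arr s3 = arr s2" "tm s3 \<le> tm s2 + 1" for s3
          using that s2 e2 fs2 pt1' pts' rr l t s2(1)[unfolded static_def base_def] pt'_def
          by (intro flow_stI[of _ r K]) (simp_all add: static_def base_def algebra_simps)
        then show ?thesis
          using False s2(3) e2(4) by simp
      qed
    qed
  qed
qed

lemma flow_correct:
  assumes "flow_ready len s" "arr s 9 = (\<lambda>_. 0)"
  shows "wp flow_code (\<lambda>s'. static s' \<and> flow_state N (arr s' 6) (arr s' 5) (var s' 20) (var s' 15) \<and>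
    K \<le> var s' 15 \<and> var s' 15 \<le> len + K \<and> var s' 20 \<le> Rm \<and> (var s' 15 = K \<or> var s' 20 = Rm) \<and>
    (\<forall>x\<in>nodes. arr s' 6 x \<le> 4 * n + 2 * k + 4) \<and>
    tm s' \<le> tm s + (100 * M + 100) * (var s' 20 + 1) + 1) s"
proof -
  have len: "len \<le> 2 * n + 2" "len \<le> M + 2" "1 \<le> len"
    using assms(1) unfolding flow_ready_def by simp_all
  \<comment> \<open>A crude bound that ensures termination; the postcondition measures time by the
    final flow value instead.\<close>
  let ?T = "tm s + (100 * M + 100) * (n + 1)"
  show ?thesis
    unfolding flow_code_def
  proof (rule wp_While_tm[where I = "flow_st (tm s) len" and T = ?T])
    show "flow_st (tm s) len s"
    proof -
      have fr: "flow_state N (arr s 6) (arr s 5) 0 (var s 15)" "var s 15 = len + K"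
        using assms(1) unfolding flow_ready_def by blast+
      show ?thesis
        using assms Rm_bounds fr(1)[unfolded fr(2)] unfolding flow_ready_def
        by (intro flow_stI[of _ 0 "len + K"]) simp_all
    qed
  next
    fix s'
    assume I: "flow_st (tm s) len s'"
    have f: "flow_state N (arr s' 6) (arr s' 5) (var s' 20) (var s' 15)" "K \<le> var s' 15" "var s' 15 \<le> len + K" "var s' 20 \<le> Rm"
      and t: "tm s' \<le> tm s + (100 * M + 100) * (var s' 20 + (if var s' 15 = K then 1 else 0))"
      and b: "static s'"
      using I unfolding flow_st_def by simp_all
    have "var s' 20 \<le> var s' 20 * var s' 15"
      using f(2) K_bounds by simp
    then have r: "var s' 20 \<le> n"
      using flow_le_n[OF f(1)] by linarith
    have "(100 * M + 100) * (var s' 20 + (if var s' 15 = K then 1 else 0)) \<le> (100 * M + 100) * (n + 1)"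
      using r by (intro mult_le_mono2) simp
    then show "tm s' \<le> ?T"
      using t by linarith
    have "(var s' 15 - K) * (Rm - var s' 20) < L"
    proof (rule product_less_L)
      have le: "2 * n + k + 2 \<le> 2 * (n + length es + k + 2)"
        by simp
      have "var s' 15 - K \<le> 2 * n + k + 2" "Rm - var s' 20 \<le> 2 * n + k + 2"
        using f(3) len(1) Rm_bounds(2) by linarith+
      then show "var s' 15 - K \<le> 2 * (n + length es + k + 2)" "Rm - var s' 20 \<le> 2 * (n + length es + k + 2)"
        using le by (blast intro: le_trans)+
    qed
    moreover have "var s' 15 - K < L" "Rm - var s' 20 < L" "0 < L"
      using f len Rm_bounds L_large by linarith+
    ultimately show "safe s' (Num 0) \<and> safe s' ((Var 15 -. Var 4) *. (Var 5 -. Var 20))"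
      using b f by (simp add: static_def base_def)
  next
    fix s'
    assume I: "flow_st (tm s) len s'" and c: "ev s' (Num 0) < ev s' ((Var 15 -. Var 4) *. (Var 5 -. Var 20))"
    then have "K < var s' 15" "var s' 20 < Rm"
      unfolding flow_st_def static_def base_def by simp_all
    then show "wp (dial_code ;; raise_code ;; Ite (Var 19) (Var 16) augment_code Skip) (flow_st (tm s) len) (s'\<lparr>tm := Suc (tm s')\<rparr>)"
      using phase_correct[OF I _ _ len(1,2)] by blast
  next
    fix s'
    assume I: "flow_st (tm s) len s'" and c: "\<not> ev s' (Num 0) < ev s' ((Var 15 -. Var 4) *. (Var 5 -. Var 20))"
    have f: "flow_state N (arr s' 6) (arr s' 5) (var s' 20) (var s' 15)" "K \<le> var s' 15" "var s' 15 \<le> len + K" "var s' 20 \<le> Rm"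
      and t: "tm s' \<le> tm s + (100 * M + 100) * (var s' 20 + (if var s' 15 = K then 1 else 0))"
      and b: "static s'" and p: "arr s' 6 1 = len + K" "\<And>x. x \<in> nodes \<Longrightarrow> arr s' 6 x \<le> len + K + arr s' 6 0"
      using I unfolding flow_st_def by simp_all
    have "arr s' 6 x \<le> 4 * n + 2 * k + 4" if "x \<in> nodes" for x
    proof -
      have "arr s' 6 0 \<le> len + K"
        using f(1) p(1) by (simp add: flow_state_def)
      then show ?thesis
        using p(2)[OF that] len K_bounds by linarith
    qed
    moreover have "var s' 15 = K \<or> var s' 20 = Rm"
      using c f b by (auto simp: static_def base_def)
    moreover have "(100 * M + 100) * (var s' 20 + (if var s' 15 = K then 1 else 0)) \<le> (100 * M + 100) * (var s' 20 + 1)"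
      by (intro mult_le_mono2) simp
    ultimately show "static (s'\<lparr>tm := Suc (tm s')\<rparr>) \<and>
      flow_state N (arr (s'\<lparr>tm := Suc (tm s')\<rparr>) 6) (arr (s'\<lparr>tm := Suc (tm s')\<rparr>) 5) (var (s'\<lparr>tm := Suc (tm s')\<rparr>) 20) (var (s'\<lparr>tm := Suc (tm s')\<rparr>) 15) \<and>
      K \<le> var (s'\<lparr>tm := Suc (tm s')\<rparr>) 15 \<and> var (s'\<lparr>tm := Suc (tm s')\<rparr>) 15 \<le> len + K \<and> var (s'\<lparr>tm := Suc (tm s')\<rparr>) 20 \<le> Rm \<and>
      (var (s'\<lparr>tm := Suc (tm s')\<rparr>) 15 = K \<or> var (s'\<lparr>tm := Suc (tm s')\<rparr>) 20 = Rm) \<and>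
      (\<forall>x\<in>nodes. arr (s'\<lparr>tm := Suc (tm s')\<rparr>) 6 x \<le> 4 * n + 2 * k + 4) \<and>
      tm (s'\<lparr>tm := Suc (tm s')\<rparr>) \<le> tm s + (100 * M + 100) * (var (s'\<lparr>tm := Suc (tm s')\<rparr>) 20 + 1) + 1"
      using f t b[unfolded static_def base_def] by (simp add: static_def base_def)
  qed
qed

section \<open>Extracting chains from the flow\<close>

definition walk_st where
  "walk_st rc0 rho W r T s \<longleftrightarrow> base s \<and> var s 7 = M \<and> arr s 3 = head \<and> arr s 4 = cost \<and> arr s 2 = nx \<and> var s 20 = r \<and>
     (\<exists>rest pl. walking rc0 r (arr s 5) (var s 21) (var s 9) rest (arr s 0) pl \<and>
       (\<forall>y. llist nx (arr s 14 y) (rest y)) \<and> tm s + 9 * walking_measure rho W r (var s 21) (var s 9) rest \<le> T)"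

lemma walk_stI:
  assumes "base s" "var s 7 = M" "arr s 3 = head" "arr s 4 = cost" "arr s 2 = nx" "var s 20 = r"
    "walking rc0 r (arr s 5) j x rest (arr s 0) pl" "var s 21 = j" "var s 9 = x"
    "\<And>y. llist nx (arr s 14 y) (rest y)" "tm s + 9 * walking_measure rho W r j x rest \<le> T"
  shows "walk_st rc0 rho W r T s"
  using assms unfolding walk_st_def by blast

lemma twin_less_1: "twin x < Suc 0 \<longleftrightarrow> x = 1"
  by (auto simp: twin_def elim: oddE)

text \<open>The bound \<open>N\<close> on residual capacities is carried along to keep the product
  in the test below \<open>L\<close>.\<close>

lemma walk_step:
  assumes I: "walk_st rc0 rho W r T s" and c: "var s 21 < var s 20"
    and caps: "capacities N rc0" "\<And>i. i < M \<Longrightarrow> arr s 5 i \<le> N" and rho: "ranking rho" "\<And>x. rho x \<le> W" and r: "r \<le> n"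
  shows "wp (Ite (Bin Xor (Var 9) (Num 1)) (Num 1) (
         incr 21 ;; Asg 9 (Num 0)) (
         Asg 11 (Rd 14 (Var 9) -. Num 1) ;;
         Ite (Num 0) ((Num 1 -. Bin Modulo (Var 11) (Num 2)) *. Rd 5 (twin_exp (Var 11))) (
           Wr 5 (Var 11 +. Num 1) (Rd 5 (Var 11 +. Num 1) -. Num 1) ;;
           Ite (Num 0) (Rd 4 (Var 11)) (
             Wr 0 (Bin Divide (Var 9) (Num 2) -. Num 1) (Var 21 +. Num 1)) Skip ;;
           Asg 9 (Rd 3 (Var 11))) (
           Wr 14 (Var 9) (Rd 2 (Var 11)))))
      (\<lambda>s'. walk_st rc0 rho W r T s' \<and> (\<forall>i<M. arr s' 5 i \<le> N)) (s\<lparr>tm := Suc (tm s)\<rparr>)"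
proof -
  obtain rest pl where b: "base s" "var s 7 = M" "arr s 3 = head" "arr s 4 = cost" "arr s 2 = nx" "var s 20 = r"
    and W: "walking rc0 r (arr s 5) (var s 21) (var s 9) rest (arr s 0) pl"
    and ll: "\<And>y. llist nx (arr s 14 y) (rest y)"
    and t: "tm s + 9 * walking_measure rho W r (var s 21) (var s 9) rest \<le> T"
    using I unfolding walk_st_def by blast
  note bs = b(1)[unfolded base_def]
  have twin_0: "twin y = 0 \<longleftrightarrow> y = 1" for y
    using twin_less_1[of y] by simp
  define j x where "j = var s 21" and "x = var s 9"
  have jx: "var s 21 = j" "var s 9 = x" "j < r"
    using c b(6) by (simp_all add: j_def x_def)
  note W' = W[unfolded jx(1,2)] and t' = t[unfolded jx(1,2)]
  have M: "M < L" "1 < L" "2 < L" "0 < L"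
    using M_bound L_large by linarith+
  have x: "x \<in> nodes" "x < 2 * n + 2"
    using walking_facts(3)[OF W'] nodes_less by simp_all
  have xL: "x < L" "twin x < L" "Suc j < L"
    using x twin_less_even[of x "n + 1"] jx(3) r L_large by simp_all
  have arr5: "arr s 5 i \<le> N" if "i < M" for i
    using caps(2) that .
  show ?thesis
  proof (cases "x = 1")
    case True
    have "walk_st rc0 rho W r T s'"
      if "var s' = (var s)(21 := Suc j, 9 := 0)" "arr s' = arr s" "tm s' \<le> tm s + 8" for s'
      using walking_next_path[of rc0 r "arr s 5" j rest "arr s 0" pl rho W, OF W'[unfolded True] rho(2)] that b bs ll t' True
      by (intro walk_stI[of _ _ _ "Suc j" 0 rest "[]"]) (simp_all add: base_def)
    then show ?thesis
      using True jx xL M arr5 by (simp add: xor_1 twin_0 incr_def twin_def)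
  next
    case False
    obtain i l where il: "rest x = i # l"
      using walking_rest[OF W' jx(3) False] by (cases "rest x") auto
    have first: "arr s 14 x = Suc i" "llist nx (nx i) l"
      using ll[of x] il by simp_all
    have i: "i < M" "tail i = x"
      using walking_facts(6)[OF W', of i x] il by simp_all
    have tw: "twin i < M"
      using twin_less[OF i(1)] .
    have iL: "i < L" "twin i < L" "head i < L"
      using i(1) tw head_less(1)[OF i(1)] M L_large by linarith+
    have prod: "(Suc 0 - i mod 2) * arr s 5 (twin i) < L"
      using arr5[OF tw] N_Suc_less by (cases "even i") (simp_all add: even_iff_mod_2_eq_zero odd_iff_mod_2_eq_one)
    show ?thesis
    proof (cases "even i \<and> 0 < arr s 5 (Suc i)")
      case True
      have iw: "twin i = Suc i"
        using True by (simp add: twin_def)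
      define rc' where "rc' = (arr s 5)(Suc i := arr s 5 (Suc i) - 1)"
      define lab' where "lab' = (if cost i = 1 then (arr s 0)(arc_vertex i := Suc j) else arr s 0)"
      have ifw: "i \<in> fwd" "head (Suc i) = x"
        using walking_take(3,4)[OF W' il jx(3) _ _ lab'_def] True caps(1) iw i
        by (auto simp: fwd_def)
      have cap: "cost i = 1 \<Longrightarrow> rc0 (Suc i) \<le> 1"
        using caps(1) ifw(1) by (force simp: capacities_def)
      have ep: "even i" "0 < arr s 5 (Suc i)"
        using True by simp_all
      have "\<exists>pl'. walking rc0 r rc' j (head i) rest lab' pl'"
        unfolding rc'_def by (rule walking_take(1)[OF W' il jx(3) ep lab'_def cap])
      then obtain pl' where pl': "walking rc0 r rc' j (head i) rest lab' pl'"
        by blast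
      have m: "walking_measure rho W r j (head i) rest < walking_measure rho W r j x rest"
        by (rule walking_take(2)[OF W' il jx(3) ep lab'_def cap rho])
      have fin: "walk_st rc0 rho W r T s'"
        if "var s' = (var s)(11 := i, 9 := head i)" "arr s' 5 = rc'" "arr s' 0 = lab'"
          "arr s' 14 = arr s 14" "arr s' 2 = arr s 2" "arr s' 3 = arr s 3" "arr s' 4 = arr s 4" "tm s' \<le> tm s + 8" for s'
        using pl' m that b bs ll t' jx
        by (intro walk_stI[of _ _ _ j "head i" rest pl']) (simp_all add: base_def)
      have rcN: "rc' a \<le> N" if "a < M" for a
        using arr5[OF that] by (auto simp: rc'_def intro: le_trans[OF diff_le_self])
      have rc'_eq: "(arr s 5)(Suc i := arr s 5 (Suc i) - Suc 0) = rc'"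
        by (simp add: rc'_def)
      have val: "arr s 5 (Suc i) - Suc 0 < L" "Suc i < L" "Suc 0 \<le> arr s 5 (Suc i)"
        using arr5[OF tw] N_Suc_less True iL(2) unfolding iw by simp_all
      have im: "i mod 2 = 0"
        using True by (simp add: even_iff_mod_2_eq_zero)
      show ?thesis
      proof (cases "cost i = 1")
        case unit: True
        note av = arc_vertex[OF ifw(1) unit]
        have xv: "x div 2 - Suc 0 = arc_vertex i" "Suc 0 \<le> x div 2" "arc_vertex i < bs" "arc_vertex i < L" "x div 2 < L"
          using av ifw(2) bs_bounds xL L_large by auto
        show ?thesis
          using False True unit jx xL M b bs first iL prod[unfolded iw] val xv fin rcN rc'_eq im iw lab'_def
          by (simp add: xor_1 twin_0 index_ok_def twin_exp_def)
      next
        case nounit: False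
        then have "cost i = 0"
          using cost_le(1)[OF ifw(1)] by linarith
        then show ?thesis
          using False True jx xL M b bs first iL prod[unfolded iw] val fin rcN rc'_eq im iw lab'_def
          by (simp add: xor_1 twin_0 index_ok_def twin_exp_def)
      qed
    next
      case nothing: False
      then have no_flow: "odd i \<or> arr s 5 (Suc i) = 0"
        by simp
      have fin: "walk_st rc0 rho W r T s'"
        if "var s' = (var s)(11 := i)" "arr s' = (arr s)(14 := (arr s 14)(x := nx i))" "tm s' \<le> tm s + 8" for s'
        using walking_skip(1)[OF W' il no_flow] walking_skip(2)[OF W' il no_flow, of rho W] that b bs ll first t' jx
        by (intro walk_stI[of _ _ _ j x "rest(x := l)" pl]) (simp_all add: base_def)
      have z: "(Suc 0 - i mod 2) * arr s 5 (twin i) = 0"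
        using no_flow by (cases "even i") (simp_all add: twin_def odd_iff_mod_2_eq_one)
      have parity: "i mod 2 = Suc 0 \<or> i mod 2 = 0 \<and> arr s 5 (twin i) = 0"
        using no_flow by (cases "even i") (simp_all add: twin_def odd_iff_mod_2_eq_one)
      have md: "i mod 2 \<le> Suc 0" "i mod 2 < L" "Suc 0 - i mod 2 < L"
        using M by (simp_all add: less_imp_diff_less)
      show ?thesis
        using parity md False jx xL M b bs first iL z fin arr5
        by (elim disjE conjE) (simp_all add: xor_1 twin_0 index_ok_def twin_exp_def)
    qed
  qed
qed

lemma chain_correct:
  assumes S: "static s" and fs: "flow_state N pt (arr s 5) r l" and r: "var s 20 = r" "r \<le> n"
    and rho: "ranking rho" "\<And>x. rho x \<le> W"
  shows "wp chain_code (\<lambda>s'. base s' \<and> (\<forall>v<n. arr s' 0 v \<le> r) \<and>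
    (\<forall>i\<in>{1..r}. dag_chain {..<n} (set es) (label_class n (arr s' 0) i)) \<and>
    (\<forall>i\<in>fwd. cost i = 1 \<longrightarrow> 0 < arr s 5 (Suc i) \<longrightarrow> 0 < arr s' 0 (arc_vertex i)) \<and>
    tm s' \<le> tm s + 3 * n + 9 * (r * (W + 2) + W + 1 + M) + 6) s"
proof -
  note sS = S[unfolded static_def base_def]
  have M: "M < L" "1 < L" "0 < L" "n < L"
    using M_bound L_large by linarith+
  define rc0 where "rc0 = arr s 5"
  have caps: "capacities N rc0" and flow: "\<And>p. net_flow rc0 p = int r * (p 1 - p 0)"
    using fs by (simp_all add: flow_state_def rc0_def)
  define T1 where "T1 = tm s + 3 * n + 1"
  define T2 where "T2 = tm s + 3 * n + 9 * (r * (W + 2) + W + 1 + M) + 4"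
  define Q where "Q = (\<lambda>s'. base s' \<and> (\<forall>v<n. arr s' 0 v \<le> r) \<and>
    (\<forall>i\<in>{1..r}. dag_chain {..<n} (set es) (label_class n (arr s' 0) i)) \<and>
    (\<forall>i\<in>fwd. cost i = 1 \<longrightarrow> 0 < arr s 5 (Suc i) \<longrightarrow> 0 < arr s' 0 (arc_vertex i)) \<and>
    tm s' \<le> tm s + 3 * n + 9 * (r * (W + 2) + W + 1 + M) + 6)"
  let ?I = "\<lambda>s'. walk_st rc0 rho W r T2 s' \<and> (\<forall>i<M. arr s' 5 i \<le> N)"
  let ?loop2 = "While (Var 21) (Var 20) (
       Ite (Bin Xor (Var 9) (Num 1)) (Num 1) (
         incr 21 ;; Asg 9 (Num 0)) (
         Asg 11 (Rd 14 (Var 9) -. Num 1) ;;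
         Ite (Num 0) ((Num 1 -. Bin Modulo (Var 11) (Num 2)) *. Rd 5 (twin_exp (Var 11))) (
           Wr 5 (Var 11 +. Num 1) (Rd 5 (Var 11 +. Num 1) -. Num 1) ;;
           Ite (Num 0) (Rd 4 (Var 11)) (
             Wr 0 (Bin Divide (Var 9) (Num 2) -. Num 1) (Var 21 +. Num 1)) Skip ;;
           Asg 9 (Rd 3 (Var 11))) (
           Wr 14 (Var 9) (Rd 2 (Var 11)))))"
  have loop2: "wp ?loop2 Q s2" if "?I s2" for s2
  proof (rule wp_While_tm[where I = ?I and T = T2])
    fix s'
    assume I: "?I s'" and c: "\<not> ev s' (Var 21) < ev s' (Var 20)"
    obtain rest pl where b: "base s'" "var s' 20 = r"
      and W: "walking rc0 r (arr s' 5) (var s' 21) (var s' 9) rest (arr s' 0) pl" and t: "tm s' \<le> T2"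
      using I unfolding walk_st_def by auto
    have "var s' 21 = r"
      using c b(2) walking_facts(1)[OF W] by simp
    note e = walking_end[OF W[unfolded this]]
    show "Q (s'\<lparr>tm := Suc (tm s')\<rparr>)"
      using b(1)[unfolded base_def] e t unfolding Q_def by (simp add: base_def T2_def rc0_def)
  next
    fix s'
    assume "?I s'" "ev s' (Var 21) < ev s' (Var 20)"
    then show "wp (Ite (Bin Xor (Var 9) (Num 1)) (Num 1) (
         incr 21 ;; Asg 9 (Num 0)) (
         Asg 11 (Rd 14 (Var 9) -. Num 1) ;;
         Ite (Num 0) ((Num 1 -. Bin Modulo (Var 11) (Num 2)) *. Rd 5 (twin_exp (Var 11))) (
           Wr 5 (Var 11 +. Num 1) (Rd 5 (Var 11 +. Num 1) -. Num 1) ;;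
           Ite (Num 0) (Rd 4 (Var 11)) (
             Wr 0 (Bin Divide (Var 9) (Num 2) -. Num 1) (Var 21 +. Num 1)) Skip ;;
           Asg 9 (Rd 3 (Var 11))) (
           Wr 14 (Var 9) (Rd 2 (Var 11))))) ?I (s'\<lparr>tm := Suc (tm s')\<rparr>)"
      by (intro walk_step[OF _ _ caps _ rho r(2)]) simp_all
  next
    show "tm s' \<le> T2" if "?I s'" for s'
      using that unfolding walk_st_def by auto
  qed (use that in simp_all)
  define I1 where "I1 s' \<longleftrightarrow> static s' \<and> var s' 20 = r \<and> arr s' 5 = rc0 \<and> var s' 8 \<le> n \<and> (\<forall>v<var s' 8. arr s' 0 v = 0) \<and>
    tm s' + 3 * (n - var s' 8) \<le> T1" for s'
  have loop1: "wp (While (Var 8) (Var 24) (Wr 0 (Var 8) (Num 0) ;; incr 8))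
      (wp (Asg 21 (Num 0) ;; Asg 9 (Num 0) ;; ?loop2) Q) s1" if "I1 s1" for s1
  proof (rule wp_While_tm[where I = I1 and T = T1])
    fix s'
    assume I: "I1 s'" and c: "\<not> ev s' (Var 8) < ev s' (Var 24)"
    note sf = I[unfolded I1_def static_def base_def]
    have z: "\<forall>v<n. arr s' 0 v = 0"
      using sf c by simp
    have meas: "walking_measure rho W r 0 0 adj \<le> r * (W + 2) + W + 1 + M"
    proof -
      have "card {i. i < M \<and> i \<in> set (adj (tail i))} \<le> M"
        using card_mono[of "{..<M}" "{i. i < M \<and> i \<in> set (adj (tail i))}"] by auto
      then show ?thesis
        by (simp add: walking_measure_def)
    qed
    have "walk_st rc0 rho W r T2 s2" if "var s2 = (var s')(21 := 0, 9 := 0)" "arr s2 = arr s'" "tm s2 \<le> tm s' + 3" for s2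
      using that sf meas adj_list walking_start[of rc0 r adj "arr s' 0", OF flow adj] z unfolding T1_def T2_def
      by (intro walk_stI[of _ _ _ 0 0 adj "[]"]) (simp_all add: base_def)
    moreover have "\<forall>i<M. arr s' 5 i \<le> N"
      using sf capacities_le[OF caps] by simp
    ultimately show "wp (Asg 21 (Num 0) ;; Asg 9 (Num 0) ;; ?loop2) Q (s'\<lparr>tm := Suc (tm s')\<rparr>)"
      using M by (simp add: loop2[unfolded One_nat_def])
  next
    fix s'
    assume I: "I1 s'" and c: "ev s' (Var 8) < ev s' (Var 24)"
    note sf = I[unfolded I1_def static_def base_def]
    have "n - var s' 8 = Suc (n - Suc (var s' 8))" "var s' 8 < n"
      using sf c by simp_all
    then show "wp (Wr 0 (Var 8) (Num 0) ;; incr 8) I1 (s'\<lparr>tm := Suc (tm s')\<rparr>)"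
      using sf M bs_bounds by (simp add: index_ok_def incr_def I1_def static_def base_def less_Suc_eq)
  qed (use that in \<open>simp_all add: I1_def\<close>)
  have "I1 s1" if "var s1 = (var s)(8 := 0)" "arr s1 = arr s" "tm s1 \<le> tm s + 1" for s1
    using that sS r by (simp add: I1_def static_def base_def T1_def rc0_def)
  then have "wp chain_code Q s"
    unfolding chain_code_def wp_Seq
    using M by (simp add: loop1[unfolded wp_Seq One_nat_def])
  then show ?thesis
    by (simp only: Q_def)
qed

end

section \<open>Output of antichains and of singletons\<close>

context input
begin

text \<open>Agrees with \<open>antichain_label\<close>, but can be stated before a network is
  fixed.\<close>

definition vertex_label :: "(nat \<Rightarrow> nat) \<Rightarrow> nat \<Rightarrow> nat" where
  "vertex_label pt v = (if v \<in> Field (set es) then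
     (if pt (2 * v + 2) < pt (2 * v + 3) then pt (2 * v + 3) - pt 0 else 0) else 1)"

lemma antichain_code_correct:
  assumes b: "base s" and mk: "arr s 13 = marks"
    and pt: "\<And>v. v \<in> Field (set es) \<Longrightarrow> arr s 6 0 \<le> arr s 6 (2 * v + 3) \<and> arr s 6 (2 * v + 3) < L"
  shows "wp antichain_code (\<lambda>s'. base s' \<and> (\<forall>v<n. arr s' 0 v = vertex_label (arr s 6) v) \<and> tm s' \<le> tm s + 5 * n + 2) s"
proof -
  define pot where "pot = arr s 6"
  define I where "I s' \<longleftrightarrow> base s' \<and> arr s' 13 = marks \<and> arr s' 6 = pot \<and> var s' 8 \<le> n \<and>
    (\<forall>v<var s' 8. arr s' 0 v = vertex_label pot v) \<and> tm s' + 5 * (n - var s' 8) \<le> tm s + 5 * n + 1" for s'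
  have b0: "0 < L" "1 < L" "3 < L"
    using L_large by linarith+
  have loop: "wp (While (Var 8) (Var 24) (
       Ite (Num 0) (Rd 13 (Var 8)) (
         Ite (Rd 6 (Num 2 *. Var 8 +. Num 2)) (Rd 6 (Num 2 *. Var 8 +. Num 3)) (
           Wr 0 (Var 8) (Rd 6 (Num 2 *. Var 8 +. Num 3) -. Rd 6 (Num 0))) (
           Wr 0 (Var 8) (Num 0))) (
         Wr 0 (Var 8) (Num 1)) ;;
       incr 8)) (\<lambda>s'. base s' \<and> (\<forall>v<n. arr s' 0 v = vertex_label (arr s 6) v) \<and> tm s' \<le> tm s + 5 * n + 2) s1" if "I s1" for s1
  proof (rule wp_While_tm[where I = I and T = "tm s + 5 * n + 1"])
    fix s'
    assume I: "I s'" and c: "ev s' (Var 8) < ev s' (Var 24)"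
    note sf = I[unfolded I_def base_def]
    define v where "v = var s' 8"
    have v: "var s' 8 = v" "v < n" "n - v = Suc (n - Suc v)"
      using sf c by (simp_all add: v_def)
    have vL: "v < L" "2 * v + 3 < L" "v < bs" "Suc v < L" "2 * v < L" "Suc (Suc (2 * v)) < L"
      using v(2) L_large bs_bounds by linarith+
    have nxt: "I s''" if "base s''" "arr s'' 13 = marks" "arr s'' 6 = pot" "var s'' 8 = Suc v"
        "arr s'' 0 = (arr s' 0)(v := vertex_label pot v)" "tm s'' \<le> tm s' + 5" for s''
      using that sf v by (simp add: I_def less_Suc_eq)
    show "wp (Ite (Num 0) (Rd 13 (Var 8)) (
         Ite (Rd 6 (Num 2 *. Var 8 +. Num 2)) (Rd 6 (Num 2 *. Var 8 +. Num 3)) (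
           Wr 0 (Var 8) (Rd 6 (Num 2 *. Var 8 +. Num 3) -. Rd 6 (Num 0))) (
           Wr 0 (Var 8) (Num 0))) (
         Wr 0 (Var 8) (Num 1)) ;;
       incr 8) I (s'\<lparr>tm := Suc (tm s')\<rparr>)"
    proof (cases "v \<in> Field (set es)")
      case True
      have p: "pot 0 \<le> pot (2 * v + 3)" "pot (2 * v + 3) < L" "pot (2 * v + 3) - pot 0 < L"
        using pt[OF True] by (simp_all add: pot_def less_imp_diff_less)
      show ?thesis
      proof (cases "pot (2 * v + 2) < pot (2 * v + 3)")
        case less: True
        have "vertex_label pot v = pot (2 * v + 3) - pot 0"
          using True less by (simp add: vertex_label_def)
        then show ?thesis
          using True less p vL v sf b0
          by (simp add: marks_def index_ok_def incr_def nxt base_def)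
      next
        case False
        have "vertex_label pot v = 0"
          using True False by (simp add: vertex_label_def)
        then show ?thesis
          using True False p vL v sf b0
          by (simp add: marks_def index_ok_def incr_def nxt base_def)
      qed
    next
      case False
      have "vertex_label pot v = Suc 0"
        using False by (simp add: vertex_label_def)
      then show ?thesis
        using False vL v sf b0
        by (simp add: marks_def index_ok_def incr_def nxt base_def)
    qed
  next
    fix s'
    assume I: "I s'" and c: "\<not> ev s' (Var 8) < ev s' (Var 24)"
    note sf = I[unfolded I_def base_def]
    have "var s' 8 = n"
      using sf c by simp
    then show "base (s'\<lparr>tm := Suc (tm s')\<rparr>) \<and> (\<forall>v<n. arr (s'\<lparr>tm := Suc (tm s')\<rparr>) 0 v = vertex_label (arr s 6) v) \<and>
        tm (s'\<lparr>tm := Suc (tm s')\<rparr>) \<le> tm s + 5 * n + 2"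
      using sf by (simp add: base_def pot_def)
  qed (use that b0 in \<open>simp_all add: I_def\<close>)
  have "I s1" if "var s1 = (var s)(8 := 0)" "arr s1 = arr s" "tm s1 \<le> tm s + 1" for s1
    using that b[unfolded base_def] mk by (simp add: I_def base_def pot_def)
  then show ?thesis
    unfolding antichain_code_def wp_Seq wp_Asg using b0 by (intro conjI loop) simp_all
qed

lemma fill_correct:
  assumes b: "base s" and c: "var s 22 = c" "var s 23 = l" "c \<le> l" "l < L"
  shows "wp fill_code (\<lambda>s'. (\<forall>v<n. arr s' 0 v = fill c l (arr s 0) v) \<and> tm s' \<le> tm s + 6 * n + 2) s"
proof -
  define lab where "lab = arr s 0"
  \<comment> \<open>Counts the zeros before \<open>v\<close>; on reaching \<open>v\<close> the
    program counter for fresh labels is \<open>c\<close> plus this number, capped at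
    \<open>l\<close>.\<close>
  define zc where "zc v = card {u. u < v \<and> lab u = 0}" for v
  have zc_0: "zc 0 = 0"
    by (simp add: zc_def)
  have zc_Suc: "zc (Suc v) = (if lab v = 0 then Suc (zc v) else zc v)" for v
  proof -
    have "{u. u < Suc v \<and> lab u = 0} = (if lab v = 0 then insert v {u. u < v \<and> lab u = 0} else {u. u < v \<and> lab u = 0})"
      by (auto simp: less_Suc_eq)
    then show ?thesis
      by (simp add: zc_def)
  qed
  have rank: "zero_rank lab v = zc (Suc v)" for v
    by (simp add: zero_rank_def zc_def less_Suc_eq_le)
  define I where "I s' \<longleftrightarrow> base s' \<and> var s' 23 = l \<and> var s' 8 \<le> n \<and> var s' 22 = min l (c + zc (var s' 8)) \<and>
    (\<forall>v<n. arr s' 0 v = (if v < var s' 8 then fill c l lab v else lab v)) \<and>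
    tm s' + 6 * (n - var s' 8) \<le> tm s + 6 * n + 1" for s'
  have b0: "0 < L" "1 < L"
    using L_large by linarith+
  have loop: "wp (While (Var 8) (Var 24) (
       Ite (Num 0) (Rd 0 (Var 8)) Skip (
         Ite (Var 22) (Var 23) (incr 22 ;; Wr 0 (Var 8) (Var 22)) Skip) ;;
       incr 8)) (\<lambda>s'. (\<forall>v<n. arr s' 0 v = fill c l (arr s 0) v) \<and> tm s' \<le> tm s + 6 * n + 2) s1" if "I s1" for s1
  proof (rule wp_While_tm[where I = I and T = "tm s + 6 * n + 1"])
    fix s'
    assume I: "I s'" and cc: "ev s' (Var 8) < ev s' (Var 24)"
    note sf = I[unfolded I_def base_def]
    define v where "v = var s' 8"
    have v: "var s' 8 = v" "v < n" "n - v = Suc (n - Suc v)"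
      using sf cc by (simp_all add: v_def)
    have vL: "v < L" "v < bs" "Suc v < L"
      using v(2) L_large bs_bounds by linarith+
    have labv: "arr s' 0 v = lab v"
      using sf v by simp
    have nxt: "I s''" if "base s''" "var s'' 23 = l" "var s'' 8 = Suc v" "var s'' 22 = min l (c + zc (Suc v))"
        "\<And>u. u \<noteq> v \<Longrightarrow> arr s'' 0 u = arr s' 0 u" "arr s'' 0 v = fill c l lab v" "tm s'' \<le> tm s' + 6" for s''
    proof -
      have "arr s'' 0 u = (if u < Suc v then fill c l lab u else lab u)" if "u < n" for u
        using sf v \<open>u < n\<close> \<open>arr s'' 0 v = _\<close> \<open>\<And>u. u \<noteq> v \<Longrightarrow> arr s'' 0 u = arr s' 0 u\<close>[of u]
        by (cases "u = v") (auto simp: less_Suc_eq)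
      then show ?thesis
        using that(1-4,7) sf v by (simp add: I_def)
    qed
    show "wp (Ite (Num 0) (Rd 0 (Var 8)) Skip (
         Ite (Var 22) (Var 23) (incr 22 ;; Wr 0 (Var 8) (Var 22)) Skip) ;;
       incr 8) I (s'\<lparr>tm := Suc (tm s')\<rparr>)"
    proof (cases "lab v = 0")
      case False
      then have "fill c l lab v = lab v" "zc (Suc v) = zc v"
        by (simp_all add: fill_def zc_Suc)
      then show ?thesis
        using False labv vL v sf b0 by (simp add: index_ok_def incr_def nxt base_def)
    next
      case zero: True
      have z: "zc (Suc v) = Suc (zc v)"
        using zero by (simp add: zc_Suc)
      show ?thesis
      proof (cases "c + zc v < l")
        case True
        then have "fill c l lab v = Suc (c + zc v)" "min l (c + zc v) = c + zc v" "min l (Suc (c + zc v)) = Suc (c + zc v)"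
          using zero by (simp_all add: fill_def rank z)
        moreover have "Suc (c + zc v) < L"
          using True c(4) by simp
        ultimately show ?thesis
          using zero labv vL v sf b0 True z by (simp add: index_ok_def incr_def nxt base_def)
      next
        case False
        then have "fill c l lab v = 0" "min l (c + zc v) = l" "min l (Suc (c + zc v)) = l"
          using zero by (simp_all add: fill_def rank z)
        then show ?thesis
          using zero labv vL v sf b0 False z by (simp add: index_ok_def incr_def nxt base_def)
      qed
    qed
  next
    fix s'
    assume I: "I s'" and cc: "\<not> ev s' (Var 8) < ev s' (Var 24)"
    note sf = I[unfolded I_def base_def]
    have "var s' 8 = n"
      using sf cc by simp
    then show "(\<forall>v<n. arr (s'\<lparr>tm := Suc (tm s')\<rparr>) 0 v = fill c l (arr s 0) v) \<and>
        tm (s'\<lparr>tm := Suc (tm s')\<rparr>) \<le> tm s + 6 * n + 2"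
      using sf by (simp add: lab_def)
  qed (use that b0 in \<open>simp_all add: I_def\<close>)
  have "I s1" if "var s1 = (var s)(8 := 0)" "arr s1 = arr s" "tm s1 \<le> tm s + 1" for s1
    using that b[unfolded base_def] c by (simp add: I_def base_def lab_def zc_0)
  then show ?thesis
    unfolding fill_code_def wp_Seq wp_Asg using b0 by (intro conjI loop) simp_all
qed

definition main_post :: "st \<Rightarrow> bool" where
  "main_post s \<longleftrightarrow> base s \<and> arr s 13 = marks \<and> K \<le> var s 15 \<and> var s 15 \<le> 2 * n + 2 + k \<and> var s 20 \<le> Rm \<and>
     (var s 15 = K \<or> var s 20 = Rm) \<and> var s 20 \<le> n \<and>
     (\<forall>v\<in>Field (set es). arr s 6 0 \<le> arr s 6 (2 * v + 3) \<and> arr s 6 (2 * v + 3) < L) \<and>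
     certificate n (set es) (var s 20) (var s 15) (arr s 0) (vertex_label (arr s 6)) \<and>
     tm s \<le> 5000 * (n + (var s 20 + 1) * length es + 1)"

end

lemma (in residual) vertex_label: "antichain_label = vertex_label"
  by (simp add: fun_eq_iff antichain_label_def vertex_label_def)

text \<open>The capacity \<open>N\<close> acts as infinity: with flow value at most \<open>n\<close>
  and ranks at most \<open>2 n + 2\<close>, every arc carries less than \<open>N\<close>, so the
  free arcs remain residual.\<close>

lemma (in residual) final_correct:
  assumes s: "flow_state N pt rc r l" and l: "K \<le> l" and rho: "ranking rho" "\<And>x. rho x \<le> W" "W \<le> 2 * n + 2"
    and small: "\<forall>x\<in>nodes. pt x \<le> 4 * n + 2 * k + 4"
    and lc: "\<forall>v<n. lc v \<le> r" "\<forall>i\<in>{1..r}. dag_chain {..<n} (set es) (label_class n lc i)"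
      "\<forall>i\<in>fwd. cost i = 1 \<longrightarrow> 0 < rc (Suc i) \<longrightarrow> 0 < lc (arc_vertex i)"
  shows "certificate n (set es) r l lc (vertex_label pt)"
    "\<forall>v\<in>Field (set es). pt 0 \<le> pt (2 * v + 3) \<and> pt (2 * v + 3) < L"
proof -
  have l1: "1 \<le> l"
    using l K_bounds by linarith
  have "r \<le> r * l"
    using l1 by simp
  then have r: "r \<le> n"
    using flow_le_n[OF s] by linarith
  have fs: "capacities N rc" "feasible pt rc" "\<And>p. net_flow rc p = int r * (p 1 - p 0)"
    using s by (simp_all add: flow_state_def)
  have free: "0 < rc i" if i: "i \<in> fwd" "cost i = 0" for i
  proof -
    have "rc (Suc i) \<le> r * rho 1"
      by (rule flow_bound[OF rho(1) _ i(1)]) (simp add: fs(3))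
    also have "\<dots> \<le> n * (2 * n + 2)"
      using r rho(2)[of 1] rho(3) by (intro mult_le_mono) linarith+
    also have "\<dots> < N"
      by (simp add: N_def algebra_simps)
    finally have "rc (Suc i) < N" .
    moreover have "rc i + rc (Suc i) = N"
      using fs(1) i by (simp add: capacities_def)
    ultimately show ?thesis
      by linarith
  qed
  show "certificate n (set es) r l lc (vertex_label pt)"
    unfolding vertex_label[symmetric]
    using lc by (intro certificate_from_flow[OF s l1 free]) blast+
  show "\<forall>v\<in>Field (set es). pt 0 \<le> pt (2 * v + 3) \<and> pt (2 * v + 3) < L"
  proof
    fix v
    assume v: "v \<in> Field (set es)"
    have "(0, 2 * v + 2, 0) \<in> arc_spec (set es)" "(2 * v + 2, 2 * v + 3, 0) \<in> arc_spec (set es)"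
      using v by (auto simp: arc_spec_def)
    from this[THEN arc_exists] obtain i j where
      i: "i \<in> fwd" "head (Suc i) = 0" "head i = 2 * v + 2" "cost i = 0" and
      j: "j \<in> fwd" "head (Suc j) = 2 * v + 2" "head j = 2 * v + 3" "cost j = 0"
      by blast
    have "pt 0 \<le> pt (2 * v + 2)" "pt (2 * v + 2) \<le> pt (2 * v + 3)"
      using feasible_residual[OF fs(2) i(1) free[OF i(1,4)]] feasible_residual[OF fs(2) j(1) free[OF j(1,4)]] i j by simp_all
    moreover have "pt (2 * v + 3) \<le> 4 * n + 2 * k + 4"
      using small head_node(1)[OF fwd_less(1)[OF j(1)]] j(3) by simp
    ultimately show "pt 0 \<le> pt (2 * v + 3) \<and> pt (2 * v + 3) < L"
      using L_large by linarith
  qed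
qed

section \<open>The four algorithms\<close>

lemma label_class_cong: "(\<And>v. v < n \<Longrightarrow> f v = g v) \<Longrightarrow> label_class n f = label_class n g"
  by (auto simp: label_class_def fun_eq_iff)

lemma label_partition_cong:
  assumes "\<And>v. v < n \<Longrightarrow> f v = g v"
  shows "label_partition n f = label_partition n g"
proof -
  have "f ` {..<n} = g ` {..<n}"
    using assms by (intro image_cong) simp_all
  then show ?thesis
    using label_class_cong[OF assms] by (simp add: label_partition_def)
qed

lemma fill_cong: "(\<And>u. u \<le> v \<Longrightarrow> f u = g u) \<Longrightarrow> fill c l f v = fill c l g v"
proof -
  assume "\<And>u. u \<le> v \<Longrightarrow> f u = g u"
  then have "{u. u \<le> v \<and> f u = 0} = {u. u \<le> v \<and> g u = 0}" "f v = g v"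
    by auto
  then show ?thesis
    by (simp add: fill_def zero_rank_def)
qed

lemma (in input) written_stages:
  "warrs kahn_code = {6, 11, 12}" "warrs flow_code = {5, 6, 7, 8, 9, 10}" "warrs chain_code = {0, 5, 14}"
  "wvars chain_code = {8, 9, 11, 21}" "wvars antichain_code = {8}"
  by (auto simp: kahn_code_def flow_code_def chain_code_def antichain_code_def incr_def
    dial_code_def raise_code_def augment_code_def)

lemma (in residual) network_correct:
  assumes S: "static s" and deg: "\<And>y. arr s 11 y = card {i \<in> fwd. head i = y}" and pot: "arr s 6 = (\<lambda>_. 0)"
    and caps: "capacities N (arr s 5)" "\<And>i. odd i \<Longrightarrow> arr s 5 i = 0"
    and zero: "arr s 9 = (\<lambda>_. 0)" and mk: "arr s 13 = marks"
    and Q: "\<And>s'. base s' \<Longrightarrow> arr s' 13 = marks \<Longrightarrow> K \<le> var s' 15 \<Longrightarrow> var s' 15 \<le> 2 * n + 2 + k \<Longrightarrow>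
      var s' 20 \<le> Rm \<Longrightarrow> var s' 15 = K \<or> var s' 20 = Rm \<Longrightarrow> var s' 20 \<le> n \<Longrightarrow>
      \<forall>v\<in>Field (set es). arr s' 6 0 \<le> arr s' 6 (2 * v + 3) \<and> arr s' 6 (2 * v + 3) < L \<Longrightarrow>
      certificate n (set es) (var s' 20) (var s' 15) (arr s' 0) (vertex_label (arr s' 6)) \<Longrightarrow>
      tm s' \<le> tm s + 245 * (var s' 20 * M) + 142 * M + 3 * n + 158 \<Longrightarrow> Q s'"
  shows "wp kahn_code (wp flow_code (wp chain_code Q)) s"
proof (rule wp_frame[OF kahn_correct[OF S deg pot caps]], unfold written_stages)
  fix s1
  assume 1: "(\<exists>len. flow_ready len s1) \<and> tm s1 \<le> tm s + 24 * M + 24"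
    and a1: "\<And>a. a \<notin> {6, 11, 12} \<Longrightarrow> arr s1 a = arr s a"
  obtain len where len: "flow_ready len s1"
    using 1 by blast
  obtain rho0 where rho0: "ranking rho0" "\<And>x. x \<in> nodes \<Longrightarrow> rho0 x \<le> len"
    and W: "len \<le> M + 2" "len \<le> 2 * n + 2"
    using len unfolding flow_ready_def by blast
  define rho where "rho x = min (rho0 x) len" for x
  have rho: "ranking rho" "\<And>x. rho x \<le> len"
  proof -
    have "rho0 (head (Suc i)) < rho0 (head i)" "rho0 (head i) \<le> len" if "i \<in> fwd" for i
      using rho0 that head_node(1)[OF fwd_less(1)[OF that]] by (simp_all add: ranking_def)
    then show "ranking rho"
      by (fastforce simp: ranking_def rho_def)
  qed (simp add: rho_def)
  have a9: "arr s1 9 = (\<lambda>_. 0)" "arr s1 13 = marks"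
    using a1[of 9] a1[of 13] zero mk by simp_all
  show "wp flow_code (wp chain_code Q) s1"
  proof (rule wp_frame[OF flow_correct[OF len a9(1)]], unfold written_stages, elim conjE)
    fix s2
    assume st2: "static s2" and fs: "flow_state N (arr s2 6) (arr s2 5) (var s2 20) (var s2 15)"
      and l: "K \<le> var s2 15" "var s2 15 \<le> len + K" "var s2 20 \<le> Rm" "var s2 15 = K \<or> var s2 20 = Rm"
      and small: "\<forall>x\<in>nodes. arr s2 6 x \<le> 4 * n + 2 * k + 4"
      and t2: "tm s2 \<le> tm s1 + (100 * M + 100) * (var s2 20 + 1) + 1"
      and a2: "\<And>a. a \<notin> {5, 6, 7, 8, 9, 10} \<Longrightarrow> arr s2 a = arr s1 a"
    define r where "r = var s2 20"
    have "1 \<le> var s2 15"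
      using l(1) K_bounds by linarith
    then have "r * 1 \<le> r * var s2 15"
      by (rule mult_le_mono2)
    also have "\<dots> \<le> n"
      using flow_le_n[OF fs] by (simp only: r_def)
    finally have r: "var s2 20 = r" "r \<le> n"
      by (simp_all add: r_def)
    show "wp chain_code Q s2"
    proof (rule wp_frame[OF chain_correct[OF st2 fs[unfolded r(1)] r rho]], unfold written_stages, elim conjE)
      fix s3
      assume b3: "base s3" and lc: "\<forall>v<n. arr s3 0 v \<le> r"
        "\<forall>i\<in>{1..r}. dag_chain {..<n} (set es) (label_class n (arr s3 0) i)"
        "\<forall>i\<in>fwd. cost i = 1 \<longrightarrow> 0 < arr s2 5 (Suc i) \<longrightarrow> 0 < arr s3 0 (arc_vertex i)"
        and t3: "tm s3 \<le> tm s2 + 3 * n + 9 * (r * (len + 2) + len + 1 + M) + 6"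
        and v3: "\<And>x. x \<notin> {8, 9, 11, 21} \<Longrightarrow> var s3 x = var s2 x"
        and a3: "\<And>a. a \<notin> {0, 5, 14} \<Longrightarrow> arr s3 a = arr s2 a"
      have same: "var s3 20 = r" "var s3 15 = var s2 15" "arr s3 6 = arr s2 6" "arr s3 13 = marks"
        using v3[of 20] v3[of 15] a3[of 6] a3[of 13] a2[of 13] a9 r by simp_all
      note fin = final_correct[OF fs[unfolded r(1)] l(1) rho W(2) small lc]
      have "r \<le> r * M"
        using flow_M_0[OF fs] l(1) K_bounds r(1) by (cases "M = 0") auto
      moreover have "r * (len + 2) \<le> r * M + 4 * r"
        using mult_le_mono2[OF W(1), of r] by (simp add: algebra_simps)
      moreover have "tm s2 \<le> tm s1 + (100 * (r * M) + 100 * M + 100 * r + 100) + 1"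
        using t2 r(1) by (simp add: algebra_simps)
      \<comment> \<open>With the products abstracted to variables the estimate becomes linear
        arithmetic.\<close>
      moreover have "t3 \<le> t + 245 * x + 142 * M + 3 * n + 158"
        if "r \<le> x" "y \<le> x + 4 * r" "t2 \<le> t1 + (100 * x + 100 * M + 100 * r + 100) + 1" "t1 \<le> t + 24 * M + 24"
          "t3 \<le> t2 + 3 * n + 9 * (y + len + 1 + M) + 6" "len \<le> M + 2" for t t1 t2 t3 x y :: nat
        using that by simp
      ultimately have "tm s3 \<le> tm s + 245 * (r * M) + 142 * M + 3 * n + 158"
        using 1 t3 W(1) by blast
      then show "Q s3"
        using b3 same l W(2) K_bounds r fin by (intro Q) simp_all
    qed
  qed
qed

section \<open>Assembling the programs\<close>

context input
begin

lemma main_correct: "wp (main_code antichain_bound) main_post (init_st (encode n es k))"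
  unfolding main_code_def wp_Seq
proof (rule wp_conseq[OF init_correct])
  fix s1
  assume 1: "base s1 \<and> arr s1 = (\<lambda>a. if a = 0 then io else (\<lambda>_. 0)) \<and> tm s1 = 6"
  show "wp mark_code (wp build_code (wp kahn_code (wp flow_code (wp chain_code main_post)))) s1"
  proof (rule wp_conseq[OF mark_correct])
    fix s2
    assume 2: "base s2 \<and> arr s2 = (\<lambda>a. if a = 0 then io else if a = 13 then marks else (\<lambda>_. 0)) \<and>
      tm s2 \<le> tm s1 + 4 * length es + 2"
    show "wp build_code (wp kahn_code (wp flow_code (wp chain_code main_post))) s2"
    proof (rule wp_conseq[OF build_correct])
      fix s
      assume 3: "base s \<and> built_st all_arcs s \<and> arr s 0 = io \<and> arr s 13 = marks \<and>
        arr s 6 = (\<lambda>_. 0) \<and> arr s 9 = (\<lambda>_. 0) \<and> tm s \<le> tm s2 + 52 * n + 14 * length es + 5"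
      define M where "M = 2 * length all_arcs"
      have b: "built all_arcs (arr s 3) (arr s 4) (arr s 5) (arr s 11) (arr s 2) (arr s 14)"
        using 3 by blast
      note bd = b[unfolded built_def, folded M_def]
      have net: "network n (set es) M (arr s 3) (arr s 4)"
        unfolding M_def by (rule network_built[OF b])
      have "\<forall>x. \<exists>l. llist (arr s 2) (arr s 14 x) l \<and> distinct l \<and> set l = {i. i < M \<and> arr s 3 (twin i) = x}"
        using bd by blast
      then obtain adj where adj: "\<And>x. llist (arr s 2) (arr s 14 x) (adj x)"
        "\<And>x. distinct (adj x) \<and> set (adj x) = {i. i < M \<and> arr s 3 (twin i) = x}"
        by metis
      interpret residual L bs n k es antichain_bound M "arr s 3" "arr s 4" "arr s 2" "arr s 14" adj
      proof (intro residual.intro residual_axioms.intro input_axioms net adj(1))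
        show "network.is_adj M (arr s 3) x (adj x)" for x
          using adj(2) by (simp add: network.is_adj_def[OF net])
        show "M \<le> 8 * n + 2 * length es"
          using length_all_arcs(1) by (simp add: M_def)
      qed
      have fwd_eq: "fwd = (\<lambda>a. 2 * a) ` {..<length all_arcs}"
        unfolding fwd_def by (auto simp: M_def elim!: evenE)
      have deg: "arr s 11 y = card {i \<in> fwd. arr s 3 i = y}" for y
      proof -
        have "{i \<in> fwd. arr s 3 i = y} = (\<lambda>a. 2 * a) ` {a. a < length all_arcs \<and> arr s 3 (2 * a) = y}"
          by (auto simp: fwd_eq)
        then have "card {i \<in> fwd. arr s 3 i = y} = card {a. a < length all_arcs \<and> arr s 3 (2 * a) = y}"
          by (simp add: card_image inj_on_def)
        then show ?thesis
          using bd by simp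
      qed
      have odd: "\<And>i. odd i \<Longrightarrow> arr s 5 i = 0"
        using bd by blast
      have caps: "capacities N (arr s 5)"
        using bd odd by (auto simp: capacities_def fwd_eq)
      have st: "static s"
        using 3 unfolding static_def by (simp add: M_def)
      show "wp kahn_code (wp flow_code (wp chain_code main_post)) s"
      proof (rule network_correct[OF st deg _ caps odd])
        show "arr s 6 = (\<lambda>_. 0)" "arr s 9 = (\<lambda>_. 0)" "arr s 13 = marks"
          using 3 by blast+
      next
        fix s' :: st
        define r where "r = var s' 20"
        assume t: "tm s' \<le> tm s + 245 * (var s' 20 * M) + 142 * M + 3 * n + 158"
        have M: "M \<le> 18 * length es"
          using length_all_arcs(2) by (simp add: M_def)
        have "r * M \<le> 18 * (r * length es)"
          using mult_le_mono2[OF M, of r] by (simp add: algebra_simps)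
        then have "tm s' \<le> 5000 * n + 5000 * (r * length es) + 5000 * length es + 5000"
          using 1 2 3 t M unfolding r_def by linarith
        then have t': "tm s' \<le> 5000 * (n + (var s' 20 + 1) * length es + 1)"
          by (simp add: r_def algebra_simps)
        assume "base s'" "arr s' 13 = marks" "K \<le> var s' 15" "var s' 15 \<le> 2 * n + 2 + k"
          "var s' 20 \<le> Rm" "var s' 15 = K \<or> var s' 20 = Rm" "var s' 20 \<le> n"
          "\<forall>v\<in>Field (set es). arr s' 6 0 \<le> arr s' 6 (2 * v + 3) \<and> arr s' 6 (2 * v + 3) < L"
          "certificate n (set es) (var s' 20) (var s' 15) (arr s' 0) (vertex_label (arr s' 6))"
        then show "main_post s'"
          unfolding main_post_def using t' by blast
      qed
    qed (use 2 in simp_all)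
  qed (use 1 in simp_all)
qed

lemma partition_output:
  assumes b: "base s" and x: "x \<noteq> 22" "x \<noteq> 23" "var s x + n < L"
  shows "wp (Asg 22 (Var x) ;; Asg 23 (Var x +. Var 24) ;; fill_code)
    (\<lambda>s'. (\<forall>v<n. arr s' 0 v = fill (var s x) (var s x + n) (arr s 0) v) \<and> tm s' \<le> tm s + 6 * n + 4) s"
proof -
  define s1 where "s1 = s\<lparr>var := (var s)(22 := var s x, 23 := var s x + n), tm := Suc (Suc (tm s))\<rparr>"
  have s1: "base s1" "var s1 22 = var s x" "var s1 23 = var s x + n" "arr s1 = arr s" "tm s1 = tm s + 2"
    using b x by (simp_all add: s1_def base_def)
  have "wp fill_code (\<lambda>s'. (\<forall>v<n. arr s' 0 v = fill (var s x) (var s x + n) (arr s 0) v) \<and>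
    tm s' \<le> tm s + 6 * n + 4) s1"
    by (rule wp_conseq[OF fill_correct[OF s1(1-3)]]) (use x s1 in simp_all)
  then show ?thesis
    using b x by (simp add: s1_def base_def)
qed

lemma family_output:
  assumes b: "base s" and x: "x \<noteq> 22" "x \<noteq> 23" "var s x \<le> k"
  shows "wp (Asg 22 (Var x) ;; Asg 23 (Var 3) ;; fill_code)
    (\<lambda>s'. (\<forall>v<n. arr s' 0 v = fill (var s x) k (arr s 0) v) \<and> tm s' \<le> tm s + 6 * n + 4) s"
proof -
  define s1 where "s1 = s\<lparr>var := (var s)(22 := var s x, 23 := k), tm := Suc (Suc (tm s))\<rparr>"
  have s1: "base s1" "var s1 22 = var s x" "var s1 23 = k" "arr s1 = arr s" "tm s1 = tm s + 2"
    using b x by (simp_all add: s1_def base_def)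
  have "k < L"
    using L_large by linarith
  then have "wp fill_code (\<lambda>s'. (\<forall>v<n. arr s' 0 v = fill (var s x) k (arr s 0) v) \<and>
    tm s' \<le> tm s + 6 * n + 4) s1"
    by (intro wp_conseq[OF fill_correct[OF s1(1-3)]]) (use x s1 in simp_all)
  then show ?thesis
    using b x by (simp add: s1_def base_def)
qed

text \<open>Every vertex is isolated or an end of an edge, which bounds \<open>n\<close>; positivity
  of \<open>a\<close> pays for the phase without augmentation.\<close>

lemma time_bound:
  assumes r: "r \<le> a" and a: "0 < length es \<Longrightarrow> 1 \<le> a"
    and t: "t \<le> 5000 * (n + (r + 1) * length es + 1) + 11 * n + 6"
  shows "t \<le> 21000 * (a * card (set es) + card (isolated n es) + 1)"
proof -
  have m: "card (set es) = length es"
    using dag by (simp add: dag_input_def distinct_card)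
  have "{..<n} \<subseteq> isolated n es \<union> Field (set es)"
    by (auto simp: isolated_def)
  moreover have "finite (isolated n es)" "finite (Field (set es))"
    by (simp_all add: isolated_def finite_Field)
  ultimately have "n \<le> card (isolated n es \<union> Field (set es))"
    using card_mono[of "isolated n es \<union> Field (set es)" "{..<n}"] by simp
  also have "\<dots> \<le> card (isolated n es) + 2 * length es"
    using card_Field card_Un_le[of "isolated n es" "Field (set es)"] by linarith
  finally have n: "n \<le> card (isolated n es) + 2 * length es" .
  have am: "r * length es \<le> a * length es" "length es \<le> a * length es"
    using r a by (cases "length es = 0"; simp)+
  \<comment> \<open>The decisive coefficient is
    \<open>2 * 5011 + 5000 + 5000 = 20022\<close>.\<close>
  have arith: "t \<le> 21000 * (x + c + 1)"
    if "t \<le> 5011 * n + 5000 * y + 5000 * j + 5006" "n \<le> c + 2 * j" "y \<le> x" "j \<le> x" for c j x y :: nat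
    using that by simp
  have "t \<le> 5011 * n + 5000 * (r * length es) + 5000 * length es + 5006"
    using t by (simp add: algebra_simps)
  then show ?thesis
    unfolding m using n am by (rule arith)
qed

lemma vertices_nonempty: "0 < length es \<Longrightarrow> {..<n} \<noteq> {}"
  using es_bounds[of 0] by auto

lemma main_post_facts:
  assumes "main_post s"
  shows "base s" "arr s 13 = marks" "K \<le> var s 15" "var s 15 \<le> 2 * n + 2 + k" "var s 20 \<le> Rm"
    "var s 15 = K \<or> var s 20 = Rm" "var s 20 \<le> n"
    "\<And>v. v \<in> Field (set es) \<Longrightarrow> arr s 6 0 \<le> arr s 6 (2 * v + 3) \<and> arr s 6 (2 * v + 3) < L"
    "certificate n (set es) (var s 20) (var s 15) (arr s 0) (vertex_label (arr s 6))"
    "tm s \<le> 5000 * (n + (var s 20 + 1) * length es + 1)"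
  using assms unfolding main_post_def by blast+

lemma antichain_stage:
  assumes s: "main_post s"
    and Q: "\<And>s'. base s' \<Longrightarrow> var s' 15 = var s 15 \<Longrightarrow> (\<And>v. v < n \<Longrightarrow> arr s' 0 v = vertex_label (arr s 6) v) \<Longrightarrow>
      tm s' \<le> tm s + 5 * n + 2 \<Longrightarrow> Q s'"
  shows "wp antichain_code Q s"
  by (rule wp_frame[OF antichain_code_correct[OF main_post_facts(1,2,8)[OF s]]])
    (simp_all add: Q written_stages)

lemma MCP_correct:
  assumes antichain_bound
  shows "wp MCP_code (\<lambda>s. tm s \<le> 21000 * alpha_bound n es k \<and> solves_MCP n es k (arr s 0)) (init_st (encode n es k))"
  unfolding MCP_code_def
proof (subst wp_Seq, rule wp_conseq)
  show "wp (main_code True) main_post (init_st (encode n es k))"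
    using main_correct assms by simp
next
  fix s
  assume "main_post s"
  note P = main_post_facts[OF this]
  \<comment> \<open>The flow limit \<open>n + 1\<close> cannot have been reached, so the loop
    stopped because \<open>l\<close> is \<open>K\<close>.\<close>
  have l: "var s 15 = k"
    using P(6,7) assms unfolding K_def Rm_def by auto
  have r: "var s 20 + n < L"
    using P(7) L_large by linarith
  show "wp (Asg 22 (Var 20) ;; Asg 23 (Var 20 +. Var 24) ;; fill_code)
    (\<lambda>s. tm s \<le> 21000 * alpha_bound n es k \<and> solves_MCP n es k (arr s 0)) s"
  proof (rule wp_conseq[OF partition_output[OF P(1) _ _ r]])
    fix s'
    assume s': "(\<forall>v<n. arr s' 0 v = fill (var s 20) (var s 20 + n) (arr s 0) v) \<and> tm s' \<le> tm s + 6 * n + 4"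
    have "label_partition n (arr s' 0) = label_partition n (fill (var s 20) (var s 20 + n) (arr s 0))"
      using s' by (intro label_partition_cong) simp
    then have "solves_MCP n es k (arr s' 0)"
      using cert_MA_MCP(2)[OF P(9)] by (simp add: solves_MCP_def l)
    moreover have "tm s' \<le> 21000 * alpha_bound n es k"
      unfolding alpha_bound_def
      using cert_r_le_alpha[OF P(9)] alpha_pos[of "{..<n}" k "set es"] vertices_nonempty k_pos s' P(10)
      by (intro time_bound[of "var s 20"]) (simp_all add: l)
    ultimately show "tm s' \<le> 21000 * alpha_bound n es k \<and> solves_MCP n es k (arr s' 0)"
      by blast
  qed simp_all
qed

lemma MA_correct:
  assumes antichain_bound
  shows "wp MA_code (\<lambda>s. tm s \<le> 21000 * alpha_bound n es k \<and> solves_MA n es k (arr s 0)) (init_st (encode n es k))"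
  unfolding MA_code_def
proof (subst wp_Seq, rule wp_conseq)
  show "wp (main_code True) main_post (init_st (encode n es k))"
    using main_correct assms by simp
next
  fix s
  assume main: "main_post s"
  note P = main_post_facts[OF main]
  have l: "var s 15 = k"
    using P(6,7) assms unfolding K_def Rm_def by auto
  show "wp (antichain_code ;; Asg 22 (Var 15) ;; Asg 23 (Var 3) ;; fill_code)
    (\<lambda>s. tm s \<le> 21000 * alpha_bound n es k \<and> solves_MA n es k (arr s 0)) s"
  proof (subst wp_Seq, rule antichain_stage[OF main])
    fix s1
    assume s1: "base s1" "var s1 15 = var s 15" "\<And>v. v < n \<Longrightarrow> arr s1 0 v = vertex_label (arr s 6) v"
      "tm s1 \<le> tm s + 5 * n + 2"
    show "wp (Asg 22 (Var 15) ;; Asg 23 (Var 3) ;; fill_code)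
      (\<lambda>s. tm s \<le> 21000 * alpha_bound n es k \<and> solves_MA n es k (arr s 0)) s1"
    proof (rule wp_conseq[OF family_output[OF s1(1)]])
      fix s'
      assume s': "(\<forall>v<n. arr s' 0 v = fill (var s1 15) k (arr s1 0) v) \<and> tm s' \<le> tm s1 + 6 * n + 4"
      have "arr s' 0 v = fill k k (vertex_label (arr s 6)) v" if "v < n" for v
        using s' that s1 l fill_cong[of v "arr s1 0" "vertex_label (arr s 6)" k k] by simp
      then have "label_class n (arr s' 0) = label_class n (fill k k (vertex_label (arr s 6)))"
        by (rule label_class_cong)
      then have "solves_MA n es k (arr s' 0)"
        using cert_MA_MCP(1)[OF P(9) order_refl] by (simp add: solves_MA_def l)
      moreover have "tm s' \<le> 21000 * alpha_bound n es k"
        unfolding alpha_bound_def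
        using cert_r_le_alpha[OF P(9)] alpha_pos[of "{..<n}" k "set es"] vertices_nonempty k_pos s' s1(4) P(10)
        by (intro time_bound[of "var s 20"]) (simp_all add: l)
      ultimately show "tm s' \<le> 21000 * alpha_bound n es k \<and> solves_MA n es k (arr s' 0)"
        by blast
    qed (simp_all add: s1(2) l)
  qed
qed

lemma MC_correct:
  assumes "\<not> antichain_bound"
  shows "wp MC_code (\<lambda>s. tm s \<le> 21000 * beta_bound n es k \<and> solves_MC n es k (arr s 0)) (init_st (encode n es k))"
  unfolding MC_code_def
proof (subst wp_Seq, rule wp_conseq)
  show "wp (main_code False) main_post (init_st (encode n es k))"
    using main_correct assms by simp
next
  fix s
  assume "main_post s"
  note P = main_post_facts[OF this]
  have l: "var s 20 \<le> k" "var s 20 = k \<or> var s 15 = 1" "1 \<le> var s 15"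
    using P(3,5,6) assms unfolding K_def Rm_def by auto
  show "wp (Asg 22 (Var 20) ;; Asg 23 (Var 3) ;; fill_code)
    (\<lambda>s. tm s \<le> 21000 * beta_bound n es k \<and> solves_MC n es k (arr s 0)) s"
  proof (rule wp_conseq[OF family_output[OF P(1) _ _ l(1)]])
    fix s'
    assume s': "(\<forall>v<n. arr s' 0 v = fill (var s 20) k (arr s 0) v) \<and> tm s' \<le> tm s + 6 * n + 4"
    have "label_class n (arr s' 0) = label_class n (fill (var s 20) k (arr s 0))"
      using s' by (intro label_class_cong) simp
    then have "solves_MC n es k (arr s' 0)"
      using cert_MC_MAP(1)[OF P(9) l(1,2) order_refl] by (simp add: solves_MC_def)
    moreover have "tm s' \<le> 21000 * beta_bound n es k"
      unfolding beta_bound_def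
      using cert_r_le_beta[OF P(9) _ l(1)] beta_pos[of "{..<n}" k "set es"] vertices_nonempty k_pos s' P(10) l(3)
      by (intro time_bound[of "var s 20"]) simp_all
    ultimately show "tm s' \<le> 21000 * beta_bound n es k \<and> solves_MC n es k (arr s' 0)"
      by blast
  qed simp_all
qed

lemma MAP_correct:
  assumes "\<not> antichain_bound"
  shows "wp MAP_code (\<lambda>s. tm s \<le> 21000 * beta_bound n es k \<and> solves_MAP n es k (arr s 0)) (init_st (encode n es k))"
  unfolding MAP_code_def
proof (subst wp_Seq, rule wp_conseq)
  show "wp (main_code False) main_post (init_st (encode n es k))"
    using main_correct assms by simp
next
  fix s
  assume main: "main_post s"
  note P = main_post_facts[OF main]
  have l: "var s 20 \<le> k" "var s 20 = k \<or> var s 15 = 1" "1 \<le> var s 15"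
    using P(3,5,6) assms unfolding K_def Rm_def by auto
  have L: "var s 15 + n < L"
    using P(4) L_large by linarith
  show "wp (antichain_code ;; Asg 22 (Var 15) ;; Asg 23 (Var 15 +. Var 24) ;; fill_code)
    (\<lambda>s. tm s \<le> 21000 * beta_bound n es k \<and> solves_MAP n es k (arr s 0)) s"
  proof (subst wp_Seq, rule antichain_stage[OF main])
    fix s1
    assume s1: "base s1" "var s1 15 = var s 15" "\<And>v. v < n \<Longrightarrow> arr s1 0 v = vertex_label (arr s 6) v"
      "tm s1 \<le> tm s + 5 * n + 2"
    show "wp (Asg 22 (Var 15) ;; Asg 23 (Var 15 +. Var 24) ;; fill_code)
      (\<lambda>s. tm s \<le> 21000 * beta_bound n es k \<and> solves_MAP n es k (arr s 0)) s1"
    proof (rule wp_conseq[OF partition_output[OF s1(1)]])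
      fix s'
      assume s': "(\<forall>v<n. arr s' 0 v = fill (var s1 15) (var s1 15 + n) (arr s1 0) v) \<and> tm s' \<le> tm s1 + 6 * n + 4"
      let ?f = "fill (var s 15) (var s 15 + n) (vertex_label (arr s 6))"
      have "arr s' 0 v = ?f v" if "v < n" for v
        using s' that s1 fill_cong[of v "arr s1 0" "vertex_label (arr s 6)"] by simp
      then have "label_partition n (arr s' 0) = label_partition n ?f"
        by (rule label_partition_cong)
      then have "solves_MAP n es k (arr s' 0)"
        using cert_MC_MAP(2)[OF P(9) l(1,2) order_refl] by (simp add: solves_MAP_def)
      moreover have "tm s' \<le> 21000 * beta_bound n es k"
        unfolding beta_bound_def
        using cert_r_le_beta[OF P(9) _ l(1)] beta_pos[of "{..<n}" k "set es"] vertices_nonempty k_pos s' s1(4) P(10) l(3)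
        by (intro time_bound[of "var s 20"]) simp_all
      ultimately show "tm s' \<le> 21000 * beta_bound n es k \<and> solves_MAP n es k (arr s' 0)"
        by blast
    qed (use L in \<open>simp_all add: s1(2)\<close>)
  qed
qed

end

text \<open>With S the sum of all input parameters plus 2, the memory needs at most
  \<open>2048 * S^2 + 3 * S\<close> cells, where 2048 is 32 times 64. As \<open>S \<ge> 3\<close>,
  the spare factor \<open>S^12\<close> of \<open>S^14\<close> absorbs the constants.\<close>

lemma word_size:
  assumes "word_size_ok 14 n es k w" "dag_input n es k"
  defines "L \<equiv> 64 * ((n + length es + k + 2) * (n + length es + k + 2))"
  shows "2 * length es + n + 3 + 32 * L \<le> 2 ^ w" "1 \<le> L" "6 \<le> w"
    "i < length (encode n es k) \<Longrightarrow> encode n es k ! i < 2 ^ w"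
proof -
  define S where "S = n + length es + k + 2"
  have S: "3 \<le> S"
    using assms(2) by (simp add: S_def dag_input_def)
  have le: "S ^ 14 \<le> 2 ^ w"
    using assms(1) by (simp add: word_size_ok_def input_size_def S_def add_ac)
  have "(3::nat) ^ 12 \<le> S ^ 12"
    using S by (rule power_mono) simp
  then have "2048 + 3 \<le> S ^ 12"
    by simp
  then have "(2048 + 3) * (S * S) \<le> S ^ 12 * (S * S)"
    by (rule mult_right_mono) simp
  also have "\<dots> = S ^ 14"
    by (simp add: power_def eval_nat_numeral mult_ac)
  finally have main: "2048 * (S * S) + 3 * (S * S) \<le> 2 ^ w"
    using le by (simp add: algebra_simps)
  have "3 * S \<le> S * S"
    using S by (rule mult_right_mono) simp
  moreover have "L = 64 * (S * S)"
    by (simp only: L_def S_def)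
  moreover have "2 * length es + n + 3 \<le> 3 * S"
    by (simp add: S_def)
  ultimately show "2 * length es + n + 3 + 32 * L \<le> 2 ^ w" "1 \<le> L"
    using main S by linarith+
  have "3 * 3 \<le> S * S"
    using S by (intro mult_le_mono)
  then have "(2::nat) ^ 6 < 2 ^ w"
    using main by simp
  then have "6 < w"
    by (rule power_less_imp_less_exp[rotated]) simp
  then show "6 \<le> w"
    by simp
  assume "i < length (encode n es k)"
  then have "encode n es k ! i \<in> set (encode n es k)"
    by simp
  then have "encode n es k ! i < S"
    using assms(2) by (fastforce simp: encode_def S_def dag_input_def)
  then show "encode n es k ! i < 2 ^ w"
    using main \<open>3 * S \<le> S * S\<close> by linarith
qed

lemma las_vegas_solvable_program:
  assumes cm: "\<And>L n es k. input L (2 * length es + n + 3) n k es \<Longrightarrow>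
      bounds.wp L (2 * length es + n + 3) cm (\<lambda>s. tm s \<le> C * f n es k \<and> Sol n es k (arr s 0)) (init_st (encode n es k))"
    and ok: "com_ok cm" and f: "\<And>n es k. 1 \<le> f n es k"
    and Sol: "\<And>n es k g h. (\<And>v. v < n \<Longrightarrow> g v = h v) \<Longrightarrow> Sol n es k g \<Longrightarrow> Sol n es k h"
  shows "las_vegas_solvable Sol f"
proof (rule las_vegas_solvable_deterministic)
  fix n es k w \<omega>
  assume dag: "dag_input n es k" and w: "word_size_ok 14 n es k w"
  define L where "L = 64 * ((n + length es + k + 2) * (n + length es + k + 2))"
  note ws = word_size[OF w dag, folded L_def]
  have "input L (2 * length es + n + 3) n k es"
    by (rule input.intro) (simp_all only: dag L_def)
  from program_correct[OF ws ok cm[OF this]] Sol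
  obtain t where t: "t \<le> length prelude + unit_cost cm * (C * f n es k)"
    "halted (program cm) (run w (program cm) (encode n es k) \<omega> t)"
    "Sol n es k (mem (run w (program cm) (encode n es k) \<omega> t))"
    by blast
  have "length prelude * 1 \<le> length prelude * f n es k"
    using f by (rule mult_le_mono2)
  then have "t \<le> length prelude * f n es k + unit_cost cm * (C * f n es k)"
    using t(1) by linarith
  then have "t \<le> (length prelude + unit_cost cm * C) * f n es k"
    by (simp add: algebra_simps)
  then show "\<exists>t\<le>(length prelude + unit_cost cm * C) * f n es k.
      halted (program cm) (run w (program cm) (encode n es k) \<omega> t) \<and>
      Sol n es k (mem (run w (program cm) (encode n es k) \<omega> t))"
    using t(2,3) by blast
qed simp

lemma codes_ok: "com_ok MCP_code" "com_ok MA_code" "com_ok MAP_code" "com_ok MC_code"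
  by (simp_all add: MCP_code_def MA_code_def MAP_code_def MC_code_def main_code_def init_code_def mark_code_def
    build_code_def vertex_code_def arc_code_def kahn_code_def flow_code_def dial_code_def raise_code_def
    augment_code_def chain_code_def antichain_code_def fill_code_def incr_def twin_exp_def)

lemma solves_cong:
  assumes "\<And>v. v < n \<Longrightarrow> g v = h v"
  shows "solves_MCP n es k g \<Longrightarrow> solves_MCP n es k h" "solves_MA n es k g \<Longrightarrow> solves_MA n es k h"
    "solves_MAP n es k g \<Longrightarrow> solves_MAP n es k h" "solves_MC n es k g \<Longrightarrow> solves_MC n es k h"
  using label_class_cong[OF assms] label_partition_cong[OF assms]
  by (simp_all add: solves_MCP_def solves_MA_def solves_MAP_def solves_MC_def)

theorem theorem2:
  shows "las_vegas_solvable solves_MCP alpha_bound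
    \<and> las_vegas_solvable solves_MA alpha_bound
    \<and> las_vegas_solvable solves_MAP beta_bound
    \<and> las_vegas_solvable solves_MC beta_bound"
proof (intro conjI)
  show "las_vegas_solvable solves_MCP alpha_bound"
    by (rule las_vegas_solvable_program[OF input.MCP_correct[where antichain_bound = True] _ _ solves_cong(1)])
      (simp_all add: codes_ok alpha_bound_def)
  show "las_vegas_solvable solves_MA alpha_bound"
    by (rule las_vegas_solvable_program[OF input.MA_correct[where antichain_bound = True] _ _ solves_cong(2)])
      (simp_all add: codes_ok alpha_bound_def)
  show "las_vegas_solvable solves_MAP beta_bound"
    by (rule las_vegas_solvable_program[OF input.MAP_correct[where antichain_bound = False] _ _ solves_cong(3)])
      (simp_all add: codes_ok beta_bound_def)
  show "las_vegas_solvable solves_MC beta_bound"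
    by (rule las_vegas_solvable_program[OF input.MC_correct[where antichain_bound = False] _ _ solves_cong(4)])
      (simp_all add: codes_ok beta_bound_def)
qed

end
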